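(* Let $h\in[1,n-1]$ and $A^\star=(A^{\bar0}|A^{\bar1})=(a^{\bar0}_{i,j}|a^{\bar1}_{i,j})\in M_n(\mathbb N|\mathbb N_2)_r$ with base $A=(a_{i,j})$, $a_{i,j}=a^{\bar0}_{i,j}+a^{\bar1}_{i,j}$. Write $\overrightarrow{\mathbf r}^{k}_{h}=\sum_{j=k+1}^na_{h,j}$ and $\overleftarrow{\mathbf r}^{k}_{h+1}=\sum_{u=1}^{k-1}a_{h+1,u}$. Then, for $\lambda,\mu\in\Lambda(n,r)$ and $\varepsilon=\delta_{\lambda,\mathrm{ro}(A)}$, the following multiplication formulas hold in $\mathcal Q_q(n,r;R)$: (1) $\phi_{(\mu|O)}\phi_{A^\star}=\delta_{\mu,\mathrm{ro}(A)}\phi_{A^\star}$ and $\phi_{A^\star}\phi_{(\mu|O)}=\delta_{\mu,\mathrm{co}(A)}\phi_{A^\star}$. (2) $$\begin{aligned}\phi_{(\lambda+E_{h,h+1}-E_{h+1,h+1}|O)}\,\phi_{A^\star}=\varepsilon\sum_{k=1}^n\Big\{&q^{\overrightarrow{\mathbf r}^{k}_{h}+a^{\bar1}_{h+1,k}}[\![a^{\bar0}_{h,k}+1]\!]_q\,\phi_{(A^{\bar0}+E_{h,k}-E_{h+1,k}|A^{\bar1})}+q^{\overrightarrow{\mathbf r}^{k}_{h}}\phi_{(A^{\bar0}|A^{\bar1}+E_{h,k}-E_{h+1,k})}\\&+q^{\overrightarrow{\mathbf r}^{k}_{h}-1}[\![a_{h,k}+1]\!]_{q,q^2}\,\phi_{(A^{\bar0}+2E_{h,k}|A^{\bar1}-E_{h,k}-E_{h+1,k})}\Big\}.\end{aligned}$$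 (3) $$\begin{aligned}\phi_{(\lambda-E_{h,h}+E_{h+1,h}|O)}\,\phi_{A^\star}=\varepsilon\sum_{k=1}^n\Big\{&q^{\overleftarrow{\mathbf r}^{k}_{h+1}}[\![a^{\bar0}_{h+1,k}+1]\!]_q\,\phi_{(A^{\bar0}-E_{h,k}+E_{h+1,k}|A^{\bar1})}+q^{\overleftarrow{\mathbf r}^{k}_{h+1}+a_{h,k}-1}\phi_{(A^{\bar0}|A^{\bar1}-E_{h,k}+E_{h+1,k})}\\&+q^{\overleftarrow{\mathbf r}^{k}_{h+1}+a_{h,k}-2}[\![a_{h+1,k}+1]\!]_{q,q^2}\,\phi_{(A^{\bar0}+2E_{h+1,k}|A^{\bar1}-E_{h,k}-E_{h+1,k})}\Big\}.\end{aligned}$$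
   Context: $\mathbb N$ = non-negative integers, $\mathbb N_2=\{0,1\}\subset\mathbb N$, $[1,n]=\{1,\dots,n\}$; $[\![m]\!]_x=1+x+\cdots+x^{m-1}$ and $[\![m]\!]_{x,y}=[\![m]\!]_x-[\![m]\!]_y$. Let $R$ be a commutative ring with $1$, $q\in R$ a unit, $q\neq1$. Hecke--Clifford superalgebra: $\mathcal H^c_{r,R}$ is the associative $R$-superalgebra generated by even $T_1,\dots,T_{r-1}$ and odd $c_1,\dots,c_r$ subject to $c_i^2=-1$, $c_ic_j=-c_jc_i$ ($i\ne j$); $(T_i-q)(T_i+1)=0$, $T_iT_j=T_jT_i$ ($|i-j|>1$), $T_iT_{i+1}T_i=T_{i+1}T_iT_{i+1}$; $c_jT_i=T_ic_j$ ($j\ne i,i+1$), $c_{i+1}T_i=T_ic_i$, $c_iT_i=T_ic_{i+1}+(q-1)(c_i-c_{i+1})$. In the symmetric group $\mathfrak S_r$ (composition right to left) let $s_i=(i,i+1)$, and $T_w=T_{i_1}\cdots T_{i_k}$ for a reduced expression $w=s_{i_1}\cdots s_{i_k}$. Compositions and matrices: $\Lambda(n,r)=\{\lambda\in\mathbb N^n:\lambda_1+\cdots+\lambda_n=r\}$, $\widetilde\lambda_i=\lambda_1+\cdots+\lambda_i$, $\widetilde\lambda_0=0$. For a composition $\lambda$ of $r$, $\mathfrak S_\lambda$ is the standard Young subgroup, $\mathcal D_\lambda$ the set of shortest representatives of the right cosets of $\mathfrak S_\lambda$ in $\mathfrak S_r$, and $x_\lambda=\sum_{w\in\mathfrak S_\lambda}T_w$.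 For $A=(a_{i,j})\in M_n(\mathbb N)$: $\mathrm{ro}(A)=(\sum_ja_{i,j})_i$, $\mathrm{co}(A)=(\sum_ia_{i,j})_j$; $\nu_A=(a_{1,1},\dots,a_{n,1},a_{1,2},\dots,a_{n,2},\dots,a_{1,n},\dots,a_{n,n})$; $\widetilde a_{i,j}=\sum_{p=1}^{j-1}\sum_{u=1}^na_{u,p}+\sum_{u=1}^ia_{u,j}$ ($0\le i\le n$); $\widehat a_{h,k-1}=\widetilde\lambda_{h-1}+\sum_{u=1}^{k-1}a_{h,u}$ where $\lambda=\mathrm{ro}(A)$; $d_A\in\mathfrak S_r$ ($r$ the sum of entries of $A$) is the permutation with $d_A(\widetilde a_{h-1,k}+p)=\widehat a_{h,k-1}+p$ whenever $a_{h,k}>0$, $p\in[1,a_{h,k}]$ (the distinguished double coset representative associated with $A$). $E_{i,j}$ is a matrix unit, $\lambda\in\mathbb N^n$ is also regarded as the diagonal matrix $\mathrm{diag}(\lambda)$, and $O$ is the zero matrix. $M_n(\mathbb N|\mathbb N_2)$ is the set of pairs $A^\star=(A^{\bar0}|A^{\bar1})$ with $A^{\bar0}\in M_n(\mathbb N)$, $A^{\bar1}\in M_n(\mathbb N_2)$; $A=\lfloor A^\star\rfloor=A^{\bar0}+A^{\bar1}$ is its base; $M_n(\mathbb N|\mathbb N_2)_r$ is the subset where the entries of $A$ sum to $r$. Queer $q$-Schur superalgebra: $\mathcal Q_q(n,r;R)=\mathrm{End}_{\mathcal H^c_{r,R}}\big(\bigoplus_{\lambda\in\Lambda(n,r)}x_\lambda\mathcal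 H^c_{r,R}\big)$ (endomorphisms of right $\mathcal H^c_{r,R}$-modules, $\phi(mh)=\phi(m)h$; the product is composition). Put $c_{q,i,j}=q^{j-i}c_i+\cdots+qc_{j-1}+c_j$. For $A^\star\in M_n(\mathbb N|\mathbb N_2)_r$ with base $A$, $c_{A^\star}=\prod(c_{q,\widetilde a_{i-1,j}+1,\widetilde a_{i,j}})^{a^{\bar1}_{i,j}}$, the product taken in the order $(i,j)=(1,1),(2,1),\dots,(n,1),(1,2),\dots,(n,n)$ (factors with exponent $0$ are $1$); $\Sigma_A=\sum_{\sigma\in\mathcal D_{\nu_A}\cap\mathfrak S_{\mathrm{co}(A)}}T_\sigma$; $T_{A^\star}=x_{\mathrm{ro}(A)}T_{d_A}c_{A^\star}\Sigma_A$; and $\phi_{A^\star}\in\mathcal Q_q(n,r;R)$ is defined by $\phi_{A^\star}(x_\mu h)=\delta_{\mu,\mathrm{co}(A)}T_{A^\star}h$ for $\mu\in\Lambda(n,r)$, $h\in\mathcal H^c_{r,R}$. The $\phi_{A^\star}$ form an $R$-basis of $\mathcal Q_q(n,r;R)$. Convention: for a pair $M^\star$ of integer matrices with $M^\star\notin M_n(\mathbb N|\mathbb N_2)$ (a negative entry somewhere, or an entry $>1$ in the second matrix), $\phi_{M^\star}=0$. *)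

theory Defs
  imports
    "HOL-Algebra.QuotRing"
    "HOL-Algebra.Module"
    "HOL-Combinatorics.Permutations"
    "HOL-Library.FuncSet"
    "HOL-Library.Function_Algebras"
begin

section \<open>Scalars\<close>

text \<open>The coefficient ring is a type of class \<open>comm_ring_1\<close>.\<close>

definition unit_pow :: "'a::comm_ring_1 \<Rightarrow> int \<Rightarrow> 'a" where
  "unit_pow q e = (if 0 \<le> e then q ^ nat e else (THE y. q * y = 1) ^ nat (- e))"

definition qnum :: "'a::comm_ring_1 \<Rightarrow> nat \<Rightarrow> 'a" where
  "qnum x m = (\<Sum>i<m. x ^ i)"

definition qnum2 :: "'a::comm_ring_1 \<Rightarrow> 'a \<Rightarrow> nat \<Rightarrow> 'a" where
  "qnum2 x y m = qnum x m - qnum y m"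


section \<open>The Hecke--Clifford superalgebra\<close>

datatype gen = GT nat | GC nat

definition gens :: "nat \<Rightarrow> gen set" where
  "gens r = GT ` {1..<r} \<union> GC ` {1..r}"

text \<open>The free associative algebra on \<open>gens r\<close>: finitely supported functions on words, with the
  convolution product with respect to concatenation.\<close>

definition free_alg :: "nat \<Rightarrow> ('a::comm_ring_1, gen list \<Rightarrow> 'a) module" where
  "free_alg r =
    \<lparr> carrier = {f. finite {w. f w \<noteq> 0} \<and> (\<forall>w. f w \<noteq> 0 \<longrightarrow> set w \<subseteq> gens r)},
      monoid.mult = (\<lambda>f g w. \<Sum>k\<le>length w. f (take k w) * g (drop k w)),
      one = (\<lambda>w. if w = [] then 1 else 0),
      zero = (\<lambda>w. 0),
      add = (\<lambda>f g w. f w + g w),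
      smult = (\<lambda>a f w. a * f w) \<rparr>"

definition free_gen :: "gen \<Rightarrow> gen list \<Rightarrow> 'a::comm_ring_1" where
  "free_gen x = (\<lambda>w. if w = [x] then 1 else 0)"

text \<open>The defining relations, as pairs of a left-hand and a right-hand side. All relations are
  homogeneous for the parity in which the \<open>GT i\<close> are even and the \<open>GC i\<close> odd, so the
  underlying algebra of the superalgebra with this presentation is the ordinary quotient algebra.\<close>

definition hc_rels :: "'a::comm_ring_1 \<Rightarrow> nat \<Rightarrow> ((gen list \<Rightarrow> 'a) \<times> (gen list \<Rightarrow> 'a)) set" where
  "hc_rels q r = (let F = free_alg r; T = (\<lambda>i. free_gen (GT i)); c = (\<lambda>i. free_gen (GC i)) in
      {(c i \<otimes>\<^bsub>F\<^esub> c i, \<ominus>\<^bsub>F\<^esub> \<one>\<^bsub>F\<^esub>) | i. i \<in> {1..r}}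
    \<union> {(c i \<otimes>\<^bsub>F\<^esub> c j, \<ominus>\<^bsub>F\<^esub> (c j \<otimes>\<^bsub>F\<^esub> c i)) | i j. i \<in> {1..r} \<and> j \<in> {1..r} \<and> i \<noteq> j}
    \<union> {((T i \<ominus>\<^bsub>F\<^esub> q \<odot>\<^bsub>F\<^esub> \<one>\<^bsub>F\<^esub>) \<otimes>\<^bsub>F\<^esub> (T i \<oplus>\<^bsub>F\<^esub> \<one>\<^bsub>F\<^esub>), \<zero>\<^bsub>F\<^esub>) | i. i \<in> {1..<r}}
    \<union> {(T i \<otimes>\<^bsub>F\<^esub> T j, T j \<otimes>\<^bsub>F\<^esub> T i) | i j.
         i \<in> {1..<r} \<and> j \<in> {1..<r} \<and> \<bar>int i - int j\<bar> > 1}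
    \<union> {(T i \<otimes>\<^bsub>F\<^esub> T (i+1) \<otimes>\<^bsub>F\<^esub> T i, T (i+1) \<otimes>\<^bsub>F\<^esub> T i \<otimes>\<^bsub>F\<^esub> T (i+1)) | i.
         i \<in> {1..<r} \<and> i + 1 \<in> {1..<r}}
    \<union> {(c j \<otimes>\<^bsub>F\<^esub> T i, T i \<otimes>\<^bsub>F\<^esub> c j) | i j.
         i \<in> {1..<r} \<and> j \<in> {1..r} \<and> j \<noteq> i \<and> j \<noteq> i + 1}
    \<union> {(c (i+1) \<otimes>\<^bsub>F\<^esub> T i, T i \<otimes>\<^bsub>F\<^esub> c i) | i. i \<in> {1..<r}}
    \<union> {(c i \<otimes>\<^bsub>F\<^esub> T i, T i \<otimes>\<^bsub>F\<^esub> c (i+1) \<oplus>\<^bsub>F\<^esub> (q - 1) \<odot>\<^bsub>F\<^esub> (c i \<ominus>\<^bsub>F\<^esub> c (i+1))) | i. i \<in> {1..<r}})"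

definition hc_ideal :: "'a::comm_ring_1 \<Rightarrow> nat \<Rightarrow> (gen list \<Rightarrow> 'a) set" where
  "hc_ideal q r = Idl\<^bsub>free_alg r\<^esub> {a \<ominus>\<^bsub>free_alg r\<^esub> b | a b. (a, b) \<in> hc_rels q r}"

definition hecke_clifford :: "'a::comm_ring_1 \<Rightarrow> nat \<Rightarrow> ('a, (gen list \<Rightarrow> 'a) set) module" where
  "hecke_clifford q r = (let F = free_alg r; I = hc_ideal q r; H = F Quot I in
    \<lparr> carrier = carrier H, monoid.mult = monoid.mult H, one = one H, zero = zero H, add = add H,
      smult = (\<lambda>a X. \<Union>f\<in>X. I +>\<^bsub>F\<^esub> (a \<odot>\<^bsub>F\<^esub> f)) \<rparr>)"

definition hcT :: "'a::comm_ring_1 \<Rightarrow> nat \<Rightarrow> nat \<Rightarrow> (gen list \<Rightarrow> 'a) set" where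
  "hcT q r i = hc_ideal q r +>\<^bsub>free_alg r :: ('a, gen list \<Rightarrow> 'a) module\<^esub> free_gen (GT i)"

definition hcC :: "'a::comm_ring_1 \<Rightarrow> nat \<Rightarrow> nat \<Rightarrow> (gen list \<Rightarrow> 'a) set" where
  "hcC q r i = hc_ideal q r +>\<^bsub>free_alg r :: ('a, gen list \<Rightarrow> 'a) module\<^esub> free_gen (GC i)"

definition list_mult :: "('b, 'c) monoid_scheme \<Rightarrow> 'b list \<Rightarrow> 'b" where
  "list_mult G xs = foldr (monoid.mult G) xs (one G)"


section \<open>Symmetric groups\<close>

definition word_perm :: "nat list \<Rightarrow> nat \<Rightarrow> nat" where
  "word_perm is = foldr (\<lambda>i w. transpose i (i + 1) \<circ> w) is id"

definition perm_length :: "nat \<Rightarrow> (nat \<Rightarrow> nat) \<Rightarrow> nat" where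
  "perm_length r w =
    (LEAST k. \<exists>is. set is \<subseteq> {1..<r} \<and> word_perm is = w \<and> length is = k)"

definition reduced_expr :: "nat \<Rightarrow> (nat \<Rightarrow> nat) \<Rightarrow> nat list \<Rightarrow> bool" where
  "reduced_expr r w is \<longleftrightarrow>
    set is \<subseteq> {1..<r} \<and> word_perm is = w \<and> length is = perm_length r w"

text \<open>Independence of the chosen reduced expression is Matsumoto's theorem.\<close>

definition T_perm :: "'a::comm_ring_1 \<Rightarrow> nat \<Rightarrow> (nat \<Rightarrow> nat) \<Rightarrow> (gen list \<Rightarrow> 'a) set" where
  "T_perm q r w = list_mult (hecke_clifford q r) (map (hcT q r) (SOME is. reduced_expr r w is))"


section \<open>Compositions and matrices\<close>

text \<open>A composition is a list, so its \<open>i\<close>-th part is \<open>lam ! (i - 1)\<close>. Matrix indices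
  start at 1, and an \<open>n\<close> by \<open>n\<close> matrix is a function which vanishes outside
  \<open>{1..n} \<times> {1..n}\<close>; matrices are added and subtracted pointwise.\<close>

definition compositions :: "nat \<Rightarrow> nat \<Rightarrow> nat list set" where
  "compositions n r = {lam. length lam = n \<and> sum_list lam = r}"

definition young :: "nat list \<Rightarrow> (nat \<Rightarrow> nat) set" where
  "young lam = {w. w permutes {1..sum_list lam} \<and>
    (\<forall>i<length lam. let B = {sum_list (take i lam)<..sum_list (take (i + 1) lam)} in w ` B = B)}"

definition min_coset_reps :: "nat list \<Rightarrow> (nat \<Rightarrow> nat) set" where
  "min_coset_reps lam = (let r = sum_list lam in
    {d. d permutes {1..r} \<and> (\<forall>w\<in>young lam. perm_length r d \<le> perm_length r (w \<circ> d))})"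

definition x_elt :: "'a::comm_ring_1 \<Rightarrow> nat list \<Rightarrow> (gen list \<Rightarrow> 'a) set" where
  "x_elt q lam = (let r = sum_list lam in
    \<Oplus>\<^bsub>hecke_clifford q r\<^esub> w\<in>young lam. T_perm q r w)"

definition ro :: "nat \<Rightarrow> (nat \<Rightarrow> nat \<Rightarrow> nat) \<Rightarrow> nat list" where
  "ro n a = map (\<lambda>i. \<Sum>j=1..n. a i j) [1..<n+1]"

definition co :: "nat \<Rightarrow> (nat \<Rightarrow> nat \<Rightarrow> nat) \<Rightarrow> nat list" where
  "co n a = map (\<lambda>j. \<Sum>i=1..n. a i j) [1..<n+1]"

definition nu :: "nat \<Rightarrow> (nat \<Rightarrow> nat \<Rightarrow> nat) \<Rightarrow> nat list" where
  "nu n a = concat (map (\<lambda>j. map (\<lambda>i. a i j) [1..<n+1]) [1..<n+1])"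

definition a_tilde :: "nat \<Rightarrow> (nat \<Rightarrow> nat \<Rightarrow> nat) \<Rightarrow> nat \<Rightarrow> nat \<Rightarrow> nat" where
  "a_tilde n a i j = (\<Sum>p\<in>{1..<j}. \<Sum>u=1..n. a u p) + (\<Sum>u=1..i. a u j)"

definition a_hat :: "nat \<Rightarrow> (nat \<Rightarrow> nat \<Rightarrow> nat) \<Rightarrow> nat \<Rightarrow> nat \<Rightarrow> nat" where
  "a_hat n a h k = sum_list (take (h - 1) (ro n a)) + (\<Sum>u=1..k. a h u)"

definition d_perm :: "nat \<Rightarrow> (nat \<Rightarrow> nat \<Rightarrow> nat) \<Rightarrow> nat \<Rightarrow> nat" where
  "d_perm n a = (THE d. d permutes {1..\<Sum>i=1..n. \<Sum>j=1..n. a i j} \<and>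
    (\<forall>h\<in>{1..n}. \<forall>k\<in>{1..n}. \<forall>p\<in>{1..a h k}.
       d (a_tilde n a (h - 1) k + p) = a_hat n a h (k - 1) + p))"

definition E :: "nat \<Rightarrow> nat \<Rightarrow> nat \<Rightarrow> nat \<Rightarrow> int" where
  "E h k = (\<lambda>i j. if i = h \<and> j = k then 1 else 0)"

definition diag :: "nat list \<Rightarrow> nat \<Rightarrow> nat \<Rightarrow> int" where
  "diag lam = (\<lambda>i j. if i = j \<and> i \<in> {1..length lam} then int (lam ! (i - 1)) else 0)"

text \<open>Pairs of integer matrices; those in \<open>star_mats n\<close> have entries in \<open>\<nat>\<close>
  and in \<open>{0, 1}\<close>, respectively.\<close>

type_synonym star_mat = "(nat \<Rightarrow> nat \<Rightarrow> int) \<times> (nat \<Rightarrow> nat \<Rightarrow> int)"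

definition star_mats :: "nat \<Rightarrow> star_mat set" where
  "star_mats n = {(A0, A1).
     (\<forall>i j. \<not> (i \<in> {1..n} \<and> j \<in> {1..n}) \<longrightarrow> A0 i j = 0 \<and> A1 i j = 0) \<and>
     (\<forall>i\<in>{1..n}. \<forall>j\<in>{1..n}. 0 \<le> A0 i j \<and> A1 i j \<in> {0, 1})}"

definition base :: "star_mat \<Rightarrow> nat \<Rightarrow> nat \<Rightarrow> nat" where
  "base M = (\<lambda>i j. nat (fst M i j + snd M i j))"

definition star_mats_deg :: "nat \<Rightarrow> nat \<Rightarrow> star_mat set" where
  "star_mats_deg n r = {M \<in> star_mats n. (\<Sum>i=1..n. \<Sum>j=1..n. base M i j) = r}"


section \<open>The queer q-Schur superalgebra\<close>

text \<open>The direct sum of the right ideals generated by the \<open>x_elt q lam\<close>: the index set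
  \<open>compositions n r\<close> is finite, so its elements are families.\<close>

definition dsum :: "'a::comm_ring_1 \<Rightarrow> nat \<Rightarrow> nat \<Rightarrow> (nat list \<Rightarrow> (gen list \<Rightarrow> 'a) set) set" where
  "dsum q n r = (let H = hecke_clifford q r in
    PiE (compositions n r) (\<lambda>lam. {x_elt q lam \<otimes>\<^bsub>H\<^esub> h | h. h \<in> carrier H}))"

definition dsum_add where
  "dsum_add q n r u v = (\<lambda>lam\<in>compositions n r. u lam \<oplus>\<^bsub>hecke_clifford q r\<^esub> v lam)"

definition dsum_act where
  "dsum_act q n r v h = (\<lambda>lam\<in>compositions n r. v lam \<otimes>\<^bsub>hecke_clifford q r\<^esub> h)"

definition dsum_smult where
  "dsum_smult q n r a v = (\<lambda>lam\<in>compositions n r. a \<odot>\<^bsub>hecke_clifford q r\<^esub> v lam)"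

definition dsum_in where
  "dsum_in q n r mu m =
    (\<lambda>lam\<in>compositions n r. if lam = mu then m else \<zero>\<^bsub>hecke_clifford q r\<^esub>)"

text \<open>Endomorphisms are \<open>R\<close>-linear automatically, because the scalars act through
  the Hecke--Clifford superalgebra.\<close>

definition queer_schur :: "'a::comm_ring_1 \<Rightarrow> nat \<Rightarrow> nat \<Rightarrow>
    ('a, (nat list \<Rightarrow> (gen list \<Rightarrow> 'a) set) \<Rightarrow> nat list \<Rightarrow> (gen list \<Rightarrow> 'a) set) module" where
  "queer_schur q n r = (let V = dsum q n r; H = hecke_clifford q r in
    \<lparr> carrier = {f \<in> V \<rightarrow>\<^sub>E V.
        (\<forall>u\<in>V. \<forall>v\<in>V. f (dsum_add q n r u v) = dsum_add q n r (f u) (f v)) \<and>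
        (\<forall>v\<in>V. \<forall>h\<in>carrier H. f (dsum_act q n r v h) = dsum_act q n r (f v) h)},
      monoid.mult = (\<lambda>f g. compose V f g),
      one = (\<lambda>v\<in>V. v),
      zero = (\<lambda>v\<in>V. \<lambda>lam\<in>compositions n r. \<zero>\<^bsub>H\<^esub>),
      add = (\<lambda>f g. \<lambda>v\<in>V. dsum_add q n r (f v) (g v)),
      smult = (\<lambda>a f. \<lambda>v\<in>V. dsum_smult q n r a (f v)) \<rparr>)"

definition c_q :: "'a::comm_ring_1 \<Rightarrow> nat \<Rightarrow> nat \<Rightarrow> nat \<Rightarrow> (gen list \<Rightarrow> 'a) set" where
  "c_q q r i j = (let H = hecke_clifford q r in
    \<Oplus>\<^bsub>H\<^esub> t\<in>{i..j}. (q ^ (j - t)) \<odot>\<^bsub>H\<^esub> hcC q r t)"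

definition c_star :: "'a::comm_ring_1 \<Rightarrow> nat \<Rightarrow> nat \<Rightarrow> star_mat \<Rightarrow> (gen list \<Rightarrow> 'a) set" where
  "c_star q n r M = (let H = hecke_clifford q r; a = base M in
    list_mult H
      (concat (map (\<lambda>j. map (\<lambda>i.
          c_q q r (a_tilde n a (i - 1) j + 1) (a_tilde n a i j) [^]\<^bsub>H\<^esub> nat (snd M i j))
        [1..<n+1]) [1..<n+1])))"

definition Sigma_elt :: "'a::comm_ring_1 \<Rightarrow> nat \<Rightarrow> nat \<Rightarrow> (nat \<Rightarrow> nat \<Rightarrow> nat) \<Rightarrow> (gen list \<Rightarrow> 'a) set"
  where
  "Sigma_elt q n r a = (\<Oplus>\<^bsub>hecke_clifford q r\<^esub> \<sigma>\<in>min_coset_reps (nu n a) \<inter> young (co n a). T_perm q r \<sigma>)"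

definition T_star :: "'a::comm_ring_1 \<Rightarrow> nat \<Rightarrow> nat \<Rightarrow> star_mat \<Rightarrow> (gen list \<Rightarrow> 'a) set" where
  "T_star q n r M = (let H = hecke_clifford q r; a = base M in
    x_elt q (ro n a) \<otimes>\<^bsub>H\<^esub> T_perm q r (d_perm n a) \<otimes>\<^bsub>H\<^esub> c_star q n r M \<otimes>\<^bsub>H\<^esub> Sigma_elt q n r a)"

text \<open>For \<open>M\<close> in \<open>star_mats_deg n r\<close> the value on \<open>x_elt q mu \<otimes> h\<close>
  lies in the summand indexed by the row sums of \<open>M\<close>.\<close>

definition phi :: "'a::comm_ring_1 \<Rightarrow> nat \<Rightarrow> nat \<Rightarrow> star_mat \<Rightarrow>
    (nat list \<Rightarrow> (gen list \<Rightarrow> 'a) set) \<Rightarrow> nat list \<Rightarrow> (gen list \<Rightarrow> 'a) set" where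
  "phi q n r M = (let H = hecke_clifford q r; Q = queer_schur q n r; a = base M in
    if M \<in> star_mats_deg n r then
      (THE f. f \<in> carrier Q \<and>
        (\<forall>mu\<in>compositions n r. \<forall>h\<in>carrier H.
           f (dsum_in q n r mu (x_elt q mu \<otimes>\<^bsub>H\<^esub> h)) =
             dsum_in q n r (ro n a)
               (if mu = co n a then T_star q n r M \<otimes>\<^bsub>H\<^esub> h else \<zero>\<^bsub>H\<^esub>)))
    else \<zero>\<^bsub>Q\<^esub>)"

end

theory Submission
  imports Defs
begin

text \<open>
  Since \<open>T_A = x_ro \<cdot> (T_d c_A \<Sigma>_A)\<close> and the homomorphisms \<open>phi\<close> are determined by the images of the
  generators, the product of \<open>phi B\<close> and \<open>phi A\<close> is governed by the element \<open>T_B (T_d c_A \<Sigma>_A)\<close> of the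
  Hecke--Clifford superalgebra. When \<open>B\<close> differs from a diagonal matrix by moving one unit from row
  \<open>h + 1\<close> to row \<open>h\<close> (or back), \<open>T_B = x_b V\<close>, where \<open>V\<close> is the sum of the \<open>T_i\<close>-chains
  \<open>1 + T_s + T_s T_(s+1) + \<dots>\<close> that carry the moved position through its row.

  The elements \<open>v b \<rho> = \<Sum>{T_w | b \<circ> w = \<rho>}\<close> behave like the words \<open>\<rho>\<close> of a tensor space, on which \<open>V\<close>
  acts by a coproduct formula: it changes one letter \<open>h + 1\<close> to \<open>h\<close> and collects a power of \<open>q\<close>. This
  gives the sum over the columns \<open>k\<close> and reduces each summand to two adjacent blocks of the composition
  \<open>\<nu>_A\<close>. There \<open>c_q\<close> of a block is transported by \<open>x C = C' x\<close>, with \<open>C'\<close> the element with reversed powers of \<open>q\<close>,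
  and comparing \<open>c_q\<close> of the old blocks with \<open>c_q\<close> of the new ones
  gives the three terms, according to the parities of the two entries.

  A word over the row indices is encoded by the function \<open>\<rho>\<close> on positions, and a composition by the
  monotone function \<open>b\<close> that sends a position to the index of its block.
\<close>

section \<open>Inversions and reduced words\<close>

text \<open>The obstacle is the Clifford part: \<open>c_q\<close> of a block commutes neither with
  the \<open>T_t\<close> inside the block nor with \<open>V\<close>. Two weaker properties replace
  commutation. Factors on other blocks commute with the chains (\<open>outside\<close>). A factor on
  a block of \<open>b\<close> can be moved to the left of the corresponding \<open>x\<close>
  (\<open>transports\<close>), so that the chains meet an eigenvector of the \<open>T_t\<close>
  concerned and act by q-numbers. The sums \<Sigma> before and after the move differ, because
  \<nu>_A changes. Each is completed to one and the same sum over representatives of the common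
  refinement that isolates the moved position: one by the chains through the block that the position
  leaves, the other by the chains through the block that it joins. This identity converts the old
  normal form into the new one. The coefficient [[m]]_q - [[m]]_{q^2} appears when two odd entries
  meet: \<open>V\<close> has eigenvalue [[m]]_q on an eigenvector, whereas \<open>c_q\<close> of m
  positions squares to -[[m]]_{q^2}.\<close>

declare One_nat_def [simp del]

definition sw :: "nat \<Rightarrow> nat \<Rightarrow> nat" where
  "sw t = transpose t (Suc t)"

lemma sw_apply: "sw t x = (if x = t then Suc t else if x = Suc t then t else x)"
  by (simp add: sw_def transpose_def)

lemma sw_first [simp]: "sw t t = Suc t"
  and sw_second [simp]: "sw t (Suc t) = t"
  and sw_other: "x \<noteq> t \<Longrightarrow> x \<noteq> Suc t \<Longrightarrow> sw t x = x"
  and sw_involutory [simp]: "sw t (sw t x) = x"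
  by (simp_all add: sw_apply)

definition invs :: "nat \<Rightarrow> (nat \<Rightarrow> nat) \<Rightarrow> (nat \<times> nat) set" where
  "invs r f = {(x, y). 1 \<le> x \<and> x < y \<and> y \<le> r \<and> f y < f x}"

lemma finite_invs [simp]: "finite (invs r f)"
  by (rule finite_subset[of _ "{..r} \<times> {..r}"]) (auto simp: invs_def)

lemma sw_permutes: "t \<in> {1..<r} \<Longrightarrow> sw t permutes {1..r}"
  unfolding sw_def by (rule permutes_swap_id) auto

lemma sw_sw: "w \<circ> sw t \<circ> sw t = w"
  by (simp add: fun_eq_iff)

text \<open>Applying \<open>sw t\<close> to both coordinates carries the inversions of
  \<open>f\<close> into those of \<open>f \<circ> sw t\<close>; the pair \<open>(t, Suc t)\<close>
  is the only new one.\<close>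

lemma card_invs_sw:
  assumes t: "t \<in> {1..<r}" and f: "f t < f (Suc t)"
  shows "card (invs r (f \<circ> sw t)) = Suc (card (invs r f))"
proof -
  let ?s = "sw t"
  have eq: "invs r (f \<circ> ?s) = insert (t, Suc t) (map_prod ?s ?s ` invs r f)" (is "_ = ?R")
  proof (intro Set.set_eqI)
    fix p :: "nat \<times> nat"
    obtain x y where p: "p = (x, y)" by (cases p)
    have "p \<in> ?R \<longleftrightarrow> p = (t, Suc t) \<or> (?s x, ?s y) \<in> invs r f"
    proof -
      have "p \<in> map_prod ?s ?s ` invs r f \<longleftrightarrow> (?s x, ?s y) \<in> invs r f"
        unfolding p by (force simp: image_iff)
      then show ?thesis by auto
    qed
    also have "\<dots> \<longleftrightarrow> p \<in> invs r (f \<circ> ?s)"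
      using t f unfolding p by (auto simp: invs_def sw_apply split: if_splits)
    finally show "p \<in> invs r (f \<circ> ?s) \<longleftrightarrow> p \<in> ?R" ..
  qed
  have "inj_on (map_prod ?s ?s) (invs r f)"
    by (intro inj_onI) (metis map_prod_simp prod.collapse prod.inject sw_involutory)
  moreover have "(t, Suc t) \<notin> map_prod ?s ?s ` invs r f"
    by (auto simp: invs_def sw_apply split: if_splits)
  ultimately show ?thesis
    unfolding eq by (simp add: card_image)
qed

lemma card_invs_sw_down:
  assumes t: "t \<in> {1..<r}" and f: "f (Suc t) < f t"
  shows "card (invs r f) = Suc (card (invs r (f \<circ> sw t)))"
  using card_invs_sw[OF t, of "f \<circ> sw t"] f by (simp add: sw_sw)

lemma permutes_strict_mono_id:
  fixes w :: "nat \<Rightarrow> nat"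
  assumes w: "w permutes {1..r}" and mono: "\<And>t. t \<in> {1..<r} \<Longrightarrow> w t < w (Suc t)"
  shows "w = id"
proof (rule permutes_natset_ge[OF w], intro ballI)
  fix x assume "x \<in> {1..r}"
  then show "x \<le> w x"
  proof (induction x)
    case (Suc x)
    show ?case
    proof (cases "x = 0")
      case True
      then show ?thesis using permutes_in_image[OF w, of 1] Suc.prems by (auto simp: One_nat_def)
    next
      case False
      then show ?thesis using Suc mono[of x] by auto
    qed
  qed simp
qed

lemma permutes_neq_Suc: "w permutes A \<Longrightarrow> w t \<noteq> w (Suc t)"
  by (metis injD n_not_Suc_n permutes_inj)

lemma descent_exists:
  fixes w :: "nat \<Rightarrow> nat"
  assumes "w permutes {1..r}" "w \<noteq> id"
  obtains t where "t \<in> {1..<r}" "w (Suc t) < w t"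
proof -
  have "\<exists>t\<in>{1..<r}. \<not> w t < w (Suc t)"
    using permutes_strict_mono_id assms by blast
  then obtain t where t: "t \<in> {1..<r}" "\<not> w t < w (Suc t)" by blast
  moreover have "w t \<noteq> w (Suc t)"
    by (rule permutes_neq_Suc[OF assms(1)])
  ultimately show ?thesis using that by force
qed

lemma permutes_comp_sw:
  "w permutes {1..r} \<Longrightarrow> t \<in> {1..<r} \<Longrightarrow> w \<circ> sw t permutes {1..r}"
  by (rule permutes_compose[OF sw_permutes])

text \<open>Every permutation is reached from \<open>id\<close> by right multiplications that add
  one inversion each, since a permutation other than \<open>id\<close> has a descent that can be
  stripped.\<close>

lemma permutes_invs_induct [consumes 1, case_names id swap]:
  assumes "w permutes {1..r}"
    and "P id"
    and step: "\<And>w t. w permutes {1..r} \<Longrightarrow> t \<in> {1..<r} \<Longrightarrow> w t < w (Suc t) \<Longrightarrow> P w \<Longrightarrow> P (w \<circ> sw t)"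
  shows "P w"
  using assms(1)
proof (induction "card (invs r w)" arbitrary: w rule: less_induct)
  case less
  show ?case
  proof (cases "w = id")
    case False
    then obtain t where t: "t \<in> {1..<r}" "w (Suc t) < w t"
      using descent_exists less.prems by blast
    then have "P (w \<circ> sw t)"
      using less card_invs_sw_down[of t r w] permutes_comp_sw by simp
    moreover have "w \<circ> sw t permutes {1..r}"
      using t less.prems by (intro permutes_comp_sw)
    ultimately have "P (w \<circ> sw t \<circ> sw t)"
      using t step[of "w \<circ> sw t" t] by simp
    then show ?thesis by (simp only: sw_sw)
  qed (use assms in simp)
qed

section \<open>Words in the simple transpositions and their length\<close>

lemma foldr_comp: "foldr (\<lambda>i w. g i \<circ> w) is w = foldr (\<lambda>i w. g i \<circ> w) is id \<circ> w"
  by (induction "is") (auto simp: comp_assoc)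

lemma word_perm_Nil [simp]: "word_perm [] = id"
  by (simp add: word_perm_def)

lemma word_perm_append: "word_perm (is @ js) = word_perm is \<circ> word_perm js"
  using foldr_comp[of "\<lambda>i. transpose i (i + 1)" "is" "word_perm js"] by (simp add: word_perm_def)

lemma word_perm_single: "word_perm [i] = sw i"
  by (simp add: word_perm_def sw_def One_nat_def)

lemma word_perm_snoc: "word_perm (is @ [i]) = word_perm is \<circ> sw i"
  by (simp add: word_perm_append word_perm_single)

lemma word_perm_permutes: "set is \<subseteq> {1..<r} \<Longrightarrow> word_perm is permutes {1..r}"
proof (induction "is" rule: rev_induct)
  case (snoc i "is")
  then show ?case unfolding word_perm_snoc by (intro permutes_comp_sw) auto
qed (simp add: permutes_id)

lemma card_invs_word_perm: "set is \<subseteq> {1..<r} \<Longrightarrow> card (invs r (word_perm is)) \<le> length is"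
proof (induction "is" rule: rev_induct)
  case Nil
  have "invs r id = {}" by (auto simp: invs_def)
  then show ?case by (simp del: id_apply)
next
  case (snoc i "is")
  let ?w = "word_perm is"
  have i: "i \<in> {1..<r}" using snoc.prems by simp
  have "?w i \<noteq> ?w (Suc i)"
    using snoc.prems by (intro permutes_neq_Suc[OF word_perm_permutes]) auto
  then have "card (invs r (?w \<circ> sw i)) \<le> Suc (card (invs r ?w))"
    using card_invs_sw[OF i, of ?w] card_invs_sw_down[OF i, of ?w] by linarith
  then show ?case using snoc by (simp add: word_perm_snoc o_def)
qed

lemma word_perm_exists:
  "w permutes {1..r} \<Longrightarrow> \<exists>is. set is \<subseteq> {1..<r} \<and> word_perm is = w \<and> length is = card (invs r w)"
proof (induction w rule: permutes_invs_induct)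
  case id
  have "invs r id = {}" by (auto simp: invs_def)
  then show ?case by (intro exI[of _ "[]"]) (simp del: id_apply)
next
  case (swap w t)
  then obtain "is" where "set is \<subseteq> {1..<r}" "word_perm is = w" "length is = card (invs r w)"
    by blast
  then show ?case
    using swap card_invs_sw[of t r w]
    by (intro exI[of _ "is @ [t]"]) (simp add: word_perm_snoc o_def)
qed

text \<open>One letter changes the inversion number by one, so no word is shorter than it; stripping
  descents produces a word of exactly this length.\<close>

lemma perm_length_eq:
  assumes "w permutes {1..r}"
  shows "perm_length r w = card (invs r w)"
  unfolding perm_length_def
proof (rule Least_equality)
  show "\<exists>is. set is \<subseteq> {1..<r} \<and> word_perm is = w \<and> length is = card (invs r w)"
    by (rule word_perm_exists[OF assms])
  show "card (invs r w) \<le> k"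
    if "\<exists>is. set is \<subseteq> {1..<r} \<and> word_perm is = w \<and> length is = k" for k
    using that card_invs_word_perm by blast
qed

lemma reduced_expr_iff:
  "reduced_expr r w is \<longleftrightarrow> set is \<subseteq> {1..<r} \<and> word_perm is = w \<and> length is = card (invs r w)"
  unfolding reduced_expr_def using perm_length_eq word_perm_permutes by metis

lemma reduced_expr_exists: "w permutes {1..r} \<Longrightarrow> \<exists>is. reduced_expr r w is"
  using word_perm_exists by (simp add: reduced_expr_iff)

lemma reduced_expr_snoc:
  assumes "reduced_expr r w is" "t \<in> {1..<r}" "w t < w (Suc t)"
  shows "reduced_expr r (w \<circ> sw t) (is @ [t])"
  using assms card_invs_sw[of t r w] by (simp add: reduced_expr_iff word_perm_snoc)

text \<open>If the last letter lowered the inversion number, the remaining word would be shorter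
  than the inversion number of its own product.\<close>

lemma reduced_expr_butlast:
  assumes "reduced_expr r w (is @ [t])"
  shows "t \<in> {1..<r}" "w (Suc t) < w t" "reduced_expr r (w \<circ> sw t) is"
proof -
  let ?u = "word_perm is"
  have sub: "set is \<subseteq> {1..<r}" and t: "t \<in> {1..<r}" and w: "w = ?u \<circ> sw t"
    and len: "Suc (length is) = card (invs r w)"
    using assms by (auto simp: reduced_expr_iff word_perm_snoc)
  have le: "card (invs r ?u) \<le> length is" using card_invs_word_perm[OF sub] .
  have "?u t \<noteq> ?u (Suc t)"
    by (rule permutes_neq_Suc[OF word_perm_permutes[OF sub]])
  then have "?u t < ?u (Suc t)"
    using card_invs_sw_down[OF t, of ?u] le len unfolding w by linarith
  then show "t \<in> {1..<r}" "w (Suc t) < w t" "reduced_expr r (w \<circ> sw t) is"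
    using t w len card_invs_sw[OF t, of ?u] sub by (auto simp: reduced_expr_iff sw_sw)
qed

text \<open>If the words end in different letters \<open>t\<close> and \<open>u\<close>, then \<open>w\<close> also has reduced
  expressions ending in the two sides of the braid relation between \<open>t\<close> and \<open>u\<close>.\<close>

lemma matsumoto:
  fixes g :: "nat \<Rightarrow> 'b::monoid_mult"
  assumes comm: "\<And>i j. i \<in> {1..<r} \<Longrightarrow> j \<in> {1..<r} \<Longrightarrow> Suc i < j \<Longrightarrow> g i * g j = g j * g i"
    and braid: "\<And>i. i \<in> {1..<r} \<Longrightarrow> Suc i \<in> {1..<r} \<Longrightarrow>
      g i * g (Suc i) * g i = g (Suc i) * g i * g (Suc i)"
    and "reduced_expr r w is" "reduced_expr r w js"
  shows "prod_list (map g is) = prod_list (map g js)"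
  using assms(3,4)
proof (induction "length is" arbitrary: w "is" js rule: less_induct)
  case less
  have len: "length js = length is" using less.prems by (simp add: reduced_expr_iff)
  show ?case
  proof (cases "is" rule: rev_cases)
    case Nil
    then show ?thesis using len by simp
  next
    case iss: (snoc is' t)
    then obtain js' u where js: "js = js' @ [u]" using len by (cases js rule: rev_cases) auto
    note t = reduced_expr_butlast[OF less.prems(1)[unfolded iss]]
    note u = reduced_expr_butlast[OF less.prems(2)[unfolded js]]
    have perm: "w permutes {1..r}"
      using less.prems(1) word_perm_permutes by (auto simp: reduced_expr_iff)
    have IH: "prod_list (map g ks) = prod_list (map g ls)"
      if "reduced_expr r v ks" "reduced_expr r v ls" "length ks < length is" for v ks ls
      using less.hyps that by blast
    have main: "prod_list (map g is') * g t = prod_list (map g js') * g u"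
      if t: "t \<in> {1..<r}" "w (Suc t) < w t" "reduced_expr r (w \<circ> sw t) is'"
      and u: "u \<in> {1..<r}" "w (Suc u) < w u" "reduced_expr r (w \<circ> sw u) js'"
      and "t < u" and lens: "length is' < length is" "length js' < length is" for t u is' js'
    proof (cases "Suc t = u")
      case False
      with \<open>t < u\<close> have tu: "Suc t < u" by simp
      let ?v = "w \<circ> sw t \<circ> sw u"
      have v': "?v = w \<circ> sw u \<circ> sw t" using tu by (auto simp: fun_eq_iff sw_apply)
      have "?v permutes {1..r}" using perm t u by (intro permutes_comp_sw)
      then obtain ks where ks: "reduced_expr r ?v ks" using reduced_expr_exists by blast
      have a1: "?v u < ?v (Suc u)" "?v t < ?v (Suc t)"
        using tu t u by (auto simp: sw_apply)
      have r1: "reduced_expr r (w \<circ> sw t) (ks @ [u])"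
        using reduced_expr_snoc[OF ks u(1) a1(1)] by (simp only: sw_sw)
      have r2: "reduced_expr r (w \<circ> sw u) (ks @ [t])"
        using reduced_expr_snoc[OF ks t(1) a1(2)] by (simp only: v' sw_sw)
      have "prod_list (map g is') * g t = prod_list (map g ks) * g u * g t"
        using IH[OF t(3) r1] lens by simp
      also have "\<dots> = prod_list (map g ks) * g t * g u"
        using comm[OF t(1) u(1) tu] by (simp add: mult.assoc)
      also have "\<dots> = prod_list (map g js') * g u"
        using IH[OF u(3) r2] lens by simp
      finally show ?thesis .
    next
      case True
      let ?v = "w \<circ> sw t \<circ> sw u \<circ> sw t"
      have v': "?v = w \<circ> sw u \<circ> sw t \<circ> sw u" using True by (auto simp: fun_eq_iff sw_apply)
      have "?v permutes {1..r}" using perm t u by (intro permutes_comp_sw)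
      then obtain ks where ks: "reduced_expr r ?v ks" using reduced_expr_exists by blast
      have w: "w (Suc (Suc t)) < w (Suc t)" "w (Suc t) < w t" using t u True by auto
      have r1: "reduced_expr r (w \<circ> sw t \<circ> sw u) (ks @ [t])"
        using reduced_expr_snoc[OF ks t(1)] w True by (simp add: sw_sw sw_apply)
      have r2: "reduced_expr r (w \<circ> sw t) (ks @ [t] @ [u])"
        using reduced_expr_snoc[OF r1 u(1)] w True by (simp add: sw_sw sw_apply)
      have s1: "reduced_expr r (w \<circ> sw u \<circ> sw t) (ks @ [u])"
        using reduced_expr_snoc[OF ks u(1)] w True unfolding v' by (simp add: sw_sw sw_apply)
      have s2: "reduced_expr r (w \<circ> sw u) (ks @ [u] @ [t])"
        using reduced_expr_snoc[OF s1 t(1)] w True by (simp add: sw_sw sw_apply)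
      have "prod_list (map g is') * g t = prod_list (map g ks) * (g t * g u * g t)"
        using IH[OF t(3) r2] lens by (simp add: mult.assoc)
      also have "\<dots> = prod_list (map g ks) * (g u * g t * g u)"
        using braid[of t] t u True by simp
      also have "\<dots> = prod_list (map g js') * g u"
        using IH[OF u(3) s2] lens by (simp add: mult.assoc)
      finally show ?thesis .
    qed
    have lens: "length is' < length is" "length js' < length is"
      using iss js len by auto
    consider "t = u" | "t < u" | "u < t" by linarith
    then have "prod_list (map g is') * g t = prod_list (map g js') * g u"
    proof cases
      case 1
      then show ?thesis using IH[OF t(3)] u(3) lens by simp
    next
      case 2
      then show ?thesis using main[OF t u 2 lens] by simp
    next
      case 3
      then show ?thesis using main[OF u t 3 lens(2,1)] by simp
    qed
    then show ?thesis by (simp add: iss js)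
  qed
qed

section \<open>Cosets of Young subgroups\<close>

abbreviation pinv :: "(nat \<Rightarrow> nat) \<Rightarrow> nat \<Rightarrow> nat" where
  "pinv \<equiv> Hilbert_Choice.inv"

text \<open>For a block function \<open>b\<close> and a word \<open>\<rho>\<close> this set is empty
  or a single right coset of the Young subgroup of \<open>b\<close>; the word
  \<open>\<rho> = b\<close> gives the subgroup itself.\<close>

definition fibre :: "nat \<Rightarrow> (nat \<Rightarrow> nat) \<Rightarrow> (nat \<Rightarrow> nat) \<Rightarrow> (nat \<Rightarrow> nat) set" where
  "fibre r b \<rho> = {w. w permutes {1..r} \<and> (\<forall>x\<in>{1..r}. b (w x) = \<rho> x)}"

abbreviation yg :: "nat \<Rightarrow> (nat \<Rightarrow> nat) \<Rightarrow> (nat \<Rightarrow> nat) set" where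
  "yg r b \<equiv> fibre r b b"

text \<open>The shortest representatives of the right cosets of \<open>yg r b\<close>: the inverse
  of \<open>d\<close> is increasing on every block. \<open>inc\<close> is the mirror image for left
  cosets.\<close>

definition dr :: "nat \<Rightarrow> (nat \<Rightarrow> nat) \<Rightarrow> (nat \<Rightarrow> nat) set" where
  "dr r b = {d. d permutes {1..r} \<and>
    (\<forall>x\<in>{1..r}. \<forall>y\<in>{1..r}. x < y \<longrightarrow> b (d x) = b (d y) \<longrightarrow> d x < d y)}"

definition inc :: "nat \<Rightarrow> (nat \<Rightarrow> nat) \<Rightarrow> (nat \<Rightarrow> nat) set" where
  "inc r b = {e. e permutes {1..r} \<and>
    (\<forall>x\<in>{1..r}. \<forall>y\<in>{1..r}. x < y \<longrightarrow> b x = b y \<longrightarrow> e x < e y)}"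

text \<open>Additivity of length in the product \<open>u \<circ> v\<close>, expressed by inversions:
  those of \<open>v\<close> survive.\<close>

definition noninv :: "nat \<Rightarrow> (nat \<Rightarrow> nat) \<Rightarrow> (nat \<Rightarrow> nat) \<Rightarrow> bool" where
  "noninv r u v \<longleftrightarrow> (\<forall>x\<in>{1..r}. \<forall>y\<in>{1..r}. x < y \<longrightarrow> v y < v x \<longrightarrow> u (v y) < u (v x))"

definition interval_block :: "nat \<Rightarrow> (nat \<Rightarrow> nat) \<Rightarrow> nat \<Rightarrow> nat \<Rightarrow> bool" where
  "interval_block r b i j \<longleftrightarrow> 1 \<le> i \<and> i \<le> j \<and> j \<le> r \<and>
     (\<forall>x\<in>{1..r}. b x = b i \<longleftrightarrow> i \<le> x \<and> x \<le> j)"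

text \<open>Only the partition is prescribed, not the values of \<open>b'\<close>, so that a
  monotone \<open>b'\<close> can be chosen and the same \<open>b'\<close> can serve two functions
  that differ at \<open>x0\<close>.\<close>

definition isolates :: "nat \<Rightarrow> (nat \<Rightarrow> nat) \<Rightarrow> (nat \<Rightarrow> nat) \<Rightarrow> nat \<Rightarrow> bool" where
  "isolates r b b' x0 \<longleftrightarrow> x0 \<in> {1..r} \<and>
    (\<forall>x\<in>{1..r}. \<forall>y\<in>{1..r}. b' x = b' y \<longleftrightarrow> b x = b y \<and> (x = x0 \<longleftrightarrow> y = x0))"

lemma fibre_permutes: "w \<in> fibre r b \<rho> \<Longrightarrow> w permutes {1..r}"
  and dr_permutes: "d \<in> dr r b \<Longrightarrow> d permutes {1..r}"
  and inc_permutes: "e \<in> inc r b \<Longrightarrow> e permutes {1..r}"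
  unfolding fibre_def dr_def inc_def by blast+

lemma fibreD: "w \<in> fibre r b \<rho> \<Longrightarrow> x \<in> {1..r} \<Longrightarrow> b (w x) = \<rho> x"
  unfolding fibre_def by blast

lemma drD:
  "d \<in> dr r b \<Longrightarrow> x \<in> {1..r} \<Longrightarrow> y \<in> {1..r} \<Longrightarrow> x < y \<Longrightarrow> b (d x) = b (d y) \<Longrightarrow> d x < d y"
  unfolding dr_def by blast

lemma incD:
  "e \<in> inc r b \<Longrightarrow> x \<in> {1..r} \<Longrightarrow> y \<in> {1..r} \<Longrightarrow> x < y \<Longrightarrow> b x = b y \<Longrightarrow> e x < e y"
  unfolding inc_def by blast

lemma permutes_range: "w permutes {1..r} \<Longrightarrow> x \<in> {1..r} \<Longrightarrow> w x \<in> {1..r}"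
  by (simp only: permutes_in_image)

lemma fibre_comp:
  assumes "w \<in> fibre r b \<rho>" "u \<in> fibre r \<rho> \<sigma>"
  shows "w \<circ> u \<in> fibre r b \<sigma>"
proof -
  have "b (w (u x)) = \<sigma> x" if "x \<in> {1..r}" for x
    using fibreD[OF assms(1) permutes_range[OF fibre_permutes[OF assms(2)] that]]
      fibreD[OF assms(2) that] by simp
  then show ?thesis
    using permutes_compose[OF fibre_permutes[OF assms(2)] fibre_permutes[OF assms(1)]]
    by (simp add: fibre_def)
qed

lemma fibre_inv:
  assumes "w \<in> fibre r b \<rho>"
  shows "pinv w \<in> fibre r \<rho> b"
proof -
  have w: "w permutes {1..r}" using assms by (rule fibre_permutes)
  have "\<rho> (pinv w x) = b x" if "x \<in> {1..r}" for x
    using fibreD[OF assms permutes_range[OF permutes_inv[OF w] that]] permutes_inverses(1)[OF w, of x]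
    by simp
  then show ?thesis using permutes_inv[OF w] by (simp add: fibre_def)
qed

lemma id_yg [simp]: "id \<in> yg r b"
  by (simp add: fibre_def permutes_id)

lemma permutes_inv_comp: "w permutes S \<Longrightarrow> pinv w \<circ> w = id" "w permutes S \<Longrightarrow> w \<circ> pinv w = id"
  by (simp_all add: permutes_inv_o)

lemma inv_inc_iff:
  assumes "d permutes {1..r}"
  shows "pinv d \<in> inc r b \<longleftrightarrow> d \<in> dr r b"
proof
  assume d: "d \<in> dr r b"
  have inv: "pinv d permutes {1..r}" using assms by (rule permutes_inv)
  have "pinv d x < pinv d y" if "x \<in> {1..r}" "y \<in> {1..r}" "x < y" "b x = b y" for x y
  proof (rule ccontr)
    assume "\<not> pinv d x < pinv d y"
    moreover have "pinv d x \<noteq> pinv d y" using that inv by (metis less_irrefl permutes_inverses(1)[OF assms])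
    ultimately have "pinv d y < pinv d x" by simp
    moreover have "pinv d x \<in> {1..r}" "pinv d y \<in> {1..r}" using permutes_range[OF inv] that by auto
    ultimately have "d (pinv d y) < d (pinv d x)"
      using that permutes_inverses(1)[OF assms] by (intro drD[OF d]) auto
    then show False using that permutes_inverses(1)[OF assms] by simp
  qed
  then show "pinv d \<in> inc r b" using inv by (simp add: inc_def)
next
  assume e: "pinv d \<in> inc r b"
  have "d x < d y" if xy: "x \<in> {1..r}" "y \<in> {1..r}" "x < y" "b (d x) = b (d y)" for x y
  proof (rule ccontr)
    assume "\<not> d x < d y"
    moreover have "d x \<noteq> d y" using xy by (metis less_irrefl permutes_inverses(2)[OF assms])
    ultimately have "d y < d x" by simp
    then have "pinv d (d y) < pinv d (d x)"
      using permutes_range[OF assms] xy by (intro incD[OF e]) auto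
    then show False using xy permutes_inverses(2)[OF assms] by simp
  qed
  then show "d \<in> dr r b" using assms by (simp add: dr_def)
qed

section \<open>Unique factorisation into a shortest representative and a Young element\<close>

lemma inc_if_adjacent:
  assumes b: "mono_on {1..r} b" and e: "e permutes {1..r}"
    and adj: "\<And>t. t \<in> {1..<r} \<Longrightarrow> b t = b (Suc t) \<Longrightarrow> e t < e (Suc t)"
  shows "e \<in> inc r b"
proof -
  have "e x < e y" if "x < y" "x \<in> {1..r}" "y \<in> {1..r}" "b x = b y" for x y
    using that
  proof (induction y)
    case (Suc y)
    show ?case
    proof (cases "x = y")
      case True
      then show ?thesis using Suc adj[of y] by auto
    next
      case False
      then have y: "y \<in> {1..r}" "x < y" using Suc.prems by auto
      \<comment> \<open>Monotonicity makes blocks intervals: \<open>y\<close> is squeezed between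
        two positions of one block.\<close>
      then have "b x \<le> b y" "b y \<le> b (Suc y)"
        using monotone_onD[OF b, of x y] monotone_onD[OF b, of y "Suc y"] Suc.prems y by auto
      then have eq: "b x = b y" "b y = b (Suc y)" using Suc.prems by auto
      have "e y < e (Suc y)" using eq y Suc.prems by (intro adj) auto
      moreover have "e x < e y" using Suc.IH y eq Suc.prems by auto
      ultimately show ?thesis by simp
    qed
  qed simp
  then show ?thesis using e by (simp add: inc_def)
qed

lemma sw_yg:
  assumes "t \<in> {1..<r}" "b t = b (Suc t)"
  shows "sw t \<in> yg r b"
  using assms sw_permutes[OF assms(1)] by (auto simp: fibre_def sw_apply)

text \<open>Take \<open>w \<circ> u\<close> with the fewest inversions in its coset: a descent
  inside a block could be removed by a further Young element.\<close>

lemma inc_decomposition: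
  assumes b: "mono_on {1..r} b" and w: "w permutes {1..r}"
  obtains e u where "e \<in> inc r b" "u \<in> yg r b" "w = e \<circ> u"
proof -
  obtain u where u: "u \<in> yg r b"
    and min: "\<And>v. v \<in> yg r b \<Longrightarrow> card (invs r (w \<circ> u)) \<le> card (invs r (w \<circ> v))"
    using ex_has_least_nat[of "\<lambda>u. u \<in> yg r b" id "\<lambda>u. card (invs r (w \<circ> u))"] id_yg by blast
  have perm: "w \<circ> u permutes {1..r}" using w u by (simp add: fibre_permutes permutes_compose)
  have "w \<circ> u \<in> inc r b"
  proof (rule inc_if_adjacent[OF b perm])
    fix t assume t: "t \<in> {1..<r}" "b t = b (Suc t)"
    have "u \<circ> sw t \<in> yg r b" using fibre_comp[OF u sw_yg[OF t]] .
    then have "card (invs r (w \<circ> u)) \<le> card (invs r (w \<circ> u \<circ> sw t))"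
      using min[of "u \<circ> sw t"] by (simp add: comp_assoc)
    then have "\<not> (w \<circ> u) (Suc t) < (w \<circ> u) t"
      using card_invs_sw_down[OF t(1), of "w \<circ> u"] by linarith
    then show "(w \<circ> u) t < (w \<circ> u) (Suc t)"
      using permutes_neq_Suc[OF perm, of t] by linarith
  qed
  moreover have "pinv u \<in> yg r b" by (rule fibre_inv[OF u])
  moreover have "w = w \<circ> u \<circ> pinv u"
    using permutes_inv_comp(2)[OF fibre_permutes[OF u]] by (simp add: comp_assoc)
  ultimately show ?thesis using that by blast
qed

lemma yg_order_preserving_id:
  assumes b: "mono_on {1..r} b" and g: "g \<in> yg r b"
    and "\<And>x y. x \<in> {1..r} \<Longrightarrow> y \<in> {1..r} \<Longrightarrow> x < y \<Longrightarrow> b x = b y \<Longrightarrow> g x < g y"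
  shows "g = id"
proof (rule permutes_strict_mono_id[OF fibre_permutes[OF g]])
  fix t assume t: "t \<in> {1..<r}"
  have mem: "t \<in> {1..r}" "Suc t \<in> {1..r}" using t by auto
  note gmem = permutes_range[OF fibre_permutes[OF g] mem(1)]
    permutes_range[OF fibre_permutes[OF g] mem(2)]
  show "g t < g (Suc t)"
  proof (cases "b t = b (Suc t)")
    case True
    then show ?thesis using assms(3)[OF mem] by simp
  next
    case False
    have "b t \<le> b (Suc t)" using mem by (auto intro!: monotone_onD[OF b])
    then have "b (g t) < b (g (Suc t))" using False g mem by (simp add: fibre_def)
    then show ?thesis using b gmem by (meson leD leI monotone_onD)
  qed
qed

lemma inc_unique:
  assumes b: "mono_on {1..r} b" and e: "e \<in> inc r b" and g: "g \<in> yg r b" and eg: "e \<circ> g \<in> inc r b"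
  shows "g = id"
proof (rule yg_order_preserving_id[OF b g])
  fix x y assume xy: "x \<in> {1..r}" "y \<in> {1..r}" "x < y" "b x = b y"
  note gp = fibre_permutes[OF g]
  have 1: "e (g x) < e (g y)" using incD[OF eg xy] by simp
  have mem: "g x \<in> {1..r}" "g y \<in> {1..r}" "b (g x) = b (g y)"
    using permutes_range[OF gp] xy fibreD[OF g] by auto
  show "g x < g y"
  proof (rule ccontr)
    assume "\<not> g x < g y"
    then consider "g x = g y" | "g y < g x" by linarith
    then show False
    proof cases
      case 2
      then have "e (g y) < e (g x)" using mem by (intro incD[OF e]) auto
      then show False using 1 by simp
    qed (use 1 in simp)
  qed
qed

text \<open>Inversion of permutations exchanges \<open>dr\<close> and \<open>inc\<close>, so
  uniqueness for right cosets follows from uniqueness for left cosets.\<close>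

lemma dr_unique:
  assumes b: "mono_on {1..r} b" and d: "d \<in> dr r b" and g: "g \<in> yg r b" and gd: "g \<circ> d \<in> dr r b"
  shows "g = id"
proof -
  note dp = dr_permutes[OF d] and gp = fibre_permutes[OF g] and gdp = dr_permutes[OF gd]
  have "pinv (g \<circ> d) = pinv d \<circ> pinv g"
    using dp gp by (intro o_inv_distrib permutes_bij)
  then have "pinv d \<circ> pinv g \<in> inc r b"
    using inv_inc_iff[OF gdp, of b] gd by simp
  then have "pinv g = id"
    using inc_unique[OF b _ fibre_inv[OF g]] inv_inc_iff[OF dp] d by blast
  then have "pinv (pinv g) = id" by simp
  then show ?thesis by (simp only: inv_inv_eq[OF permutes_bij[OF gp]])
qed

lemma dr_decomposition:
  assumes b: "mono_on {1..r} b" and w: "w permutes {1..r}"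
  obtains u d where "u \<in> yg r b" "d \<in> dr r b" "w = u \<circ> d"
proof -
  obtain e u where eu: "e \<in> inc r b" "u \<in> yg r b" "pinv w = e \<circ> u"
    using inc_decomposition[OF b permutes_inv[OF w]] .
  note ep = inc_permutes[OF eu(1)] and up = fibre_permutes[OF eu(2)]
  have "w = pinv (pinv w)" using w by (simp add: permutes_inv_inv)
  also have "\<dots> = pinv u \<circ> pinv e"
    unfolding eu(3) using ep up by (intro o_inv_distrib permutes_bij)
  finally have "w = pinv u \<circ> pinv e" .
  moreover have "pinv e \<in> dr r b"
    using eu(1) inv_inc_iff[OF permutes_inv[OF ep], of b] by (simp add: permutes_inv_inv[OF ep])
  ultimately show ?thesis using that fibre_inv[OF eu(2)] by blast
qed

text \<open>A Young element inverts only pairs within one block, and there \<open>e\<close> is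
  increasing.\<close>

lemma noninv_inc_yg:
  assumes b: "mono_on {1..r} b" and e: "e \<in> inc r b" and u: "u \<in> yg r b"
  shows "noninv r e u"
  unfolding noninv_def
proof (intro ballI impI)
  fix x y assume xy: "x \<in> {1..r}" "y \<in> {1..r}" "x < y" "u y < u x"
  note m = permutes_range[OF fibre_permutes[OF u]]
  have "b (u y) \<le> b (u x)" "b x \<le> b y"
    using xy m[OF xy(1)] m[OF xy(2)] by (auto intro!: monotone_onD[OF b])
  then have "b y = b x" "b (u y) = b (u x)" using fibreD[OF u] xy by auto
  then show "e (u y) < e (u x)" using xy m by (intro incD[OF e]) auto
qed

text \<open>The images of a pair that \<open>d\<close> inverts lie in different blocks, and a Young
  element keeps the order of different blocks.\<close>

lemma noninv_yg_dr:
  assumes b: "mono_on {1..r} b" and u: "u \<in> yg r b" and d: "d \<in> dr r b"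
  shows "noninv r u d"
  unfolding noninv_def
proof (intro ballI impI)
  fix x y assume xy: "x \<in> {1..r}" "y \<in> {1..r}" "x < y" "d y < d x"
  note m = permutes_range[OF dr_permutes[OF d]]
  have "b (d x) \<noteq> b (d y)" using drD[OF d xy(1-3)] xy(4) by linarith
  moreover have "b (d y) \<le> b (d x)"
    using xy m[OF xy(1)] m[OF xy(2)] by (auto intro!: monotone_onD[OF b])
  ultimately have "b (u (d y)) < b (u (d x))"
    using fibreD[OF u m[OF xy(1)]] fibreD[OF u m[OF xy(2)]] by linarith
  then show "u (d y) < u (d x)"
    using b permutes_range[OF fibre_permutes[OF u]] m xy by (meson leD leI monotone_onD)
qed

text \<open>\<open>U\<close> may be any union of left cosets of the Young subgroup. The case in view
  is a fibre over a word that is constant on the blocks of \<open>b\<close>.\<close>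

lemma bij_betw_inc_yg:
  assumes b: "mono_on {1..r} b" and U: "\<And>w. w \<in> U \<Longrightarrow> w permutes {1..r}"
    and cl: "\<And>w u. w \<in> U \<Longrightarrow> u \<in> yg r b \<Longrightarrow> w \<circ> u \<in> U"
  shows "bij_betw (\<lambda>(e, u). e \<circ> u) ((U \<inter> inc r b) \<times> yg r b) U"
proof (rule bij_betwI')
  fix p p' assume "p \<in> (U \<inter> inc r b) \<times> yg r b" "p' \<in> (U \<inter> inc r b) \<times> yg r b"
  then obtain e u e' u' where p: "p = (e, u)" "e \<in> inc r b" "u \<in> yg r b"
    and p': "p' = (e', u')" "e' \<in> inc r b" "u' \<in> yg r b" by auto
  have "e = e' \<and> u = u'" if eq: "e \<circ> u = e' \<circ> u'"
  proof -
    note up = fibre_permutes[OF p(3)] and up' = fibre_permutes[OF p'(3)]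
    let ?g = "u' \<circ> pinv u"
    have g: "?g \<in> yg r b" using p p' by (auto intro: fibre_comp fibre_inv)
    have e: "e = e' \<circ> ?g"
      using arg_cong[OF eq, of "\<lambda>f. f \<circ> pinv u"] permutes_inv_comp(2)[OF up] by (simp add: comp_assoc)
    then have id: "?g = id" using inc_unique[OF b p'(2) g] p(2) by simp
    have "u' = ?g \<circ> u" using permutes_inv_comp(1)[OF up] by (simp add: comp_assoc)
    then show ?thesis using e id by simp
  qed
  then show "(case p of (e, u) \<Rightarrow> e \<circ> u) = (case p' of (e, u) \<Rightarrow> e \<circ> u) \<longleftrightarrow> p = p'"
    using p p' by auto
next
  fix p assume "p \<in> (U \<inter> inc r b) \<times> yg r b"
  then show "(case p of (e, u) \<Rightarrow> e \<circ> u) \<in> U" using cl by auto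
next
  fix w assume w: "w \<in> U"
  obtain e u where eu: "e \<in> inc r b" "u \<in> yg r b" "w = e \<circ> u"
    using inc_decomposition[OF b U[OF w]] .
  have "e = w \<circ> pinv u"
    using eu permutes_inv_comp(2)[OF fibre_permutes[OF eu(2)]] by (simp add: comp_assoc)
  then have "e \<in> U" using cl[OF w fibre_inv[OF eu(2)]] by simp
  then show "\<exists>p\<in>(U \<inter> inc r b) \<times> yg r b. w = (case p of (e, u) \<Rightarrow> e \<circ> u)" using eu by auto
qed

text \<open>Transitivity of shortest representatives along a chain of Young subgroups,
  \<open>b1\<close> finer than \<open>b2\<close> finer than \<open>b3\<close>: a representative for
  the smallest inside the largest factors uniquely through the middle one.\<close>

lemma bij_betw_dr_chain:
  assumes b2: "mono_on {1..r} b2"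
    and 12: "\<And>x y. x \<in> {1..r} \<Longrightarrow> y \<in> {1..r} \<Longrightarrow> b1 x = b1 y \<Longrightarrow> b2 x = b2 y"
    and 23: "\<And>x y. x \<in> {1..r} \<Longrightarrow> y \<in> {1..r} \<Longrightarrow> b2 x = b2 y \<Longrightarrow> b3 x = b3 y"
  shows "bij_betw (\<lambda>(u, d). u \<circ> d) ((dr r b1 \<inter> yg r b2) \<times> (dr r b2 \<inter> yg r b3)) (dr r b1 \<inter> yg r b3)"
proof (rule bij_betwI')
  have sub: "u \<in> yg r b3" if u: "u \<in> yg r b2" for u
  proof -
    have "b3 (u x) = b3 x" if "x \<in> {1..r}" for x
      using 23[OF permutes_range[OF fibre_permutes[OF u] that] that] fibreD[OF u that] by simp
    then show ?thesis using fibre_permutes[OF u] by (simp add: fibre_def)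
  qed
  fix p assume p: "p \<in> (dr r b1 \<inter> yg r b2) \<times> (dr r b2 \<inter> yg r b3)"
  then obtain u d where ud: "p = (u, d)" "u \<in> dr r b1" "u \<in> yg r b2" "d \<in> dr r b2" "d \<in> yg r b3"
    by auto
  note up = fibre_permutes[OF ud(3)] and dp = fibre_permutes[OF ud(5)]
  have "u \<circ> d \<in> yg r b3" using fibre_comp[OF sub[OF ud(3)] ud(5)] .
  moreover have "u (d x) < u (d y)"
    if xy: "x \<in> {1..r}" "y \<in> {1..r}" "x < y" "b1 (u (d x)) = b1 (u (d y))" for x y
  proof -
    note m = permutes_range[OF dp xy(1)] permutes_range[OF dp xy(2)]
    have "b2 (u (d x)) = b2 (u (d y))"
      using xy m permutes_range[OF up] by (intro 12) auto
    then have "b2 (d x) = b2 (d y)" using fibreD[OF ud(3)] m by simp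
    then have "d x < d y" using xy by (intro drD[OF ud(4)])
    then show ?thesis using xy m by (intro drD[OF ud(2)])
  qed
  ultimately show "(case p of (u, d) \<Rightarrow> u \<circ> d) \<in> dr r b1 \<inter> yg r b3"
    using ud up dp by (simp add: dr_def permutes_compose)
next
  fix p p' assume "p \<in> (dr r b1 \<inter> yg r b2) \<times> (dr r b2 \<inter> yg r b3)"
    "p' \<in> (dr r b1 \<inter> yg r b2) \<times> (dr r b2 \<inter> yg r b3)"
  then obtain u d u' d' where p: "p = (u, d)" "u \<in> yg r b2" "d \<in> dr r b2"
    and p': "p' = (u', d')" "u' \<in> yg r b2" "d' \<in> dr r b2" by auto
  have "u = u' \<and> d = d'" if eq: "u \<circ> d = u' \<circ> d'"
  proof -
    note up = fibre_permutes[OF p(2)] and up' = fibre_permutes[OF p'(2)]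
    let ?g = "pinv u' \<circ> u"
    have g: "?g \<in> yg r b2" using p p' by (auto intro: fibre_comp fibre_inv)
    have d: "d' = ?g \<circ> d"
      using arg_cong[OF eq, of "\<lambda>f. pinv u' \<circ> f"] permutes_inv_comp(1)[OF up']
      by (simp add: comp_assoc[symmetric])
    then have id: "?g = id" using dr_unique[OF b2 p(3) g] p'(3) by simp
    have "u = u' \<circ> ?g" using permutes_inv_comp(2)[OF up'] by (simp add: comp_assoc[symmetric])
    then show ?thesis using d id by simp
  qed
  then show "(case p of (u, d) \<Rightarrow> u \<circ> d) = (case p' of (u, d) \<Rightarrow> u \<circ> d) \<longleftrightarrow> p = p'"
    using p p' by auto
next
  fix w assume w: "w \<in> dr r b1 \<inter> yg r b3"
  then have wp: "w permutes {1..r}" by (blast dest: fibre_permutes)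
  obtain u d where ud: "u \<in> yg r b2" "d \<in> dr r b2" "w = u \<circ> d"
    using dr_decomposition[OF b2 wp] .
  note up = fibre_permutes[OF ud(1)] and dp = dr_permutes[OF ud(2)]
  have u3: "u \<in> yg r b3"
  proof -
    have "b3 (u x) = b3 x" if "x \<in> {1..r}" for x
      using 23[OF permutes_range[OF up that] that] fibreD[OF ud(1) that] by simp
    then show ?thesis using up by (simp add: fibre_def)
  qed
  have "d = pinv u \<circ> w"
    using ud(3) permutes_inv_comp(1)[OF up] by (simp add: comp_assoc[symmetric])
  then have d3: "d \<in> yg r b3" using fibre_comp[OF fibre_inv[OF u3]] w by auto
  \<comment> \<open>To compare \<open>u x\<close> and \<open>u y\<close>, pull \<open>x\<close> and
    \<open>y\<close> back along \<open>d\<close>; this preserves their order since they lie in one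
    block of \<open>b2\<close>, and then the hypothesis on \<open>w\<close> applies.\<close>
  have "u x < u y" if xy: "x \<in> {1..r}" "y \<in> {1..r}" "x < y" "b1 (u x) = b1 (u y)" for x y
  proof -
    note im = permutes_range[OF permutes_inv[OF dp]]
    have eqs: "d (pinv d x) = x" "d (pinv d y) = y" using permutes_inverses(1)[OF dp] by auto
    have "b2 (u x) = b2 (u y)" using xy permutes_range[OF up] by (intro 12) auto
    then have "b2 x = b2 y" using fibreD[OF ud(1)] xy by simp
    then have "pinv d x < pinv d y"
      using ud(2) inv_inc_iff[OF dp, of b2] xy by (intro incD[of "pinv d" r b2]) auto
    then have "w (pinv d x) < w (pinv d y)"
      using w xy im ud(3) eqs by (intro drD[of w r b1]) auto
    then show ?thesis using ud(3) eqs by simp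
  qed
  then have "u \<in> dr r b1" using up by (simp add: dr_def)
  then show "\<exists>p\<in>(dr r b1 \<inter> yg r b2) \<times> (dr r b2 \<inter> yg r b3). w = (case p of (u, d) \<Rightarrow> u \<circ> d)"
    using ud d3 by auto
qed

section \<open>Explicit representatives when one position is split off its block\<close>

lemma word_perm_upt:
  "i \<le> t \<Longrightarrow> word_perm [i..<t] x = (if x = t then i else if i \<le> x \<and> x < t then Suc x else x)"
proof (induction t arbitrary: x)
  case (Suc t)
  show ?case
  proof (cases "i = Suc t")
    case False
    then show ?thesis using Suc by (auto simp: word_perm_snoc sw_apply)
  qed simp
qed simp

lemma word_perm_rev_upt:
  "i \<le> t \<Longrightarrow> word_perm (rev [i..<t]) x = (if x = i then t else if i < x \<and> x \<le> t then x - 1 else x)"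
proof (induction t arbitrary: x)
  case (Suc t)
  show ?case
  proof (cases "i = Suc t")
    case False
    have "word_perm (rev [i..<Suc t]) = sw t \<circ> word_perm (rev [i..<t])"
      using False Suc.prems word_perm_append[of "[t]"] by (simp add: word_perm_single)
    then show ?thesis using Suc False by (auto simp: sw_apply)
  qed simp
qed simp

lemma reduced_expr_Nil: "reduced_expr r id []"
proof -
  have "invs r id = {}" by (auto simp: invs_def)
  then show ?thesis unfolding reduced_expr_iff by (simp del: id_apply)
qed

lemma reduced_expr_upt:
  "1 \<le> i \<Longrightarrow> i \<le> t \<Longrightarrow> t \<le> r \<Longrightarrow> reduced_expr r (word_perm [i..<t]) [i..<t]"
proof (induction t)
  case (Suc t)
  show ?case
  proof (cases "i = Suc t")
    case False
    then have "reduced_expr r (word_perm [i..<t] \<circ> sw t) ([i..<t] @ [t])"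
      using False Suc.prems by (intro reduced_expr_snoc[OF Suc.IH]) (auto simp: word_perm_upt)
    moreover have "[i..<Suc t] = [i..<t] @ [t]" using False Suc.prems by simp
    ultimately show ?thesis by (simp only: word_perm_snoc)
  qed (metis upt_rec less_irrefl reduced_expr_Nil word_perm_Nil)
qed simp

lemma reduced_expr_rev_upt:
  "1 \<le> i \<Longrightarrow> i \<le> t \<Longrightarrow> t \<le> r \<Longrightarrow> reduced_expr r (word_perm (rev [i..<t])) (rev [i..<t])"
proof (induction "t - i" arbitrary: i)
  case 0
  then have "[i..<t] = []" by simp
  then show ?case using reduced_expr_Nil by (metis rev.simps(1) word_perm_Nil)
next
  case (Suc k)
  then have eq: "rev [i..<t] = rev [Suc i..<t] @ [i]" by (simp add: upt_conv_Cons)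
  have "reduced_expr r (word_perm (rev [Suc i..<t]) \<circ> sw i) (rev [Suc i..<t] @ [i])"
    using Suc by (intro reduced_expr_snoc) (auto simp: word_perm_rev_upt)
  then show ?case unfolding eq word_perm_snoc .
qed

text \<open>The Young element that links the two representatives fixes \<open>x0\<close>, so it
  preserves even the finer partition; shortest representatives of one coset of the finer subgroup
  coincide.\<close>

lemma dr_isolates_unique:
  assumes b': "mono_on {1..r} b'" and iso: "isolates r b b' x0"
    and d: "d \<in> dr r b' \<inter> yg r b" and d': "d' \<in> dr r b' \<inter> yg r b"
    and t: "d t = x0" "d' t = x0"
  shows "d = d'"
proof -
  have dp: "d permutes {1..r}" and dp': "d' permutes {1..r}" using d d' by (auto dest: fibre_permutes)
  let ?g = "d' \<circ> pinv d"
  have g: "?g \<in> yg r b" using d d' by (auto intro: fibre_comp fibre_inv)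
  note gp = fibre_permutes[OF g]
  have x0: "?g x0 = x0" using t permutes_inverses(2)[OF dp] by auto
  have "b' (?g x) = b' x" if x: "x \<in> {1..r}" for x
  proof -
    have "?g x = x0 \<longleftrightarrow> x = x0" using x0 permutes_inj[OF gp] by (metis injD)
    moreover have "b (?g x) = b x" using fibreD[OF g x] .
    ultimately show ?thesis using iso x permutes_range[OF gp x] unfolding isolates_def by blast
  qed
  then have "?g \<in> yg r b'" using gp by (simp add: fibre_def)
  moreover have gd: "d' = ?g \<circ> d" using permutes_inv_comp(1)[OF dp] by (simp add: comp_assoc)
  ultimately have "?g = id" using dr_unique[OF b', of d ?g] d d' by simp
  then show ?thesis using gd by simp
qed

lemma interval_blockD:
  assumes "interval_block r b i j" "x \<in> {1..r}"
  shows "b x = b i \<longleftrightarrow> i \<le> x \<and> x \<le> j"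
  using assms by (simp add: interval_block_def)

text \<open>A representative is determined by the position of the block that it sends to the
  isolated one, and a cycle realises each choice.\<close>

lemma coset_reps_first:
  assumes b': "mono_on {1..r} b'" and iso: "isolates r b b' i" and blk: "interval_block r b i j"
  shows "bij_betw (\<lambda>t. word_perm [i..<t]) {i..j} (dr r b' \<inter> yg r b)"
proof (rule bij_betwI')
  have ij: "1 \<le> i" "i \<le> j" "j \<le> r" using blk by (auto simp: interval_block_def)
  note bl = interval_blockD[OF blk]
  have mem: "word_perm [i..<t] \<in> dr r b' \<inter> yg r b" if t: "t \<in> {i..j}" for t
  proof -
    have p: "word_perm [i..<t] permutes {1..r}" using t ij by (intro word_perm_permutes) auto
    have "b (word_perm [i..<t] x) = b x" if "x \<in> {1..r}" for x
      using t ij that bl[of x] bl[of "Suc x"] by (auto simp: word_perm_upt)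
    moreover have "word_perm [i..<t] x < word_perm [i..<t] y"
      if xy: "x \<in> {1..r}" "y \<in> {1..r}" "x < y"
        "b' (word_perm [i..<t] x) = b' (word_perm [i..<t] y)" for x y
    proof -
      have "(word_perm [i..<t] x = i) = (word_perm [i..<t] y = i)"
        using iso xy permutes_range[OF p] unfolding isolates_def by blast
      then show ?thesis using xy t by (auto simp: word_perm_upt split: if_splits)
    qed
    ultimately show ?thesis using p by (simp add: dr_def fibre_def)
  qed
  show "word_perm [i..<t] \<in> dr r b' \<inter> yg r b" if "t \<in> {i..j}" for t using mem[OF that] .
  show "word_perm [i..<t] = word_perm [i..<t'] \<longleftrightarrow> t = t'" if t: "t \<in> {i..j}" "t' \<in> {i..j}" for t t'
  proof
    assume "word_perm [i..<t] = word_perm [i..<t']"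
    then have "word_perm [i..<t'] t = i" using t word_perm_upt[of i t t] by simp
    then show "t = t'" using t by (auto simp: word_perm_upt split: if_splits)
  qed simp
  fix d assume d: "d \<in> dr r b' \<inter> yg r b"
  then have dp: "d permutes {1..r}" by (auto dest: fibre_permutes)
  let ?t = "pinv d i"
  have t1: "?t \<in> {1..r}" using ij by (intro permutes_range[OF permutes_inv[OF dp]]) auto
  have "d ?t = i" using permutes_inverses(1)[OF dp] .
  moreover from this have "b ?t = b i" using d t1 by (metis IntD2 fibreD)
  then have t: "?t \<in> {i..j}" using bl[OF t1] by simp
  moreover have "word_perm [i..<?t] ?t = i" using t by (simp add: word_perm_upt)
  ultimately have "d = word_perm [i..<?t]"
    using dr_isolates_unique[OF b' iso d mem[OF t]] by blast
  then show "\<exists>t\<in>{i..j}. d = word_perm [i..<t]" using t by blast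
qed

lemma coset_reps_last:
  assumes b': "mono_on {1..r} b'" and iso: "isolates r b b' j" and blk: "interval_block r b i j"
  shows "bij_betw (\<lambda>t. word_perm (rev [t..<j])) {i..j} (dr r b' \<inter> yg r b)"
proof (rule bij_betwI')
  have ij: "1 \<le> i" "i \<le> j" "j \<le> r" using blk by (auto simp: interval_block_def)
  note bl = interval_blockD[OF blk]
  have mem: "word_perm (rev [t..<j]) \<in> dr r b' \<inter> yg r b" if t: "t \<in> {i..j}" for t
  proof -
    have p: "word_perm (rev [t..<j]) permutes {1..r}" using t ij by (intro word_perm_permutes) auto
    have "b (word_perm (rev [t..<j]) x) = b x" if "x \<in> {1..r}" for x
      using t ij that bl[of x] bl[of "x - 1"] bl[of j] by (force simp: word_perm_rev_upt)
    moreover have "word_perm (rev [t..<j]) x < word_perm (rev [t..<j]) y"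
      if xy: "x \<in> {1..r}" "y \<in> {1..r}" "x < y"
        "b' (word_perm (rev [t..<j]) x) = b' (word_perm (rev [t..<j]) y)" for x y
    proof -
      have "(word_perm (rev [t..<j]) x = j) = (word_perm (rev [t..<j]) y = j)"
        using iso xy permutes_range[OF p] unfolding isolates_def by blast
      then show ?thesis using xy t by (auto simp: word_perm_rev_upt split: if_splits)
    qed
    ultimately show ?thesis using p by (simp add: dr_def fibre_def)
  qed
  show "word_perm (rev [t..<j]) \<in> dr r b' \<inter> yg r b" if "t \<in> {i..j}" for t using mem[OF that] .
  show "word_perm (rev [t..<j]) = word_perm (rev [t'..<j]) \<longleftrightarrow> t = t'"
    if t: "t \<in> {i..j}" "t' \<in> {i..j}" for t t'
  proof
    assume "word_perm (rev [t..<j]) = word_perm (rev [t'..<j])"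
    then have "word_perm (rev [t'..<j]) t = j" using t word_perm_rev_upt[of t j t] by simp
    then show "t = t'" using t by (auto simp: word_perm_rev_upt split: if_splits)
  qed simp
  fix d assume d: "d \<in> dr r b' \<inter> yg r b"
  then have dp: "d permutes {1..r}" by (auto dest: fibre_permutes)
  let ?t = "pinv d j"
  have t1: "?t \<in> {1..r}" using ij by (intro permutes_range[OF permutes_inv[OF dp]]) auto
  have "d ?t = j" using permutes_inverses(1)[OF dp] .
  moreover from this have "b ?t = b j" using d t1 by (metis IntD2 fibreD)
  then have t: "?t \<in> {i..j}" using bl[OF t1] bl[of j] ij by simp
  moreover have "word_perm (rev [?t..<j]) ?t = j" using t by (simp add: word_perm_rev_upt)
  ultimately have "d = word_perm (rev [?t..<j])"
    using dr_isolates_unique[OF b' iso d mem[OF t]] by blast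
  then show "\<exists>t\<in>{i..j}. d = word_perm (rev [t..<j])" using t by blast
qed

lemma word_perm_inv: "pinv (word_perm is) = word_perm (rev is)"
proof (rule inv_equality)
  have *: "word_perm (rev is) (word_perm is x) = x" for "is" x
  proof (induction "is" arbitrary: x rule: rev_induct)
    case (snoc i "is")
    have "word_perm (i # rev is) y = sw i (word_perm (rev is) y)" for y
      using word_perm_append[of "[i]" "rev is"] by (simp add: word_perm_single)
    then show ?case using snoc by (simp add: word_perm_snoc)
  qed simp
  show "word_perm (rev is) (word_perm is x) = x" for x by (rule *)
  show "word_perm is (word_perm (rev is) x) = x" for x using *[of "rev is"] by simp
qed

text \<open>Inverses of right representatives are left representatives, and inversion reverses
  words: descending chains become ascending ones.\<close>

lemma left_coset_reps_last:
  assumes b': "mono_on {1..r} b'" and iso: "isolates r b b' j" and blk: "interval_block r b i j"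
  shows "bij_betw (\<lambda>t. word_perm [t..<j]) {i..j} (yg r b \<inter> inc r b')"
proof -
  have "bij_betw pinv (dr r b' \<inter> yg r b) (yg r b \<inter> inc r b')"
  proof (rule bij_betwI[where g = pinv])
    show "pinv \<in> dr r b' \<inter> yg r b \<rightarrow> yg r b \<inter> inc r b'"
      using inv_inc_iff[where b = b'] by (auto intro: fibre_inv dest: dr_permutes)
    show "pinv \<in> yg r b \<inter> inc r b' \<rightarrow> dr r b' \<inter> yg r b"
    proof
      fix e assume e: "e \<in> yg r b \<inter> inc r b'"
      then have ep: "e permutes {1..r}" by (auto dest: fibre_permutes)
      show "pinv e \<in> dr r b' \<inter> yg r b"
        using e inv_inc_iff[OF permutes_inv[OF ep], of b'] permutes_inv_inv[OF ep]
        by (auto intro: fibre_inv)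
    qed
  qed (auto dest!: fibre_permutes simp: permutes_inv_inv)
  from bij_betw_trans[OF coset_reps_last[OF assms] this]
  show ?thesis by (simp add: o_def word_perm_inv)
qed

lemma invs_noninv: "d permutes {1..r} \<Longrightarrow> noninv r u d \<Longrightarrow> invs r d \<subseteq> invs r (u \<circ> d)"
  by (auto simp: invs_def noninv_def)

text \<open>Connects the order condition with the shortest elements by which
  \<open>min_coset_reps\<close> is defined. For the converse, write \<open>d = u \<circ> d0\<close>
  with \<open>d0\<close> satisfying the order condition; minimality of length forces
  \<open>d\<close> and \<open>d0\<close> to have the same inversions, so \<open>u\<close> cannot
  reverse a pair within a block.\<close>

lemma dr_iff_perm_length:
  assumes b: "mono_on {1..r} b" and d: "d permutes {1..r}"
  shows "d \<in> dr r b \<longleftrightarrow> (\<forall>w\<in>yg r b. perm_length r d \<le> perm_length r (w \<circ> d))"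
proof
  assume dr: "d \<in> dr r b"
  show "\<forall>w\<in>yg r b. perm_length r d \<le> perm_length r (w \<circ> d)"
  proof
    fix w assume w: "w \<in> yg r b"
    have "card (invs r d) \<le> card (invs r (w \<circ> d))"
      by (intro card_mono invs_noninv noninv_yg_dr[OF b w dr] d) simp
    then show "perm_length r d \<le> perm_length r (w \<circ> d)"
      using perm_length_eq[OF d] perm_length_eq[OF permutes_compose[OF d fibre_permutes[OF w]]] by simp
  qed
next
  assume min: "\<forall>w\<in>yg r b. perm_length r d \<le> perm_length r (w \<circ> d)"
  obtain u d0 where ud: "u \<in> yg r b" "d0 \<in> dr r b" "d = u \<circ> d0"
    using dr_decomposition[OF b d] .
  note up = fibre_permutes[OF ud(1)] and dp = dr_permutes[OF ud(2)]
  have d0: "d0 = pinv u \<circ> d"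
    using ud(3) permutes_inv_comp(1)[OF up] by (simp add: comp_assoc[symmetric])
  have "perm_length r d \<le> perm_length r d0"
    using min fibre_inv[OF ud(1)] unfolding d0 by blast
  then have le: "card (invs r d) \<le> card (invs r d0)"
    by (simp add: perm_length_eq d dp)
  have sub: "invs r d0 \<subseteq> invs r d"
    unfolding ud(3) by (intro invs_noninv noninv_yg_dr[OF b ud(1,2)] dp)
  then have eq: "invs r d0 = invs r d"
    using le by (intro card_seteq finite_invs)
  have "u = id"
  proof (rule yg_order_preserving_id[OF b ud(1)], rule ccontr)
    fix x y assume xy: "x \<in> {1..r}" "y \<in> {1..r}" "x < y" "b x = b y" and "\<not> u x < u y"
    moreover have "u x \<noteq> u y" using xy(3) permutes_inj[OF up] by (metis injD less_irrefl)
    ultimately have "u y < u x" by simp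
    moreover have "pinv d0 x < pinv d0 y"
      using ud(2) inv_inc_iff[OF dp, of b] xy by (intro incD[of "pinv d0" r b]) auto
    ultimately have "(pinv d0 x, pinv d0 y) \<in> invs r d"
      using permutes_range[OF permutes_inv[OF dp]] xy permutes_inverses(1)[OF dp]
      by (simp add: invs_def ud(3))
    then have "d0 (pinv d0 y) < d0 (pinv d0 x)" unfolding eq[symmetric] by (simp add: invs_def)
    then show False using xy permutes_inverses(1)[OF dp] by simp
  qed
  then show "d \<in> dr r b" using ud by simp
qed

section \<open>Hecke--Clifford relations in a ring\<close>

text \<open>Here \<open>q\<close> is a central element of the ring, the image of the scalar. Only
  the defining relations are assumed, so every ring in which they hold, in particular the presented
  algebra, is an instance.\<close>

locale hecke_clifford_ring =
  fixes r :: nat and q :: "'b::{ring,monoid_mult}" and T c :: "nat \<Rightarrow> 'b"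
  assumes q_central: "q * x = x * q"
    and T_T: "t \<in> {1..<r} \<Longrightarrow> T t * T t = (q - 1) * T t + q"
    and T_comm: "i \<in> {1..<r} \<Longrightarrow> j \<in> {1..<r} \<Longrightarrow> Suc i < j \<Longrightarrow> T i * T j = T j * T i"
    and T_braid: "i \<in> {1..<r} \<Longrightarrow> Suc i \<in> {1..<r} \<Longrightarrow>
      T i * T (Suc i) * T i = T (Suc i) * T i * T (Suc i)"
    and c_c: "i \<in> {1..r} \<Longrightarrow> c i * c i = - 1"
    and c_anticomm: "i \<in> {1..r} \<Longrightarrow> j \<in> {1..r} \<Longrightarrow> i \<noteq> j \<Longrightarrow> c i * c j = - (c j * c i)"
    and c_T: "t \<in> {1..<r} \<Longrightarrow> j \<in> {1..r} \<Longrightarrow> j \<noteq> t \<Longrightarrow> j \<noteq> Suc t \<Longrightarrow> c j * T t = T t * c j"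
    and c_Suc_T: "t \<in> {1..<r} \<Longrightarrow> c (Suc t) * T t = T t * c t"
    and c_T_same: "t \<in> {1..<r} \<Longrightarrow>
      c t * T t = T t * c (Suc t) + (q - 1) * (c t - c (Suc t))"
begin

definition Tw :: "(nat \<Rightarrow> nat) \<Rightarrow> 'b" where
  "Tw w = prod_list (map T (SOME is. reduced_expr r w is))"

definition SS :: "(nat \<Rightarrow> nat) set \<Rightarrow> 'b" where
  "SS U = (\<Sum>w\<in>U. Tw w)"

text \<open>The element \<open>x_\<lambda>\<close> of the composition whose blocks are the level
  sets of \<open>b\<close>.\<close>

abbreviation xx :: "(nat \<Rightarrow> nat) \<Rightarrow> 'b" where
  "xx b \<equiv> SS (yg r b)"

abbreviation vv :: "(nat \<Rightarrow> nat) \<Rightarrow> (nat \<Rightarrow> nat) \<Rightarrow> 'b" where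
  "vv b \<rho> \<equiv> SS (fibre r b \<rho>)"

lemma q_left: "x * (q * y) = q * (x * y)"
  by (metis mult.assoc q_central)

lemma qpow_central: "q ^ m * x = x * q ^ m"
proof (induction m)
  case (Suc m)
  then show ?case by (simp add: mult.assoc) (metis mult.assoc q_central)
qed simp

lemma qpow_left: "x * (q ^ m * y) = q ^ m * (x * y)"
  by (metis mult.assoc qpow_central)

section \<open>Products of \<open>Tw\<close> when lengths add\<close>

lemma Tw_reduced: "reduced_expr r w is \<Longrightarrow> Tw w = prod_list (map T is)"
  unfolding Tw_def
  by (rule matsumoto[of r T w]) (auto intro: T_comm T_braid someI)

lemma Tw_id [simp]: "Tw id = 1"
  using Tw_reduced[OF reduced_expr_Nil] by simp

lemma Tw_comp_sw:
  assumes "w permutes {1..r}" "t \<in> {1..<r}" "w t < w (Suc t)"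
  shows "Tw (w \<circ> sw t) = Tw w * T t"
proof -
  obtain ws where ws: "reduced_expr r w ws" using reduced_expr_exists assms by blast
  show ?thesis
    using Tw_reduced[OF ws] Tw_reduced[OF reduced_expr_snoc[OF ws assms(2,3)]] by simp
qed

lemma Tw_sw: "t \<in> {1..<r} \<Longrightarrow> Tw (sw t) = T t"
  using Tw_comp_sw[OF permutes_id, of t] by simp

text \<open>By \<open>noninv\<close>, a letter appended to \<open>v\<close> at an ascent is appended
  at an ascent of \<open>u \<circ> v\<close> too, so both sides gain the same factor
  \<open>T t\<close>.\<close>

lemma Tw_comp:
  assumes u: "u permutes {1..r}"
  shows "v permutes {1..r} \<Longrightarrow> noninv r u v \<Longrightarrow> Tw (u \<circ> v) = Tw u * Tw v"
proof (induction v rule: permutes_invs_induct)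
  case (swap v t)
  have mem: "t \<in> {1..r}" "Suc t \<in> {1..r}" using swap(2) by auto
  have "u (v t) < u (v (Suc t))"
    using swap.prems(1)[unfolded noninv_def, rule_format, OF mem] swap.hyps(3) by simp
  moreover have "noninv r u v"
    unfolding noninv_def
  proof (intro ballI impI)
    fix x y assume xy: "x \<in> {1..r}" "y \<in> {1..r}" "x < y" "v y < v x"
    then have "sw t x < sw t y" using swap.hyps(3) by (auto simp: sw_apply)
    moreover have "sw t x \<in> {1..r}" "sw t y \<in> {1..r}" using xy mem by (auto simp: sw_apply)
    ultimately show "u (v y) < u (v x)"
      using swap.prems(1)[unfolded noninv_def, rule_format, of "sw t x" "sw t y"] xy by simp
  qed
  ultimately show ?case
    using swap Tw_comp_sw[of "u \<circ> v" t] Tw_comp_sw[of v t] u permutes_compose[OF swap(1) u]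
    by (simp add: o_def mult.assoc)
qed simp

lemma SS_mult:
  assumes bij: "bij_betw (\<lambda>(u, v). u \<circ> v) (U \<times> V) W"
    and "\<And>u v. u \<in> U \<Longrightarrow> v \<in> V \<Longrightarrow> u permutes {1..r} \<and> v permutes {1..r} \<and> noninv r u v"
  shows "SS U * SS V = SS W"
proof -
  have "SS W = (\<Sum>(u, v)\<in>U \<times> V. Tw (u \<circ> v))"
    unfolding SS_def using sum.reindex_bij_betw[OF bij, of Tw] by (simp add: split_def)
  also have "\<dots> = (\<Sum>(u, v)\<in>U \<times> V. Tw u * Tw v)"
    using assms(2) Tw_comp by (intro sum.cong) auto
  finally show ?thesis
    by (simp add: SS_def sum_product sum.cartesian_product)
qed

lemma SS_inc_yg:
  assumes b: "mono_on {1..r} b" and U: "\<And>w. w \<in> U \<Longrightarrow> w permutes {1..r}"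
    and cl: "\<And>w u. w \<in> U \<Longrightarrow> u \<in> yg r b \<Longrightarrow> w \<circ> u \<in> U"
  shows "SS U = SS (U \<inter> inc r b) * xx b"
  by (rule SS_mult[symmetric, OF bij_betw_inc_yg[OF b U cl]])
     (auto dest: U fibre_permutes noninv_inc_yg[OF b])

lemma SS_dr_chain:
  assumes b2: "mono_on {1..r} b2"
    and 12: "\<And>x y. x \<in> {1..r} \<Longrightarrow> y \<in> {1..r} \<Longrightarrow> b1 x = b1 y \<Longrightarrow> b2 x = b2 y"
    and 23: "\<And>x y. x \<in> {1..r} \<Longrightarrow> y \<in> {1..r} \<Longrightarrow> b2 x = b2 y \<Longrightarrow> b3 x = b3 y"
  shows "SS (dr r b1 \<inter> yg r b2) * SS (dr r b2 \<inter> yg r b3) = SS (dr r b1 \<inter> yg r b3)"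
  by (rule SS_mult[OF bij_betw_dr_chain[OF assms]])
     (auto dest: fibre_permutes noninv_yg_dr[OF b2])

lemma dr_id: "dr r id \<inter> yg r b = yg r b"
proof -
  have "d \<in> dr r id" if d: "d permutes {1..r}" for d
  proof -
    have "d x < d y" if "x < y" "id (d x) = id (d y)" for x y
      using injD[OF permutes_inj[OF d], of x y] that by simp
    then show ?thesis using d unfolding dr_def by blast
  qed
  then have "yg r b \<subseteq> dr r id" using fibre_permutes by blast
  then show ?thesis by blast
qed

text \<open>The chain that starts with the partition into singletons, for which every permutation is
  a shortest representative.\<close>

lemma xx_SS_dr:
  assumes "mono_on {1..r} b2"
    and "\<And>x y. x \<in> {1..r} \<Longrightarrow> y \<in> {1..r} \<Longrightarrow> b2 x = b2 y \<Longrightarrow> b3 x = b3 y"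
  shows "xx b2 * SS (dr r b2 \<inter> yg r b3) = xx b3"
proof -
  have "SS (dr r id \<inter> yg r b2) * SS (dr r b2 \<inter> yg r b3) = SS (dr r id \<inter> yg r b3)"
    by (rule SS_dr_chain[OF assms(1) _ assms(2)]) auto
  then show ?thesis by (simp only: dr_id)
qed

section \<open>Coset sums as words: right factors and the action of \<open>T t\<close>\<close>

lemma fibre_refine:
  assumes "\<And>x y. x \<in> {1..r} \<Longrightarrow> y \<in> {1..r} \<Longrightarrow> b' x = b' y \<Longrightarrow> \<rho> x = \<rho> y"
    and u: "u \<in> yg r b'"
  shows "u \<in> yg r \<rho>"
proof -
  note up = fibre_permutes[OF u]
  have "\<rho> (u x) = \<rho> x" if "x \<in> {1..r}" for x
    by (rule assms(1)[OF permutes_range[OF up that] that fibreD[OF u that]])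
  then show ?thesis using up by (simp add: fibre_def)
qed

text \<open>The fibre is stable under right multiplication by the Young subgroup of every partition
  \<open>b'\<close> that refines the word. This is how words acquire a right factor
  \<open>xx b'\<close>, which absorbs the \<open>T t\<close> inside the blocks of
  \<open>b'\<close>.\<close>

lemma vv_factor:
  assumes b': "mono_on {1..r} b'"
    and "\<And>x y. x \<in> {1..r} \<Longrightarrow> y \<in> {1..r} \<Longrightarrow> b' x = b' y \<Longrightarrow> \<rho> x = \<rho> y"
  shows "vv b \<rho> = SS (fibre r b \<rho> \<inter> inc r b') * xx b'"
  using fibre_refine[OF assms(2)]
  by (intro SS_inc_yg[OF b']) (auto dest: fibre_permutes intro: fibre_comp)

lemma vv_cong: "(\<And>x. x \<in> {1..r} \<Longrightarrow> \<rho> x = \<rho>' x) \<Longrightarrow> vv b \<rho> = vv b \<rho>'"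
  by (simp add: fibre_def cong: conj_cong)

text \<open>The function merges \<open>t\<close> and \<open>Suc t\<close> into one block and leaves
  singletons elsewhere. Its \<open>xx\<close> is \<open>1 + T t\<close>, hence any element with this
  factor is an eigenvector of \<open>T t\<close> with eigenvalue \<open>q\<close>.\<close>

lemma mono_pair: "mono_on {1..r} (\<lambda>x. if x = Suc t then t else x)"
  by (auto simp: monotone_on_def)

lemma yg_pair:
  assumes t: "t \<in> {1..<r}"
  shows "yg r (\<lambda>x. if x = Suc t then t else x) = {id, sw t}" (is "yg r ?b = _")
proof
  show "{id, sw t} \<subseteq> yg r ?b" using sw_yg[OF t, of ?b] by simp
  show "yg r ?b \<subseteq> {id, sw t}"
  proof
    fix w assume w: "w \<in> yg r ?b"
    have "w permutes {t, Suc t}"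
    proof (rule permutes_superset[OF fibre_permutes[OF w]])
      fix x assume "x \<in> {1..r} - {t, Suc t}"
      then show "w x = x" using fibreD[OF w, of x] by (auto split: if_splits)
    qed
    then show "w \<in> {id, sw t}" by (simp add: permutes_doubleton_iff sw_def)
  qed
qed

lemma xx_pair:
  assumes t: "t \<in> {1..<r}"
  shows "xx (\<lambda>x. if x = Suc t then t else x) = 1 + T t"
proof -
  have "id \<noteq> sw t" by (metis id_apply n_not_Suc_n sw_first)
  then show ?thesis unfolding yg_pair[OF t] SS_def by (simp add: Tw_sw[OF t])
qed

lemma pair_eigen:
  assumes t: "t \<in> {1..<r}"
  shows "(1 + T t) * T t = q * (1 + T t)" "T t * (1 + T t) = q * (1 + T t)"
  by (simp_all add: algebra_simps T_T[OF t] q_central)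

lemma vv_T_eigen:
  assumes t: "t \<in> {1..<r}" and eq: "\<rho> t = \<rho> (Suc t)"
  shows "vv b \<rho> * T t = q * vv b \<rho>"
proof -
  let ?p = "\<lambda>x. if x = Suc t then t else x"
  have "vv b \<rho> = SS (fibre r b \<rho> \<inter> inc r ?p) * xx ?p"
    by (rule vv_factor[OF mono_pair]) (use eq in \<open>auto split: if_splits\<close>)
  then have eq: "vv b \<rho> = SS (fibre r b \<rho> \<inter> inc r ?p) * (1 + T t)"
    unfolding xx_pair[OF t] .
  show ?thesis
    unfolding eq mult.assoc pair_eigen(1)[OF t] by (rule q_left)
qed

lemma T_xx_eigen:
  assumes t: "t \<in> {1..<r}" and eq: "b t = b (Suc t)"
  shows "T t * xx b = q * xx b"
proof -
  let ?p = "\<lambda>x. if x = Suc t then t else x"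
  have "xx ?p * SS (dr r ?p \<inter> yg r b) = xx b"
    by (rule xx_SS_dr[OF mono_pair]) (use eq in \<open>auto split: if_splits\<close>)
  then have eq: "xx b = (1 + T t) * SS (dr r ?p \<inter> yg r b)"
    unfolding xx_pair[OF t] by simp
  show ?thesis
    unfolding eq mult.assoc[symmetric] pair_eigen(2)[OF t] ..
qed

lemma fibre_sw:
  assumes t: "t \<in> {1..<r}"
  shows "bij_betw (\<lambda>w. w \<circ> sw t) (fibre r b \<rho>) (fibre r b (\<rho> \<circ> sw t))"
proof (rule bij_betwI[where g = "\<lambda>w. w \<circ> sw t"])
  have "sw t \<in> fibre r \<rho> (\<rho> \<circ> sw t)" for \<rho> :: "nat \<Rightarrow> nat"
    using sw_permutes[OF t] by (simp add: fibre_def)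
  then have *: "w \<circ> sw t \<in> fibre r b (\<rho> \<circ> sw t)" if "w \<in> fibre r b \<rho>" for w \<rho>
    using fibre_comp that by blast
  show "(\<lambda>w. w \<circ> sw t) \<in> fibre r b \<rho> \<rightarrow> fibre r b (\<rho> \<circ> sw t)" using * by blast
  show "(\<lambda>w. w \<circ> sw t) \<in> fibre r b (\<rho> \<circ> sw t) \<rightarrow> fibre r b \<rho>"
    using *[of _ "\<rho> \<circ> sw t"] by (auto simp only: sw_sw)
qed (simp_all only: sw_sw)

text \<open>All \<open>w\<close> in the fibre have an ascent at \<open>t\<close>: their values there
  lie in increasing blocks of the monotone \<open>b\<close>.\<close>

lemma vv_T_move:
  assumes b: "mono_on {1..r} b" and t: "t \<in> {1..<r}" and less: "\<rho> t < \<rho> (Suc t)"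
  shows "vv b \<rho> * T t = vv b (\<rho> \<circ> sw t)"
proof -
  have "Tw (w \<circ> sw t) = Tw w * T t" if w: "w \<in> fibre r b \<rho>" for w
  proof (rule Tw_comp_sw[OF fibre_permutes[OF w] t])
    have mem: "t \<in> {1..r}" "Suc t \<in> {1..r}" using t by auto
    have "b (w t) < b (w (Suc t))" using fibreD[OF w mem(1)] fibreD[OF w mem(2)] less by simp
    then show "w t < w (Suc t)"
      using permutes_range[OF fibre_permutes[OF w]] mem by (meson b leD leI monotone_onD)
  qed
  then show ?thesis
    unfolding SS_def sum_distrib_right
    using sum.reindex_bij_betw[OF fibre_sw[OF t], of Tw b \<rho>] by (metis (no_types, lifting) sum.cong)
qed

text \<open>Lengths add along the coset of a shortest representative, so the product is the sum over
  the whole coset, and this coset is the fibre over \<open>b \<circ> d\<close>.\<close>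

lemma xx_Tw:
  assumes b: "mono_on {1..r} b" and d: "d \<in> dr r b"
  shows "xx b * Tw d = vv b (b \<circ> d)"
proof -
  note dp = dr_permutes[OF d]
  have df: "d \<in> fibre r b (b \<circ> d)" using dp by (simp add: fibre_def)
  have "bij_betw (\<lambda>(u, v). u \<circ> v) (yg r b \<times> {d}) (fibre r b (b \<circ> d))"
  proof (rule bij_betwI[where g = "\<lambda>w. (w \<circ> pinv d, d)"])
    show "(\<lambda>(u, v). u \<circ> v) \<in> yg r b \<times> {d} \<rightarrow> fibre r b (b \<circ> d)"
      using fibre_comp[OF _ df] by auto
    show "(\<lambda>w. (w \<circ> pinv d, d)) \<in> fibre r b (b \<circ> d) \<rightarrow> yg r b \<times> {d}"
      using fibre_comp[OF _ fibre_inv[OF df]] by auto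
  qed (auto simp: comp_assoc permutes_inv_comp[OF dp])
  then have "xx b * SS {d} = vv b (b \<circ> d)"
    by (rule SS_mult) (auto dest: fibre_permutes intro: dp noninv_yg_dr[OF b _ d])
  then show ?thesis by (simp add: SS_def)
qed

text \<open>A descent of a Young element lies inside a block. Stripping it stays within the subgroup
  and uses only a \<open>T t\<close> with \<open>t\<close> and \<open>Suc t\<close> in one
  block.\<close>

lemma commute_Tw:
  assumes b: "mono_on {1..r} b" and w: "w \<in> yg r b"
    and z: "\<And>t. t \<in> {1..<r} \<Longrightarrow> b t = b (Suc t) \<Longrightarrow> z * T t = T t * z"
  shows "z * Tw w = Tw w * z"
  using w
proof (induction "card (invs r w)" arbitrary: w rule: less_induct)
  case less
  note wp = fibre_permutes[OF less.prems]
  show ?case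
  proof (cases "w = id")
    case False
    then obtain t where t: "t \<in> {1..<r}" "w (Suc t) < w t" using descent_exists[OF wp] by blast
    have mem: "t \<in> {1..r}" "Suc t \<in> {1..r}" using t by auto
    have "b (w (Suc t)) \<le> b (w t)" "b t \<le> b (Suc t)"
      using t mem permutes_range[OF wp mem(1)] permutes_range[OF wp mem(2)]
      by (auto intro!: monotone_onD[OF b])
    then have bt: "b t = b (Suc t)" using fibreD[OF less.prems mem(1)] fibreD[OF less.prems mem(2)] by simp
    let ?u = "w \<circ> sw t"
    have u: "?u \<in> yg r b" using fibre_comp[OF less.prems sw_yg[OF t(1) bt]] .
    have IH: "z * Tw ?u = Tw ?u * z" using less u card_invs_sw_down[of t r w] t by simp
    have "Tw w = Tw ?u * T t"
      using Tw_comp_sw[of ?u t] t permutes_comp_sw[OF wp] by (simp add: sw_sw)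
    then show ?thesis using IH z[OF t(1) bt] by (metis mult.assoc)
  qed simp
qed

lemma commute_xx:
  assumes b: "mono_on {1..r} b"
    and z: "\<And>t. t \<in> {1..<r} \<Longrightarrow> b t = b (Suc t) \<Longrightarrow> z * T t = T t * z"
  shows "z * xx b = xx b * z"
  using commute_Tw[OF b _ z] by (simp add: SS_def sum_distrib_left sum_distrib_right)

section \<open>Clifford sums and chains of \<open>T t\<close> on eigenvectors\<close>

definition Cq :: "nat \<Rightarrow> nat \<Rightarrow> 'b" where
  "Cq i j = (\<Sum>t\<in>{i..j}. q ^ (j - t) * c t)"

definition Cp :: "nat \<Rightarrow> nat \<Rightarrow> 'b" where
  "Cp i j = (\<Sum>t\<in>{i..j}. q ^ (t - i) * c t)"

definition up :: "nat \<Rightarrow> nat \<Rightarrow> 'b" where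
  "up i j = prod_list (map T [i..<j])"

definition dn :: "nat \<Rightarrow> nat \<Rightarrow> 'b" where
  "dn i j = prod_list (map T (rev [i..<j]))"

text \<open>The sum over the shortest representatives when the first position of the block
  \<open>i..j\<close> is split off; \<open>Vdn\<close> is the sum for the last position.\<close>

definition Vup :: "nat \<Rightarrow> nat \<Rightarrow> 'b" where
  "Vup i j = (\<Sum>t\<in>{i..j}. up i t)"

definition Vdn :: "nat \<Rightarrow> nat \<Rightarrow> 'b" where
  "Vdn i j = (\<Sum>t\<in>{i..j}. dn t j)"

definition qn :: "nat \<Rightarrow> 'b" where
  "qn m = (\<Sum>k<m. q ^ k)"

lemma up_same [simp]: "up i i = 1" and dn_same [simp]: "dn i i = 1"
  by (simp_all add: up_def dn_def)

lemma up_Suc: "i \<le> j \<Longrightarrow> up i (Suc j) = up i j * T j"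
  by (simp add: up_def)

lemma up_rec: "i < j \<Longrightarrow> up i j = T i * up (Suc i) j"
  by (simp add: up_def upt_conv_Cons)

lemma dn_rec: "i < j \<Longrightarrow> dn i j = dn (Suc i) j * T i"
  by (simp add: dn_def upt_conv_Cons)

lemma Cq_empty: "j < i \<Longrightarrow> Cq i j = 0"
  by (simp add: Cq_def)

lemma Cp_empty: "j < i \<Longrightarrow> Cp i j = 0"
  by (simp add: Cp_def)

lemma Cq_Suc: "i \<le> Suc j \<Longrightarrow> Cq i (Suc j) = q * Cq i j + c (Suc j)"
proof -
  assume "i \<le> Suc j"
  moreover have "(\<Sum>t\<in>{i..j}. q ^ (Suc j - t) * c t) = (\<Sum>t\<in>{i..j}. q * (q ^ (j - t) * c t))"
    by (intro sum.cong) (auto simp: Suc_diff_le mult.assoc)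
  ultimately show ?thesis by (simp add: Cq_def sum_distrib_left)
qed

lemma Cq_first: "i \<le> j \<Longrightarrow> Cq i j = q ^ (j - i) * c i + Cq (Suc i) j"
  unfolding Cq_def by (simp add: sum.atLeast_Suc_atMost)

lemma Cp_first: "i \<le> j \<Longrightarrow> Cp i j = c i + q * Cp (Suc i) j"
proof -
  assume "i \<le> j"
  moreover have "(\<Sum>t\<in>{Suc i..j}. q ^ (t - i) * c t) = (\<Sum>t\<in>{Suc i..j}. q * (q ^ (t - Suc i) * c t))"
  proof (intro sum.cong)
    fix t assume "t \<in> {Suc i..j}"
    then have "t - i = Suc (t - Suc i)" by auto
    then show "q ^ (t - i) * c t = q * (q ^ (t - Suc i) * c t)" by (simp add: mult.assoc)
  qed simp
  ultimately show ?thesis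
    unfolding Cp_def by (simp add: sum.atLeast_Suc_atMost sum_distrib_left)
qed

lemma Cp_last: "i \<le> Suc j \<Longrightarrow> Cp i (Suc j) = Cp i j + q ^ (Suc j - i) * c (Suc j)"
  by (simp add: Cp_def)

lemma Cq_single [simp]: "Cq i i = c i" and Cp_single [simp]: "Cp i i = c i"
  by (simp_all add: Cq_def Cp_def)

definition eigen :: "'b \<Rightarrow> nat \<Rightarrow> nat \<Rightarrow> bool" where
  "eigen x i j \<longleftrightarrow> (\<forall>t\<in>{i..<j}. x * T t = q * x)"

lemma eigen_up: "eigen x i j \<Longrightarrow> i \<le> t \<Longrightarrow> t \<le> j \<Longrightarrow> x * up i t = q ^ (t - i) * x"
proof (induction t)
  case (Suc t)
  show ?case
  proof (cases "i = Suc t")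
    case False
    then have it: "i \<le> t" using Suc.prems by simp
    have "x * up i (Suc t) = (x * up i t) * T t" using it by (simp add: up_Suc mult.assoc)
    also have "\<dots> = q ^ (t - i) * (x * T t)" using Suc it by (simp add: mult.assoc)
    also have "x * T t = q * x" using Suc.prems it by (simp add: eigen_def)
    finally show ?thesis using it by (simp add: Suc_diff_le mult.assoc power_commutes)
        (metis mult.assoc power_commutes)
  qed simp
qed simp

lemma eigen_dn: "eigen x i j \<Longrightarrow> i \<le> t \<Longrightarrow> t \<le> j \<Longrightarrow> x * dn t j = q ^ (j - t) * x"
proof (induction "j - t" arbitrary: t)
  case (Suc k)
  then have tj: "t < j" by simp
  have "x * dn t j = (x * dn (Suc t) j) * T t" using tj by (simp add: dn_rec mult.assoc)
  also have "\<dots> = q ^ (j - Suc t) * (x * T t)" using Suc tj by (simp add: mult.assoc)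
  also have "x * T t = q * x" using Suc.prems tj by (simp add: eigen_def)
  finally show ?case
    using tj Suc_diff_Suc[OF tj] by (metis mult.assoc power_Suc2)
qed simp

lemma sum_qpow: "i \<le> j \<Longrightarrow> (\<Sum>t\<in>{i..j}. q ^ (t - i)) = qn (Suc (j - i))"
  unfolding qn_def
  by (rule sum.reindex_bij_witness[of _ "\<lambda>k. k + i" "\<lambda>t. t - i"]) auto

lemma sum_qpow_rev: "i \<le> j \<Longrightarrow> (\<Sum>t\<in>{i..j}. q ^ (j - t)) = qn (Suc (j - i))"
  unfolding qn_def
  by (rule sum.reindex_bij_witness[of _ "\<lambda>k. j - k" "\<lambda>t. j - t"]) auto

lemma eigen_Vup: "eigen x i j \<Longrightarrow> i \<le> j \<Longrightarrow> x * Vup i j = qn (Suc (j - i)) * x"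
  by (simp add: Vup_def sum_distrib_left eigen_up flip: sum_qpow sum_distrib_right)

lemma eigen_Vdn: "eigen x i j \<Longrightarrow> i \<le> j \<Longrightarrow> x * Vdn i j = qn (Suc (j - i)) * x"
  by (simp add: Vdn_def sum_distrib_left eigen_dn flip: sum_qpow_rev sum_distrib_right)

text \<open>The relation \<open>c (Suc t) * T t = T t * c t\<close> has no correction term, so the
  generator slides through a descending chain and only its index drops.\<close>

lemma c_dn: "1 \<le> t \<Longrightarrow> t \<le> j \<Longrightarrow> j \<le> r \<Longrightarrow> c j * dn t j = dn t j * c t"
proof (induction "j - t" arbitrary: t)
  case (Suc k)
  then have tj: "t < j" by simp
  have "c j * dn t j = (c j * dn (Suc t) j) * T t" using tj by (simp add: dn_rec mult.assoc)
  also have "\<dots> = dn (Suc t) j * (c (Suc t) * T t)" using Suc tj by (simp add: mult.assoc)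
  also have "\<dots> = dn (Suc t) j * T t * c t" using Suc.prems tj by (simp add: c_Suc_T mult.assoc)
  finally show ?case using tj by (simp add: dn_rec)
qed simp

text \<open>The chain down to \<open>t\<close> leaves its eigenvalue \<open>q ^ (j - t)\<close> in
  front of \<open>c t\<close>: the weights of \<open>c_q\<close> are eigenvalues of chains.\<close>

lemma eigen_c_Vdn:
  assumes x: "eigen x i j" and ij: "1 \<le> i" "i \<le> j" "j \<le> r"
  shows "x * c j * Vdn i j = x * Cq i j"
proof -
  have "x * c j * dn t j = x * (q ^ (j - t) * c t)" if "t \<in> {i..j}" for t
  proof -
    have "x * c j * dn t j = (x * dn t j) * c t" using c_dn[of t j] that ij by (simp add: mult.assoc)
    also have "x * dn t j = q ^ (j - t) * x" using that by (intro eigen_dn[OF x]) auto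
    finally show ?thesis by (simp add: mult.assoc qpow_left[of x])
  qed
  then show ?thesis by (simp add: Vdn_def Cq_def sum_distrib_left)
qed

text \<open>The eigenvalue gives \<open>q * (x * c (Suc t))\<close>, from which the correction term
  of the relation removes \<open>q - 1\<close> copies.\<close>

lemma eigen_c_T:
  assumes "x * T t = q * x" "t \<in> {1..<r}"
  shows "x * c t * T t = x * c (Suc t) + (q - 1) * (x * c t)"
proof -
  have "x * c t * T t = x * T t * c (Suc t) + (q - 1) * (x * c t - x * c (Suc t))"
    using assms(2) by (simp add: mult.assoc c_T_same distrib_left left_diff_distrib right_diff_distrib q_left[of x])
  then show ?thesis using assms(1) by (simp add: algebra_simps)
qed

lemma eigen_Cq_T:
  assumes "x * T t = q * x" "t \<in> {1..<r}" "1 \<le> i" "j < t"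
  shows "x * Cq i j * T t = q * (x * Cq i j)"
proof -
  have "x * (q ^ (j - s) * c s) * T t = q * (x * (q ^ (j - s) * c s))" if "s \<in> {i..j}" for s
  proof -
    have "c s * T t = T t * c s" using that assms by (intro c_T) auto
    then have "x * (q ^ (j - s) * c s) * T t = q ^ (j - s) * (x * T t * c s)"
      by (simp add: mult.assoc qpow_left[of x])
    then show ?thesis using assms(1) by (simp add: mult.assoc qpow_left[of x] q_left[of "q ^ (j - s)"])
  qed
  then show ?thesis by (simp add: Cq_def sum_distrib_left sum_distrib_right)
qed

text \<open>In an ascending chain every step leaves a correction behind; they accumulate to
  \<open>q - 1\<close> times \<open>c_q\<close> of the positions passed.\<close>

lemma eigen_c_up:
  assumes x: "eigen x i j" and ij: "1 \<le> i" "j \<le> r"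
  shows "i \<le> t \<Longrightarrow> Suc t \<le> j \<Longrightarrow> x * c i * up i (Suc t) = x * c (Suc t) + (q - 1) * (x * Cq i t)"
proof (induction t)
  case 0
  then show ?case using ij by simp
next
  case (Suc t)
  have xT: "x * T s = q * x" if "s \<in> {i..<j}" for s using x that by (simp add: eigen_def)
  show ?case
  proof (cases "i = Suc t")
    case True
    then show ?thesis
      using eigen_c_T[of x i] xT[of i] Suc.prems ij by (simp add: up_Suc)
  next
    case False
    then have it: "i \<le> t" using Suc.prems by simp
    have "x * c i * up i (Suc (Suc t)) = (x * c i * up i (Suc t)) * T (Suc t)"
      using it by (simp add: up_Suc mult.assoc)
    also have "\<dots> = x * c (Suc t) * T (Suc t) + (q - 1) * (x * Cq i t * T (Suc t))"
      using Suc it by (simp add: distrib_right mult.assoc)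
    also have "\<dots> = x * c (Suc (Suc t)) + (q - 1) * (x * c (Suc t)) + (q - 1) * (q * (x * Cq i t))"
      using eigen_c_T[of x "Suc t"] eigen_Cq_T[of x "Suc t" i t] xT[of "Suc t"] Suc.prems it ij by simp
    also have "\<dots> = x * c (Suc (Suc t)) + (q - 1) * (x * Cq i (Suc t))"
      using it by (simp add: Cq_Suc q_left[of x] algebra_simps)
    finally show ?thesis .
  qed
qed

text \<open>The chain up to \<open>Suc t\<close> contributes \<open>c (Suc t)\<close> and
  \<open>q - 1\<close> further copies of \<open>Cq i t\<close>. Together with the previous chains
  this is the recursion of \<open>Cq\<close>.\<close>

lemma eigen_c_Vup:
  assumes x: "eigen x i j" and ij: "1 \<le> i" "j \<le> r"
  shows "i \<le> t \<Longrightarrow> t \<le> j \<Longrightarrow> x * c i * Vup i t = x * Cq i t"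
proof (induction t)
  case (Suc t)
  show ?case
  proof (cases "i = Suc t")
    case False
    then have it: "i \<le> t" using Suc.prems by simp
    have "x * c i * Vup i (Suc t) = x * c i * Vup i t + x * c i * up i (Suc t)"
      using it by (simp add: Vup_def distrib_left)
    also have "\<dots> = x * Cq i t + (x * c (Suc t) + (q - 1) * (x * Cq i t))"
      using Suc it eigen_c_up[OF x ij it] by simp
    also have "\<dots> = x * Cq i (Suc t)"
      using it by (simp add: Cq_Suc algebra_simps q_left[of x])
    finally show ?thesis .
  qed (simp add: Vup_def)
qed (use ij in \<open>simp add: Vup_def\<close>)

lemma T_Cp_eigen:
  assumes "T t * x = q * x" "t \<in> {1..<r}" "j \<le> r" "Suc t < i"
  shows "T t * (Cp i j * x) = q * (Cp i j * x)"
proof -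
  have "T t * (q ^ (s - i) * c s * x) = q * (q ^ (s - i) * c s * x)" if "s \<in> {i..j}" for s
  proof -
    have "T t * c s = c s * T t" using that assms by (intro c_T[symmetric]) auto
    then have "T t * (q ^ (s - i) * c s * x) = q ^ (s - i) * (c s * (T t * x))"
      by (metis mult.assoc qpow_left)
    then show ?thesis
      using assms(1) by (simp add: mult.assoc q_left[of "c s"] q_left[of "q ^ (s - i)"])
  qed
  then show ?thesis by (simp add: Cp_def sum_distrib_left sum_distrib_right)
qed

text \<open>Counterpart of \<open>eigen_c_up\<close> with the eigenvector on the right. The
  induction now starts at the upper end \<open>j\<close>, which reverses the powers of
  \<open>q\<close> and yields \<open>Cp\<close>.\<close>

lemma up_c_eigen:
  assumes x: "\<And>t. t \<in> {i..<j} \<Longrightarrow> T t * x = q * x" and ij: "1 \<le> i" "j \<le> r"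
  shows "i \<le> t \<Longrightarrow> t \<le> j \<Longrightarrow> up t j * c j * x = c t * x + (q - 1) * (Cp (Suc t) j * x)"
proof (induction "j - t" arbitrary: t)
  case 0
  then show ?case by (simp add: Cp_empty)
next
  case (Suc k)
  then have tj: "t < j" by simp
  have tr: "t \<in> {1..<r}" using tj Suc.prems ij by auto
  have xT: "T t * x = q * x" using x tj Suc.prems by simp
  have Tc: "T t * c (Suc t) = c t * T t - (q - 1) * (c t - c (Suc t))"
    using c_T_same[OF tr] by simp
  have "up t j * c j * x = T t * (up (Suc t) j * c j * x)"
    using tj by (simp add: up_rec mult.assoc)
  also have "\<dots> = T t * (c (Suc t) * x + (q - 1) * (Cp (Suc (Suc t)) j * x))"
    using Suc tj by simp
  also have "\<dots> = T t * c (Suc t) * x + (q - 1) * (T t * (Cp (Suc (Suc t)) j * x))"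
    by (simp add: algebra_simps q_left[of "T t"])
  also have "\<dots> = T t * c (Suc t) * x + (q - 1) * (q * (Cp (Suc (Suc t)) j * x))"
    using T_Cp_eigen[OF xT tr ij(2)] by simp
  also have "T t * c (Suc t) * x = c t * (T t * x) - (q - 1) * (c t * x - c (Suc t) * x)"
    unfolding Tc by (simp add: left_diff_distrib mult.assoc)
  also have "\<dots> = c t * x + (q - 1) * (c (Suc t) * x)"
    unfolding xT by (simp add: algebra_simps q_left[of "c t"])
  finally show ?case using tj by (simp add: Cp_first algebra_simps)
qed

lemma sum_up_c_eigen:
  assumes x: "\<And>t. t \<in> {i..<j} \<Longrightarrow> T t * x = q * x" and ij: "1 \<le> i" "j \<le> r"
  shows "i \<le> s \<Longrightarrow> s \<le> Suc j \<Longrightarrow> (\<Sum>t\<in>{s..j}. up t j * c j * x) = Cp s j * x"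
proof (induction "Suc j - s" arbitrary: s)
  case 0
  then show ?case by (simp add: Cp_empty)
next
  case (Suc k)
  then have sj: "s \<le> j" by simp
  have "(\<Sum>t\<in>{s..j}. up t j * c j * x) = up s j * c j * x + Cp (Suc s) j * x"
    using Suc sj by (simp add: sum.atLeast_Suc_atMost)
  also have "\<dots> = Cp s j * x"
    using up_c_eigen[OF x ij Suc.prems(1) sj] sj by (simp add: Cp_first algebra_simps)
  finally show ?case .
qed

section \<open>Sums over a split-off position and the passage of \<open>Cq\<close> through
  \<open>xx\<close>\<close>

lemma SS_first:
  assumes b': "mono_on {1..r} b'" and iso: "isolates r b b' i" and blk: "interval_block r b i j"
  shows "SS (dr r b' \<inter> yg r b) = Vup i j"
proof -
  have "Tw (word_perm [i..<t]) = up i t" if "t \<in> {i..j}" for t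
    using Tw_reduced[OF reduced_expr_upt[of i t r]] that blk by (simp add: up_def interval_block_def)
  then show ?thesis
    unfolding SS_def Vup_def sum.reindex_bij_betw[OF coset_reps_first[OF assms], symmetric] by simp
qed

lemma SS_last:
  assumes b': "mono_on {1..r} b'" and iso: "isolates r b b' j" and blk: "interval_block r b i j"
  shows "SS (dr r b' \<inter> yg r b) = Vdn i j"
proof -
  have "Tw (word_perm (rev [t..<j])) = dn t j" if "t \<in> {i..j}" for t
    using Tw_reduced[OF reduced_expr_rev_upt[of t j r]] that blk by (simp add: dn_def interval_block_def)
  then show ?thesis
    unfolding SS_def Vdn_def sum.reindex_bij_betw[OF coset_reps_last[OF assms], symmetric] by simp
qed

lemma isolatesD:
  assumes "isolates r b b' x0" "x \<in> {1..r}" "y \<in> {1..r}" "b' x = b' y"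
  shows "b x = b y"
  using assms unfolding isolates_def by blast

text \<open>Left and right representatives of the same subgroup are inverse to each other, so
  ascending chains stand on the left and descending ones on the right.\<close>

lemma xx_isolates:
  assumes b: "mono_on {1..r} b" and b': "mono_on {1..r} b'" and iso: "isolates r b b' j"
    and blk: "interval_block r b i j"
  shows "xx b = (\<Sum>t\<in>{i..j}. up t j) * xx b'" "xx b = xx b' * Vdn i j"
proof -
  have W: "SS (yg r b \<inter> inc r b') = (\<Sum>t\<in>{i..j}. up t j)"
  proof -
    have "Tw (word_perm [t..<j]) = up t j" if "t \<in> {i..j}" for t
      using Tw_reduced[OF reduced_expr_upt[of t j r]] that blk by (simp add: up_def interval_block_def)
    then show ?thesis
      unfolding SS_def sum.reindex_bij_betw[OF left_coset_reps_last[OF b' iso blk], symmetric] by simp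
  qed
  show "xx b = (\<Sum>t\<in>{i..j}. up t j) * xx b'"
    unfolding W[symmetric] by (rule vv_factor[OF b' isolatesD[OF iso]])
  show "xx b = xx b' * Vdn i j"
    unfolding SS_last[OF b' iso blk, symmetric] by (rule xx_SS_dr[OF b' isolatesD[OF iso], symmetric])
qed

lemma xx_eigen: "interval_block r b i j \<Longrightarrow> eigen (xx b) i j"
proof -
  assume blk: "interval_block r b i j"
  have "xx b * T t = q * xx b" if t: "t \<in> {i..<j}" for t
  proof (rule vv_T_eigen)
    show "t \<in> {1..<r}" using t blk by (auto simp: interval_block_def)
    have "t \<in> {1..r}" "Suc t \<in> {1..r}" using t blk by (auto simp: interval_block_def)
    then show "b t = b (Suc t)"
      using t interval_blockD[OF blk, of t] interval_blockD[OF blk, of "Suc t"] by simp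
  qed
  then show ?thesis by (simp add: eigen_def)
qed

lemma exists_isolating_last:
  assumes b: "mono_on {1..r} b" and blk: "interval_block r b i j"
  obtains b' where "mono_on {1..r} b'" "isolates r b b' j"
proof -
  \<comment> \<open>Doubling frees one value directly above that of the block for its last position,
    so the result stays monotone.\<close>
  let ?b' = "\<lambda>x. 2 * b x + (if x = j then 1 else 0)"
  have ij: "1 \<le> i" "i \<le> j" "j \<le> r" using blk by (auto simp: interval_block_def)
  have "?b' x \<le> ?b' y" if xy: "x \<in> {1..r}" "y \<in> {1..r}" "x \<le> y" for x y
  proof -
    have le: "b x \<le> b y" using monotone_onD[OF b] xy .
    have "b y \<noteq> b x" if "x = j" "y \<noteq> j"
      using interval_blockD[OF blk xy(2)] interval_blockD[OF blk, of j] ij xy that by auto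
    then show ?thesis using le by (cases "x = j"; cases "y = j") auto
  qed
  then have "mono_on {1..r} ?b'" by (intro mono_onI)
  moreover have "isolates r b ?b' j"
    unfolding isolates_def using ij by (auto, presburger+)
  ultimately show ?thesis using that by blast
qed

text \<open>If \<open>b'\<close> splits off the last position \<open>j\<close> of the block, \<open>V\<close> and \<open>W\<close> are the sums over its right and
  left coset representatives and \<open>X = xx b\<close>, then \<open>X C = X c\<^sub>j V = W xx b' c\<^sub>j V = W c\<^sub>j X\<close>.\<close>

lemma xx_Cq:
  assumes b: "mono_on {1..r} b" and blk: "interval_block r b i j"
  shows "xx b * Cq i j = Cp i j * xx b"
proof -
  have ij: "1 \<le> i" "i \<le> j" "j \<le> r" using blk by (auto simp: interval_block_def)
  obtain b' where b': "mono_on {1..r} b'" and iso: "isolates r b b' j"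
    using exists_isolating_last[OF b blk] .
  let ?W = "\<Sum>t\<in>{i..j}. up t j"
  note fac = xx_isolates[OF b b' iso blk]
  have comm: "c j * xx b' = xx b' * c j"
  proof (rule commute_xx[OF b'])
    fix t assume t: "t \<in> {1..<r}" "b' t = b' (Suc t)"
    then have "t = j \<longleftrightarrow> Suc t = j"
      using iso unfolding isolates_def by auto
    then show "c j * T t = T t * c j" using t ij by (intro c_T) auto
  qed
  have "xx b * Cq i j = xx b * c j * Vdn i j"
    using eigen_c_Vdn[OF xx_eigen[OF blk] ij] by simp
  also have "\<dots> = ?W * (xx b' * c j) * Vdn i j" by (simp add: fac(1) mult.assoc)
  also have "\<dots> = ?W * c j * (xx b' * Vdn i j)" by (simp add: comm[symmetric] mult.assoc)
  also have "\<dots> = (\<Sum>t\<in>{i..j}. up t j * c j * xx b)"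
    by (simp add: fac(2)[symmetric] sum_distrib_right)
  also have "\<dots> = Cp i j * xx b"
  proof (rule sum_up_c_eigen)
    fix t assume t: "t \<in> {i..<j}"
    show "T t * xx b = q * xx b"
    proof (rule T_xx_eigen)
      show "t \<in> {1..<r}" using t ij by auto
      show "b t = b (Suc t)"
        using t ij interval_blockD[OF blk, of t] interval_blockD[OF blk, of "Suc t"] by auto
    qed
  qed (use ij in auto)
  finally show ?thesis .
qed

end

section \<open>Root vectors acting on words\<close>

text \<open>At a descent of \<open>d \<in> dr r b\<close> the two values lie in different blocks, so
  stripping the descent keeps all order conditions.\<close>

lemma dr_induct [consumes 2, case_names id swap]:
  assumes b: "mono_on {1..r} b" and "d \<in> dr r b" and "P id"
    and step: "\<And>d t. d \<in> dr r b \<Longrightarrow> t \<in> {1..<r} \<Longrightarrow> b (d t) < b (d (Suc t)) \<Longrightarrow> P d \<Longrightarrow> P (d \<circ> sw t)"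
  shows "P d"
  using assms(2)
proof (induction "card (invs r d)" arbitrary: d rule: less_induct)
  case less
  note dp = dr_permutes[OF less.prems]
  show ?case
  proof (cases "d = id")
    case False
    then obtain t where t: "t \<in> {1..<r}" "d (Suc t) < d t" using descent_exists[OF dp] by blast
    have mem: "t \<in> {1..r}" "Suc t \<in> {1..r}" using t by auto
    have ne: "b (d t) \<noteq> b (d (Suc t))" using drD[OF less.prems mem] t by auto
    moreover have "b (d (Suc t)) \<le> b (d t)"
      using t mem permutes_range[OF dp mem(1)] permutes_range[OF dp mem(2)]
      by (auto intro!: monotone_onD[OF b])
    ultimately have lt: "b (d (Suc t)) < b (d t)" by simp
    let ?u = "d \<circ> sw t"
    have "d (sw t x) < d (sw t y)"
      if xy: "x \<in> {1..r}" "y \<in> {1..r}" "x < y" "b (d (sw t x)) = b (d (sw t y))" for x y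
    proof (rule drD[OF less.prems])
      show "sw t x \<in> {1..r}" "sw t y \<in> {1..r}" using xy mem by (auto simp: sw_apply)
      show "sw t x < sw t y" using xy ne by (auto simp: sw_apply split: if_splits)
    qed (use xy in simp)
    then have u: "?u \<in> dr r b" using permutes_comp_sw[OF dp t(1)] by (simp add: dr_def)
    have "P ?u" using less u card_invs_sw_down[of t r d] t by simp
    then have "P (?u \<circ> sw t)" using step[OF u t(1)] lt by simp
    then show ?thesis by (simp only: sw_sw)
  qed (use assms in simp)
qed

text \<open>Whether \<open>s\<close> is isolated does not depend on the block of \<open>b\<close> to
  which it belonged, so one refinement serves the partitions before and after \<open>s\<close>
  moves.\<close>

lemma isolates_upd:
  assumes iso: "isolates r b b' s" and b2: "\<And>x. x \<noteq> s \<Longrightarrow> b2 x = b x"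
  shows "isolates r b2 b' s"
  unfolding isolates_def
proof (intro conjI ballI)
  show "s \<in> {1..r}" using iso unfolding isolates_def by (rule conjunct1)
  fix x y assume xy: "x \<in> {1..r}" "y \<in> {1..r}"
  have "b' x = b' y \<longleftrightarrow> b x = b y \<and> (x = s \<longleftrightarrow> y = s)"
    using iso[unfolded isolates_def, THEN conjunct2, rule_format, OF xy] .
  moreover have "b x = b y \<longleftrightarrow> b2 x = b2 y" if "x = s \<longleftrightarrow> y = s"
    using b2[of x] b2[of y] that by (cases "x = s") simp_all
  ultimately show "b' x = b' y \<longleftrightarrow> b2 x = b2 y \<and> (x = s \<longleftrightarrow> y = s)" by blast
qed

lemma isolates_iff:
  assumes "isolates r b b' s" "x \<in> {1..r}" "y \<in> {1..r}"
  shows "b' x = b' y \<longleftrightarrow> b x = b y \<and> (x = s \<longleftrightarrow> y = s)"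
  using assms(1)[unfolded isolates_def, THEN conjunct2, rule_format, OF assms(2,3)] .

lemma interval_block_bounds: "interval_block r b i j \<Longrightarrow> 1 \<le> i \<and> i \<le> j \<and> j \<le> r"
  by (simp add: interval_block_def)

lemma isolates_rest_first:
  assumes iso: "isolates r b b' s" and blk: "interval_block r b s e" and "s < e"
  shows "interval_block r b' (Suc s) e"
proof -
  note bd = interval_block_bounds[OF blk]
  have m: "Suc s \<in> {1..r}" using bd \<open>s < e\<close> by simp
  have "b (Suc s) = b s" using interval_blockD[OF blk m] bd \<open>s < e\<close> by simp
  then have "b' x = b' (Suc s) \<longleftrightarrow> Suc s \<le> x \<and> x \<le> e" if "x \<in> {1..r}" for x
    using isolates_iff[OF iso that m] interval_blockD[OF blk that] by auto
  then show ?thesis using bd \<open>s < e\<close> by (simp add: interval_block_def)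
qed

lemma isolates_rest_last:
  assumes iso: "isolates r b b' s" and blk: "interval_block r b i s" and "i < s"
  shows "interval_block r b' i (s - 1)"
proof -
  note bd = interval_block_bounds[OF blk]
  have m: "i \<in> {1..r}" using bd by simp
  have "b' x = b' i \<longleftrightarrow> i \<le> x \<and> x \<le> s - 1" if "x \<in> {1..r}" for x
    using isolates_iff[OF iso that m] interval_blockD[OF blk that] \<open>i < s\<close> by auto
  then show ?thesis using bd \<open>i < s\<close> by (auto simp: interval_block_def)
qed

lemma isolates_other:
  assumes iso: "isolates r b b' s" and blk: "interval_block r b i j" and "s < i \<or> j < s"
  shows "interval_block r b' i j"
proof -
  note bd = interval_block_bounds[OF blk]
  have m: "i \<in> {1..r}" using bd by simp
  have "b' x = b' i \<longleftrightarrow> i \<le> x \<and> x \<le> j" if "x \<in> {1..r}" for x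
    using isolates_iff[OF iso that m] interval_blockD[OF blk that] assms(3) bd by auto
  then show ?thesis using bd by (simp add: interval_block_def)
qed

lemma exists_isolating_first:
  assumes b: "mono_on {1..r} b" and blk: "interval_block r b i j"
  obtains b' where "mono_on {1..r} b'" "isolates r b b' i"
proof -
  have ij: "1 \<le> i" "i \<le> j" "j \<le> r" using blk by (auto simp: interval_block_def)
  \<comment> \<open>After doubling, every position except \<open>i\<close> is raised by one, so that
    \<open>i\<close> comes just before the rest of its block.\<close>
  let ?b' = "\<lambda>x. if x = i then 2 * b x else Suc (2 * b x)"
  have "?b' x \<le> ?b' y" if xy: "x \<in> {1..r}" "y \<in> {1..r}" "x \<le> y" for x y
  proof -
    have le: "b x \<le> b y" using monotone_onD[OF b] xy .
    have "b y \<noteq> b x" if "y = i" "x \<noteq> i"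
      using interval_blockD[OF blk xy(1)] ij xy that by auto
    then show ?thesis using le by (cases "x = i"; cases "y = i") auto
  qed
  then have "mono_on {1..r} ?b'" by (intro mono_onI)
  moreover have "isolates r b ?b' i"
    unfolding isolates_def using ij by (auto, presburger+)
  ultimately show ?thesis using that by blast
qed

context hecke_clifford_ring
begin

text \<open>The single letter \<open>h\<close> travels right through a run of letters
  \<open>Suc h\<close>; each step exchanges an ascending pair of letters.\<close>

lemma word_up:
  assumes b: "mono_on {1..r} b" and \<rho>: "\<And>x. x \<in> {s..e} \<Longrightarrow> \<rho> x = Suc h" and se: "1 \<le> s" "e \<le> r"
  shows "s \<le> t \<Longrightarrow> t \<le> e \<Longrightarrow> vv b (\<rho>(s := h)) * up s t = vv b (\<rho>(t := h))"
proof (induction t)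
  case 0
  then show ?case using se by simp
next
  case (Suc t)
  show ?case
  proof (cases "s = Suc t")
    case False
    then have st: "s \<le> t" using Suc.prems by simp
    have bt: "\<rho> t = Suc h" "\<rho> (Suc t) = Suc h"
      using \<rho>[of t] \<rho>[of "Suc t"] st Suc.prems by auto
    have "vv b (\<rho>(s := h)) * up s (Suc t) = vv b (\<rho>(s := h)) * up s t * T t"
      by (simp only: up_Suc[OF st] mult.assoc)
    also have "vv b (\<rho>(s := h)) * up s t = vv b (\<rho>(t := h))"
      using Suc.prems st by (intro Suc.IH) auto
    also have "\<dots> * T t = vv b (\<rho>(t := h) \<circ> sw t)"
      using bt st se Suc.prems by (intro vv_T_move b) auto
    also have "\<dots> = vv b (\<rho>(Suc t := h))"
      using bt by (intro vv_cong) (auto simp: sw_apply)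
    finally show ?thesis .
  qed simp
qed

lemma word_dn:
  assumes b: "mono_on {1..r} b" and \<rho>: "\<And>x. x \<in> {i..s} \<Longrightarrow> \<rho> x = h" and se: "1 \<le> i" "s \<le> r"
  shows "i \<le> t \<Longrightarrow> t \<le> s \<Longrightarrow> vv b (\<rho>(s := Suc h)) * dn t s = vv b (\<rho>(t := Suc h))"
proof (induction "s - t" arbitrary: t)
  case 0
  then show ?case by simp
next
  case (Suc k)
  from Suc have ts: "t < s" by simp
  have bt: "\<rho> t = h" "\<rho> (Suc t) = h"
    using \<rho>[of t] \<rho>[of "Suc t"] ts Suc.prems by auto
  have "vv b (\<rho>(s := Suc h)) * dn t s = vv b (\<rho>(s := Suc h)) * dn (Suc t) s * T t"
    by (simp only: dn_rec[OF ts] mult.assoc)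
  also have "vv b (\<rho>(s := Suc h)) * dn (Suc t) s = vv b (\<rho>(Suc t := Suc h))"
    using Suc ts by (intro Suc.hyps(1)) auto
  also have "\<dots> * T t = vv b (\<rho>(Suc t := Suc h) \<circ> sw t)"
    using bt ts se Suc.prems by (intro vv_T_move b) auto
  also have "\<dots> = vv b (\<rho>(t := Suc h))"
    using bt by (intro vv_cong) (auto simp: sw_apply)
  finally show ?case .
qed

text \<open>The coproduct formula for the root vectors of quantum \<open>gl\<^sub>n\<close> on tensor space, with \<open>vv b \<rho>\<close> in the
  role of the basis vector indexed by the word \<open>\<rho>\<close>.\<close>

lemma raise_words:
  assumes b: "mono_on {1..r} b" and bp: "mono_on {1..r} (b(s := h))"
    and blk: "interval_block r b s e" and bs: "b s = Suc h" and d: "d \<in> dr r b"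
  shows "xx (b(s := h)) * Vup s e * Tw d =
    (\<Sum>i | i \<in> {1..r} \<and> b (d i) = Suc h.
      q ^ card {y \<in> {1..r}. i < y \<and> b (d y) = h} * vv (b(s := h)) ((b \<circ> d)(i := h)))"
proof -
  let ?bp = "b(s := h)"
  define N where "N \<rho> i = card {y \<in> {1..r}. i < y \<and> \<rho> y = h}" for \<rho> :: "nat \<Rightarrow> nat" and i
  have se: "1 \<le> s" "s \<le> e" "e \<le> r" using blk by (auto simp: interval_block_def)
  obtain b' where b': "mono_on {1..r} b'" and iso: "isolates r b b' s"
    using exists_isolating_first[OF b blk] .
  have iso': "isolates r ?bp b' s" using iso by (rule isolates_upd) simp
  define P where "P = SS (fibre r ?bp ?bp \<inter> inc r b')"
  \<comment> \<open>With \<open>xx b\<close> as a right factor the operator meets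
    \<open>Tw d\<close> in the product \<open>xx b * Tw d\<close>, which is a word; \<open>P\<close>
    then plays the role of the root vector.\<close>
  have P: "xx ?bp * Vup s e = P * xx b"
  proof -
    have "xx ?bp = P * xx b'" unfolding P_def by (rule vv_factor[OF b' isolatesD[OF iso']])
    moreover have "xx b' * Vup s e = xx b"
      unfolding SS_first[OF b' iso blk, symmetric] by (rule xx_SS_dr[OF b' isolatesD[OF iso]])
    ultimately show ?thesis by (simp add: mult.assoc)
  qed
  have "P * vv b (b \<circ> d) =
    (\<Sum>i | i \<in> {1..r} \<and> b (d i) = Suc h. q ^ N (b \<circ> d) i * vv ?bp ((b \<circ> d)(i := h)))"
    using b d
  proof (induction d rule: dr_induct)
    case id
    \<comment> \<open>In the sorted word the letters \<open>Suc h\<close> fill \<open>s..e\<close>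
      and no letter \<open>h\<close> follows them, so all exponents are 0.\<close>
    have set: "{i. i \<in> {1..r} \<and> b (id i) = Suc h} = {s..e}"
    proof -
      have "b x = Suc h \<longleftrightarrow> s \<le> x \<and> x \<le> e" if "x \<in> {1..r}" for x
        using interval_blockD[OF blk that] by (simp add: bs)
      then show ?thesis using se by auto
    qed
    have "N (b \<circ> id) i = 0" if i: "i \<in> {s..e}" for i
    proof -
      have "b y \<noteq> h" if "y \<in> {1..r}" "i < y" for y
      proof -
        have "b i = Suc h" using interval_blockD[OF blk, of i] i bs se by auto
        moreover have "b i \<le> b y" using i se that by (intro monotone_onD[OF b]) auto
        ultimately show ?thesis by simp
      qed
      then have "{y \<in> {1..r}. i < y \<and> (b \<circ> id) y = h} = {}" by auto
      then show ?thesis unfolding N_def by (simp only: card.empty)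
    qed
    moreover have "P * vv b (b \<circ> id) = (\<Sum>i\<in>{s..e}. vv ?bp (b(i := h)))"
    proof -
      have eq: "b x = Suc h" if "x \<in> {s..e}" for x
        using interval_blockD[OF blk, of x] that bs se by auto
      show ?thesis
        using word_up[OF bp eq se(1,3)] by (simp add: P[symmetric] Vup_def sum_distrib_left)
    qed
    ultimately show ?case unfolding set by (simp add: fun_upd_def)
  next
    case (swap d t)
    let ?r = "b \<circ> d"
    have mem: "t \<in> {1..r}" "Suc t \<in> {1..r}" using swap(2) by auto
    have less: "?r t < ?r (Suc t)" using swap by simp
    have tm: "q ^ N ?r i * vv ?bp (?r(i := h)) * T t =
        q ^ N (?r \<circ> sw t) (sw t i) * vv ?bp ((?r \<circ> sw t)(sw t i := h))"
      if i: "i \<in> {1..r}" "?r i = Suc h" for i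
    proof -
      have upd: "(?r \<circ> sw t)(sw t i := h) = ?r(i := h) \<circ> sw t"
        by (rule ext) (metis comp_apply fun_upd_apply sw_involutory)
      have card: "N (?r \<circ> sw t) (sw t i) = card {y \<in> {1..r}. sw t i < sw t y \<and> ?r y = h}"
        unfolding N_def
        by (rule bij_betw_same_card, rule bij_betwI[where f = "sw t" and g = "sw t"])
           (use mem in \<open>auto simp: sw_apply split: if_splits\<close>)
      show ?thesis
      \<comment> \<open>The only case in which the exponent changes. After the replacement both
        letters at \<open>t\<close> and \<open>Suc t\<close> are \<open>h\<close>, so
        \<open>T t\<close> acts by \<open>q\<close>; on the other side the exchange puts one more
        \<open>h\<close> to the right of the replaced position.\<close>
      proof (cases "i = Suc t \<and> ?r t = h")
        case True
        have S: "{y \<in> {1..r}. sw t i < sw t y \<and> ?r y = h} = insert t {y \<in> {1..r}. i < y \<and> ?r y = h}"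
          using True mem by (auto simp: sw_apply split: if_splits)
        have N: "N (?r \<circ> sw t) (sw t i) = Suc (N ?r i)"
          unfolding card S by (subst N_def, rule card_insert_disjoint) (use True in auto)
        have fx: "vv ?bp (?r(i := h) \<circ> sw t) = vv ?bp (?r(i := h))"
          using True by (intro vv_cong) (auto simp: sw_apply)
        have "vv ?bp (?r(i := h)) * T t = q * vv ?bp (?r(i := h))"
          using True by (intro vv_T_eigen swap(2)) simp
        then show ?thesis unfolding N upd fx
          by (simp add: mult.assoc) (metis mult.assoc power_commutes)
      next
        case False
        have S: "{y \<in> {1..r}. sw t i < sw t y \<and> ?r y = h} = {y \<in> {1..r}. i < y \<and> ?r y = h}"
          using False less i by (auto simp: sw_apply split: if_splits)
        have N: "N (?r \<circ> sw t) (sw t i) = N ?r i" unfolding card S by (simp only: N_def)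
        have "(?r(i := h)) t < (?r(i := h)) (Suc t)" using False less i by auto
        then have "vv ?bp (?r(i := h)) * T t = vv ?bp (?r(i := h) \<circ> sw t)"
          by (intro vv_T_move bp swap(2))
        then show ?thesis unfolding N upd by (simp add: mult.assoc)
      qed
    qed
    have "P * vv b (b \<circ> (d \<circ> sw t)) = P * vv b ?r * T t"
      unfolding mult.assoc vv_T_move[OF b swap(2) less] comp_assoc ..
    also have "\<dots> = (\<Sum>i | i \<in> {1..r} \<and> ?r i = Suc h. q ^ N ?r i * vv ?bp (?r(i := h)) * T t)"
      unfolding swap(4) sum_distrib_right by (rule sum.cong) simp_all
    also have "\<dots> = (\<Sum>i | i \<in> {1..r} \<and> ?r i = Suc h.
        q ^ N (?r \<circ> sw t) (sw t i) * vv ?bp ((?r \<circ> sw t)(sw t i := h)))"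
      using tm by (intro sum.cong) auto
    also have "\<dots> = (\<Sum>i | i \<in> {1..r} \<and> (?r \<circ> sw t) i = Suc h.
        q ^ N (?r \<circ> sw t) i * vv ?bp ((?r \<circ> sw t)(i := h)))"
      by (rule sum.reindex_bij_witness[of _ "sw t" "sw t"])
         (use mem in \<open>auto simp: sw_apply split: if_splits\<close>)
    finally show ?case by (simp add: o_def fun_upd_def)
  qed
  then show ?thesis by (simp add: P mult.assoc xx_Tw[OF b d] N_def)
qed

text \<open>The opposite root vector. The last position of a block is moved and descending chains
  carry it to the left, so the exponent counts the letters \<open>Suc h\<close> on the left.\<close>

lemma lower_words:
  assumes b: "mono_on {1..r} b" and bp: "mono_on {1..r} (b(s := Suc h))"
    and blk: "interval_block r b a s" and bs: "b s = h" and d: "d \<in> dr r b"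
  shows "xx (b(s := Suc h)) * Vdn a s * Tw d =
    (\<Sum>i | i \<in> {1..r} \<and> b (d i) = h.
      q ^ card {y \<in> {1..r}. y < i \<and> b (d y) = Suc h} * vv (b(s := Suc h)) ((b \<circ> d)(i := Suc h)))"
proof -
  let ?bp = "b(s := Suc h)"
  define N where "N \<rho> i = card {y \<in> {1..r}. y < i \<and> \<rho> y = Suc h}" for \<rho> :: "nat \<Rightarrow> nat" and i
  have as: "1 \<le> a" "a \<le> s" "s \<le> r" using blk by (auto simp: interval_block_def)
  have ba: "b a = h" using interval_blockD[OF blk, of s] bs as by simp
  obtain b' where b': "mono_on {1..r} b'" and iso: "isolates r b b' s"
    using exists_isolating_last[OF b blk] .
  have iso': "isolates r ?bp b' s" using iso by (rule isolates_upd) simp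
  define P where "P = SS (fibre r ?bp ?bp \<inter> inc r b')"
  have P: "xx ?bp * Vdn a s = P * xx b"
  proof -
    have "xx ?bp = P * xx b'" unfolding P_def by (rule vv_factor[OF b' isolatesD[OF iso']])
    moreover have "xx b' * Vdn a s = xx b"
      unfolding SS_last[OF b' iso blk, symmetric] by (rule xx_SS_dr[OF b' isolatesD[OF iso]])
    ultimately show ?thesis by (simp add: mult.assoc)
  qed
  have "P * vv b (b \<circ> d) =
    (\<Sum>i | i \<in> {1..r} \<and> b (d i) = h. q ^ N (b \<circ> d) i * vv ?bp ((b \<circ> d)(i := Suc h)))"
    using b d
  proof (induction d rule: dr_induct)
    case id
    have set: "{i. i \<in> {1..r} \<and> b (id i) = h} = {a..s}"
    proof -
      have "x \<in> {1..r} \<and> b (id x) = h \<longleftrightarrow> x \<in> {a..s}" for x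
        using interval_blockD[OF blk, of x] as by (cases "x \<in> {1..r}") (simp add: ba, auto)
      then show ?thesis by (simp only: Collect_mem_eq)
    qed
    have "N (b \<circ> id) i = 0" if i: "i \<in> {a..s}" for i
    proof -
      have "b y \<noteq> Suc h" if "y \<in> {1..r}" "y < i" for y
      proof -
        have "b i = h" using interval_blockD[OF blk, of i] i ba as by auto
        moreover have "b y \<le> b i" using i as that by (intro monotone_onD[OF b]) auto
        ultimately show ?thesis by simp
      qed
      then have "{y \<in> {1..r}. y < i \<and> (b \<circ> id) y = Suc h} = {}" by auto
      then show ?thesis unfolding N_def by (simp only: card.empty)
    qed
    moreover have "P * vv b (b \<circ> id) = (\<Sum>i\<in>{a..s}. vv ?bp (b(i := Suc h)))"
    proof -
      have eq: "b x = h" if "x \<in> {a..s}" for x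
        using interval_blockD[OF blk, of x] that ba as by auto
      show ?thesis
        using word_dn[OF bp eq as(1,3)] by (simp add: P[symmetric] Vdn_def sum_distrib_left)
    qed
    ultimately show ?case unfolding set by (simp add: fun_upd_def)
  next
    case (swap d t)
    let ?r = "b \<circ> d"
    have mem: "t \<in> {1..r}" "Suc t \<in> {1..r}" using swap(2) by auto
    have less: "?r t < ?r (Suc t)" using swap by simp
    have tm: "q ^ N ?r i * vv ?bp (?r(i := Suc h)) * T t =
        q ^ N (?r \<circ> sw t) (sw t i) * vv ?bp ((?r \<circ> sw t)(sw t i := Suc h))"
      if i: "i \<in> {1..r}" "?r i = h" for i
    proof -
      have upd: "(?r \<circ> sw t)(sw t i := Suc h) = ?r(i := Suc h) \<circ> sw t"
        by (rule ext) (metis comp_apply fun_upd_apply sw_involutory)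
      have card: "N (?r \<circ> sw t) (sw t i) = card {y \<in> {1..r}. sw t y < sw t i \<and> ?r y = Suc h}"
        unfolding N_def
        by (rule bij_betw_same_card, rule bij_betwI[where f = "sw t" and g = "sw t"])
           (use mem in \<open>auto simp: sw_apply split: if_splits\<close>)
      show ?thesis
      proof (cases "i = t \<and> ?r (Suc t) = Suc h")
        case True
        have S: "{y \<in> {1..r}. sw t y < sw t i \<and> ?r y = Suc h} =
            insert (Suc t) {y \<in> {1..r}. y < i \<and> ?r y = Suc h}"
          using True mem by (auto simp: sw_apply split: if_splits)
        have N: "N (?r \<circ> sw t) (sw t i) = Suc (N ?r i)"
          unfolding card S by (subst N_def, rule card_insert_disjoint) (use True in auto)
        have fx: "vv ?bp (?r(i := Suc h) \<circ> sw t) = vv ?bp (?r(i := Suc h))"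
          using True by (intro vv_cong) (auto simp: sw_apply)
        have "vv ?bp (?r(i := Suc h)) * T t = q * vv ?bp (?r(i := Suc h))"
          using True by (intro vv_T_eigen swap(2)) simp
        then show ?thesis unfolding N upd fx
          by (simp add: mult.assoc) (metis mult.assoc power_commutes)
      next
        case False
        have S: "{y \<in> {1..r}. sw t y < sw t i \<and> ?r y = Suc h} = {y \<in> {1..r}. y < i \<and> ?r y = Suc h}"
          using False less i by (auto simp: sw_apply split: if_splits)
        have N: "N (?r \<circ> sw t) (sw t i) = N ?r i" unfolding card S by (simp only: N_def)
        have "(?r(i := Suc h)) t < (?r(i := Suc h)) (Suc t)" using False less i by auto
        then have "vv ?bp (?r(i := Suc h)) * T t = vv ?bp (?r(i := Suc h) \<circ> sw t)"
          by (intro vv_T_move bp swap(2))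
        then show ?thesis unfolding N upd by (simp add: mult.assoc)
      qed
    qed
    have "P * vv b (b \<circ> (d \<circ> sw t)) = P * vv b ?r * T t"
      unfolding mult.assoc vv_T_move[OF b swap(2) less] comp_assoc ..
    also have "\<dots> = (\<Sum>i | i \<in> {1..r} \<and> ?r i = h. q ^ N ?r i * vv ?bp (?r(i := Suc h)) * T t)"
      unfolding swap(4) sum_distrib_right by (rule sum.cong) simp_all
    also have "\<dots> = (\<Sum>i | i \<in> {1..r} \<and> ?r i = h.
        q ^ N (?r \<circ> sw t) (sw t i) * vv ?bp ((?r \<circ> sw t)(sw t i := Suc h)))"
      using tm by (intro sum.cong) auto
    also have "\<dots> = (\<Sum>i | i \<in> {1..r} \<and> (?r \<circ> sw t) i = h.
        q ^ N (?r \<circ> sw t) i * vv ?bp ((?r \<circ> sw t)(i := Suc h)))"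
      by (rule sum.reindex_bij_witness[of _ "sw t" "sw t"])
         (use mem in \<open>auto simp: sw_apply split: if_splits\<close>)
    finally show ?case by (simp add: o_def fun_upd_def)
  qed
  then show ?thesis by (simp add: P mult.assoc xx_Tw[OF b d] N_def)
qed

end

section \<open>Moving one position between two blocks\<close>

context hecke_clifford_ring
begin

section \<open>Squares of Clifford sums and chains on a single block\<close>

definition qn2 :: "nat \<Rightarrow> 'b" where
  "qn2 m = (\<Sum>k<m. (q ^ 2) ^ k)"

lemma qn_Suc_left: "qn (Suc m) = 1 + q * qn m"
  unfolding qn_def by (simp add: sum.lessThan_Suc_shift sum_distrib_left del: sum.lessThan_Suc)

lemma qn_Suc: "qn (Suc m) = qn m + q ^ m"
  by (simp add: qn_def)

lemma qn2_Suc_left: "qn2 (Suc m) = 1 + q ^ 2 * qn2 m"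
  unfolding qn2_def by (simp add: sum.lessThan_Suc_shift sum_distrib_left del: sum.lessThan_Suc)

lemma qn_central: "qn m * x = x * qn m"
  by (simp add: qn_def sum_distrib_left sum_distrib_right qpow_central)

lemma qn2_central: "qn2 m * x = x * qn2 m"
  by (simp add: qn2_def sum_distrib_left sum_distrib_right qpow_central flip: power_mult)

lemma Cq_c_anticomm:
  assumes "1 \<le> i" "j \<le> r" "k \<in> {1..r}" "k < i \<or> j < k"
  shows "Cq i j * c k = - (c k * Cq i j)"
proof -
  have "q ^ (j - t) * c t * c k = - (c k * (q ^ (j - t) * c t))" if "t \<in> {i..j}" for t
  proof -
    have "c t * c k = - (c k * c t)" using that assms by (intro c_anticomm) auto
    then show ?thesis by (simp add: mult.assoc qpow_left[of "c k"])
  qed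
  then show ?thesis by (simp add: Cq_def sum_distrib_left sum_distrib_right sum_negf)
qed

text \<open>The generators anticommute, so the mixed terms cancel, and each generator contributes
  \<open>-1\<close> times the square of its weight.\<close>

lemma Cq_square:
  assumes i: "1 \<le> i"
  shows "j \<le> r \<Longrightarrow> i \<le> Suc j \<Longrightarrow> Cq i j * Cq i j = - qn2 (Suc j - i)"
proof (induction j)
  case 0
  then show ?case using i by (simp add: Cq_empty qn2_def)
next
  case (Suc j)
  show ?case
  proof (cases "i = Suc (Suc j)")
    case True
    then show ?thesis by (simp add: Cq_empty qn2_def)
  next
    case False
    then have ij: "i \<le> Suc j" using Suc.prems by simp
    have anti: "Cq i j * c (Suc j) = - (c (Suc j) * Cq i j)"
      using Suc.prems i by (intro Cq_c_anticomm) auto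
    have cc: "c (Suc j) * c (Suc j) = - 1" using Suc.prems by (intro c_c) auto
    have "Cq i (Suc j) * Cq i (Suc j) =
        q * (q * (Cq i j * Cq i j)) + q * (Cq i j * c (Suc j) + c (Suc j) * Cq i j) + c (Suc j) * c (Suc j)"
      by (simp add: Cq_Suc[OF ij] distrib_left distrib_right mult.assoc q_left[of "Cq i j"] q_left[of "c (Suc j)"])
    also have "\<dots> = - qn2 (Suc (Suc j) - i)"
      using Suc.IH Suc.prems ij
      by (simp add: anti cc Suc_diff_le qn2_Suc_left power2_eq_square mult.assoc)
    finally show ?thesis .
  qed
qed

text \<open>The four cases are the parities of the block \<open>i..s-1\<close>, which receives the
  position \<open>s\<close>, and of the block that \<open>s\<close> leaves. The element
  \<open>x\<close> transports \<open>Cq i s\<close> but not \<open>Cq i (s - 1)\<close>, which is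
  therefore expressed through \<open>q * Cq i (s - 1) = Cq i s - c s\<close>.\<close>

lemma local_block_raise:
  assumes x: "eigen x i s" and C: "x * Cq i s = C' * x" and qi: "qi * q = 1"
    and bd: "1 \<le> i" "i \<le> s" "s \<le> r"
  shows "x * Vdn i s = qn (Suc (s - i)) * x"
    and "x * c s * Vdn i s = x * Cq i s"
    and "x * Cq i (s - 1) * Vdn i s = qn (s - i) * (x * Cq i s)"
    and "x * Cq i (s - 1) * c s * Vdn i s = qi * (qn (Suc (s - i)) - qn2 (Suc (s - i))) * x"
proof -
  show 1: "x * Vdn i s = qn (Suc (s - i)) * x" by (rule eigen_Vdn[OF x bd(2)])
  show 2: "x * c s * Vdn i s = x * Cq i s" by (rule eigen_c_Vdn[OF x bd])
  \<comment> \<open>Both identities that involve \<open>Cq i (s - 1)\<close> are proved after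
    multiplication by \<open>q\<close>, where the recursion of \<open>Cq\<close> applies without
    division.\<close>
  have cancel: "u = v" if "q * u = q * v" for u v
    using that qi by (metis mult.assoc mult_1_left)
  have Cq: "Cq i s = q * Cq i (s - 1) + c s"
    using Cq_Suc[of i "s - 1"] bd by simp
  have C0: "q * Cq i (s - 1) = Cq i s - c s" using Cq by simp
  show "x * Cq i (s - 1) * Vdn i s = qn (s - i) * (x * Cq i s)"
  proof (rule cancel)
    have "q * (x * Cq i (s - 1) * Vdn i s) = x * (q * Cq i (s - 1)) * Vdn i s"
      by (simp add: mult.assoc q_left[of x])
    also have "\<dots> = C' * (x * Vdn i s) - x * c s * Vdn i s"
      unfolding C0 by (simp add: right_diff_distrib left_diff_distrib C mult.assoc)
    also have "\<dots> = qn (Suc (s - i)) * (x * Cq i s) - x * Cq i s"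
      unfolding 1 2 C by (metis mult.assoc qn_central)
    also have "\<dots> = q * (qn (s - i) * (x * Cq i s))"
      by (simp add: qn_Suc_left distrib_right mult.assoc)
    finally show "q * (x * Cq i (s - 1) * Vdn i s) = q * (qn (s - i) * (x * Cq i s))" .
  qed
  have qi': "q * qi = 1" using qi q_central by metis
  have sq: "Cq i s * Cq i s = - qn2 (Suc (s - i))"
    using Cq_square[OF bd(1), of s] bd by (simp add: Suc_diff_le)
  show "x * Cq i (s - 1) * c s * Vdn i s = qi * (qn (Suc (s - i)) - qn2 (Suc (s - i))) * x"
  proof (rule cancel)
    have "q * (x * Cq i (s - 1) * c s * Vdn i s) = x * (q * Cq i (s - 1)) * c s * Vdn i s"
      by (simp add: mult.assoc q_left[of x])
    also have "\<dots> = C' * (x * c s * Vdn i s) + x * Vdn i s"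
      unfolding C0 using c_c[of s] bd
      by (simp add: right_diff_distrib left_diff_distrib C mult.assoc)
        (simp add: mult.assoc[symmetric] distrib_right)
    also have "\<dots> = x * (Cq i s * Cq i s) + qn (Suc (s - i)) * x"
      unfolding 1 2 mult.assoc[symmetric] C[symmetric] by simp
    also have "\<dots> = q * (qi * (qn (Suc (s - i)) - qn2 (Suc (s - i))) * x)"
      unfolding sq mult.assoc[symmetric] qi' by (simp add: left_diff_distrib qn2_central)
    finally show "q * (x * Cq i (s - 1) * c s * Vdn i s) =
      q * (qi * (qn (Suc (s - i)) - qn2 (Suc (s - i))) * x)" .
  qed
qed

text \<open>Both \<open>(1 + q) * qn2 m\<close> and \<open>(1 + q ^ m) * qn m\<close> are
  \<open>qn (2 * m)\<close>: split its powers by parity, or into two halves. This brings the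
  coefficient that arises in lowering into the form of the one that arises in raising.\<close>

lemma qn_qn2: "q * (qn2 m - q ^ (m - 1) * qn m) = qn m - qn2 m" if "0 < m"
proof -
  have "(1 + q) * qn2 m = qn (2 * m)"
    by (induction m) (simp_all add: qn2_def qn_def algebra_simps power_mult_distrib flip: power_add power_mult power_Suc)
  moreover have "qn (2 * m) = (1 + q ^ m) * qn m"
  proof -
    have "qn (m + k) = qn m + q ^ m * qn k" for k
      by (induction k) (simp_all add: qn_def algebra_simps power_add, metis qpow_central)
    from this[of m] show ?thesis by (simp add: mult_2 distrib_right)
  qed
  moreover have "q * q ^ (m - 1) = q ^ m" using that by (metis Suc_pred' power_Suc)
  ultimately show ?thesis
    by (simp add: right_diff_distrib algebra_simps flip: mult.assoc) 
qed

text \<open>Splitting off the first position,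
  \<open>Cq (Suc s) e = Cq s e - q ^ (e - s) * c s\<close>, requires no division. In exchange
  \<open>c s\<close> stands to the left of \<open>Cq (Suc s) e\<close> in the last case and has to
  be moved past it first, at the cost of a sign.\<close>

lemma local_block_lower:
  assumes x: "eigen x s e" and C: "x * Cq s e = C' * x" and qi: "qi * q = 1"
    and se: "1 \<le> s" "s \<le> e" "e \<le> r"
  shows "x * Vup s e = qn (Suc (e - s)) * x"
    and "x * c s * Vup s e = x * Cq s e"
    and "x * Cq (Suc s) e * Vup s e = qn (e - s) * (x * Cq s e)"
    and "x * c s * Cq (Suc s) e * Vup s e = qi * (qn (Suc (e - s)) - qn2 (Suc (e - s))) * x"
proof -
  show 1: "x * Vup s e = qn (Suc (e - s)) * x" by (rule eigen_Vup[OF x se(2)])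
  show 2: "x * c s * Vup s e = x * Cq s e" by (rule eigen_c_Vup[OF x se(1,3,2)]) simp
  have C0: "Cq (Suc s) e = Cq s e - q ^ (e - s) * c s" using Cq_first[OF se(2)] by simp
  have "x * Cq (Suc s) e * Vup s e = C' * (x * Vup s e) - q ^ (e - s) * (x * c s * Vup s e)"
    unfolding C0 by (simp add: right_diff_distrib left_diff_distrib C mult.assoc qpow_left[of x])
  also have "\<dots> = qn (Suc (e - s)) * (x * Cq s e) - q ^ (e - s) * (x * Cq s e)"
    unfolding 1 2 C by (metis mult.assoc qn_central)
  finally show "x * Cq (Suc s) e * Vup s e = qn (e - s) * (x * Cq s e)"
    by (simp add: qn_Suc distrib_right)
  have sq: "Cq s e * Cq s e = - qn2 (Suc (e - s))"
    using Cq_square[OF se(1), of e] se by (simp add: Suc_diff_le)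
  have anti: "c s * Cq (Suc s) e = - (Cq (Suc s) e * c s)"
    using Cq_c_anticomm[of "Suc s" e s] se by simp
  note anti
  also have "- (Cq (Suc s) e * c s) = - (Cq s e * c s) - q ^ (e - s)"
    unfolding C0 using c_c[of s] se by (simp add: left_diff_distrib mult.assoc)
  finally have cK: "c s * Cq (Suc s) e = - (Cq s e * c s) - q ^ (e - s)" .
  have "x * c s * Cq (Suc s) e * Vup s e = x * (c s * Cq (Suc s) e) * Vup s e"
    by (simp only: mult.assoc)
  also have "\<dots> = - (x * Cq s e * c s * Vup s e) - q ^ (e - s) * (x * Vup s e)"
    unfolding cK by (simp add: right_diff_distrib left_diff_distrib mult.assoc qpow_left[of x])
  also have "x * Cq s e * c s * Vup s e = C' * (x * c s * Vup s e)"
    by (simp only: C mult.assoc)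
  also have "- \<dots> - q ^ (e - s) * (x * Vup s e) = - (x * (Cq s e * Cq s e)) - q ^ (e - s) * (qn (Suc (e - s)) * x)"
    unfolding 1 2 mult.assoc[symmetric] C[symmetric] by simp
  also have "\<dots> = (qn2 (Suc (e - s)) - q ^ (e - s) * qn (Suc (e - s))) * x"
    unfolding sq by (simp add: left_diff_distrib mult.assoc qn2_central)
  also have "qn2 (Suc (e - s)) - q ^ (e - s) * qn (Suc (e - s)) = qi * (qn (Suc (e - s)) - qn2 (Suc (e - s)))"
    unfolding qn_qn2[of "Suc (e - s)", OF zero_less_Suc, symmetric] mult.assoc[symmetric] qi by simp
  finally show "x * c s * Cq (Suc s) e * Vup s e = qi * (qn (Suc (e - s)) - qn2 (Suc (e - s))) * x" .
qed

section \<open>Elements that commute with chains and elements that pass through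
  \<open>xx\<close>\<close>

lemma commute_prod_list: "(\<And>y. y \<in> set ys \<Longrightarrow> y * z = z * y) \<Longrightarrow> prod_list ys * z = z * prod_list ys"
  for z :: 'b
  by (induction ys) (simp_all, metis mult.assoc)

lemma commute_sum: "(\<And>t. t \<in> A \<Longrightarrow> f t * z = z * f t) \<Longrightarrow> sum f A * z = z * sum f A"
  for z :: 'b
  by (simp add: sum_distrib_left sum_distrib_right)

lemma T_Cq_commute:
  assumes "t \<in> {1..<r}" "1 \<le> i" "j \<le> r" "Suc t < i \<or> j < t"
  shows "T t * Cq i j = Cq i j * T t"
proof -
  have "q ^ (j - s) * c s * T t = T t * (q ^ (j - s) * c s)" if "s \<in> {i..j}" for s
  proof -
    have "c s * T t = T t * c s" using that assms by (intro c_T) auto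
    then show ?thesis by (simp add: mult.assoc qpow_left[of "T t"])
  qed
  then show ?thesis unfolding Cq_def by (intro commute_sum[symmetric])
qed

definition outside :: "nat \<Rightarrow> nat \<Rightarrow> 'b \<Rightarrow> bool" where
  "outside i j z \<longleftrightarrow> (\<forall>t\<in>{i..<j}. T t * z = z * T t)"

lemma outside_Cq:
  assumes "1 \<le> i" "j \<le> r" "1 \<le> k" "l \<le> r" "j < k \<or> l < i"
  shows "outside i j (Cq k l)"
  unfolding outside_def using assms by (intro ballI T_Cq_commute) auto

lemma outside_1 [simp]: "outside i j 1"
  by (simp add: outside_def)

lemma outside_mult: "outside i j x \<Longrightarrow> outside i j y \<Longrightarrow> outside i j (x * y)"
  unfolding outside_def by (metis mult.assoc)

lemma outside_power: "outside i j x \<Longrightarrow> outside i j (x ^ n)"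
  by (induction n) (simp_all add: outside_mult)

lemma outside_prod_list: "(\<And>y. y \<in> set ys \<Longrightarrow> outside i j y) \<Longrightarrow> outside i j (prod_list ys)"
  by (induction ys) (simp_all add: outside_mult)

lemma outside_Vup: "outside i j z \<Longrightarrow> Vup i j * z = z * Vup i j"
  unfolding Vup_def up_def by (intro commute_sum commute_prod_list) (auto simp: outside_def)

lemma outside_Vdn: "outside i j z \<Longrightarrow> Vdn i j * z = z * Vdn i j"
  unfolding Vdn_def dn_def by (intro commute_sum commute_prod_list) (auto simp: outside_def)

text \<open>The substitute for commutation that \<open>c_q\<close> of a block of \<open>b\<close>
  offers. The form \<open>z'\<close> on the left is left open; in the block computations it is
  turned back into \<open>z\<close> once the chains have acted.\<close>

definition transports :: "(nat \<Rightarrow> nat) \<Rightarrow> 'b \<Rightarrow> bool" where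
  "transports b z \<longleftrightarrow> (\<exists>z'. xx b * z = z' * xx b)"

lemma transports_1 [simp]: "transports b 1"
  by (auto simp: transports_def intro: exI[of _ 1])

lemma transports_mult: "transports b x \<Longrightarrow> transports b y \<Longrightarrow> transports b (x * y)"
  unfolding transports_def by (metis mult.assoc)

lemma transports_power: "transports b x \<Longrightarrow> transports b (x ^ n)"
  by (induction n) (simp_all add: transports_mult)

lemma transports_prod_list: "(\<And>y. y \<in> set ys \<Longrightarrow> transports b y) \<Longrightarrow> transports b (prod_list ys)"
  by (induction ys) (simp_all add: transports_mult)

lemma transports_Cq: "mono_on {1..r} b \<Longrightarrow> interval_block r b i j \<Longrightarrow> transports b (Cq i j)"
  unfolding transports_def using xx_Cq by blast

end

text \<open>Two consecutive blocks \<open>{i..<s}\<close>, \<open>{s..e}\<close> for \<open>b1\<close> and \<open>{i..s}\<close>, \<open>{s<..e}\<close> for \<open>b2\<close>; the common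
  refinement \<open>b'\<close> isolates the position \<open>s\<close> that moves.\<close>

locale adjacent_blocks = hecke_clifford_ring +
  fixes b1 b2 b' \<mu> :: "nat \<Rightarrow> nat" and i s e :: nat and qi :: 'a
  assumes b1: "mono_on {1..r} b1" and b2: "mono_on {1..r} b2" and b': "mono_on {1..r} b'"
    and same: "\<And>x. x \<noteq> s \<Longrightarrow> b2 x = b1 x"
    and blk1: "interval_block r b1 s e" and blk2: "interval_block r b2 i s"
    and iso1: "isolates r b1 b' s"
    and ref1: "\<And>x y. x \<in> {1..r} \<Longrightarrow> y \<in> {1..r} \<Longrightarrow> b1 x = b1 y \<Longrightarrow> \<mu> x = \<mu> y"
    and ref2: "\<And>x y. x \<in> {1..r} \<Longrightarrow> y \<in> {1..r} \<Longrightarrow> b2 x = b2 y \<Longrightarrow> \<mu> x = \<mu> y"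
    and qi: "qi * q = 1"
begin

abbreviation "S1 \<equiv> SS (dr r b1 \<inter> yg r \<mu>)"
abbreviation "S2 \<equiv> SS (dr r b2 \<inter> yg r \<mu>)"

lemma bounds: "1 \<le> i" "i \<le> s" "s \<le> e" "e \<le> r"
  using interval_block_bounds[OF blk1] interval_block_bounds[OF blk2] by auto

lemma iso2: "isolates r b2 b' s"
  using isolates_upd[OF iso1 same] .

text \<open>Both sides are the sum over shortest representatives for \<open>b'\<close> inside
  \<open>\<mu>\<close>, factored once through \<open>b1\<close> and once through
  \<open>b2\<close>.\<close>

lemma Vup_S1: "Vup s e * S1 = Vdn i s * S2"
proof -
  have "SS (dr r b' \<inter> yg r b1) * S1 = SS (dr r b' \<inter> yg r \<mu>)"
    by (rule SS_dr_chain[OF b1 isolatesD[OF iso1] ref1])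
  moreover have "SS (dr r b' \<inter> yg r b2) * S2 = SS (dr r b' \<inter> yg r \<mu>)"
    by (rule SS_dr_chain[OF b2 isolatesD[OF iso2] ref2])
  ultimately show ?thesis
    unfolding SS_first[OF b' iso1 blk1] SS_last[OF b' iso2 blk2] by simp
qed

lemma xx_b':
  shows "xx b' * Vup s e = xx b1" and "xx b' * Vdn i s = xx b2"
    and "\<exists>P. xx b1 = P * xx b'" and "\<exists>P. xx b2 = P * xx b'"
proof -
  show "xx b' * Vup s e = xx b1"
    unfolding SS_first[OF b' iso1 blk1, symmetric] by (rule xx_SS_dr[OF b' isolatesD[OF iso1]])
  show "xx b' * Vdn i s = xx b2"
    unfolding SS_last[OF b' iso2 blk2, symmetric] by (rule xx_SS_dr[OF b' isolatesD[OF iso2]])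
  show "\<exists>P. xx b1 = P * xx b'" by (rule exI, rule vv_factor[OF b' isolatesD[OF iso1]])
  show "\<exists>P. xx b2 = P * xx b'" by (rule exI, rule vv_factor[OF b' isolatesD[OF iso2]])
qed

lemma xx_b'_c: "xx b' * c s = c s * xx b'"
proof (rule commute_xx[OF b', symmetric])
  fix t assume t: "t \<in> {1..<r}" "b' t = b' (Suc t)"
  then have "t = s \<longleftrightarrow> Suc t = s" using isolates_iff[OF iso1, of t "Suc t"] by simp
  then show "c s * T t = T t * c s" using t bounds by (intro c_T) auto
qed

lemma xx_b'_Cq_right: "xx b' * Cq (Suc s) e = Cp (Suc s) e * xx b'"
proof (cases "s < e")
  case True
  show ?thesis by (rule xx_Cq[OF b' isolates_rest_first[OF iso1 blk1 True]])
qed (simp add: Cq_empty Cp_empty)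

lemma xx_b'_Cq_left: "xx b' * Cq i (s - 1) = Cp i (s - 1) * xx b'"
proof (cases "i < s")
  case True
  show ?thesis by (rule xx_Cq[OF b' isolates_rest_last[OF iso2 blk2 True]])
next
  case False
  then have "s - 1 < i" using bounds by simp
  then show ?thesis by (simp add: Cq_empty Cp_empty)
qed

lemma interval_block_left: "i < s \<Longrightarrow> interval_block r b1 i (s - 1)"
proof -
  assume "i < s"
  have m: "i \<in> {1..r}" "s \<in> {1..r}" using bounds by auto
  have "b1 x = b1 i \<longleftrightarrow> i \<le> x \<and> x \<le> s - 1" if x: "x \<in> {1..r}" for x
  proof (cases "x = s")
    case True
    have "b1 i \<noteq> b1 s" using interval_blockD[OF blk1 m(1)] \<open>i < s\<close> by simp
    then show ?thesis using True \<open>i < s\<close> by auto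
  next
    case False
    then have "b1 x = b1 i \<longleftrightarrow> b2 x = b2 i" using same \<open>i < s\<close> by simp
    then show ?thesis using interval_blockD[OF blk2 x] False by auto
  qed
  then show ?thesis using bounds \<open>i < s\<close> by (auto simp: interval_block_def)
qed

lemma transports_left: "transports b1 (Cq i (s - 1))" "transports b' (Cq i (s - 1))"
proof -
  show "transports b' (Cq i (s - 1))" unfolding transports_def using xx_b'_Cq_left by blast
  show "transports b1 (Cq i (s - 1))"
  proof (cases "i < s")
    case True
    show ?thesis by (rule transports_Cq[OF b1 interval_block_left[OF True]])
  next
    case False
    then have "s - 1 < i" using bounds by simp
    then show ?thesis by (auto simp: transports_def Cq_empty intro: exI[of _ 0])
  qed
qed

text \<open>Together with \<open>xx b'\<close> the chains form \<open>xx b1\<close>, through which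
  \<open>Cq s e\<close> passes and becomes \<open>Cp s e\<close>. Splitting \<open>c s\<close> off
  \<open>Cp s e\<close> leaves two summands that return through \<open>xx b'\<close>.\<close>

lemma pass_Vup: "xx b' * Vup s e * Cq s e = xx b' * (c s + q * Cq (Suc s) e) * Vup s e"
proof -
  have "xx b' * Vup s e * Cq s e = Cp s e * xx b' * Vup s e"
    unfolding xx_b'(1) xx_Cq[OF b1 blk1] by (simp add: mult.assoc xx_b'(1))
  also have "Cp s e * xx b' = xx b' * (c s + q * Cq (Suc s) e)"
    using bounds(3)
    by (simp add: Cp_first distrib_right distrib_left mult.assoc q_left[of "xx b'"] xx_b'_c xx_b'_Cq_right)
  finally show ?thesis .
qed

text \<open>As for \<open>Vup\<close>, but the last position is split off: it has weight
  \<open>q ^ (s - i)\<close> in \<open>Cp i s\<close>, the source of the power with exponent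
  \<open>a_{h,k} - 1\<close> in the lowering formula.\<close>

lemma pass_Vdn: "xx b' * Vdn i s * Cq i s = xx b' * (Cq i (s - 1) + q ^ (s - i) * c s) * Vdn i s"
proof -
  have "xx b' * Vdn i s * Cq i s = Cp i s * xx b' * Vdn i s"
    unfolding xx_b'(2) xx_Cq[OF b2 blk2] by (simp add: mult.assoc xx_b'(2))
  also have "Cp i s * xx b' = xx b' * (Cq i (s - 1) + q ^ (s - i) * c s)"
    using Cp_last[of i "s - 1"] bounds
    by (simp add: distrib_right distrib_left mult.assoc qpow_left[of "xx b'"] xx_b'_c xx_b'_Cq_left)
  finally show ?thesis .
qed

text \<open>\<open>L\<close> and \<open>R\<close> stand for the factors of \<open>c_A\<close> on the
  blocks to the left and to the right of the two blocks in question.\<close>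

context
  fixes L R :: 'a
  assumes L: "outside i e L" "transports b1 L" "transports b2 L" "transports b' L"
    and R: "outside i e R"
begin

lemma outsideL: "outside s e L" "outside i s L" and outsideR: "outside s e R" "outside i s R"
  using L(1) R bounds by (auto simp: outside_def)

text \<open>\<open>A\<close> is everything in front of the factor of the old block
  \<open>s..e\<close>: \<open>L\<close>, or \<open>L\<close> with the odd factor of the left block.
  The ascending chains travel right to \<open>S1\<close>, where they are exchanged for descending
  ones, which travel back to the place where they act on an eigenvector.\<close>

lemma raise_through:
  assumes A: "outside s e A" "transports b' A"
  shows "xx b2 * Vup s e * A * R * S1 = xx b2 * A * Vdn i s * R * S2"
    and "xx b2 * Vup s e * A * Cq s e * R * S1 =
      xx b2 * A * c s * Vdn i s * R * S2 + q * (xx b2 * A * Vdn i s * Cq (Suc s) e * R * S2)"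
proof -
  note ZA = outside_Vup[OF A(1)] and ZR = outside_Vup[OF outsideR(1)] and YR = outside_Vdn[OF outsideR(2)]
  have ZRS: "Vup s e * R * S1 = Vdn i s * R * S2"
    unfolding ZR YR mult.assoc Vup_S1 ..
  show "xx b2 * Vup s e * A * R * S1 = xx b2 * A * Vdn i s * R * S2"
  proof -
    have "xx b2 * Vup s e * A * R * S1 = xx b2 * (Vup s e * A) * R * S1" by (simp only: mult.assoc)
    also have "\<dots> = xx b2 * A * (Vup s e * R * S1)" unfolding ZA by (simp only: mult.assoc)
    finally show ?thesis unfolding ZRS by (simp only: mult.assoc)
  qed
  obtain P where P: "xx b2 = P * xx b'" using xx_b'(4) by blast
  obtain A' where A': "xx b' * A = A' * xx b'" using A(2) by (auto simp: transports_def)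
  have YC: "Vdn i s * Cq (Suc s) e = Cq (Suc s) e * Vdn i s"
    using bounds by (intro outside_Vdn outside_Cq) auto
  have "xx b2 * Vup s e * A * Cq s e * R * S1 = P * (xx b' * A) * Vup s e * Cq s e * R * S1"
  proof -
    have "xx b2 * Vup s e * A * Cq s e * R * S1 = P * xx b' * (Vup s e * A) * Cq s e * R * S1"
      unfolding P by (simp only: mult.assoc)
    then show ?thesis unfolding ZA by (simp only: mult.assoc)
  qed
  also have "\<dots> = P * A' * (xx b' * Vup s e * Cq s e) * R * S1"
    unfolding A' by (simp only: mult.assoc)
  also have "\<dots> = P * (A' * xx b') * (c s + q * Cq (Suc s) e) * (Vup s e * R * S1)"
    unfolding pass_Vup by (simp only: mult.assoc)
  also have "\<dots> = xx b2 * A * (c s + q * Cq (Suc s) e) * (Vdn i s * R * S2)"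
    unfolding A'[symmetric] ZRS P by (simp only: mult.assoc)
  also have "\<dots> = xx b2 * A * c s * Vdn i s * R * S2
      + q * (xx b2 * A * (Cq (Suc s) e * Vdn i s) * R * S2)"
    by (simp add: distrib_left distrib_right mult.assoc q_left[of "xx b2"] q_left[of A])
  finally show "xx b2 * Vup s e * A * Cq s e * R * S1 =
      xx b2 * A * c s * Vdn i s * R * S2 + q * (xx b2 * A * Vdn i s * Cq (Suc s) e * R * S2)"
    unfolding YC[symmetric] by (simp only: mult.assoc)
qed

text \<open>The extra factor \<open>q\<close> for an odd right block comes from the summand
  \<open>q * Cq (Suc s) e\<close> of \<open>pass_Vup\<close>; it becomes the power of
  \<open>q\<close> whose exponent is the odd entry in row \<open>h + 1\<close>.\<close>

lemma raise_block:
  defines "m \<equiv> s - i"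
  shows "xx b2 * Vup s e * L * R * S1 = qn (Suc m) * (xx b2 * L * R * S2)"
    and "xx b2 * Vup s e * L * Cq i (s - 1) * R * S1 = qn m * (xx b2 * L * Cq i s * R * S2)"
    and "xx b2 * Vup s e * L * Cq s e * R * S1 =
      q * qn (Suc m) * (xx b2 * L * Cq (Suc s) e * R * S2) + xx b2 * L * Cq i s * R * S2"
    and "xx b2 * Vup s e * L * Cq i (s - 1) * Cq s e * R * S1 =
      q * qn m * (xx b2 * L * Cq i s * Cq (Suc s) e * R * S2)
      + qi * (qn (Suc m) - qn2 (Suc m)) * (xx b2 * L * R * S2)"
proof -
  obtain L' where L': "xx b2 * L = L' * xx b2" using L(3) by (auto simp: transports_def)
  note loc = local_block_raise[OF xx_eigen[OF blk2] xx_Cq[OF b2 blk2] qi bounds(1,2)]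
  have sr: "s \<le> r" using bounds by simp
  note loc = loc[OF sr, folded m_def]
  have qi_left: "x * (qi * y) = qi * (x * y)" for x y
  proof -
    have "qi * x = x * qi" for x using qi q_central
      by (metis mult.assoc mult_1_left mult_1_right)
    then show ?thesis by (metis mult.assoc)
  qed
  have qn_left: "x * (qn k * y) = qn k * (x * y)" for x y k by (metis mult.assoc qn_central)
  have qnd_left: "x * ((qn k - qn2 k) * y) = (qn k - qn2 k) * (x * y)" for x y k
    by (simp add: left_diff_distrib right_diff_distrib qn_left) (metis mult.assoc qn2_central)
  have e1: "xx b2 * L * Vdn i s = qn (Suc m) * (xx b2 * L)"
    unfolding L' mult.assoc loc(1) by (rule qn_left)
  have e2: "xx b2 * L * c s * Vdn i s = xx b2 * L * Cq i s"
    unfolding L' using loc(2) by (simp only: mult.assoc)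
  have e3: "xx b2 * L * Cq i (s - 1) * Vdn i s = qn m * (xx b2 * L * Cq i s)"
    unfolding L' using loc(3) by (simp only: mult.assoc qn_left)
  have e4: "xx b2 * L * Cq i (s - 1) * c s * Vdn i s = qi * (qn (Suc m) - qn2 (Suc m)) * (xx b2 * L)"
    unfolding L' using loc(4) by (simp only: mult.assoc qi_left[of L'] qnd_left[of L'])
  have oC: "outside s e (Cq i (s - 1))" using bounds by (intro outside_Cq) auto
  note r1 = raise_through[OF outsideL(1) L(4)]
  note r2 = raise_through[OF outside_mult[OF outsideL(1) oC] transports_mult[OF L(4) transports_left(2)]]
  show "xx b2 * Vup s e * L * R * S1 = qn (Suc m) * (xx b2 * L * R * S2)"
    unfolding r1(1) e1 by (simp only: mult.assoc)
  show "xx b2 * Vup s e * L * Cq s e * R * S1 =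
      q * qn (Suc m) * (xx b2 * L * Cq (Suc s) e * R * S2) + xx b2 * L * Cq i s * R * S2"
    unfolding r1(2) e1 e2 by (simp only: mult.assoc add.commute)
  show "xx b2 * Vup s e * L * Cq i (s - 1) * R * S1 = qn m * (xx b2 * L * Cq i s * R * S2)"
    using r2(1) unfolding mult.assoc[symmetric] e3 by (simp only: mult.assoc)
  show "xx b2 * Vup s e * L * Cq i (s - 1) * Cq s e * R * S1 =
      q * qn m * (xx b2 * L * Cq i s * Cq (Suc s) e * R * S2)
      + qi * (qn (Suc m) - qn2 (Suc m)) * (xx b2 * L * R * S2)"
    using r2(2) unfolding mult.assoc[symmetric] e3 e4 by (simp only: mult.assoc add.commute)
qed

text \<open>\<open>B\<close> is 1 or the odd factor of the right block. It stands behind the odd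
  factor of the left block, so the chains reach it only after that factor has been dealt
  with.\<close>

lemma lower_through:
  assumes B: "outside i s B"
  shows "xx b1 * Vdn i s * L * B * R * S2 = xx b1 * L * B * Vup s e * R * S1"
    and "xx b1 * Vdn i s * L * Cq i s * B * R * S2 =
      xx b1 * L * Cq i (s - 1) * B * Vup s e * R * S1
      + q ^ (s - i) * (xx b1 * L * c s * B * Vup s e * R * S1)"
proof -
  note ZL = outside_Vdn[OF outsideL(2)] and ZB = outside_Vdn[OF B]
    and ZR = outside_Vdn[OF outsideR(2)] and YR = outside_Vup[OF outsideR(1)]
  have ZRS: "Vdn i s * R * S2 = Vup s e * R * S1"
    unfolding ZR YR mult.assoc Vup_S1 ..
  show "xx b1 * Vdn i s * L * B * R * S2 = xx b1 * L * B * Vup s e * R * S1"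
  proof -
    have "xx b1 * Vdn i s * L * B * R * S2 = xx b1 * (Vdn i s * L) * B * R * S2" by (simp only: mult.assoc)
    also have "\<dots> = xx b1 * L * (Vdn i s * B) * R * S2" unfolding ZL by (simp only: mult.assoc)
    also have "\<dots> = xx b1 * L * B * (Vdn i s * R * S2)" unfolding ZB by (simp only: mult.assoc)
    finally show ?thesis unfolding ZRS by (simp only: mult.assoc)
  qed
  obtain P where P: "xx b1 = P * xx b'" using xx_b'(3) by blast
  obtain L' where L': "xx b' * L = L' * xx b'" using L(4) by (auto simp: transports_def)
  have "xx b1 * Vdn i s * L * Cq i s * B * R * S2 = P * xx b' * (Vdn i s * L) * Cq i s * B * R * S2"
    unfolding P by (simp only: mult.assoc)
  also have "\<dots> = P * (xx b' * L) * Vdn i s * Cq i s * B * R * S2"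
    unfolding ZL by (simp only: mult.assoc)
  also have "\<dots> = P * L' * (xx b' * Vdn i s * Cq i s) * B * R * S2"
    unfolding L' by (simp only: mult.assoc)
  also have "\<dots> = P * (L' * xx b') * (Cq i (s - 1) + q ^ (s - i) * c s) * (Vdn i s * B) * R * S2"
    unfolding pass_Vdn by (simp only: mult.assoc)
  also have "\<dots> = xx b1 * L * (Cq i (s - 1) + q ^ (s - i) * c s) * B * (Vup s e * R * S1)"
    unfolding L'[symmetric] ZRS[symmetric] ZB P by (simp only: mult.assoc)
  also have "\<dots> = xx b1 * L * Cq i (s - 1) * B * Vup s e * R * S1
      + q ^ (s - i) * (xx b1 * L * c s * B * Vup s e * R * S1)"
    by (simp add: distrib_left distrib_right mult.assoc qpow_left[of "xx b1"] qpow_left[of L])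
  finally show "xx b1 * Vdn i s * L * Cq i s * B * R * S2 =
      xx b1 * L * Cq i (s - 1) * B * Vup s e * R * S1
      + q ^ (s - i) * (xx b1 * L * c s * B * Vup s e * R * S1)" .
qed

lemma lower_block:
  defines "l \<equiv> e - s"
  shows "xx b1 * Vdn i s * L * R * S2 = qn (Suc l) * (xx b1 * L * R * S1)"
    and "xx b1 * Vdn i s * L * Cq (Suc s) e * R * S2 = qn l * (xx b1 * L * Cq s e * R * S1)"
    and "xx b1 * Vdn i s * L * Cq i s * R * S2 =
      qn (Suc l) * (xx b1 * L * Cq i (s - 1) * R * S1) + q ^ (s - i) * (xx b1 * L * Cq s e * R * S1)"
    and "xx b1 * Vdn i s * L * Cq i s * Cq (Suc s) e * R * S2 =
      qn l * (xx b1 * L * Cq i (s - 1) * Cq s e * R * S1)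
      + q ^ (s - i) * (qi * (qn (Suc l) - qn2 (Suc l)) * (xx b1 * L * R * S1))"
proof -
  obtain L' where L': "xx b1 * L = L' * xx b1" using L(2) by (auto simp: transports_def)
  obtain C' where C': "xx b1 * (L * Cq i (s - 1)) = C' * xx b1"
    using transports_mult[OF L(2) transports_left(1)] by (auto simp: transports_def)
  have sr: "1 \<le> s" using bounds by simp
  note loc = local_block_lower[OF xx_eigen[OF blk1] xx_Cq[OF b1 blk1] qi sr bounds(3,4), folded l_def]
  have qi_left: "x * (qi * y) = qi * (x * y)" for x y
  proof -
    have "qi * x = x * qi" for x using qi q_central
      by (metis mult.assoc mult_1_left mult_1_right)
    then show ?thesis by (metis mult.assoc)
  qed
  have qn_left: "x * (qn k * y) = qn k * (x * y)" for x y k by (metis mult.assoc qn_central)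
  have qnd_left: "x * ((qn k - qn2 k) * y) = (qn k - qn2 k) * (x * y)" for x y k
    by (simp add: left_diff_distrib right_diff_distrib qn_left) (metis mult.assoc qn2_central)
  have e1: "xx b1 * L * Vup s e = qn (Suc l) * (xx b1 * L)"
    unfolding L' mult.assoc loc(1) by (rule qn_left)
  have e1': "xx b1 * (L * Cq i (s - 1)) * Vup s e = qn (Suc l) * (xx b1 * (L * Cq i (s - 1)))"
    unfolding C' using loc(1) by (simp only: mult.assoc qn_left)
  have e2: "xx b1 * L * c s * Vup s e = xx b1 * L * Cq s e"
    unfolding L' using loc(2) by (simp only: mult.assoc)
  have e3: "xx b1 * L * Cq (Suc s) e * Vup s e = qn l * (xx b1 * L * Cq s e)"
    unfolding L' using loc(3) by (simp only: mult.assoc qn_left)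
  have e3': "xx b1 * (L * Cq i (s - 1)) * Cq (Suc s) e * Vup s e =
      qn l * (xx b1 * (L * Cq i (s - 1)) * Cq s e)"
    unfolding C' using loc(3) by (simp only: mult.assoc qn_left)
  have e4: "xx b1 * L * c s * Cq (Suc s) e * Vup s e = qi * (qn (Suc l) - qn2 (Suc l)) * (xx b1 * L)"
    unfolding L' using loc(4) by (simp only: mult.assoc qi_left[of L'] qnd_left[of L'])
  have oC: "outside i s (Cq (Suc s) e)" using bounds by (intro outside_Cq) auto
  note r1 = lower_through[OF outside_1] and r2 = lower_through[OF oC]
  show "xx b1 * Vdn i s * L * R * S2 = qn (Suc l) * (xx b1 * L * R * S1)"
    using r1(1) unfolding mult_1_right e1 by (simp only: mult.assoc)
  show "xx b1 * Vdn i s * L * Cq (Suc s) e * R * S2 = qn l * (xx b1 * L * Cq s e * R * S1)"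
    using r2(1) unfolding e3 by (simp only: mult.assoc)
  show "xx b1 * Vdn i s * L * Cq i s * R * S2 =
      qn (Suc l) * (xx b1 * L * Cq i (s - 1) * R * S1) + q ^ (s - i) * (xx b1 * L * Cq s e * R * S1)"
    using r1(2) unfolding mult_1_right e2 e1'[unfolded mult.assoc[symmetric]] by (simp only: mult.assoc)
  show "xx b1 * Vdn i s * L * Cq i s * Cq (Suc s) e * R * S2 =
      qn l * (xx b1 * L * Cq i (s - 1) * Cq s e * R * S1)
      + q ^ (s - i) * (qi * (qn (Suc l) - qn2 (Suc l)) * (xx b1 * L * R * S1))"
    using r2(2) unfolding e4 e3'[unfolded mult.assoc[symmetric]] by (simp only: mult.assoc)
qed

end

end

section \<open>Matrices as block functions\<close>

definition ps :: "(nat \<Rightarrow> nat) \<Rightarrow> nat \<Rightarrow> nat" where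
  "ps f t = sum f {..<t}"

text \<open>Blocks are counted from 0 and positions from 1. The least index skips empty blocks; only
  positions up to the total have a meaningful block.\<close>

definition blk :: "(nat \<Rightarrow> nat) \<Rightarrow> nat \<Rightarrow> nat" where
  "blk f x = (LEAST t. x \<le> ps f (Suc t))"

lemma ps_0 [simp]: "ps f 0 = 0"
  and ps_Suc: "ps f (Suc t) = ps f t + f t"
  by (simp_all add: ps_def)

lemma ps_mono: "t \<le> u \<Longrightarrow> ps f t \<le> ps f u"
  unfolding ps_def by (rule sum_mono2) auto

lemma ps_cong: "(\<And>u. u < t \<Longrightarrow> f u = g u) \<Longrightarrow> ps f t = ps g t"
  by (simp add: ps_def)

lemma blk_bounds:
  assumes "x \<in> {1..ps f m}"
  shows "blk f x < m" "ps f (blk f x) < x" "x \<le> ps f (Suc (blk f x))"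
proof -
  obtain m' where m: "m = Suc m'" using assms by (cases m) auto
  have ex: "x \<le> ps f (Suc m')" using assms m by simp
  show "x \<le> ps f (Suc (blk f x))" unfolding blk_def by (rule LeastI[of _ m']) (rule ex)
  have "blk f x \<le> m'" unfolding blk_def by (rule Least_le) (rule ex)
  then show "blk f x < m" using m by simp
  show "ps f (blk f x) < x"
  proof (cases "blk f x")
    case (Suc t)
    then have "\<not> x \<le> ps f (Suc t)" unfolding blk_def by (intro not_less_Least) simp
    then show ?thesis using Suc by simp
  qed (use assms in simp)
qed

lemma blk_unique:
  assumes "ps f t < x" "x \<le> ps f (Suc t)"
  shows "blk f x = t"
  unfolding blk_def
proof (rule Least_equality)
  show "t \<le> u" if "x \<le> ps f (Suc u)" for u
    using that assms(1) ps_mono[of "Suc u" t f] by (cases "Suc u \<le> t") auto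
qed fact

lemma blk_eq_iff: "x \<in> {1..ps f m} \<Longrightarrow> blk f x = t \<longleftrightarrow> ps f t < x \<and> x \<le> ps f (Suc t)"
  using blk_bounds[of x f m] blk_unique[of f t x] by auto

lemma blk_mono: "mono_on {1..ps f m} (blk f)"
proof (rule mono_onI)
  fix x y assume xy: "x \<in> {1..ps f m}" "y \<in> {1..ps f m}" "x \<le> y"
  show "blk f x \<le> blk f y"
    unfolding blk_def[of f x] by (rule Least_le) (use blk_bounds(3)[OF xy(2)] xy(3) in simp)
qed

lemma blk_interval_block:
  assumes "t < m" "0 < f t"
  shows "interval_block (ps f m) (blk f) (Suc (ps f t)) (ps f (Suc t))"
proof -
  have le: "ps f (Suc t) \<le> ps f m" using assms by (intro ps_mono) simp
  have b: "blk f (Suc (ps f t)) = t" using assms by (intro blk_unique) (simp_all add: ps_Suc)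
  show ?thesis
    using le assms blk_eq_iff[of _ f m t] by (auto simp: interval_block_def b ps_Suc One_nat_def)
qed

lemma blk_vimage: "t < m \<Longrightarrow> {x \<in> {1..ps f m}. blk f x = t} = {Suc (ps f t)..ps f (Suc t)}"
proof (intro Set.set_eqI iffI)
  fix x assume t: "t < m"
  show "x \<in> {Suc (ps f t)..ps f (Suc t)}" if "x \<in> {x \<in> {1..ps f m}. blk f x = t}"
    using that blk_eq_iff[of x f m t] by simp
  show "x \<in> {x \<in> {1..ps f m}. blk f x = t}" if x: "x \<in> {Suc (ps f t)..ps f (Suc t)}"
    using x ps_mono[of "Suc t" m f] t blk_unique[of f t x] by (simp add: One_nat_def)
qed

lemma card_blk_vimage:
  assumes "U \<subseteq> {..<m}"
  shows "card {x \<in> {1..ps f m}. blk f x \<in> U} = sum f U"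
proof -
  have fin: "finite U" using assms finite_subset by blast
  have "{x \<in> {1..ps f m}. blk f x \<in> U} = (\<Union>t\<in>U. {x \<in> {1..ps f m}. blk f x = t})" by auto
  also have "card \<dots> = (\<Sum>t\<in>U. card {x \<in> {1..ps f m}. blk f x = t})"
    by (rule card_UN_disjoint) (auto intro: fin)
  also have "\<dots> = sum f U"
  proof (rule sum.cong)
    fix t assume "t \<in> U"
    then have "t < m" using assms by auto
    then show "card {x \<in> {1..ps f m}. blk f x = t} = f t"
      unfolding blk_vimage[OF \<open>t < m\<close>] by (simp add: ps_Suc)
  qed simp
  finally show ?thesis .
qed

text \<open>A matrix is flattened column by column: the cell \<open>k * n + h\<close> lies in row
  \<open>h\<close> and column \<open>k\<close>, both counted from 0.\<close>

definition rowsum :: "nat \<Rightarrow> (nat \<Rightarrow> nat) \<Rightarrow> nat \<Rightarrow> nat" where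
  "rowsum n f h = (\<Sum>k<n. f (k * n + h))"

definition colsum :: "nat \<Rightarrow> (nat \<Rightarrow> nat) \<Rightarrow> nat \<Rightarrow> nat" where
  "colsum n f k = (\<Sum>h<n. f (k * n + h))"

lemma ps_add: "ps f (t + u) = ps f t + (\<Sum>v<u. f (t + v))"
  by (induction u) (simp_all add: ps_Suc)

lemma ps_colsum: "ps f (k * n) = ps (colsum n f) k"
proof (induction k)
  case (Suc k)
  have "ps f (Suc k * n) = ps f (k * n + n)" by (simp add: add.commute)
  then show ?case by (simp only: ps_add ps_Suc Suc colsum_def)
qed simp

lemma blk_colsum:
  assumes "x \<in> {1..ps f (m * n)}" "0 < n"
  shows "blk (colsum n f) x = blk f x div n"
proof (rule blk_unique)
  let ?t = "blk f x"
  note b = blk_bounds[OF assms(1)]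
  have t: "?t = ?t div n * n + ?t mod n" by simp
  have "ps (colsum n f) (?t div n) \<le> ps f ?t"
    unfolding ps_colsum[symmetric] by (rule ps_mono) simp
  then show "ps (colsum n f) (?t div n) < x" using b by simp
  have "Suc ?t \<le> Suc (?t div n) * n"
    using mod_less_divisor[OF assms(2), of ?t] t by (simp only: mult_Suc)
  then have "ps f (Suc ?t) \<le> ps (colsum n f) (Suc (?t div n))"
    unfolding ps_colsum[symmetric] by (rule ps_mono)
  then show "x \<le> ps (colsum n f) (Suc (?t div n))" using b by simp
qed

text \<open>The index of the transposed cell. \<open>f \<circ> tflip n\<close> lists the same matrix
  row by row, which reduces statements about rows to those about columns.\<close>

definition tflip :: "nat \<Rightarrow> nat \<Rightarrow> nat" where
  "tflip n t = t mod n * n + t div n"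

lemma tflip_less:
  assumes "t < n * n"
  shows "tflip n t < n * n"
proof -
  have n: "0 < n" using assms by (cases n) auto
  have "t div n < n" using assms by (simp add: less_mult_imp_div_less)
  moreover have "t mod n < n" using n by simp
  then have "Suc (t mod n) * n \<le> n * n" by (intro mult_le_mono1) simp
  ultimately show ?thesis unfolding tflip_def by simp
qed

lemma tflip_div_mod:
  assumes "t < n * n"
  shows "tflip n t div n = t mod n" "tflip n t mod n = t div n"
proof -
  have "t div n < n" using assms by (simp add: less_mult_imp_div_less)
  then show "tflip n t div n = t mod n" "tflip n t mod n = t div n"
    by (simp_all add: tflip_def)
qed

lemma tflip_tflip: "t < n * n \<Longrightarrow> tflip n (tflip n t) = t"
  unfolding tflip_def[of n "tflip n t"] by (simp add: tflip_div_mod)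

lemma ps_tflip: "ps (f \<circ> tflip n) (n * n) = ps f (n * n)"
  unfolding ps_def o_def
  by (rule sum.reindex_bij_witness[of _ "tflip n" "tflip n"]) (auto simp: tflip_tflip tflip_less)

lemma colsum_tflip: "h < n \<Longrightarrow> colsum n (f \<circ> tflip n) h = rowsum n f h"
  unfolding colsum_def rowsum_def o_def by (rule sum.cong) (auto simp: tflip_def)

lemma ps_rowsum: "h \<le> n \<Longrightarrow> ps (rowsum n f) h = ps (f \<circ> tflip n) (h * n)"
  unfolding ps_colsum by (rule ps_cong) (simp add: colsum_tflip)

lemma ps_rowsum_total: "ps (rowsum n f) n = ps f (n * n)"
  by (simp add: ps_rowsum ps_tflip)

lemma blk_cong:
  assumes "\<And>u. u < m \<Longrightarrow> f u = g u" "x \<in> {1..ps f m}"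
  shows "blk f x = blk g x"
proof -
  have eq: "ps f u = ps g u" if "u \<le> m" for u using assms(1) that by (intro ps_cong) auto
  note b = blk_bounds[OF assms(2)]
  have "ps g (blk f x) < x" "x \<le> ps g (Suc (blk f x))"
    using b eq[of "blk f x"] eq[of "Suc (blk f x)"] by auto
  then show ?thesis using blk_unique by metis
qed

lemma blk_rowsum:
  assumes "x \<in> {1..ps f (n * n)}"
  shows "blk (rowsum n f) x = blk (f \<circ> tflip n) x div n"
proof -
  have n: "0 < n" using assms by (cases n) auto
  have "blk (rowsum n f) x = blk (colsum n (f \<circ> tflip n)) x"
    by (rule blk_cong[of n]) (use assms in \<open>auto simp: colsum_tflip ps_rowsum_total\<close>)
  also have "\<dots> = blk (f \<circ> tflip n) x div n"
    by (rule blk_colsum[of _ _ n]) (use assms n in \<open>auto simp: ps_tflip\<close>)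
  finally show ?thesis .
qed

text \<open>The permutation \<open>d_A\<close>, where \<open>f\<close> lists the entries of \<open>A\<close> column by column: it carries the \<open>t\<close>-th block of the column
  reading order monotonically onto the corresponding block of the row reading order.\<close>

definition shuffle :: "nat \<Rightarrow> (nat \<Rightarrow> nat) \<Rightarrow> nat \<Rightarrow> nat" where
  "shuffle n f x = (if x \<in> {1..ps f (n * n)}
    then ps (f \<circ> tflip n) (tflip n (blk f x)) + (x - ps f (blk f x)) else x)"

lemma shuffle_block:
  assumes x: "x \<in> {1..ps f (n * n)}"
  shows "shuffle n f x \<in> {1..ps f (n * n)}"
    and "blk (f \<circ> tflip n) (shuffle n f x) = tflip n (blk f x)"
    and "shuffle n f x - ps (f \<circ> tflip n) (tflip n (blk f x)) = x - ps f (blk f x)"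
proof -
  let ?t = "blk f x" and ?g = "f \<circ> tflip n"
  note b = blk_bounds[OF x]
  have g: "?g (tflip n ?t) = f ?t" using b by (simp add: tflip_tflip)
  have s: "shuffle n f x = ps ?g (tflip n ?t) + (x - ps f ?t)" using x by (simp add: shuffle_def)
  have 1: "ps ?g (tflip n ?t) < shuffle n f x" using b s by simp
  have "x - ps f ?t \<le> f ?t" using b by (simp add: ps_Suc)
  then have 2: "shuffle n f x \<le> ps ?g (Suc (tflip n ?t))"
    unfolding s ps_Suc g by simp
  have "ps ?g (Suc (tflip n ?t)) \<le> ps ?g (n * n)"
    using tflip_less[OF b(1)] by (intro ps_mono) simp
  then show "shuffle n f x \<in> {1..ps f (n * n)}" using 1 2 by (simp add: ps_tflip One_nat_def)
  show "blk ?g (shuffle n f x) = tflip n ?t" using 1 2 by (rule blk_unique)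
  show "shuffle n f x - ps ?g (tflip n ?t) = x - ps f ?t" using s by simp
qed

lemma comp_tflip_ps: "t \<le> n * n \<Longrightarrow> ps ((f \<circ> tflip n) \<circ> tflip n) t = ps f t"
  by (rule ps_cong) (simp add: tflip_tflip)

text \<open>The inverse is the shuffle of the transposed matrix.\<close>

lemma shuffle_permutes: "shuffle n f permutes {1..ps f (n * n)}"
proof (rule bij_imp_permutes)
  have inv: "shuffle n (f \<circ> tflip n) (shuffle n f x) = x" if x: "x \<in> {1..ps f (n * n)}" for x f
  proof -
    note b = blk_bounds[OF x] and s = shuffle_block[OF x]
    have "shuffle n f x \<in> {1..ps (f \<circ> tflip n) (n * n)}" using s(1) by (simp only: ps_tflip)
    then have "shuffle n (f \<circ> tflip n) (shuffle n f x) =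
        ps ((f \<circ> tflip n) \<circ> tflip n) (blk f x) + (x - ps f (blk f x))"
      unfolding shuffle_def[of n "f \<circ> tflip n"] using s(2,3) b by (simp add: tflip_tflip)
    then show ?thesis using b by (simp add: comp_tflip_ps)
  qed
  \<comment> \<open>The double transpose is known to agree with \<open>f\<close> on the cells below
    \<open>n * n\<close>, so the comparison is made at positions of the range.\<close>
  have cong: "shuffle n ((f \<circ> tflip n) \<circ> tflip n) x = shuffle n f x" if x: "x \<in> {1..ps f (n * n)}" for x f
  proof -
    let ?g = "(f \<circ> tflip n) \<circ> tflip n"
    have eq: "blk ?g x = blk f x"
      by (rule blk_cong[of "n * n", symmetric]) (use x in \<open>auto simp: tflip_tflip\<close>)
    have b: "blk f x < n * n" using blk_bounds[OF x] by simp
    have "ps (?g \<circ> tflip n) (tflip n (blk f x)) = ps (f \<circ> tflip n) (tflip n (blk f x))"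
      using tflip_less[OF b] by (intro ps_cong) (simp add: tflip_tflip tflip_less)
    then show ?thesis
      unfolding shuffle_def eq using b by (simp add: comp_tflip_ps)
  qed
  show "bij_betw (shuffle n f) {1..ps f (n * n)} {1..ps f (n * n)}"
  proof (rule bij_betwI[where g = "shuffle n (f \<circ> tflip n)"])
    show "shuffle n f \<in> {1..ps f (n * n)} \<rightarrow> {1..ps f (n * n)}"
      using shuffle_block(1) by blast
    show "shuffle n (f \<circ> tflip n) \<in> {1..ps f (n * n)} \<rightarrow> {1..ps f (n * n)}"
      using shuffle_block(1)[of _ "f \<circ> tflip n" n] by (simp only: ps_tflip) blast
    show "shuffle n (f \<circ> tflip n) (shuffle n f x) = x" if "x \<in> {1..ps f (n * n)}" for x
      using inv[OF that] .
    show "shuffle n f (shuffle n (f \<circ> tflip n) y) = y" if y: "y \<in> {1..ps f (n * n)}" for y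
    proof -
      have y': "y \<in> {1..ps (f \<circ> tflip n) (n * n)}" using y by (simp only: ps_tflip)
      have "shuffle n (f \<circ> tflip n) y \<in> {1..ps f (n * n)}"
        using shuffle_block(1)[OF y'] by (simp only: ps_tflip)
      then show ?thesis using inv[OF y'] cong by metis
    qed
  qed
qed (auto simp: shuffle_def)

lemma shuffle_row:
  assumes "x \<in> {1..ps f (n * n)}"
  shows "blk (rowsum n f) (shuffle n f x) = blk f x mod n"
  using blk_rowsum[OF shuffle_block(1)[OF assms]] shuffle_block(2)[OF assms]
    tflip_div_mod[OF blk_bounds(1)[OF assms]] by simp

text \<open>Within one row both reading orders run through the columns from left to right, so
  positions that end up in the same row keep their order.\<close>

lemma shuffle_dr: "shuffle n f \<in> dr (ps f (n * n)) (blk (rowsum n f))"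
  unfolding dr_def
proof (intro CollectI conjI ballI impI shuffle_permutes)
  fix x y assume x: "x \<in> {1..ps f (n * n)}" and y: "y \<in> {1..ps f (n * n)}" and "x < y"
    and "blk (rowsum n f) (shuffle n f x) = blk (rowsum n f) (shuffle n f y)"
  then have eq: "blk f x mod n = blk f y mod n" by (simp add: shuffle_row)
  have le: "blk f x \<le> blk f y" using monotone_onD[OF blk_mono x y] \<open>x < y\<close> by simp
  note bx = blk_bounds[OF x] and by' = blk_bounds[OF y]
  note sx = shuffle_block[OF x] and sy = shuffle_block[OF y]
  show "shuffle n f x < shuffle n f y"
  proof (cases "blk f x = blk f y")
    case True
    then show ?thesis using \<open>x < y\<close> bx by' x y by (simp add: shuffle_def)
  next
    case False
    have "blk f x div n \<noteq> blk f y div n" using False eq by (metis mod_mult_div_eq)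
    then have "tflip n (blk f x) < tflip n (blk f y)"
      using le eq div_le_mono[OF le, of n] by (simp add: tflip_def)
    then have "blk (f \<circ> tflip n) (shuffle n f x) < blk (f \<circ> tflip n) (shuffle n f y)"
      using sx(2) sy(2) by simp
    moreover have "shuffle n f x \<in> {1..ps (f \<circ> tflip n) (n * n)}" "shuffle n f y \<in> {1..ps (f \<circ> tflip n) (n * n)}"
      using sx(1) sy(1) by (simp_all only: ps_tflip)
    ultimately show ?thesis using monotone_onD[OF blk_mono] by (meson leD leI)
  qed
qed

section \<open>Moving one unit between neighbouring blocks\<close>

lemma ps_move_up:
  assumes "0 < f (Suc t)"
  shows "ps (f(t := Suc (f t), Suc t := f (Suc t) - 1)) u = (if u = Suc t then Suc (ps f u) else ps f u)"
  using assms by (induction u) (auto simp: ps_Suc)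

lemma ps_move_down:
  assumes "0 < f t"
  shows "ps (f(t := f t - 1, Suc t := Suc (f (Suc t)))) u = (if u = Suc t then ps f u - 1 else ps f u)"
proof (induction u)
  case (Suc u)
  then show ?case using assms by (auto simp: ps_Suc)
qed simp

text \<open>Only the boundary between the two blocks shifts, so a single position changes its block:
  the first of the block that shrinks.\<close>

lemma blk_move_up:
  assumes f: "0 < f (Suc t)" and x: "x \<in> {1..ps f m}"
  shows "blk (f(t := Suc (f t), Suc t := f (Suc t) - 1)) x = ((blk f)(Suc (ps f (Suc t)) := t)) x"
proof (cases "x = Suc (ps f (Suc t))")
  case True
  then show ?thesis
    using f by (auto intro!: blk_unique simp: ps_move_up ps_Suc)
next
  case False
  then show ?thesis
    using blk_bounds[OF x] f by (auto intro!: blk_unique simp: ps_move_up)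
qed

lemma blk_move_down:
  assumes f: "0 < f t" and x: "x \<in> {1..ps f m}"
  shows "blk (f(t := f t - 1, Suc t := Suc (f (Suc t)))) x = ((blk f)(ps f (Suc t) := Suc t)) x"
proof (cases "x = ps f (Suc t)")
  case True
  then show ?thesis
    using f by (auto intro!: blk_unique simp: ps_move_down ps_Suc)
next
  case False
  then show ?thesis
    using blk_bounds[OF x] f by (auto intro!: blk_unique simp: ps_move_down)
qed

section \<open>The multiplication formulas in a ring\<close>

lemma fibre_cong:
  assumes "\<And>x. x \<in> {1..r} \<Longrightarrow> b x = b2 x" "\<And>x. x \<in> {1..r} \<Longrightarrow> \<rho> x = \<rho>2 x"
  shows "fibre r b \<rho> = fibre r b2 \<rho>2"
proof -
  have "(\<forall>x\<in>{1..r}. b (w x) = \<rho> x) \<longleftrightarrow> (\<forall>x\<in>{1..r}. b2 (w x) = \<rho>2 x)" if "w permutes {1..r}" for w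
    using assms(1)[OF permutes_range[OF that]] assms(2) by simp
  then show ?thesis unfolding fibre_def by blast
qed

lemma dr_cong_iff:
  assumes "\<And>x y. x \<in> {1..r} \<Longrightarrow> y \<in> {1..r} \<Longrightarrow> b x = b y \<longleftrightarrow> b2 x = b2 y"
  shows "dr r b = dr r b2"
proof -
  have "(b (d x) = b (d y)) = (b2 (d x) = b2 (d y))"
    if "d permutes {1..r}" "x \<in> {1..r}" "y \<in> {1..r}" for d x y
    by (rule assms; rule permutes_range[OF that(1)]; rule that)
  then show ?thesis unfolding dr_def by blast
qed

lemma dr_cong:
  assumes "\<And>x. x \<in> {1..r} \<Longrightarrow> b x = b2 x"
  shows "dr r b = dr r b2"
  by (rule dr_cong_iff) (simp add: assms)

lemma interval_block_cong:
  assumes "interval_block r b i j" "\<And>x. x \<in> {1..r} \<Longrightarrow> b x = b2 x"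
  shows "interval_block r b2 i j"
proof -
  note bd = interval_block_bounds[OF assms(1)]
  have i: "i \<in> {1..r}" using bd by simp
  have "b2 x = b2 i \<longleftrightarrow> i \<le> x \<and> x \<le> j" if "x \<in> {1..r}" for x
    using interval_blockD[OF assms(1) that] assms(2)[OF that] assms(2)[OF i] by simp
  then show ?thesis using bd by (simp add: interval_block_def)
qed

lemma mono_on_cong:
  assumes "mono_on {1..r} b" "\<And>x. x \<in> {1..r} \<Longrightarrow> b x = b2 x"
  shows "mono_on {1..r} b2"
proof (rule mono_onI)
  fix x y assume "x \<in> {1..r}" "y \<in> {1..r}" "x \<le> y"
  then show "b2 x \<le> b2 y" using monotone_onD[OF assms(1)] assms(2) by metis
qed

text \<open>Rows \<open>h\<close> and \<open>Suc h\<close> of one column are neighbouring cells of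
  the flattening, so moving a unit between them updates two consecutive values.\<close>

lemma rowsum_upd2:
  assumes k: "k < n" and h: "Suc h < n" and h': "h' < n"
  shows "rowsum n (f(k * n + h := u, Suc (k * n + h) := v)) h' =
    (if h' = h then rowsum n f h - f (k * n + h) + u
     else if h' = Suc h then rowsum n f (Suc h) - f (Suc (k * n + h)) + v else rowsum n f h')"
proof -
  have inj: "j * n + h' = k * n + l \<longleftrightarrow> j = k \<and> h' = l" if "l < n" for j l
    using h' that by (metis add.commute mod_mult_self1 mod_less mult_cancel2 add_right_cancel not_less_zero)
  have S: "Suc (k * n + h) = k * n + Suc h" by simp
  let ?f = "f(k * n + h := u, Suc (k * n + h) := v)"
  have f: "?f (j * n + h') = (if j = k then (if h' = h then u else if h' = Suc h then v else f (j * n + h'))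
      else f (j * n + h'))" for j
    unfolding S using inj[of h j] inj[of "Suc h" j] h by (simp del: add_Suc_right)
  have "rowsum n ?f h' = ?f (k * n + h') + (\<Sum>j\<in>{..<n} - {k}. ?f (j * n + h'))"
    unfolding rowsum_def using k by (intro sum.remove) auto
  also have "(\<Sum>j\<in>{..<n} - {k}. ?f (j * n + h')) = (\<Sum>j\<in>{..<n} - {k}. f (j * n + h'))"
    by (intro sum.cong) (simp_all only: f, auto)
  finally have 1: "rowsum n ?f h' = ?f (k * n + h') + (\<Sum>j\<in>{..<n} - {k}. f (j * n + h'))" .
  have "rowsum n f h' = f (k * n + h') + (\<Sum>j\<in>{..<n} - {k}. f (j * n + h'))"
    unfolding rowsum_def using k by (intro sum.remove) auto
  then show ?thesis unfolding 1 f by auto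
qed

lemma rowsum_ge: "k < n \<Longrightarrow> f (k * n + h) \<le> rowsum n f h"
  unfolding rowsum_def by (rule member_le_sum[of k "{..<n}" "\<lambda>k. f (k * n + h)"]) auto

lemma rowsum_move_up:
  assumes k: "k < n" and h: "Suc h < n" and f: "0 < f (Suc (k * n + h))" and h': "h' < n"
  shows "((rowsum n f)(h := Suc (rowsum n f h), Suc h := rowsum n f (Suc h) - 1)) h' =
    rowsum n (f(k * n + h := Suc (f (k * n + h)), Suc (k * n + h) := f (Suc (k * n + h)) - 1)) h'"
  using rowsum_ge[OF k, of f h] rowsum_ge[OF k, of f "Suc h"] f unfolding rowsum_upd2[OF k h h'] by auto

lemma rowsum_move_down:
  assumes k: "k < n" and h: "Suc h < n" and f: "0 < f (k * n + h)" and h': "h' < n"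
  shows "((rowsum n f)(h := rowsum n f h - 1, Suc h := Suc (rowsum n f (Suc h)))) h' =
    rowsum n (f(k * n + h := f (k * n + h) - 1, Suc (k * n + h) := Suc (f (Suc (k * n + h))))) h'"
  using rowsum_ge[OF k, of f h] rowsum_ge[OF k, of f "Suc h"] f unfolding rowsum_upd2[OF k h h'] by auto

context hecke_clifford_ring
begin

text \<open>Here \<open>f\<close> and \<open>ex\<close> list the entries of a base matrix \<open>A\<close> and of its odd part column by column,
  with index \<open>k * n + h\<close> for the entry \<open>(h + 1, k + 1)\<close>; then \<open>cst\<close>, \<open>sig\<close> and \<open>tst\<close> are
  \<open>c_A\<close>, \<open>\<Sigma>_A\<close> and \<open>T_A\<close>, because \<open>x_ro T_d = vv b (b \<circ> d)\<close> for \<open>d \<in> dr r b\<close>.\<close>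

definition cst :: "(nat \<Rightarrow> nat) \<Rightarrow> (nat \<Rightarrow> nat) \<Rightarrow> nat \<Rightarrow> nat \<Rightarrow> 'b" where
  "cst f ex l m = prod_list (map (\<lambda>t. Cq (Suc (ps f t)) (ps f (Suc t)) ^ ex t) [l..<m])"

definition sig :: "nat \<Rightarrow> (nat \<Rightarrow> nat) \<Rightarrow> 'b" where
  "sig n f = SS (dr r (blk f) \<inter> yg r (\<lambda>x. blk f x div n))"

definition tst :: "nat \<Rightarrow> (nat \<Rightarrow> nat) \<Rightarrow> (nat \<Rightarrow> nat) \<Rightarrow> 'b" where
  "tst n f ex = vv (blk (rowsum n f)) (\<lambda>x. blk f x mod n) * cst f ex 0 (n * n) * sig n f"

lemma cst_split:
  assumes "Suc (Suc t) \<le> m"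
  shows "cst f ex 0 m = cst f ex 0 t * Cq (Suc (ps f t)) (ps f (Suc t)) ^ ex t
    * Cq (Suc (ps f (Suc t))) (ps f (Suc (Suc t))) ^ ex (Suc t) * cst f ex (Suc (Suc t)) m"
proof -
  have "[0..<m] = [0..<t] @ [t, Suc t] @ [Suc (Suc t)..<m]"
    using assms upt_add_eq_append[of 0 t "m - t"] by (simp add: upt_conv_Cons)
  then show ?thesis by (simp add: cst_def mult.assoc)
qed

lemma cst_cong:
  assumes "\<And>u. l \<le> u \<Longrightarrow> u < m \<Longrightarrow>
    ps f u = ps g u \<and> ps f (Suc u) = ps g (Suc u) \<and> ex u = ex' u"
  shows "cst f ex l m = cst g ex' l m"
  unfolding cst_def by (intro arg_cong[of _ _ prod_list] map_cong) (use assms in auto)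

lemma outside_cst:
  assumes "1 \<le> i" "j \<le> r" "ps f m \<le> r" "ps f m < i \<or> j \<le> ps f l"
  shows "outside i j (cst f ex l m)"
  unfolding cst_def
proof (rule outside_prod_list)
  fix y assume "y \<in> set (map (\<lambda>t. Cq (Suc (ps f t)) (ps f (Suc t)) ^ ex t) [l..<m])"
  then obtain u where u: "l \<le> u" "u < m" and y: "y = Cq (Suc (ps f u)) (ps f (Suc u)) ^ ex u" by auto
  have "ps f (Suc u) \<le> ps f m" "ps f l \<le> ps f u" using u by (auto intro!: ps_mono)
  then show "outside i j y"
    unfolding y using assms by (intro outside_power outside_Cq) (auto simp: One_nat_def)
qed

lemma transports_cst:
  assumes b: "mono_on {1..r} b"
    and "\<And>u. l \<le> u \<Longrightarrow> u < m \<Longrightarrow> 0 < ex u \<Longrightarrow> interval_block r b (Suc (ps f u)) (ps f (Suc u))"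
  shows "transports b (cst f ex l m)"
  unfolding cst_def
proof (rule transports_prod_list)
  fix y assume "y \<in> set (map (\<lambda>t. Cq (Suc (ps f t)) (ps f (Suc t)) ^ ex t) [l..<m])"
  then obtain u where u: "l \<le> u" "u < m" and y: "y = Cq (Suc (ps f u)) (ps f (Suc u)) ^ ex u" by auto
  show "transports b y"
  proof (cases "ex u = 0")
    case False
    then show ?thesis unfolding y using assms u by (intro transports_power transports_Cq) auto
  qed (simp add: y)
qed

lemma SS_right_multiple:
  assumes r: "r = ps f (n * n)" and ex: "\<And>u. u < n * n \<Longrightarrow> ex u \<le> f u"
  shows "\<exists>y. tst n f ex = y * xx (\<lambda>x. blk f x div n)"
proof -
  have mono: "mono_on {1..r} (blk f)" unfolding r by (rule blk_mono)
  define P where "P = SS (fibre r (blk (rowsum n f)) (\<lambda>x. blk f x mod n) \<inter> inc r (blk f))"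
  have P: "vv (blk (rowsum n f)) (\<lambda>x. blk f x mod n) = P * xx (blk f)"
    unfolding P_def by (rule vv_factor[OF mono]) simp
  have "transports (blk f) (cst f ex 0 (n * n))"
  proof (rule transports_cst[OF mono])
    fix u assume "u < n * n" "0 < ex u"
    then show "interval_block r (blk f) (Suc (ps f u)) (ps f (Suc u))"
      unfolding r using ex[of u] by (intro blk_interval_block) auto
  qed
  then obtain c' where c': "xx (blk f) * cst f ex 0 (n * n) = c' * xx (blk f)"
    by (auto simp: transports_def)
  have "xx (blk f) * sig n f = xx (\<lambda>x. blk f x div n)"
    unfolding sig_def by (rule xx_SS_dr[OF mono]) simp
  then have "tst n f ex = P * c' * xx (\<lambda>x. blk f x div n)"
    unfolding tst_def P by (metis c' mult.assoc)
  then show ?thesis by blast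
qed

lemma div_mod_index:
  assumes "Suc h < n"
  shows "(k * n + h) div n = k" "Suc (k * n + h) div n = k" "(k * n + h) mod n = h"
    "Suc (k * n + h) mod n = Suc h"
proof -
  have S: "Suc (k * n + h) = Suc h + k * n" by simp
  show "(k * n + h) div n = k" "(k * n + h) mod n = h" using assms by simp_all
  show "Suc (k * n + h) div n = k" "Suc (k * n + h) mod n = Suc h"
    unfolding S using assms by (simp_all del: add_Suc)
qed

lemma index_less:
  assumes "k < n" "Suc h < n"
  shows "Suc (k * n + h) < n * n"
proof -
  have "Suc k * n \<le> n * n" using assms by (intro mult_le_mono1) simp
  then show ?thesis using assms by simp
qed

text \<open>The contribution of one column to the raising formula, without the power of
  \<open>q\<close> that counts the entries further right in row \<open>h\<close>. The cell of row
  \<open>h\<close> is \<open>t\<close>, the one below it \<open>Suc t\<close>; the conditions encode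
  the convention that \<open>phi\<close> vanishes outside \<open>star_mats\<close>.\<close>

definition raise_terms :: "nat \<Rightarrow> (nat \<Rightarrow> nat) \<Rightarrow> (nat \<Rightarrow> nat) \<Rightarrow> 'b \<Rightarrow> nat \<Rightarrow> 'b" where
  "raise_terms n f ex qi t = (let f' = f(t := Suc (f t), Suc t := f (Suc t) - 1) in
    (if ex (Suc t) < f (Suc t) then q ^ ex (Suc t) * qn (Suc (f t - ex t)) * tst n f' ex else 0)
    + (if ex t = 0 \<and> ex (Suc t) = 1 then tst n f' (ex(t := 1, Suc t := 0)) else 0)
    + (if ex t = 1 \<and> ex (Suc t) = 1
       then qi * (qn (Suc (f t)) - qn2 (Suc (f t))) * tst n f' (ex(t := 0, Suc t := 0)) else 0))"

definition lower_terms :: "nat \<Rightarrow> (nat \<Rightarrow> nat) \<Rightarrow> (nat \<Rightarrow> nat) \<Rightarrow> 'b \<Rightarrow> nat \<Rightarrow> 'b" where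
  "lower_terms n f ex qi t = (let f' = f(t := f t - 1, Suc t := Suc (f (Suc t))) in
    (if ex t < f t then qn (Suc (f (Suc t) - ex (Suc t))) * tst n f' ex else 0)
    + (if ex t = 1 \<and> ex (Suc t) = 0 then q ^ (f t - 1) * tst n f' (ex(t := 0, Suc t := 1)) else 0)
    + (if ex t = 1 \<and> ex (Suc t) = 1
       then q ^ (f t - 1) * (qi * (qn (Suc (f (Suc t))) - qn2 (Suc (f (Suc t))))
         * tst n f' (ex(t := 0, Suc t := 0))) else 0))"

text \<open>The two cells form the \<open>adjacent_blocks\<close>, and the first position of the
  lower cell moves. After the move the word is constant on the new cells, so it is a left multiple
  of \<open>xx ?b2\<close> and the computation for two blocks applies.\<close>

lemma block_raise:
  assumes r: "r = ps f (n * n)" and h: "Suc h < n" and k: "k < n" and t: "t = k * n + h"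
    and ft: "0 < f (Suc t)" and ex: "\<And>u. u < n * n \<Longrightarrow> ex u \<le> f u \<and> ex u \<le> 1"
    and qi: "qi * q = 1"
    and bp: "\<And>x. x \<in> {1..r} \<Longrightarrow> bp x = blk (rowsum n (f(t := Suc (f t), Suc t := f (Suc t) - 1))) x"
  shows "vv bp ((\<lambda>x. blk f x mod n)(Suc (ps f (Suc t)) := h)) * Vup (Suc (ps f (Suc t))) (ps f (Suc (Suc t)))
      * cst f ex 0 (n * n) * sig n f = raise_terms n f ex qi t"
proof -
  let ?f' = "f(t := Suc (f t), Suc t := f (Suc t) - 1)"
  let ?m = "n * n" and ?s = "Suc (ps f (Suc t))" and ?e = "ps f (Suc (Suc t))" and ?i = "Suc (ps f t)"
  let ?b1 = "blk f" and ?\<mu> = "\<lambda>x. blk f x div n"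
  let ?b2 = "?b1(?s := t)"
  note dm = div_mod_index[OF h, of k, folded t]
  have tm: "Suc t < ?m" using index_less[OF k h] t by simp
  have psm: "ps ?f' ?m = ps f ?m" using tm by (simp add: ps_move_up[of f t, OF ft])
  have b2f: "blk ?f' x = ?b2 x" if "x \<in> {1..r}" for x
    using blk_move_up[of f t x ?m, OF ft] that r by simp
  have er: "?e \<le> r" unfolding r using tm by (intro ps_mono) simp
  have m1: "mono_on {1..r} ?b1" unfolding r by (rule blk_mono)
  have m2: "mono_on {1..r} ?b2"
    by (rule mono_on_cong[of _ "blk ?f'"]) (use blk_mono[of ?f' ?m] b2f r psm in auto)
  have blk1: "interval_block r ?b1 ?s ?e"
    unfolding r by (rule blk_interval_block[of "Suc t" ?m f, OF tm ft])
  have blk2: "interval_block r ?b2 ?i ?s"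
  proof (rule interval_block_cong[OF _ b2f])
    show "interval_block r (blk ?f') ?i ?s"
      using blk_interval_block[of t ?m ?f'] tm psm r by (simp add: ps_move_up[of f t, OF ft])
  qed
  obtain b' where b': "mono_on {1..r} b'" and iso: "isolates r ?b1 b' ?s"
    using exists_isolating_first[OF m1 blk1] .
  have s1: "?s \<in> {1..r}" using iso by (simp add: isolates_def)
  have bs: "?b1 ?s = Suc t" using ft by (intro blk_unique) (simp_all add: ps_Suc)
  have \<mu>: "?\<mu> x = ?b2 x div n" for x using dm bs by simp
  interpret adjacent_blocks r q T c ?b1 ?b2 b' ?\<mu> ?i ?s ?e qi
  proof unfold_locales
    show "?\<mu> x = ?\<mu> y" if "?b2 x = ?b2 y" for x y unfolding \<mu> that ..
  qed (use m1 m2 b' blk1 blk2 iso qi in auto)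
  have ib1: "interval_block r ?b1 (Suc (ps f u)) (ps f (Suc u))" if "u < t" "0 < ex u" for u
    unfolding r using that ex[of u] tm by (intro blk_interval_block) auto
  have psu: "ps f (Suc u) \<le> ps f t" if "u < t" for u using that by (intro ps_mono) simp
  let ?L = "cst f ex 0 t" and ?R = "cst f ex (Suc (Suc t)) ?m"
  have psr: "ps f t \<le> r" "ps f ?m \<le> r" unfolding r using tm by (auto intro: ps_mono)
  have L: "outside ?i ?e ?L" using er psr by (intro outside_cst) (auto simp: One_nat_def)
  have L1: "transports ?b1 ?L" by (intro transports_cst m1 ib1)
  have L2: "transports ?b2 ?L"
  proof (intro transports_cst m2)
    \<comment> \<open>The cells before \<open>t\<close> keep their positions under the move, so they
      are blocks of the new partition as well.\<close>
    fix u assume u: "u < t" "0 < ex u"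
    have "interval_block r (blk ?f') (Suc (ps ?f' u)) (ps ?f' (Suc u))"
      unfolding r psm[symmetric] using u ex[of u] tm by (intro blk_interval_block) auto
    then have "interval_block r (blk ?f') (Suc (ps f u)) (ps f (Suc u))"
      using u by (simp add: ps_move_up[of f t, OF ft])
    then show "interval_block r ?b2 (Suc (ps f u)) (ps f (Suc u))"
      by (rule interval_block_cong[OF _ b2f])
  qed
  have L': "transports b' ?L"
  proof (intro transports_cst b')
    fix u assume u: "u < t" "0 < ex u"
    show "interval_block r b' (Suc (ps f u)) (ps f (Suc u))"
      using psu[OF u(1)] by (intro isolates_other[OF iso ib1[OF u]]) (simp add: ps_Suc)
  qed
  have R: "outside ?i ?e ?R" using er psr by (intro outside_cst) (auto simp: One_nat_def)
  note loc = raise_block[OF L L1 L2 L' R]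
  have w: "vv bp ((\<lambda>x. blk f x mod n)(?s := h)) = vv bp (\<lambda>x. ?b2 x mod n)"
    using dm by (intro vv_cong) auto
  have "\<exists>P. vv bp ((\<lambda>x. blk f x mod n)(?s := h)) = P * xx ?b2"
    unfolding w by (rule exI, rule vv_factor[OF m2]) simp
  then obtain P where P: "vv bp ((\<lambda>x. blk f x mod n)(?s := h)) = P * xx ?b2" by blast
  have sig1: "sig n f = S1" by (simp add: sig_def)
  have tst': "tst n ?f' e' = P * (xx ?b2 * ?L * Cq ?i ?s ^ e' t * Cq (Suc ?s) ?e ^ e' (Suc t) * ?R * S2)"
    if e': "\<And>u. u \<noteq> t \<Longrightarrow> u \<noteq> Suc t \<Longrightarrow> e' u = ex u" for e'
  proof -
    have "vv (blk (rowsum n ?f')) (\<lambda>x. blk ?f' x mod n) = P * xx ?b2"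
      unfolding P[symmetric]
      by (intro arg_cong[of _ _ SS] fibre_cong) (use bp b2f dm in auto)
    moreover have "sig n ?f' = S2"
    proof -
      have "dr r (blk ?f') = dr r ?b2" by (rule dr_cong) (rule b2f)
      moreover have "yg r (\<lambda>x. blk ?f' x div n) = yg r ?\<mu>"
        by (rule fibre_cong) (simp_all only: b2f \<mu>)
      ultimately show ?thesis by (simp add: sig_def)
    qed
    moreover have "cst ?f' e' 0 ?m = ?L * Cq ?i ?s ^ e' t * Cq (Suc ?s) ?e ^ e' (Suc t) * ?R"
    proof -
      have "cst ?f' e' 0 t = ?L" by (rule cst_cong) (auto simp: ps_move_up[of f t, OF ft] e')
      moreover have "cst ?f' e' (Suc (Suc t)) ?m = ?R"
        by (rule cst_cong) (auto simp: ps_move_up[of f t, OF ft] e')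
      ultimately show ?thesis
        using cst_split[of t ?m ?f' e'] tm by (simp add: ps_move_up[of f t, OF ft])
    qed
    ultimately show ?thesis unfolding tst_def by (simp only: mult.assoc)
  qed
  have cst: "cst f ex 0 ?m = ?L * Cq ?i (?s - 1) ^ ex t * Cq ?s ?e ^ ex (Suc t) * ?R"
    using cst_split[of t ?m f ex] tm by simp
  have mt: "?s - ?i = f t" by (simp add: ps_Suc)
  have Pq: "P * (q ^ l * qn l' * y) = q ^ l * qn l' * (P * y)" for l l' y
    by (metis mult.assoc qn_central qpow_central)
  have Pq': "P * (qi * (qn l - qn2 l) * y) = qi * (qn l - qn2 l) * (P * y)" for l y
  proof -
    have "qi * x = x * qi" for x using qi q_central
      by (metis mult.assoc mult_1_left mult_1_right)
    moreover have "(qn l - qn2 l) * x = x * (qn l - qn2 l)" for x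
      by (simp add: left_diff_distrib right_diff_distrib qn_central qn2_central)
    ultimately show ?thesis by (metis mult.assoc)
  qed
  have lhs: "vv bp ((\<lambda>x. blk f x mod n)(?s := h)) * Vup ?s ?e * cst f ex 0 ?m * sig n f =
      P * (xx ?b2 * Vup ?s ?e * ?L * Cq ?i (?s - 1) ^ ex t * Cq ?s ?e ^ ex (Suc t) * ?R * S1)"
    unfolding P cst sig1 by (simp only: mult.assoc)
  have es: "?e = ?s \<longleftrightarrow> f (Suc t) = 1" by (simp add: ps_Suc One_nat_def)
  have ext: "ex t \<le> f t" "ex t \<le> 1" "ex (Suc t) \<le> f (Suc t)" "ex (Suc t) \<le> 1"
    using ex[of t] ex[of "Suc t"] tm by auto
  \<comment> \<open>If the moved position was alone in its cell, the sum over the rest is empty.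
    This matches the convention: with an odd entry there, the even entry would become
    negative.\<close>
  have Cz: "Cq (Suc ?s) ?e = 0" if "\<not> 1 < f (Suc t)" using that ft
    by (intro Cq_empty) (simp add: ps_Suc)
  consider "ex t = 0" "ex (Suc t) = 0" | "ex t = 1" "ex (Suc t) = 0"
    | "ex t = 0" "ex (Suc t) = 1" | "ex t = 1" "ex (Suc t) = 1"
    using ext by linarith
  then show ?thesis
  proof cases
    case 1
    then show ?thesis unfolding lhs using loc(1)[unfolded mt] ft tst'[of ex] Pq[of 0]
      by (simp add: raise_terms_def mult.assoc One_nat_def)
  next
    case 2
    then have "Suc (f t - ex t) = f t" using ext by simp
    then show ?thesis unfolding lhs using 2 loc(2)[unfolded mt] ft tst'[of ex] Pq[of 0]
      by (simp add: raise_terms_def mult.assoc One_nat_def)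
  next
    case 3
    then show ?thesis
      unfolding lhs using loc(3)[unfolded mt] tst'[of ex] tst'[of "ex(t := 1, Suc t := 0)"] Pq[of 1 "Suc (f t)"] Cz
      by (cases "1 < f (Suc t)") (simp_all add: raise_terms_def distrib_left)
  next
    case 4
    then have "Suc (f t - ex t) = f t" using ext by simp
    then show ?thesis
      unfolding lhs using 4 loc(4)[unfolded mt] tst'[of ex] tst'[of "ex(t := 0, Suc t := 0)"]
        Pq[of 1 "f t"] Pq'[of "Suc (f t)"] Cz
      by (cases "1 < f (Suc t)") (simp_all add: raise_terms_def distrib_left)
  qed
qed

text \<open>The last position of the upper cell moves. Hence the old partition plays the part of
  \<open>b2\<close>, the new one that of \<open>b1\<close>, and the refinement isolates the last
  position of a block.\<close>

lemma block_lower: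
  assumes r: "r = ps f (n * n)" and h: "Suc h < n" and k: "k < n" and t: "t = k * n + h"
    and ft: "0 < f t" and ex: "\<And>u. u < n * n \<Longrightarrow> ex u \<le> f u \<and> ex u \<le> 1"
    and qi: "qi * q = 1"
    and bp: "\<And>x. x \<in> {1..r} \<Longrightarrow> bp x = blk (rowsum n (f(t := f t - 1, Suc t := Suc (f (Suc t))))) x"
  shows "vv bp ((\<lambda>x. blk f x mod n)(ps f (Suc t) := Suc h)) * Vdn (Suc (ps f t)) (ps f (Suc t))
      * cst f ex 0 (n * n) * sig n f = lower_terms n f ex qi t"
proof -
  let ?f' = "f(t := f t - 1, Suc t := Suc (f (Suc t)))"
  let ?m = "n * n" and ?s = "ps f (Suc t)" and ?e = "ps f (Suc (Suc t))" and ?i = "Suc (ps f t)"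
  let ?b2 = "blk f" and ?\<mu> = "\<lambda>x. blk f x div n"
  let ?b1 = "?b2(?s := Suc t)"
  note dm = div_mod_index[OF h, of k, folded t]
  have tm: "Suc t < ?m" using index_less[OF k h] t by simp
  note ps' = ps_move_down[of f t, OF ft]
  have psm: "ps ?f' ?m = ps f ?m" using tm by (simp add: ps')
  have b1f: "blk ?f' x = ?b1 x" if "x \<in> {1..r}" for x
    using blk_move_down[of f t x ?m, OF ft] that r by simp
  have er: "?e \<le> r" unfolding r using tm by (intro ps_mono) simp
  have m2: "mono_on {1..r} ?b2" unfolding r by (rule blk_mono)
  have m1: "mono_on {1..r} ?b1"
    by (rule mono_on_cong[of _ "blk ?f'"]) (use blk_mono[of ?f' ?m] b1f r psm in auto)
  have blk2: "interval_block r ?b2 ?i ?s"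
    unfolding r using tm by (intro blk_interval_block[of t ?m f] ft) simp
  have S: "Suc (ps f (Suc t) - 1) = ps f (Suc t)" using ft by (simp add: ps_Suc)
  have blk1: "interval_block r ?b1 ?s ?e"
  proof (rule interval_block_cong[OF _ b1f])
    show "interval_block r (blk ?f') ?s ?e"
      using blk_interval_block[of "Suc t" ?m ?f'] tm psm r by (simp add: ps' S)
  qed
  obtain b' where b': "mono_on {1..r} b'" and iso2: "isolates r ?b2 b' ?s"
    using exists_isolating_last[OF m2 blk2] .
  have iso1: "isolates r ?b1 b' ?s" using iso2 by (rule isolates_upd) simp
  have s1: "?s \<in> {1..r}" using iso2 by (simp add: isolates_def)
  have bs: "?b2 ?s = t" using ft by (intro blk_unique) (simp_all add: ps_Suc)
  have \<mu>: "?\<mu> x = ?b1 x div n" for x using dm bs by simp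
  interpret adjacent_blocks r q T c ?b1 ?b2 b' ?\<mu> ?i ?s ?e qi
  proof unfold_locales
    show "?\<mu> x = ?\<mu> y" if "?b1 x = ?b1 y" for x y unfolding \<mu> that ..
  qed (use m1 m2 b' blk1 blk2 iso1 qi in auto)
  have ib2: "interval_block r ?b2 (Suc (ps f u)) (ps f (Suc u))" if "u < t" "0 < ex u" for u
    unfolding r using that ex[of u] tm by (intro blk_interval_block) auto
  have psu: "ps f (Suc u) \<le> ps f t" if "u < t" for u using that by (intro ps_mono) simp
  let ?L = "cst f ex 0 t" and ?R = "cst f ex (Suc (Suc t)) ?m"
  have psr: "ps f t \<le> r" "ps f ?m \<le> r" unfolding r using tm by (auto intro: ps_mono)
  have L: "outside ?i ?e ?L" using er psr by (intro outside_cst) (auto simp: One_nat_def)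
  have L2: "transports ?b2 ?L" by (intro transports_cst m2 ib2)
  have L1: "transports ?b1 ?L"
  proof (intro transports_cst m1)
    fix u assume u: "u < t" "0 < ex u"
    have "interval_block r (blk ?f') (Suc (ps ?f' u)) (ps ?f' (Suc u))"
      unfolding r psm[symmetric] using u ex[of u] tm by (intro blk_interval_block) auto
    then have "interval_block r (blk ?f') (Suc (ps f u)) (ps f (Suc u))"
      using u by (simp add: ps')
    then show "interval_block r ?b1 (Suc (ps f u)) (ps f (Suc u))"
      by (rule interval_block_cong[OF _ b1f])
  qed
  have L': "transports b' ?L"
  proof (intro transports_cst b')
    fix u assume u: "u < t" "0 < ex u"
    show "interval_block r b' (Suc (ps f u)) (ps f (Suc u))"
      using psu[OF u(1)] ft by (intro isolates_other[OF iso2 ib2[OF u]]) (simp add: ps_Suc)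
  qed
  have R: "outside ?i ?e ?R" using er psr by (intro outside_cst) (auto simp: One_nat_def)
  note loc = lower_block[OF L L1 L2 L' R]
  have w: "vv bp ((\<lambda>x. blk f x mod n)(?s := Suc h)) = vv bp (\<lambda>x. ?b1 x mod n)"
    using dm by (intro vv_cong) auto
  have "\<exists>P. vv bp ((\<lambda>x. blk f x mod n)(?s := Suc h)) = P * xx ?b1"
    unfolding w by (rule exI, rule vv_factor[OF m1]) simp
  then obtain P where P: "vv bp ((\<lambda>x. blk f x mod n)(?s := Suc h)) = P * xx ?b1" by blast
  have sig2: "sig n f = S2" by (simp add: sig_def)
  have tst': "tst n ?f' e' = P * (xx ?b1 * ?L * Cq ?i (?s - 1) ^ e' t * Cq ?s ?e ^ e' (Suc t) * ?R * S1)"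
    if e': "\<And>u. u \<noteq> t \<Longrightarrow> u \<noteq> Suc t \<Longrightarrow> e' u = ex u" for e'
  proof -
    have "vv (blk (rowsum n ?f')) (\<lambda>x. blk ?f' x mod n) = P * xx ?b1"
      unfolding P[symmetric]
      by (intro arg_cong[of _ _ SS] fibre_cong) (use bp b1f dm in auto)
    moreover have "sig n ?f' = S1"
    proof -
      have "dr r (blk ?f') = dr r ?b1" by (rule dr_cong) (rule b1f)
      moreover have "yg r (\<lambda>x. blk ?f' x div n) = yg r ?\<mu>"
        by (rule fibre_cong) (simp_all only: b1f \<mu>)
      ultimately show ?thesis by (simp add: sig_def)
    qed
    moreover have "cst ?f' e' 0 ?m = ?L * Cq ?i (?s - 1) ^ e' t * Cq ?s ?e ^ e' (Suc t) * ?R"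
    proof -
      have "cst ?f' e' 0 t = ?L" by (rule cst_cong) (auto simp: ps' e')
      moreover have "cst ?f' e' (Suc (Suc t)) ?m = ?R"
        by (rule cst_cong) (auto simp: ps' e')
      ultimately show ?thesis
        using cst_split[of t ?m ?f' e'] tm by (simp add: ps' S)
    qed
    ultimately show ?thesis unfolding tst_def by (simp only: mult.assoc)
  qed
  have cst: "cst f ex 0 ?m = ?L * Cq ?i ?s ^ ex t * Cq (Suc ?s) ?e ^ ex (Suc t) * ?R"
    using cst_split[of t ?m f ex] tm by simp
  have mt: "?s - ?i = f t - 1" "?e - ?s = f (Suc t)" by (simp_all add: ps_Suc One_nat_def)
  have Pq: "P * (qn l' * y) = qn l' * (P * y)" for l' y
    by (metis mult.assoc qn_central)
  have Pp: "P * (q ^ l * y) = q ^ l * (P * y)" for l y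
    by (metis mult.assoc qpow_central)
  have Pq': "P * (q ^ l' * (qi * (qn l - qn2 l) * y)) = q ^ l' * (qi * (qn l - qn2 l) * (P * y))" for l l' y
  proof -
    have "qi * x = x * qi" for x using qi q_central
      by (metis mult.assoc mult_1_left mult_1_right)
    moreover have "(qn l - qn2 l) * x = x * (qn l - qn2 l)" for x
      by (simp add: left_diff_distrib right_diff_distrib qn_central qn2_central)
    ultimately show ?thesis by (metis mult.assoc qpow_central)
  qed
  have lhs: "vv bp ((\<lambda>x. blk f x mod n)(?s := Suc h)) * Vdn ?i ?s * cst f ex 0 ?m * sig n f =
      P * (xx ?b1 * Vdn ?i ?s * ?L * Cq ?i ?s ^ ex t * Cq (Suc ?s) ?e ^ ex (Suc t) * ?R * S2)"
    unfolding P cst sig2 by (simp only: mult.assoc)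
  have ext: "ex t \<le> f t" "ex t \<le> 1" "ex (Suc t) \<le> f (Suc t)" "ex (Suc t) \<le> 1"
    using ex[of t] ex[of "Suc t"] tm by auto
  have Cz: "Cq ?i (?s - 1) = 0" if "\<not> 1 < f t" using that ft
    by (intro Cq_empty) (simp add: ps_Suc)
  consider "ex t = 0" "ex (Suc t) = 0" | "ex t = 0" "ex (Suc t) = 1"
    | "ex t = 1" "ex (Suc t) = 0" | "ex t = 1" "ex (Suc t) = 1"
    using ext by linarith
  then show ?thesis
  proof cases
    case 1
    then show ?thesis unfolding lhs using loc(1)[unfolded mt] ft tst'[of ex] Pq
      by (simp add: lower_terms_def)
  next
    case 2
    then have "Suc (f (Suc t) - ex (Suc t)) = f (Suc t)" using ext by simp
    then show ?thesis unfolding lhs using 2 loc(2)[unfolded mt] ft tst'[of ex] Pq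
      by (simp add: lower_terms_def)
  next
    case 3
    then show ?thesis
      unfolding lhs using loc(3)[unfolded mt] tst'[of ex] tst'[of "ex(t := 0, Suc t := 1)"] Pq Pp Cz
      by (cases "1 < f t") (simp_all add: lower_terms_def distrib_left)
  next
    case 4
    then have "Suc (f (Suc t) - ex (Suc t)) = f (Suc t)" using ext by simp
    then show ?thesis
      unfolding lhs using 4 loc(4)[unfolded mt] tst'[of ex] tst'[of "ex(t := 0, Suc t := 0)"]
        Pq Pq' Pq'[of 0] Cz
      by (cases "1 < f t") (simp_all add: lower_terms_def distrib_left)
  qed
qed

section \<open>Summation over the columns\<close>

lemma sum_mult_mult: "sum F A * x * y = (\<Sum>k\<in>A. F k * x * y)" for x y :: 'b
  by (simp only: sum_distrib_right)

text \<open>The positions with letter \<open>Suc h\<close> are grouped by column. Within one cell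
  the exponent is constant and the words arise from that of the first position by the chains of
  \<open>Vup\<close>, so each column is an instance of \<open>block_raise\<close>.\<close>

lemma root_raise:
  assumes r: "r = ps f (n * n)" and h: "Suc h < n" and row: "0 < rowsum n f (Suc h)"
    and ex: "\<And>u. u < n * n \<Longrightarrow> ex u \<le> f u \<and> ex u \<le> 1" and qi: "qi * q = 1"
  defines "s \<equiv> Suc (ps (rowsum n f) (Suc h))" and "e \<equiv> ps (rowsum n f) (Suc (Suc h))"
  shows "xx ((blk (rowsum n f))(s := h)) * Vup s e * Tw (shuffle n f) * cst f ex 0 (n * n) * sig n f =
    (\<Sum>k<n. q ^ (\<Sum>j\<in>{k<..<n}. f (j * n + h)) * raise_terms n f ex qi (k * n + h))"
proof -
  let ?R = "rowsum n f"
  let ?b = "blk ?R" and ?\<rho> = "\<lambda>x. blk f x mod n"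
  let ?bp = "?b(s := h)"
  have n: "0 < n" using h by simp
  have rR: "r = ps ?R n" by (simp add: r ps_rowsum_total)
  let ?R' = "?R(h := Suc (?R h), Suc h := ?R (Suc h) - 1)"
  have psR': "ps ?R' n = ps ?R n" using h by (simp add: ps_move_up[of ?R h, OF row])
  have bp: "blk ?R' x = ?bp x" if "x \<in> {1..r}" for x
    using blk_move_up[of ?R h x n, OF row] that rR by (simp add: s_def)
  have mb: "mono_on {1..r} ?b" unfolding rR by (rule blk_mono)
  have mbp: "mono_on {1..r} ?bp"
    by (rule mono_on_cong[of _ "blk ?R'"]) (use blk_mono[of ?R' n] bp rR psR' in auto)
  have blk: "interval_block r ?b s e"
    unfolding rR s_def e_def by (rule blk_interval_block[of "Suc h" n ?R, OF h row])
  have bs: "?b s = Suc h" unfolding s_def using row by (intro blk_unique) (simp_all add: ps_Suc)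
  have d: "shuffle n f \<in> dr r ?b" unfolding r by (rule shuffle_dr)
  have row_d: "?b (shuffle n f x) = ?\<rho> x" if "x \<in> {1..r}" for x
    using shuffle_row that by (simp add: r)
  \<comment> \<open>In the column reading order row \<open>h\<close> of column \<open>k\<close>
    comes before row \<open>Suc h\<close>; the letters \<open>h\<close> further right are therefore
    those of row \<open>h\<close> in later columns.\<close>
  have cnt: "card {y \<in> {1..r}. x < y \<and> ?\<rho> y = h} = (\<Sum>j\<in>{k<..<n}. f (j * n + h))"
    if k: "k < n" and x: "x \<in> {1..r}" and bx: "blk f x = Suc (k * n + h)" for k x
  proof -
    have "{y \<in> {1..r}. x < y \<and> ?\<rho> y = h} = {y \<in> {1..ps f (n * n)}. blk f y \<in> (\<lambda>j. j * n + h) ` {k<..<n}}"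
    proof (intro Set.set_eqI iffI)
      fix y assume y: "y \<in> {y \<in> {1..r}. x < y \<and> ?\<rho> y = h}"
      then have y1: "y \<in> {1..ps f (n * n)}" using r by simp
      have u: "blk f y = blk f y div n * n + h" using y by (metis (mono_tags, lifting) mem_Collect_eq div_mult_mod_eq)
      have "blk f y div n < n" using blk_bounds(1)[OF y1] by (simp add: less_mult_imp_div_less)
      moreover have "blk f x \<le> blk f y" using x y r by (intro monotone_onD[OF blk_mono[of f "n * n"]]) auto
      then have "k * n < blk f y div n * n" using bx u by linarith
      then have "k < blk f y div n" by simp
      ultimately show "y \<in> {y \<in> {1..ps f (n * n)}. blk f y \<in> (\<lambda>j. j * n + h) ` {k<..<n}}"
        using y1 u by auto
    next
      fix y assume "y \<in> {y \<in> {1..ps f (n * n)}. blk f y \<in> (\<lambda>j. j * n + h) ` {k<..<n}}"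
      then obtain j where y: "y \<in> {1..ps f (n * n)}" and j: "k < j" "j < n" "blk f y = j * n + h" by auto
      have "Suc k * n \<le> j * n" using j by (intro mult_le_mono1) simp
      then have "blk f x < blk f y" using bx j h by simp
      then have "x < y" using x y r monotone_onD[OF blk_mono[of f "n * n"], of y x] by (meson leD leI)
      then show "y \<in> {y \<in> {1..r}. x < y \<and> ?\<rho> y = h}" using y j h r by simp
    qed
    also have "card \<dots> = sum f ((\<lambda>j. j * n + h) ` {k<..<n})"
    proof (rule card_blk_vimage)
      show "(\<lambda>j. j * n + h) ` {k<..<n} \<subseteq> {..<n * n}" using index_less[OF _ h] by (auto intro: Suc_lessD)
    qed
    also have "\<dots> = (\<Sum>j\<in>{k<..<n}. f (j * n + h))"
      using n by (subst sum.reindex) (auto simp: inj_on_def)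
    finally show ?thesis .
  qed
  have "xx ?bp * Vup s e * Tw (shuffle n f) = (\<Sum>x | x \<in> {1..r} \<and> ?b (shuffle n f x) = Suc h.
      q ^ card {y \<in> {1..r}. x < y \<and> ?b (shuffle n f y) = h} * vv ?bp ((?b \<circ> shuffle n f)(x := h)))"
    by (rule raise_words[OF mb mbp blk bs d])
  also have "\<dots> = (\<Sum>x | x \<in> {1..r} \<and> ?\<rho> x = Suc h.
      q ^ card {y \<in> {1..r}. x < y \<and> ?\<rho> y = h} * vv ?bp (?\<rho>(x := h)))"
  proof (rule sum.cong)
    show "{x. x \<in> {1..r} \<and> ?b (shuffle n f x) = Suc h} = {x. x \<in> {1..r} \<and> ?\<rho> x = Suc h}"
      using row_d by auto
    fix x
    have "{y \<in> {1..r}. x < y \<and> ?b (shuffle n f y) = h} = {y \<in> {1..r}. x < y \<and> ?\<rho> y = h}"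
      using row_d by auto
    moreover have "vv ?bp ((?b \<circ> shuffle n f)(x := h)) = vv ?bp (?\<rho>(x := h))"
      using row_d by (intro vv_cong) simp
    ultimately show "q ^ card {y \<in> {1..r}. x < y \<and> ?b (shuffle n f y) = h} * vv ?bp ((?b \<circ> shuffle n f)(x := h))
      = q ^ card {y \<in> {1..r}. x < y \<and> ?\<rho> y = h} * vv ?bp (?\<rho>(x := h))" by (simp only:)
  qed
  also have "{x. x \<in> {1..r} \<and> ?\<rho> x = Suc h} = (\<Union>k\<in>{..<n}. {x \<in> {1..r}. blk f x = Suc (k * n + h)})"
  proof (intro Set.set_eqI iffI)
    fix x assume x: "x \<in> {x. x \<in> {1..r} \<and> ?\<rho> x = Suc h}"
    then have "blk f x div n < n" using blk_bounds(1)[of x f "n * n"] r by (simp add: less_mult_imp_div_less)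
    moreover have "blk f x = Suc (blk f x div n * n + h)"
      using x by (metis (mono_tags, lifting) mem_Collect_eq div_mult_mod_eq add_Suc_right)
    ultimately show "x \<in> (\<Union>k\<in>{..<n}. {x \<in> {1..r}. blk f x = Suc (k * n + h)})" using x by blast
  next
    fix x assume "x \<in> (\<Union>k\<in>{..<n}. {x \<in> {1..r}. blk f x = Suc (k * n + h)})"
    then show "x \<in> {x. x \<in> {1..r} \<and> ?\<rho> x = Suc h}" using div_mod_index(4)[OF h] by auto
  qed
  also have "(\<Sum>x\<in>\<dots>. q ^ card {y \<in> {1..r}. x < y \<and> ?\<rho> y = h} * vv ?bp (?\<rho>(x := h))) =
    (\<Sum>k<n. \<Sum>x | x \<in> {1..r} \<and> blk f x = Suc (k * n + h).
      q ^ card {y \<in> {1..r}. x < y \<and> ?\<rho> y = h} * vv ?bp (?\<rho>(x := h)))"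
    using n by (intro sum.UNION_disjoint) auto
  finally have words: "xx ?bp * Vup s e * Tw (shuffle n f) =
    (\<Sum>k<n. \<Sum>x | x \<in> {1..r} \<and> blk f x = Suc (k * n + h).
      q ^ card {y \<in> {1..r}. x < y \<and> ?\<rho> y = h} * vv ?bp (?\<rho>(x := h)))" .
  have block: "(\<Sum>x | x \<in> {1..r} \<and> blk f x = Suc (k * n + h).
      q ^ card {y \<in> {1..r}. x < y \<and> ?\<rho> y = h} * vv ?bp (?\<rho>(x := h))) * cst f ex 0 (n * n) * sig n f
    = q ^ (\<Sum>j\<in>{k<..<n}. f (j * n + h)) * raise_terms n f ex qi (k * n + h)" if k: "k < n" for k
  proof (cases "0 < f (Suc (k * n + h))")
    case False
    have tm: "Suc (k * n + h) < n * n" by (rule index_less[OF k h])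
    have "{x \<in> {1..r}. blk f x = Suc (k * n + h)} = {}"
      unfolding r blk_vimage[OF tm] using False by (simp add: ps_Suc)
    then have "(\<Sum>x | x \<in> {1..r} \<and> blk f x = Suc (k * n + h).
      q ^ card {y \<in> {1..r}. x < y \<and> ?\<rho> y = h} * vv ?bp (?\<rho>(x := h))) = 0"
      by (simp only: sum.empty)
    moreover have "raise_terms n f ex qi (k * n + h) = 0"
      using ex[OF tm] False by (simp add: raise_terms_def)
    ultimately show ?thesis by simp
  next
    case True
    let ?t = "k * n + h"
    let ?s = "Suc (ps f (Suc ?t))" and ?e = "ps f (Suc (Suc ?t))"
    have tm: "Suc ?t < n * n" by (rule index_less[OF k h])
    have set: "{x \<in> {1..r}. blk f x = Suc ?t} = {?s..?e}" unfolding r blk_vimage[OF tm] ..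
    have er: "?e \<le> r" unfolding r using tm by (intro ps_mono) simp
    have \<rho>: "?\<rho> x = Suc h" if "x \<in> {?s..?e}" for x
    proof -
      have "blk f x = Suc ?t" using that by (intro blk_unique) auto
      then show ?thesis using div_mod_index(4)[OF h] by simp
    qed
    have "(\<Sum>x\<in>{?s..?e}. q ^ card {y \<in> {1..r}. x < y \<and> ?\<rho> y = h} * vv ?bp (?\<rho>(x := h))) =
      (\<Sum>x\<in>{?s..?e}. q ^ (\<Sum>j\<in>{k<..<n}. f (j * n + h)) * (vv ?bp (?\<rho>(?s := h)) * up ?s x))"
    proof (rule sum.cong[OF refl])
      fix x assume x: "x \<in> {?s..?e}"
      then have "x \<in> {x \<in> {1..r}. blk f x = Suc ?t}" unfolding set .
      then have "card {y \<in> {1..r}. x < y \<and> ?\<rho> y = h} = (\<Sum>j\<in>{k<..<n}. f (j * n + h))"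
        using cnt[OF k] by blast
      moreover have "vv ?bp (?\<rho>(?s := h)) * up ?s x = vv ?bp (?\<rho>(x := h))"
        using x er by (intro word_up[OF mbp \<rho>]) auto
      ultimately show "q ^ card {y \<in> {1..r}. x < y \<and> ?\<rho> y = h} * vv ?bp (?\<rho>(x := h)) =
        q ^ (\<Sum>j\<in>{k<..<n}. f (j * n + h)) * (vv ?bp (?\<rho>(?s := h)) * up ?s x)" by (simp only:)
    qed
    then have "(\<Sum>x\<in>{?s..?e}. q ^ card {y \<in> {1..r}. x < y \<and> ?\<rho> y = h} * vv ?bp (?\<rho>(x := h))) =
      q ^ (\<Sum>j\<in>{k<..<n}. f (j * n + h)) * (vv ?bp (?\<rho>(?s := h)) * Vup ?s ?e)"
      by (simp only: Vup_def sum_distrib_left)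
    moreover have "vv ?bp (?\<rho>(?s := h)) * Vup ?s ?e * cst f ex 0 (n * n) * sig n f = raise_terms n f ex qi ?t"
    proof (rule block_raise[OF r h k refl True ex qi])
      fix x assume x: "x \<in> {1..r}"
      have "blk ?R' x = blk (rowsum n (f(?t := Suc (f ?t), Suc ?t := f (Suc ?t) - 1))) x"
        using rowsum_move_up[of k n h f, OF k h True] x rR psR' by (intro blk_cong[of n]) auto
      then show "?bp x = blk (rowsum n (f(?t := Suc (f ?t), Suc ?t := f (Suc ?t) - 1))) x"
        using bp[OF x] by simp
    qed
    ultimately show ?thesis unfolding set by (simp only: mult.assoc)
  qed
  show ?thesis
    unfolding words by (subst sum_mult_mult, rule sum.cong[OF refl], simp only: lessThan_iff block)
qed

lemma root_lower:
  assumes r: "r = ps f (n * n)" and h: "Suc h < n" and row: "0 < rowsum n f h"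
    and ex: "\<And>u. u < n * n \<Longrightarrow> ex u \<le> f u \<and> ex u \<le> 1" and qi: "qi * q = 1"
  defines "s \<equiv> ps (rowsum n f) (Suc h)" and "a \<equiv> Suc (ps (rowsum n f) h)"
  shows "xx ((blk (rowsum n f))(s := Suc h)) * Vdn a s * Tw (shuffle n f) * cst f ex 0 (n * n) * sig n f =
    (\<Sum>k<n. q ^ (\<Sum>j<k. f (Suc (j * n + h))) * lower_terms n f ex qi (k * n + h))"
proof -
  let ?R = "rowsum n f"
  let ?b = "blk ?R" and ?\<rho> = "\<lambda>x. blk f x mod n"
  let ?bp = "?b(s := Suc h)"
  have n: "0 < n" using h by simp
  have rR: "r = ps ?R n" by (simp add: r ps_rowsum_total)
  let ?R' = "?R(h := ?R h - 1, Suc h := Suc (?R (Suc h)))"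
  have psR': "ps ?R' n = ps ?R n" using h by (simp add: ps_move_down[of ?R h, OF row])
  have bp: "blk ?R' x = ?bp x" if "x \<in> {1..r}" for x
    using blk_move_down[of ?R h x n, OF row] that rR by (simp add: s_def)
  have mb: "mono_on {1..r} ?b" unfolding rR by (rule blk_mono)
  have mbp: "mono_on {1..r} ?bp"
    by (rule mono_on_cong[of _ "blk ?R'"]) (use blk_mono[of ?R' n] bp rR psR' in auto)
  have blk: "interval_block r ?b a s"
    unfolding rR s_def a_def using h by (intro blk_interval_block[of h n ?R] row) simp
  have bs: "?b s = h" unfolding s_def using row by (intro blk_unique) (simp_all add: ps_Suc)
  have d: "shuffle n f \<in> dr r ?b" unfolding r by (rule shuffle_dr)
  have row_d: "?b (shuffle n f x) = ?\<rho> x" if "x \<in> {1..r}" for x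
    using shuffle_row that by (simp add: r)
  \<comment> \<open>In column \<open>k\<close> itself row \<open>Suc h\<close> comes after row
    \<open>h\<close>, so only the earlier columns contribute.\<close>
  have cnt: "card {y \<in> {1..r}. y < x \<and> ?\<rho> y = Suc h} = (\<Sum>j<k. f (Suc (j * n + h)))"
    if k: "k < n" and x: "x \<in> {1..r}" and bx: "blk f x = k * n + h" for k x
  proof -
    have "{y \<in> {1..r}. y < x \<and> ?\<rho> y = Suc h} = {y \<in> {1..ps f (n * n)}. blk f y \<in> (\<lambda>j. Suc (j * n + h)) ` {..<k}}"
    proof (intro Set.set_eqI iffI)
      fix y assume y: "y \<in> {y \<in> {1..r}. y < x \<and> ?\<rho> y = Suc h}"
      then have y1: "y \<in> {1..ps f (n * n)}" using r by simp
      have u: "blk f y = Suc (blk f y div n * n + h)"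
        using y by (metis (mono_tags, lifting) mem_Collect_eq div_mult_mod_eq add_Suc_right)
      have "blk f y \<le> blk f x" using x y r by (intro monotone_onD[OF blk_mono[of f "n * n"]]) auto
      then have "blk f y div n * n < k * n" using bx u by linarith
      then have "blk f y div n < k" by simp
      then show "y \<in> {y \<in> {1..ps f (n * n)}. blk f y \<in> (\<lambda>j. Suc (j * n + h)) ` {..<k}}"
        using y1 u by auto
    next
      fix y assume "y \<in> {y \<in> {1..ps f (n * n)}. blk f y \<in> (\<lambda>j. Suc (j * n + h)) ` {..<k}}"
      then obtain j where y: "y \<in> {1..ps f (n * n)}" and j: "j < k" "blk f y = Suc (j * n + h)" by auto
      have "Suc j * n \<le> k * n" using j by (intro mult_le_mono1) simp
      then have "blk f y < blk f x" using bx j h by simp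
      then have "y < x" using x y r monotone_onD[OF blk_mono[of f "n * n"], of x y] by (meson leD leI)
      then show "y \<in> {y \<in> {1..r}. y < x \<and> ?\<rho> y = Suc h}"
        using y j div_mod_index(4)[OF h] r by simp
    qed
    also have "card \<dots> = sum f ((\<lambda>j. Suc (j * n + h)) ` {..<k})"
    proof (rule card_blk_vimage)
      show "(\<lambda>j. Suc (j * n + h)) ` {..<k} \<subseteq> {..<n * n}" using k by (auto intro!: index_less[OF _ h])
    qed
    also have "\<dots> = (\<Sum>j<k. f (Suc (j * n + h)))"
      using n by (subst sum.reindex) (auto simp: inj_on_def)
    finally show ?thesis .
  qed
  have "xx ?bp * Vdn a s * Tw (shuffle n f) = (\<Sum>x | x \<in> {1..r} \<and> ?b (shuffle n f x) = h.
      q ^ card {y \<in> {1..r}. y < x \<and> ?b (shuffle n f y) = Suc h} * vv ?bp ((?b \<circ> shuffle n f)(x := Suc h)))"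
    by (rule lower_words[OF mb mbp blk bs d])
  also have "\<dots> = (\<Sum>x | x \<in> {1..r} \<and> ?\<rho> x = h.
      q ^ card {y \<in> {1..r}. y < x \<and> ?\<rho> y = Suc h} * vv ?bp (?\<rho>(x := Suc h)))"
  proof (rule sum.cong)
    show "{x. x \<in> {1..r} \<and> ?b (shuffle n f x) = h} = {x. x \<in> {1..r} \<and> ?\<rho> x = h}"
      using row_d by auto
    fix x
    have "{y \<in> {1..r}. y < x \<and> ?b (shuffle n f y) = Suc h} = {y \<in> {1..r}. y < x \<and> ?\<rho> y = Suc h}"
      using row_d by auto
    moreover have "vv ?bp ((?b \<circ> shuffle n f)(x := Suc h)) = vv ?bp (?\<rho>(x := Suc h))"
      using row_d by (intro vv_cong) simp
    ultimately show "q ^ card {y \<in> {1..r}. y < x \<and> ?b (shuffle n f y) = Suc h} * vv ?bp ((?b \<circ> shuffle n f)(x := Suc h))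
      = q ^ card {y \<in> {1..r}. y < x \<and> ?\<rho> y = Suc h} * vv ?bp (?\<rho>(x := Suc h))" by (simp only:)
  qed
  also have "{x. x \<in> {1..r} \<and> ?\<rho> x = h} = (\<Union>k\<in>{..<n}. {x \<in> {1..r}. blk f x = k * n + h})"
  proof (intro Set.set_eqI iffI)
    fix x assume x: "x \<in> {x. x \<in> {1..r} \<and> ?\<rho> x = h}"
    then have "blk f x div n < n" using blk_bounds(1)[of x f "n * n"] r by (simp add: less_mult_imp_div_less)
    moreover have "blk f x = blk f x div n * n + h"
      using x by (metis (mono_tags, lifting) mem_Collect_eq div_mult_mod_eq)
    ultimately show "x \<in> (\<Union>k\<in>{..<n}. {x \<in> {1..r}. blk f x = k * n + h})" using x by blast
  next
    fix x assume "x \<in> (\<Union>k\<in>{..<n}. {x \<in> {1..r}. blk f x = k * n + h})"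
    then show "x \<in> {x. x \<in> {1..r} \<and> ?\<rho> x = h}" using div_mod_index(3)[OF h] by auto
  qed
  also have "(\<Sum>x\<in>\<dots>. q ^ card {y \<in> {1..r}. y < x \<and> ?\<rho> y = Suc h} * vv ?bp (?\<rho>(x := Suc h))) =
    (\<Sum>k<n. \<Sum>x | x \<in> {1..r} \<and> blk f x = k * n + h.
      q ^ card {y \<in> {1..r}. y < x \<and> ?\<rho> y = Suc h} * vv ?bp (?\<rho>(x := Suc h)))"
    using n by (intro sum.UNION_disjoint) auto
  finally have words: "xx ?bp * Vdn a s * Tw (shuffle n f) =
    (\<Sum>k<n. \<Sum>x | x \<in> {1..r} \<and> blk f x = k * n + h.
      q ^ card {y \<in> {1..r}. y < x \<and> ?\<rho> y = Suc h} * vv ?bp (?\<rho>(x := Suc h)))" .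
  have block: "(\<Sum>x | x \<in> {1..r} \<and> blk f x = k * n + h.
      q ^ card {y \<in> {1..r}. y < x \<and> ?\<rho> y = Suc h} * vv ?bp (?\<rho>(x := Suc h))) * cst f ex 0 (n * n) * sig n f
    = q ^ (\<Sum>j<k. f (Suc (j * n + h))) * lower_terms n f ex qi (k * n + h)" if k: "k < n" for k
  proof (cases "0 < f (k * n + h)")
    case False
    have tm: "k * n + h < n * n" using index_less[OF k h] by simp
    have "{x \<in> {1..r}. blk f x = k * n + h} = {}"
      unfolding r blk_vimage[OF tm] using False by (simp add: ps_Suc)
    then have "(\<Sum>x | x \<in> {1..r} \<and> blk f x = k * n + h.
      q ^ card {y \<in> {1..r}. y < x \<and> ?\<rho> y = Suc h} * vv ?bp (?\<rho>(x := Suc h))) = 0"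
      by (simp only: sum.empty)
    moreover have "lower_terms n f ex qi (k * n + h) = 0"
      using ex[OF tm] False by (simp add: lower_terms_def)
    ultimately show ?thesis by simp
  next
    case True
    let ?t = "k * n + h"
    let ?s = "ps f (Suc ?t)" and ?i = "Suc (ps f ?t)"
    have tm: "?t < n * n" using index_less[OF k h] by simp
    have set: "{x \<in> {1..r}. blk f x = ?t} = {?i..?s}" unfolding r blk_vimage[OF tm] ..
    have er: "?s \<le> r" unfolding r using tm by (intro ps_mono) simp
    have \<rho>: "?\<rho> x = h" if "x \<in> {?i..?s}" for x
    proof -
      have "blk f x = ?t" using that by (intro blk_unique) auto
      then show ?thesis using div_mod_index(3)[OF h] by simp
    qed
    have "(\<Sum>x\<in>{?i..?s}. q ^ card {y \<in> {1..r}. y < x \<and> ?\<rho> y = Suc h} * vv ?bp (?\<rho>(x := Suc h))) =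
      (\<Sum>x\<in>{?i..?s}. q ^ (\<Sum>j<k. f (Suc (j * n + h))) * (vv ?bp (?\<rho>(?s := Suc h)) * dn x ?s))"
    proof (rule sum.cong[OF refl])
      fix x assume x: "x \<in> {?i..?s}"
      then have "x \<in> {x \<in> {1..r}. blk f x = ?t}" unfolding set .
      then have "card {y \<in> {1..r}. y < x \<and> ?\<rho> y = Suc h} = (\<Sum>j<k. f (Suc (j * n + h)))"
        using cnt[OF k] by blast
      moreover have "vv ?bp (?\<rho>(?s := Suc h)) * dn x ?s = vv ?bp (?\<rho>(x := Suc h))"
        using x er by (intro word_dn[OF mbp \<rho>]) auto
      ultimately show "q ^ card {y \<in> {1..r}. y < x \<and> ?\<rho> y = Suc h} * vv ?bp (?\<rho>(x := Suc h)) =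
        q ^ (\<Sum>j<k. f (Suc (j * n + h))) * (vv ?bp (?\<rho>(?s := Suc h)) * dn x ?s)" by (simp only:)
    qed
    then have "(\<Sum>x\<in>{?i..?s}. q ^ card {y \<in> {1..r}. y < x \<and> ?\<rho> y = Suc h} * vv ?bp (?\<rho>(x := Suc h))) =
      q ^ (\<Sum>j<k. f (Suc (j * n + h))) * (vv ?bp (?\<rho>(?s := Suc h)) * Vdn ?i ?s)"
      by (simp only: Vdn_def sum_distrib_left)
    moreover have "vv ?bp (?\<rho>(?s := Suc h)) * Vdn ?i ?s * cst f ex 0 (n * n) * sig n f = lower_terms n f ex qi ?t"
    proof (rule block_lower[OF r h k refl True ex qi])
      fix x assume x: "x \<in> {1..r}"
      have "blk ?R' x = blk (rowsum n (f(?t := f ?t - 1, Suc ?t := Suc (f (Suc ?t))))) x"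
        using rowsum_move_down[of k n h f, OF k h True] x rR psR' by (intro blk_cong[of n]) auto
      then show "?bp x = blk (rowsum n (f(?t := f ?t - 1, Suc ?t := Suc (f (Suc ?t))))) x"
        using bp[OF x] by simp
    qed
    ultimately show ?thesis unfolding set by (simp only: mult.assoc)
  qed
  show ?thesis
    unfolding words by (subst sum_mult_mult, rule sum.cong[OF refl], simp only: lessThan_iff block)
qed

end

section \<open>Diagonal and elementary matrices\<close>

definition dmat :: "nat \<Rightarrow> (nat \<Rightarrow> nat) \<Rightarrow> nat \<Rightarrow> nat" where
  "dmat n g u = (if u div n = u mod n then g (u div n) else 0)"

lemma dmat_index: "j < n \<Longrightarrow> dmat n g (k * n + j) = (if j = k then g k else 0)"
  by (auto simp: dmat_def)

lemma colsum_dmat: "k < n \<Longrightarrow> colsum n (dmat n g) k = g k"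
  by (simp add: colsum_def dmat_index)

lemma rowsum_dmat:
  assumes "h < n"
  shows "rowsum n (dmat n g) h = g h"
proof -
  have "rowsum n (dmat n g) h = (\<Sum>k<n. if h = k then g k else 0)"
    unfolding rowsum_def by (rule sum.cong) (simp_all add: dmat_index assms)
  then show ?thesis using assms by simp
qed

lemma ps_dmat:
  assumes "k < n" "j \<le> n"
  shows "ps (dmat n g) (k * n + j) = ps g k + (if k < j then g k else 0)"
proof -
  have "ps (dmat n g) (k * n) = ps g k"
    unfolding ps_colsum using assms by (intro ps_cong colsum_dmat) simp
  moreover have "(\<Sum>v<j. dmat n g (k * n + v)) = (\<Sum>v<j. if v = k then g k else 0)"
    using assms by (intro sum.cong) (simp_all add: dmat_index)
  ultimately show ?thesis by (simp add: ps_add)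
qed

lemma ps_dmat_total: "ps (dmat n g) (n * n) = ps g n"
  unfolding ps_colsum by (intro ps_cong colsum_dmat)

lemma blk_dmat:
  assumes x: "x \<in> {1..ps g n}"
  shows "blk (dmat n g) x = blk g x * n + blk g x"
proof (rule blk_unique)
  note b = blk_bounds[OF x]
  show "ps (dmat n g) (blk g x * n + blk g x) < x" using ps_dmat[of "blk g x" n "blk g x" g] b by simp
  have "ps (dmat n g) (blk g x * n + Suc (blk g x)) = ps g (Suc (blk g x))"
    using ps_dmat[of "blk g x" n "Suc (blk g x)" g] b(1) by (simp add: ps_Suc)
  then show "x \<le> ps (dmat n g) (Suc (blk g x * n + blk g x))" using b(3) by simp
qed

lemma blk_dmat_div_mod:
  assumes x: "x \<in> {1..ps g n}"
  shows "blk (dmat n g) x div n = blk g x" "blk (dmat n g) x mod n = blk g x"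
  using blk_bounds(1)[OF x] by (simp_all add: blk_dmat[OF x])

context hecke_clifford_ring
begin

lemma cst_0: "cst f (\<lambda>_. 0) l m = 1"
  by (simp add: cst_def map_replicate_const)

lemma SS_dr_yg_same:
  assumes b: "mono_on {1..r} b"
  shows "SS (dr r b \<inter> yg r b) = 1"
proof -
  have id: "id \<in> dr r b" by (simp add: dr_def permutes_id)
  have "d = id" if "d \<in> dr r b" "d \<in> yg r b" for d
    using dr_unique[OF b id that(2)] that(1) by simp
  then have "dr r b \<inter> yg r b = {id}" using id id_yg by blast
  then show ?thesis by (simp add: SS_def)
qed

text \<open>For a diagonal matrix the rows, the columns and the nonempty cells give the same
  partition, so the word is sorted and the sum \<Sigma> reduces to 1.\<close>

lemma tst_diag:
  assumes r: "r = ps g n"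
  shows "tst n (dmat n g) (\<lambda>_. 0) = xx (blk g)"
proof -
  let ?f = "dmat n g"
  have mono: "mono_on {1..r} (blk g)" unfolding r by (rule blk_mono)
  have rowb: "blk (rowsum n ?f) x = blk g x" if "x \<in> {1..r}" for x
    by (rule blk_cong[of n, symmetric]) (use that r in \<open>auto simp: rowsum_dmat\<close>)
  have "vv (blk (rowsum n ?f)) (\<lambda>x. blk ?f x mod n) = xx (blk g)"
    by (intro arg_cong[of _ _ SS] fibre_cong) (simp_all only: rowb r blk_dmat_div_mod)
  moreover have "sig n ?f = 1"
  proof -
    have "dr r (blk ?f) = dr r (blk g)"
    proof (rule dr_cong_iff)
      fix x y assume "x \<in> {1..r}" "y \<in> {1..r}"
      then show "blk ?f x = blk ?f y \<longleftrightarrow> blk g x = blk g y"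
        using blk_dmat_div_mod(1) r by (metis blk_dmat)
    qed
    moreover have "yg r (\<lambda>x. blk ?f x div n) = yg r (blk g)"
      by (rule fibre_cong) (simp_all only: r blk_dmat_div_mod)
    ultimately show ?thesis unfolding sig_def by (simp add: SS_dr_yg_same[OF mono])
  qed
  ultimately show ?thesis unfolding tst_def by (simp add: cst_0)
qed

text \<open>\<open>f\<close> is a diagonal matrix with one unit moved within its column into the
  cell \<open>u\<close>. The word equals the partition by rows, so that it is an \<open>x\<close>,
  and the cells refine the columns precisely by isolating \<open>s\<close>.\<close>

lemma tst_elementary:
  assumes r: "r = ps g n" and f: "ps f (n * n) = r"
    and row: "\<And>x. x \<in> {1..r} \<Longrightarrow> blk (rowsum n f) x = ((blk g)(s := u mod n)) x"
    and b: "\<And>x. x \<in> {1..r} \<Longrightarrow> blk f x = ((blk (dmat n g))(s := u)) x"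
    and s: "s \<in> {1..r}" "blk g s = u div n" and u: "u mod n \<noteq> u div n"
  shows "isolates r (blk g) (blk f) s"
    and "tst n f (\<lambda>_. 0) = xx ((blk g)(s := u mod n)) * SS (dr r (blk f) \<inter> yg r (blk g))"
proof -
  have div: "blk f x div n = blk g x" if "x \<in> {1..r}" for x
    using b[OF that] s(2) blk_dmat_div_mod(1)[of x g n] that r by (cases "x = s") auto
  have mod: "blk f x mod n = ((blk g)(s := u mod n)) x" if "x \<in> {1..r}" for x
    using b[OF that] blk_dmat_div_mod(2)[of x g n] that r by (cases "x = s") auto
  show "isolates r (blk g) (blk f) s"
    unfolding isolates_def
  proof (intro conjI s(1) ballI)
    fix x y assume xy: "x \<in> {1..r}" "y \<in> {1..r}"
    have eq: "blk f x = blk f y \<longleftrightarrow> blk f x div n = blk f y div n \<and> blk f x mod n = blk f y mod n"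
      by (metis div_mult_mod_eq)
    show "blk f x = blk f y \<longleftrightarrow> blk g x = blk g y \<and> (x = s \<longleftrightarrow> y = s)"
      unfolding eq div[OF xy(1)] div[OF xy(2)] mod[OF xy(1)] mod[OF xy(2)]
      using s(2) u by (cases "x = s"; cases "y = s") auto
  qed
  have "vv (blk (rowsum n f)) (\<lambda>x. blk f x mod n) = xx ((blk g)(s := u mod n))"
    by (intro arg_cong[of _ _ SS] fibre_cong) (simp_all only: row mod)
  moreover have "yg r (\<lambda>x. blk f x div n) = yg r (blk g)"
    by (rule fibre_cong) (simp_all only: div)
  ultimately show "tst n f (\<lambda>_. 0) = xx ((blk g)(s := u mod n)) * SS (dr r (blk f) \<inter> yg r (blk g))"
    unfolding tst_def sig_def by (simp add: cst_0)
qed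

text \<open>The moved unit is the first position of its column block, so \<Sigma> consists of
  ascending chains. In the lowering case it is the last position and the chains descend.\<close>

lemma tst_elementary_up:
  assumes r: "r = ps g n" and h: "Suc h < n" and g: "0 < g (Suc h)"
  defines "u \<equiv> Suc h * n + h" and "s \<equiv> Suc (ps g (Suc h))"
  shows "tst n ((dmat n g)(u := 1, Suc u := g (Suc h) - 1)) (\<lambda>_. 0) =
    xx ((blk g)(s := h)) * Vup s (ps g (Suc (Suc h)))"
proof -
  let ?d = "dmat n g"
  let ?f = "?d(u := Suc (?d u), Suc u := ?d (Suc u) - 1)"
  have Su: "Suc u = Suc h * n + Suc h" by (simp add: u_def)
  have du: "?d u = 0" using dmat_index[of h n g "Suc h"] h by (simp add: u_def)
  have dSu: "?d (Suc u) = g (Suc h)" unfolding Su using dmat_index[of "Suc h" n g "Suc h"] h by simp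
  have f: "(?d)(u := 1, Suc u := g (Suc h) - 1) = ?f" by (simp add: du dSu One_nat_def)
  have pos: "0 < ?d (Suc u)" using g dSu by simp
  have Sum: "Suc u < n * n" using index_less[OF h h] by (simp add: u_def)
  have psS: "ps ?d (Suc u) = ps g (Suc h)" unfolding Su using ps_dmat[of "Suc h" n "Suc h" g] h by simp
  have dm: "u div n = Suc h" "u mod n = h" using div_mod_index[OF h, of "Suc h"] by (simp_all add: u_def)
  have psf: "ps ?f (n * n) = r" using Sum by (simp add: ps_move_up[of ?d u, OF pos] ps_dmat_total r)
  have blkf: "blk ?f x = ((blk ?d)(s := u)) x" if "x \<in> {1..r}" for x
    using blk_move_up[of ?d u x "n * n", OF pos] that by (simp add: psS s_def ps_dmat_total r)
  have row: "blk (rowsum n ?f) x = ((blk g)(s := u mod n)) x" if "x \<in> {1..r}" for x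
  proof -
    have pos': "0 < ?d (Suc (Suc h * n + h))" using pos by (simp add: u_def)
    let ?g = "g(h := Suc (g h), Suc h := g (Suc h) - 1)"
    have "rowsum n ?f h' = ?g h'" if "h' < n" for h'
      using rowsum_move_up[of "Suc h" n h ?d h', OF h h pos' that, folded u_def] that h
      by (auto simp: rowsum_dmat fun_upd_def split: if_splits)
    moreover have "ps ?g n = ps g n" using h by (simp add: ps_move_up[of g h, OF g])
    ultimately have "blk ?g x = blk (rowsum n ?f) x" using that r by (intro blk_cong[of n]) auto
    then show ?thesis using blk_move_up[of g h x n, OF g] that by (simp add: r s_def dm)
  qed
  have blk: "interval_block r (blk g) s (ps g (Suc (Suc h)))"
    unfolding r s_def by (rule blk_interval_block[of "Suc h" n g, OF h g])
  have s: "s \<in> {1..r}" using interval_block_bounds[OF blk] by auto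
  have bs: "blk g s = u div n" unfolding s_def dm using g by (intro blk_unique) (simp_all add: ps_Suc)
  have ne: "u mod n \<noteq> u div n" by (simp add: dm)
  have iso: "isolates r (blk g) (blk ?f) s"
    by (rule tst_elementary(1)[OF r psf row blkf s bs ne])
  have tst: "tst n ?f (\<lambda>_. 0) = xx ((blk g)(s := u mod n)) * SS (dr r (blk ?f) \<inter> yg r (blk g))"
    by (rule tst_elementary(2)[OF r psf row blkf s bs ne])
  have mono: "mono_on {1..r} (blk ?f)" unfolding psf[symmetric] by (rule blk_mono)
  show ?thesis
    unfolding f tst SS_first[OF mono iso blk] dm ..
qed

lemma tst_elementary_down:
  assumes r: "r = ps g n" and h: "Suc h < n" and g: "0 < g h"
  defines "u \<equiv> h * n + h" and "s \<equiv> ps g (Suc h)"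
  shows "tst n ((dmat n g)(u := g h - 1, Suc u := 1)) (\<lambda>_. 0) =
    xx ((blk g)(s := Suc h)) * Vdn (Suc (ps g h)) s"
proof -
  let ?d = "dmat n g"
  let ?f = "?d(u := ?d u - 1, Suc u := Suc (?d (Suc u)))"
  have Su: "Suc u = h * n + Suc h" by (simp add: u_def)
  have du: "?d u = g h" using dmat_index[of h n g h] h by (simp add: u_def)
  have dSu: "?d (Suc u) = 0" unfolding Su using dmat_index[of "Suc h" n g h] h by simp
  have f: "(?d)(u := g h - 1, Suc u := 1) = ?f" by (simp add: du dSu One_nat_def)
  have pos: "0 < ?d u" using g du by simp
  have hn: "h < n" using h by simp
  have Sum: "Suc u < n * n" using index_less[OF hn h] by (simp add: u_def)
  have psS: "ps ?d (Suc u) = ps g (Suc h)"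
    unfolding Su using ps_dmat[of h n "Suc h" g] h by (simp add: ps_Suc)
  have dm: "u div n = h" "Suc u div n = h" "Suc u mod n = Suc h"
    using div_mod_index[OF h, of h] by (simp_all add: u_def)
  have psf: "ps ?f (n * n) = r" using Sum by (simp add: ps_move_down[of ?d u, OF pos] ps_dmat_total r)
  have blkf: "blk ?f x = ((blk ?d)(s := Suc u)) x" if "x \<in> {1..r}" for x
    using blk_move_down[of ?d u x "n * n", OF pos] that by (simp add: psS s_def ps_dmat_total r)
  have row: "blk (rowsum n ?f) x = ((blk g)(s := Suc u mod n)) x" if "x \<in> {1..r}" for x
  proof -
    have pos': "0 < ?d (h * n + h)" using pos by (simp add: u_def)
    let ?g = "g(h := g h - 1, Suc h := Suc (g (Suc h)))"
    have "rowsum n ?f h' = ?g h'" if "h' < n" for h'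
      using rowsum_move_down[of h n h ?d h', OF hn h pos' that, folded u_def] that h
      by (auto simp: rowsum_dmat fun_upd_def split: if_splits)
    moreover have "ps ?g n = ps g n" using h by (simp add: ps_move_down[of g h, OF g])
    ultimately have "blk ?g x = blk (rowsum n ?f) x" using that r by (intro blk_cong[of n]) auto
    then show ?thesis using blk_move_down[of g h x n, OF g] that by (simp add: r s_def dm)
  qed
  have blk: "interval_block r (blk g) (Suc (ps g h)) s"
    unfolding r s_def by (rule blk_interval_block[of h n g, OF hn g])
  have s: "s \<in> {1..r}" using interval_block_bounds[OF blk] by auto
  have bs: "blk g s = Suc u div n" unfolding s_def dm using g by (intro blk_unique) (simp_all add: ps_Suc)
  have ne: "Suc u mod n \<noteq> Suc u div n" by (simp add: dm)
  have iso: "isolates r (blk g) (blk ?f) s"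
    by (rule tst_elementary(1)[OF r psf row blkf s bs ne])
  have tst: "tst n ?f (\<lambda>_. 0) = xx ((blk g)(s := Suc u mod n)) * SS (dr r (blk ?f) \<inter> yg r (blk g))"
    by (rule tst_elementary(2)[OF r psf row blkf s bs ne])
  have mono: "mono_on {1..r} (blk ?f)" unfolding psf[symmetric] by (rule blk_mono)
  show ?thesis
    unfolding f tst SS_last[OF mono iso blk] dm ..
qed

end

section \<open>The quotient of the free algebra\<close>

definition conv :: "(gen list \<Rightarrow> 'a::comm_ring_1) \<Rightarrow> (gen list \<Rightarrow> 'a) \<Rightarrow> gen list \<Rightarrow> 'a" where
  "conv f g w = (\<Sum>k\<le>length w. f (take k w) * g (drop k w))"

lemma free_alg_carrier:
    "carrier (free_alg r) = {f. finite {w. f w \<noteq> 0} \<and> (\<forall>w. f w \<noteq> 0 \<longrightarrow> set w \<subseteq> gens r)}"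
  and free_alg_mult: "f \<otimes>\<^bsub>free_alg r\<^esub> g = conv f g"
  and free_alg_one: "\<one>\<^bsub>free_alg r\<^esub> = (\<lambda>w. if w = [] then 1 else 0)"
  and free_alg_zero: "\<zero>\<^bsub>free_alg r\<^esub> = (\<lambda>w. 0)"
  and free_alg_add: "f \<oplus>\<^bsub>free_alg r\<^esub> g = (\<lambda>w. f w + g w)"
  and free_alg_smult: "a \<odot>\<^bsub>free_alg r\<^esub> f = (\<lambda>w. a * f w)"
  by (simp_all add: free_alg_def conv_def fun_eq_iff)

lemma free_algD: "f \<in> carrier (free_alg r) \<Longrightarrow> f w \<noteq> 0 \<Longrightarrow> set w \<subseteq> gens r"
  by (simp add: free_alg_carrier)

lemma conv_assoc: "conv (conv f g) h = conv f (conv g h)"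
proof
  fix w :: "gen list"
  let ?N = "length w"
  \<comment> \<open>Both iterated products are sums over the splittings of \<open>w\<close> into
    parts of length \<open>j\<close>, of length \<open>i\<close>, and a remainder.\<close>
  define G where "G j i = f (take j w) * g (take i (drop j w)) * h (drop (j + i) w)" for j i
  have "conv (conv f g) h w = (\<Sum>k\<le>?N. \<Sum>j\<le>k. G j (k - j))"
    unfolding conv_def[of "conv f g"]
  proof (rule sum.cong)
    fix k assume "k \<in> {..?N}"
    then have "conv f g (take k w) = (\<Sum>j\<le>k. f (take j w) * g (take (k - j) (drop j w)))"
      unfolding conv_def by (intro sum.cong) (auto simp: drop_take min_def)
    then show "conv f g (take k w) * h (drop k w) = (\<Sum>j\<le>k. G j (k - j))"
      by (simp add: G_def sum_distrib_right)
  qed simp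
  also have "\<dots> = (\<Sum>(j, i)\<in>{(j, i). j + i \<le> ?N}. G j i)"
    by (rule sum.triangle_reindex_eq[symmetric])
  also have "{(j, i). j + i \<le> ?N} = Sigma {..?N} (\<lambda>j. {..?N - j})" by auto
  also have "(\<Sum>(j, i)\<in>\<dots>. G j i) = (\<Sum>j\<le>?N. \<Sum>i\<le>?N - j. G j i)"
    by (rule sum.Sigma[symmetric]) auto
  also have "\<dots> = conv f (conv g h) w"
    unfolding conv_def by (simp add: G_def sum_distrib_left mult.assoc add.commute)
  finally show "conv (conv f g) h w = conv f (conv g h) w" .
qed

lemma one_conv: "conv (\<lambda>w. if w = [] then 1 else 0) f = f"
proof
  fix w
  have "conv (\<lambda>w. if w = [] then 1 else 0) f w = (\<Sum>k\<le>length w. if k = 0 then f (drop k w) else 0)"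
    unfolding conv_def by (intro sum.cong) auto
  then show "conv (\<lambda>w. if w = [] then 1 else 0) f w = f w" by simp
qed

lemma conv_one: "conv f (\<lambda>w. if w = [] then 1 else 0) = f"
proof
  fix w
  have "conv f (\<lambda>w. if w = [] then 1 else 0) w = (\<Sum>k\<le>length w. if k = length w then f (take k w) else 0)"
    unfolding conv_def by (intro sum.cong) auto
  then show "conv f (\<lambda>w. if w = [] then 1 else 0) w = f w" by simp
qed

lemma conv_closed:
  assumes "f \<in> carrier (free_alg r)" "g \<in> carrier (free_alg r)"
  shows "conv f g \<in> carrier (free_alg r)"
proof -
  have split: "\<exists>u v. w = u @ v \<and> f u \<noteq> 0 \<and> g v \<noteq> 0" if nz: "conv f g w \<noteq> 0" for w
  proof -
    obtain k where "f (take k w) * g (drop k w) \<noteq> 0"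
      using nz unfolding conv_def by (metis (mono_tags, lifting) sum.neutral)
    then have "f (take k w) \<noteq> 0" "g (drop k w) \<noteq> 0" by auto
    then show ?thesis by (metis append_take_drop_id)
  qed
  have "{w. conv f g w \<noteq> 0} \<subseteq> (\<lambda>(u, v). u @ v) ` ({u. f u \<noteq> 0} \<times> {v. g v \<noteq> 0})"
    using split by (force simp: image_iff)
  then have "finite {w. conv f g w \<noteq> 0}"
    by (rule finite_subset) (use assms in \<open>simp add: free_alg_carrier\<close>)
  moreover have "set w \<subseteq> gens r" if "conv f g w \<noteq> 0" for w
    using split[OF that] free_algD[OF assms(1)] free_algD[OF assms(2)] by fastforce
  ultimately show ?thesis by (simp add: free_alg_carrier)
qed

lemma smult_closed: "f \<in> carrier (free_alg r) \<Longrightarrow> a \<odot>\<^bsub>free_alg r\<^esub> f \<in> carrier (free_alg r)"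
proof -
  assume f: "f \<in> carrier (free_alg r)"
  have "{w. a * f w \<noteq> 0} \<subseteq> {w. f w \<noteq> 0}" by auto
  moreover have "finite {w. f w \<noteq> 0}" using f by (simp add: free_alg_carrier)
  ultimately have "finite {w. a * f w \<noteq> 0}" by (rule finite_subset)
  moreover have "set w \<subseteq> gens r" if "a * f w \<noteq> 0" for w
    using free_algD[OF f, of w] that by fastforce
  ultimately show ?thesis by (simp add: free_alg_carrier free_alg_smult)
qed

lemma one_closed: "\<one>\<^bsub>free_alg r\<^esub> \<in> carrier (free_alg r)"
  unfolding free_alg_carrier free_alg_one by (auto intro: finite_subset[of _ "{[]}"])

lemma gen_closed: "x \<in> gens r \<Longrightarrow> free_gen x \<in> carrier (free_alg r)"
  unfolding free_alg_carrier free_gen_def by (auto intro: finite_subset[of _ "{[x]}"])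

lemma add_closed:
  assumes "f \<in> carrier (free_alg r)" "g \<in> carrier (free_alg r)"
  shows "f \<oplus>\<^bsub>free_alg r\<^esub> g \<in> carrier (free_alg r)"
proof -
  have "{w. f w + g w \<noteq> 0} \<subseteq> {w. f w \<noteq> 0} \<union> {w. g w \<noteq> 0}" by auto
  then have "finite {w. f w + g w \<noteq> 0}"
    by (rule finite_subset) (use assms in \<open>simp add: free_alg_carrier\<close>)
  moreover have "set w \<subseteq> gens r" if "f w + g w \<noteq> 0" for w
  proof -
    have "f w \<noteq> 0 \<or> g w \<noteq> 0" using that by auto
    then show ?thesis using assms by (auto simp: free_alg_carrier)
  qed
  ultimately show ?thesis by (simp add: free_alg_carrier free_alg_add)
qed

lemma free_alg_ring: "ring (free_alg r :: ('a::comm_ring_1, gen list \<Rightarrow> 'a) module)"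
proof (rule ringI)
  show "abelian_group (free_alg r :: ('a, gen list \<Rightarrow> 'a) module)"
  proof (rule abelian_groupI)
    fix f :: "gen list \<Rightarrow> 'a" assume f: "f \<in> carrier (free_alg r)"
    have "(- 1) \<odot>\<^bsub>free_alg r\<^esub> f \<oplus>\<^bsub>free_alg r\<^esub> f = \<zero>\<^bsub>free_alg r\<^esub>"
      by (simp add: free_alg_add free_alg_smult free_alg_zero)
    then show "\<exists>g\<in>carrier (free_alg r). g \<oplus>\<^bsub>free_alg r\<^esub> f = \<zero>\<^bsub>free_alg r\<^esub>"
      using smult_closed[OF f] by blast
  qed (simp_all add: add_closed, simp_all add: free_alg_carrier free_alg_add free_alg_zero add_ac)
  show "Group.monoid (free_alg r :: ('a, gen list \<Rightarrow> 'a) module)"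
    by (rule monoidI)
      (simp_all only: free_alg_mult conv_closed one_closed[unfolded free_alg_one] conv_assoc free_alg_one
        one_conv conv_one)
qed (simp_all add: free_alg_mult free_alg_add conv_def distrib_left distrib_right sum.distrib fun_eq_iff)

lemma smult_mult:
  "conv (a \<odot>\<^bsub>free_alg r\<^esub> f) g = a \<odot>\<^bsub>free_alg r\<^esub> conv f g"
  "conv f (a \<odot>\<^bsub>free_alg r\<^esub> g) = a \<odot>\<^bsub>free_alg r\<^esub> conv f g"
  by (simp_all add: conv_def free_alg_smult fun_eq_iff sum_distrib_left mult_ac)

lemma hc_rels_closed:
  assumes "(a, b) \<in> hc_rels q r"
  shows "a \<in> carrier (free_alg r)" "b \<in> carrier (free_alg r)"
proof -
  interpret F: ring "free_alg r :: ('a, gen list \<Rightarrow> 'a) module" by (rule free_alg_ring)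
  have T: "free_gen (GT i) \<in> carrier (free_alg r :: ('a, gen list \<Rightarrow> 'a) module)" if "1 \<le> i" "i < r" for i
    using that by (intro gen_closed) (simp add: gens_def)
  have c: "free_gen (GC i) \<in> carrier (free_alg r :: ('a, gen list \<Rightarrow> 'a) module)" if "1 \<le> i" "i \<le> r" for i
    using that by (intro gen_closed) (simp add: gens_def)
  have "hc_rels q r \<subseteq> carrier (free_alg r) \<times> carrier (free_alg r)"
    unfolding hc_rels_def Let_def
    by (intro Un_least subsetI; elim CollectE exE conjE; simp add: T c smult_closed)
  then show "a \<in> carrier (free_alg r)" "b \<in> carrier (free_alg r)" using assms by auto
qed

lemma hc_ideal_ideal: "ideal (hc_ideal q r) (free_alg r)"
proof -
  interpret F: ring "free_alg r :: ('a, gen list \<Rightarrow> 'a) module" by (rule free_alg_ring)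
  show ?thesis
    unfolding hc_ideal_def
    by (rule F.genideal_ideal) (auto dest: hc_rels_closed intro: F.minus_closed)
qed

section \<open>Classes modulo the ideal of relations\<close>

definition cls :: "'a::comm_ring_1 \<Rightarrow> nat \<Rightarrow> (gen list \<Rightarrow> 'a) \<Rightarrow> (gen list \<Rightarrow> 'a) set" where
  "cls q r f = hc_ideal q r +>\<^bsub>free_alg r :: ('a, gen list \<Rightarrow> 'a) module\<^esub> f"

lemma hc_sel:
  "carrier (hecke_clifford q r) = carrier (free_alg r Quot hc_ideal q r)"
  "monoid.mult (hecke_clifford q r) = monoid.mult (free_alg r Quot hc_ideal q r)"
  "one (hecke_clifford q r) = one (free_alg r Quot hc_ideal q r)"
  "zero (hecke_clifford q r) = zero (free_alg r Quot hc_ideal q r)"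
  "add (hecke_clifford q r) = add (free_alg r Quot hc_ideal q r)"
  by (simp_all add: hecke_clifford_def Let_def)

lemma hc_ring: "ring (hecke_clifford q r)"
proof -
  interpret Q: ring "free_alg r Quot hc_ideal q r"
    by (rule ideal.quotient_is_ring[OF hc_ideal_ideal])
  show ?thesis
  proof (rule ringI)
    show "abelian_group (hecke_clifford q r)"
      by (rule abelian_groupI, unfold hc_sel)
        (auto simp: Q.a_ac intro: bexI[of _ "\<ominus>\<^bsub>free_alg r Quot hc_ideal q r\<^esub> x" for x] Q.l_neg)
    show "Group.monoid (hecke_clifford q r)"
      by (rule monoidI, unfold hc_sel) (simp_all add: Q.m_assoc)
  qed (unfold hc_sel, simp_all add: Q.l_distr Q.r_distr)
qed

lemma cls_hom: "ring_hom_ring (free_alg r) (hecke_clifford q r) (cls q r)"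
proof -
  have "cls q r \<in> ring_hom (free_alg r) (free_alg r Quot hc_ideal q r)"
    using ideal.rcos_ring_hom[OF hc_ideal_ideal[of q r]] by (simp add: cls_def[abs_def])
  then have "cls q r \<in> ring_hom (free_alg r) (hecke_clifford q r)"
    by (simp add: ring_hom_def hc_sel)
  then show ?thesis using free_alg_ring hc_ring by (intro ring_hom_ringI2)
qed

lemma cls_surj:
  assumes "x \<in> carrier (hecke_clifford q r)"
  obtains f where "f \<in> carrier (free_alg r)" "x = cls q r f"
  using assms unfolding hc_sel FactRing_def A_RCOSETS_def' cls_def by auto

lemma cls_eq_iff:
  assumes "f \<in> carrier (free_alg r)" "g \<in> carrier (free_alg r)"
  shows "cls q r f = cls q r g \<longleftrightarrow> f \<ominus>\<^bsub>free_alg r\<^esub> g \<in> hc_ideal q r"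
  unfolding cls_def using ring.quotient_eq_iff_same_a_r_cos[OF free_alg_ring hc_ideal_ideal assms] by simp

lemma cls_rel:
  assumes "(a, b) \<in> hc_rels q r"
  shows "cls q r a = cls q r b"
proof -
  interpret F: ring "free_alg r :: ('a, gen list \<Rightarrow> 'a) module" by (rule free_alg_ring)
  have "{a \<ominus>\<^bsub>free_alg r\<^esub> b | a b. (a, b) \<in> hc_rels q r} \<subseteq> hc_ideal q r"
    unfolding hc_ideal_def by (rule F.genideal_self) (auto dest: hc_rels_closed intro: F.minus_closed)
  then show ?thesis using assms cls_eq_iff[OF hc_rels_closed[OF assms]] by blast
qed

lemma hc_smult:
  "a \<odot>\<^bsub>hecke_clifford q r\<^esub> x = (\<Union>g\<in>x. cls q r (a \<odot>\<^bsub>free_alg r\<^esub> g))"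
  by (simp add: hecke_clifford_def Let_def cls_def)

text \<open>Multiplication by the scalar \<open>a\<close> is multiplication by the element
  \<open>a \<odot> 1\<close>, so the class of the result depends only on the class of
  \<open>f\<close>, and all members of the union that defines the scalar multiple agree.\<close>

lemma smult_cls:
  assumes f: "f \<in> carrier (free_alg r)"
  shows "a \<odot>\<^bsub>hecke_clifford q r\<^esub> cls q r f = cls q r (a \<odot>\<^bsub>free_alg r\<^esub> f)"
proof -
  interpret F: ring "free_alg r :: ('a, gen list \<Rightarrow> 'a) module" by (rule free_alg_ring)
  interpret I: ideal "hc_ideal q r" "free_alg r" by (rule hc_ideal_ideal)
  have sub: "cls q r f \<subseteq> carrier (free_alg r)"
    unfolding cls_def using f I.a_subset by (simp add: F.a_r_coset_subset_G)
  have hom: "cls q r \<in> ring_hom (free_alg r) (hecke_clifford q r)"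
    by (rule ring_hom_ring.homh[OF cls_hom])
  have self: "f \<in> cls q r f" unfolding cls_def using f by (rule I.a_rcos_self)
  have "cls q r (a \<odot>\<^bsub>free_alg r\<^esub> g) = cls q r (a \<odot>\<^bsub>free_alg r\<^esub> f)" if g: "g \<in> cls q r f" for g
  proof -
    have gc: "g \<in> carrier (free_alg r)" using sub g by blast
    have eq: "cls q r f = cls q r g"
      unfolding cls_def by (rule I.a_repr_independence'[OF g[unfolded cls_def] f])
    have scalar: "cls q r (a \<odot>\<^bsub>free_alg r\<^esub> g) =
        cls q r (a \<odot>\<^bsub>free_alg r\<^esub> \<one>\<^bsub>free_alg r\<^esub>) \<otimes>\<^bsub>hecke_clifford q r\<^esub> cls q r g"
      if g: "g \<in> carrier (free_alg r)" for g
    proof -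
      have "a \<odot>\<^bsub>free_alg r\<^esub> g = (a \<odot>\<^bsub>free_alg r\<^esub> \<one>\<^bsub>free_alg r\<^esub>) \<otimes>\<^bsub>free_alg r\<^esub> g"
        by (simp only: free_alg_mult smult_mult free_alg_one one_conv)
      then show ?thesis using ring_hom_mult[OF hom smult_closed[OF one_closed] g] by simp
    qed
    show ?thesis unfolding scalar[OF gc] scalar[OF f] eq ..
  qed
  then have "(\<Union>g\<in>cls q r f. cls q r (a \<odot>\<^bsub>free_alg r\<^esub> g)) =
      (\<Union>g\<in>cls q r f. cls q r (a \<odot>\<^bsub>free_alg r\<^esub> f))"
    by (rule SUP_cong[OF refl])
  also have "\<dots> = cls q r (a \<odot>\<^bsub>free_alg r\<^esub> f)" using self by blast
  finally show ?thesis unfolding hc_smult .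
qed

section \<open>The Hecke--Clifford superalgebra as a type\<close>

text \<open>\<open>T_star\<close>, extended by 0 according to the convention for
  \<open>phi\<close>.\<close>

definition T_elt :: "'a::comm_ring_1 \<Rightarrow> nat \<Rightarrow> nat \<Rightarrow> star_mat \<Rightarrow> (gen list \<Rightarrow> 'a) set" where
  "T_elt q n r M = (if M \<in> star_mats_deg n r then T_star q n r M else \<zero>\<^bsub>hecke_clifford q r\<^esub>)"

text \<open>\<open>T_star\<close> without its leading \<open>x_ro\<close>: the argument that the
  second homomorphism of a product receives after its generator.\<close>

definition T_tail :: "'a::comm_ring_1 \<Rightarrow> nat \<Rightarrow> nat \<Rightarrow> star_mat \<Rightarrow> (gen list \<Rightarrow> 'a) set" where
  "T_tail q n r M = (let H = hecke_clifford q r; a = base M in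
    T_perm q r (d_perm n a) \<otimes>\<^bsub>H\<^esub> c_star q n r M \<otimes>\<^bsub>H\<^esub> Sigma_elt q n r a)"

text \<open>The right-hand side of the raising formula inside the algebra, with \<open>T_elt\<close>
  in place of \<open>phi\<close>.\<close>

definition raise_sum :: "'a::comm_ring_1 \<Rightarrow> nat \<Rightarrow> nat \<Rightarrow> nat \<Rightarrow> (nat \<Rightarrow> nat \<Rightarrow> int) \<Rightarrow> (nat \<Rightarrow> nat \<Rightarrow> int) \<Rightarrow>
    (gen list \<Rightarrow> 'a) set" where
  "raise_sum q n r h A0 A1 = (let H = hecke_clifford q r; a = base (A0, A1);
      rr = (\<lambda>k. int (\<Sum>j=k+1..n. a h j)) in
    \<Oplus>\<^bsub>H\<^esub> k\<in>{1..n}.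
            (unit_pow q (rr k + A1 (h+1) k) * qnum q (nat (A0 h k) + 1))
              \<odot>\<^bsub>H\<^esub> T_elt q n r (A0 + E h k - E (h+1) k, A1)
          \<oplus>\<^bsub>H\<^esub> unit_pow q (rr k) \<odot>\<^bsub>H\<^esub> T_elt q n r (A0, A1 + E h k - E (h+1) k)
          \<oplus>\<^bsub>H\<^esub> (unit_pow q (rr k - 1) * qnum2 q (q\<^sup>2) (a h k + 1))
              \<odot>\<^bsub>H\<^esub> T_elt q n r (A0 + 2 * E h k, A1 - E h k - E (h+1) k))"

definition lower_sum :: "'a::comm_ring_1 \<Rightarrow> nat \<Rightarrow> nat \<Rightarrow> nat \<Rightarrow> (nat \<Rightarrow> nat \<Rightarrow> int) \<Rightarrow> (nat \<Rightarrow> nat \<Rightarrow> int) \<Rightarrow>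
    (gen list \<Rightarrow> 'a) set" where
  "lower_sum q n r h A0 A1 = (let H = hecke_clifford q r; a = base (A0, A1);
      rl = (\<lambda>k. int (\<Sum>u\<in>{1..<k}. a (h+1) u)) in
    \<Oplus>\<^bsub>H\<^esub> k\<in>{1..n}.
            (unit_pow q (rl k) * qnum q (nat (A0 (h+1) k) + 1))
              \<odot>\<^bsub>H\<^esub> T_elt q n r (A0 - E h k + E (h+1) k, A1)
          \<oplus>\<^bsub>H\<^esub> unit_pow q (rl k + int (a h k) - 1) \<odot>\<^bsub>H\<^esub> T_elt q n r (A0, A1 - E h k + E (h+1) k)
          \<oplus>\<^bsub>H\<^esub> (unit_pow q (rl k + int (a h k) - 2) * qnum2 q (q\<^sup>2) (a (h+1) k + 1))
              \<odot>\<^bsub>H\<^esub> T_elt q n r (A0 + 2 * E (h+1) k, A1 - E h k - E (h+1) k))"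

text \<open>All facts about the algebra on which the passage to endomorphisms relies, joined in one
  proposition for given \<open>q\<close> and \<open>r\<close>: the diagonal case, both
  factorisations of \<open>T_star\<close>, and the two product formulas.\<close>

definition hc_formulas :: "'a::comm_ring_1 \<Rightarrow> nat \<Rightarrow> bool" where
  "hc_formulas q r \<longleftrightarrow>
    (\<forall>n mu. mu \<in> compositions n r \<longrightarrow>
      x_elt q mu \<in> carrier (hecke_clifford q r) \<and> T_star q n r (diag mu, 0) = x_elt q mu) \<and>
    (\<forall>n A0 A1. (A0, A1) \<in> star_mats_deg n r \<longrightarrow>
      T_tail q n r (A0, A1) \<in> carrier (hecke_clifford q r) \<and>
      T_star q n r (A0, A1) = x_elt q (ro n (base (A0, A1))) \<otimes>\<^bsub>hecke_clifford q r\<^esub> T_tail q n r (A0, A1) \<and>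
      (\<exists>y\<in>carrier (hecke_clifford q r).
        T_star q n r (A0, A1) = y \<otimes>\<^bsub>hecke_clifford q r\<^esub> x_elt q (co n (base (A0, A1)))) \<and>
      (\<forall>h\<in>{1..n-1}. \<forall>lam. lam = ro n (base (A0, A1)) \<longrightarrow>
        ((diag lam + E h (h+1) - E (h+1) (h+1), 0) \<in> star_mats n \<longrightarrow>
          T_star q n r (diag lam + E h (h+1) - E (h+1) (h+1), 0) \<otimes>\<^bsub>hecke_clifford q r\<^esub>
            T_tail q n r (A0, A1) = raise_sum q n r h A0 A1) \<and>
        ((diag lam - E h h + E (h+1) h, 0) \<in> star_mats n \<longrightarrow>
          T_star q n r (diag lam - E h h + E (h+1) h, 0) \<otimes>\<^bsub>hecke_clifford q r\<^esub>
            T_tail q n r (A0, A1) = lower_sum q n r h A0 A1)))"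

text \<open>A type cannot depend on the parameters \<open>q\<close> and \<open>r\<close>. To calculate in the Hecke--Clifford
  superalgebra as a type of class \<open>ring\<close>, we fix parameters for which the formulas fail, if there are
  any: once they are proved for these parameters, they hold for all.\<close>

definition some_params :: "'a::comm_ring_1 \<times> nat" where
  "some_params = (SOME p. fst p dvd 1 \<and> \<not> hc_formulas (fst p) (snd p))"

definition hc0 :: "('a::comm_ring_1, (gen list \<Rightarrow> 'a) set) module" where
  "hc0 = hecke_clifford (fst (some_params :: 'a \<times> nat)) (snd (some_params :: 'a \<times> nat))"

lemma hc0_ring: "ring hc0"
  unfolding hc0_def by (rule hc_ring)

typedef (overloaded) 'a hc = "carrier (hc0 :: ('a::comm_ring_1, (gen list \<Rightarrow> 'a) set) module)"
  morphisms rep_hc abs_hc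
  using ring.ring_simprules(2)[OF hc0_ring] by blast

instantiation hc :: (comm_ring_1) "{ring, monoid_mult}"
begin

definition "x + y = abs_hc (rep_hc x \<oplus>\<^bsub>hc0\<^esub> rep_hc y)"
definition "x * y = abs_hc (rep_hc x \<otimes>\<^bsub>hc0\<^esub> rep_hc y)"
definition "- x = abs_hc (\<ominus>\<^bsub>hc0\<^esub> rep_hc x)"
definition "x - y = abs_hc (rep_hc x \<ominus>\<^bsub>hc0\<^esub> rep_hc y)"
definition "0 = abs_hc \<zero>\<^bsub>hc0\<^esub>"
definition "1 = abs_hc \<one>\<^bsub>hc0\<^esub>"

instance
proof -
  interpret R: ring "hc0 :: ('a, (gen list \<Rightarrow> 'a) set) module" by (rule hc0_ring)
  note simps = plus_hc_def times_hc_def uminus_hc_def minus_hc_def zero_hc_def one_hc_def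
    abs_hc_inverse rep_hc_inverse rep_hc
  show "OFCLASS('a hc, ring_class)"
    by standard (simp_all add: simps R.a_ac R.m_assoc R.l_distr R.r_distr R.l_neg R.r_neg R.minus_eq)
  show "OFCLASS('a hc, monoid_mult_class)"
    by standard (simp_all add: simps R.m_assoc)
qed

end

lemma
  fixes x y :: "'a::comm_ring_1 hc"
  shows rep_hc_plus: "rep_hc (x + y) = rep_hc x \<oplus>\<^bsub>hc0\<^esub> rep_hc y"
  and rep_hc_times: "rep_hc (x * y) = rep_hc x \<otimes>\<^bsub>hc0\<^esub> rep_hc y"
  and rep_hc_uminus: "rep_hc (- x) = \<ominus>\<^bsub>hc0\<^esub> rep_hc x"
  and rep_hc_minus: "rep_hc (x - y) = rep_hc x \<ominus>\<^bsub>hc0\<^esub> rep_hc y"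
  and rep_hc_zero: "rep_hc (0 :: 'a hc) = \<zero>\<^bsub>hc0\<^esub>"
  and rep_hc_one: "rep_hc (1 :: 'a hc) = \<one>\<^bsub>hc0\<^esub>"
proof -
  interpret R: ring "hc0 :: ('a, (gen list \<Rightarrow> 'a) set) module" by (rule hc0_ring)
  note simps = plus_hc_def times_hc_def uminus_hc_def minus_hc_def zero_hc_def one_hc_def
    abs_hc_inverse rep_hc_inverse rep_hc
  show "rep_hc (x + y) = rep_hc x \<oplus>\<^bsub>hc0\<^esub> rep_hc y"
    "rep_hc (x * y) = rep_hc x \<otimes>\<^bsub>hc0\<^esub> rep_hc y"
    "rep_hc (- x) = \<ominus>\<^bsub>hc0\<^esub> rep_hc x"
    "rep_hc (x - y) = rep_hc x \<ominus>\<^bsub>hc0\<^esub> rep_hc y"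
    "rep_hc (0 :: 'a hc) = \<zero>\<^bsub>hc0\<^esub>"
    "rep_hc (1 :: 'a hc) = \<one>\<^bsub>hc0\<^esub>"
    by (simp_all add: simps R.minus_closed)
qed

lemma rep_hc_sum:
  fixes F :: "'b \<Rightarrow> 'a::comm_ring_1 hc"
  shows "rep_hc (sum F A) = (\<Oplus>\<^bsub>hc0\<^esub> x\<in>A. rep_hc (F x))"
proof -
  interpret R: ring "hc0 :: ('a, (gen list \<Rightarrow> 'a) set) module" by (rule hc0_ring)
  show ?thesis
  proof (induction A rule: infinite_finite_induct)
    case (infinite A)
    then show ?case by (simp add: rep_hc_zero R.finsum_infinite)
  next
    case empty
    then show ?case by (simp add: rep_hc_zero)
  next
    case (insert x A)
    then show ?case
      by (simp add: rep_hc_plus rep_hc R.finsum_insert)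
  qed
qed

lemma rep_hc_prod_list: "rep_hc (prod_list xs) = list_mult hc0 (map rep_hc xs)"
  by (induction xs) (simp_all add: list_mult_def rep_hc_one rep_hc_times)

lemma rep_hc_power:
  fixes x :: "'a::comm_ring_1 hc"
  shows "rep_hc (x ^ m) = rep_hc x [^]\<^bsub>hc0\<^esub> m"
proof -
  interpret R: ring "hc0 :: ('a, (gen list \<Rightarrow> 'a) set) module" by (rule hc0_ring)
  show ?thesis
    by (induction m) (simp_all only: power_0 power_Suc2 rep_hc_one rep_hc_times R.nat_pow_0 R.nat_pow_Suc)
qed

section \<open>Scalars and generators in the type\<close>

definition cl :: "(gen list \<Rightarrow> 'a::comm_ring_1) \<Rightarrow> (gen list \<Rightarrow> 'a) set" where
  "cl = cls (fst (some_params :: 'a \<times> nat)) (snd (some_params :: 'a \<times> nat))"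

definition free0 :: "('a::comm_ring_1, gen list \<Rightarrow> 'a) module" where
  "free0 = free_alg (snd (some_params :: 'a \<times> nat))"

lemma cl_hom: "ring_hom_ring free0 hc0 cl"
  unfolding free0_def hc0_def cl_def by (rule cls_hom)

lemma cl_smult:
  fixes f :: "gen list \<Rightarrow> 'a::comm_ring_1"
  assumes "f \<in> carrier free0"
  shows "a \<odot>\<^bsub>hc0\<^esub> cl f = cl (a \<odot>\<^bsub>free0\<^esub> f)"
  using assms unfolding free0_def hc0_def cl_def by (rule smult_cls)

lemma rep_hc_cl: obtains f where "f \<in> carrier free0" "rep_hc x = cl f"
proof -
  obtain f where "f \<in> carrier (free_alg (snd (some_params :: 'a \<times> nat)))"
    "rep_hc x = cls (fst (some_params :: 'a \<times> nat)) (snd (some_params :: 'a \<times> nat)) f"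
    by (rule cls_surj[OF rep_hc[of x, unfolded hc0_def]])
  then show ?thesis by (intro that[of f]) (simp_all only: free0_def cl_def)
qed

text \<open>The central element that represents a scalar; it turns scalar multiplication into
  multiplication within the type.\<close>

definition sc :: "'a::comm_ring_1 \<Rightarrow> 'a hc" where
  "sc a = abs_hc (cl (a \<odot>\<^bsub>free0\<^esub> \<one>\<^bsub>free0\<^esub>))"

lemma scalar_closed: "a \<odot>\<^bsub>free0\<^esub> \<one>\<^bsub>free0\<^esub> \<in> carrier free0"
  unfolding free0_def by (rule smult_closed[OF one_closed])

lemma rep_sc: "rep_hc (sc a) = cl (a \<odot>\<^bsub>free0\<^esub> \<one>\<^bsub>free0\<^esub>)"
  unfolding sc_def
  by (intro abs_hc_inverse ring_hom_closed[OF ring_hom_ring.homh[OF cl_hom]] scalar_closed)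

lemma free0_scalar_mult:
  "(a \<odot>\<^bsub>free0\<^esub> \<one>\<^bsub>free0\<^esub>) \<otimes>\<^bsub>free0\<^esub> f = a \<odot>\<^bsub>free0\<^esub> f"
  "f \<otimes>\<^bsub>free0\<^esub> (a \<odot>\<^bsub>free0\<^esub> \<one>\<^bsub>free0\<^esub>) = a \<odot>\<^bsub>free0\<^esub> f"
  unfolding free0_def by (simp_all only: free_alg_mult smult_mult free_alg_one one_conv conv_one)

lemma rep_sc_mult: "rep_hc (sc a * x) = a \<odot>\<^bsub>hc0\<^esub> rep_hc x"
proof -
  obtain f where f: "f \<in> carrier free0" "rep_hc x = cl f" by (rule rep_hc_cl)
  show ?thesis
    unfolding rep_hc_times rep_sc f(2)
    using ring_hom_mult[OF ring_hom_ring.homh[OF cl_hom] scalar_closed f(1)]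
    by (simp add: cl_smult[OF f(1)] free0_scalar_mult)
qed

lemma sc_central: "sc a * x = x * sc a"
proof -
  obtain f where f: "f \<in> carrier free0" "rep_hc x = cl f" by (rule rep_hc_cl)
  have "rep_hc (sc a * x) = rep_hc (x * sc a)"
    unfolding rep_hc_times rep_sc f(2)
    using ring_hom_mult[OF ring_hom_ring.homh[OF cl_hom] scalar_closed f(1)]
      ring_hom_mult[OF ring_hom_ring.homh[OF cl_hom] f(1) scalar_closed]
    by (simp add: free0_scalar_mult)
  then show ?thesis by (simp add: rep_hc_inject)
qed

lemma sc_1: "sc 1 = 1"
proof -
  have "(1::'a) \<odot>\<^bsub>free0\<^esub> \<one>\<^bsub>free0\<^esub> = \<one>\<^bsub>free0\<^esub>"
    unfolding free0_def by (simp add: free_alg_smult)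
  then have "rep_hc (sc (1::'a)) = rep_hc 1"
    unfolding rep_sc rep_hc_one using ring_hom_one[OF ring_hom_ring.homh[OF cl_hom]] by metis
  then show ?thesis by (simp add: rep_hc_inject)
qed

lemma sc_add: "sc (a + b) = sc a + sc b"
proof -
  have "(a + b) \<odot>\<^bsub>free0\<^esub> \<one>\<^bsub>free0\<^esub> =
    a \<odot>\<^bsub>free0\<^esub> \<one>\<^bsub>free0\<^esub> \<oplus>\<^bsub>free0\<^esub> b \<odot>\<^bsub>free0\<^esub> \<one>\<^bsub>free0\<^esub>"
    unfolding free0_def by (simp add: free_alg_smult free_alg_add distrib_right)
  then have "rep_hc (sc (a + b)) = rep_hc (sc a + sc b)"
    unfolding rep_sc rep_hc_plus
    using ring_hom_add[OF ring_hom_ring.homh[OF cl_hom] scalar_closed scalar_closed] by metis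
  then show ?thesis by (simp add: rep_hc_inject)
qed

lemma sc_mult: "sc (a * b) = sc a * sc b"
proof -
  have "(a * b) \<odot>\<^bsub>free0\<^esub> \<one>\<^bsub>free0\<^esub> =
    (a \<odot>\<^bsub>free0\<^esub> \<one>\<^bsub>free0\<^esub>) \<otimes>\<^bsub>free0\<^esub> (b \<odot>\<^bsub>free0\<^esub> \<one>\<^bsub>free0\<^esub>)"
    unfolding free0_scalar_mult unfolding free0_def by (simp add: free_alg_smult mult_ac)
  then have "rep_hc (sc (a * b)) = rep_hc (sc a * sc b)"
    unfolding rep_sc rep_hc_times
    using ring_hom_mult[OF ring_hom_ring.homh[OF cl_hom] scalar_closed scalar_closed] by metis
  then show ?thesis by (simp add: rep_hc_inject)
qed

lemma sc_0: "sc 0 = 0"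
  using sc_add[of 0 0] by simp

lemma sc_uminus: "sc (- a) = - sc a"
  using sc_add[of a "- a"] by (intro minus_unique[symmetric]) (simp add: sc_0)

lemma sc_minus: "sc (a - b) = sc a - sc b"
  using sc_add[of a "- b"] by (simp add: sc_uminus)

lemma sc_power: "sc (a ^ m) = sc a ^ m"
  by (induction m) (simp_all add: sc_1 sc_mult)

lemma sc_sum: "sc (sum F A) = (\<Sum>x\<in>A. sc (F x))"
  by (induction A rule: infinite_finite_induct) (simp_all add: sc_0 sc_add)

definition hT :: "nat \<Rightarrow> 'a::comm_ring_1 hc" where
  "hT i = abs_hc (cl (free_gen (GT i)))"

definition hC :: "nat \<Rightarrow> 'a::comm_ring_1 hc" where
  "hC i = abs_hc (cl (free_gen (GC i)))"

lemma GT_closed: "i \<in> {1..<snd (some_params :: 'a \<times> nat)} \<Longrightarrow>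
    free_gen (GT i) \<in> carrier (free0 :: ('a::comm_ring_1, gen list \<Rightarrow> 'a) module)"
  and GC_closed: "i \<in> {1..snd (some_params :: 'a \<times> nat)} \<Longrightarrow>
    free_gen (GC i) \<in> carrier (free0 :: ('a::comm_ring_1, gen list \<Rightarrow> 'a) module)"
  unfolding free0_def by (auto intro!: gen_closed simp: gens_def)

lemma rep_hT: "i \<in> {1..<snd (some_params :: 'a \<times> nat)} \<Longrightarrow>
    rep_hc (hT i :: 'a::comm_ring_1 hc) = cl (free_gen (GT i))"
  unfolding hT_def
  by (intro abs_hc_inverse ring_hom_closed[OF ring_hom_ring.homh[OF cl_hom]] GT_closed)

lemma rep_hC: "i \<in> {1..snd (some_params :: 'a \<times> nat)} \<Longrightarrow>
    rep_hc (hC i :: 'a::comm_ring_1 hc) = cl (free_gen (GC i))"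
  unfolding hC_def
  by (intro abs_hc_inverse ring_hom_closed[OF ring_hom_ring.homh[OF cl_hom]] GC_closed)

text \<open>Each relation of the presentation becomes an equality of classes, and injectivity of
  \<open>rep_hc\<close> turns it into an equation of the type.\<close>

lemma hecke_clifford_ring_hc:
  "hecke_clifford_ring (snd (some_params :: 'a \<times> nat)) (sc (fst (some_params :: 'a \<times> nat))) hT
    (hC :: nat \<Rightarrow> 'a::comm_ring_1 hc)"
proof -
  let ?q = "fst (some_params :: 'a \<times> nat)" and ?r = "snd (some_params :: 'a \<times> nat)"
  let ?F = "free0 :: ('a, gen list \<Rightarrow> 'a) module"
  interpret C: ring_hom_ring ?F "hc0 :: ('a, (gen list \<Rightarrow> 'a) set) module" cl by (rule cl_hom)
  let ?T = "\<lambda>i. free_gen (GT i) :: gen list \<Rightarrow> 'a" and ?c = "\<lambda>i. free_gen (GC i) :: gen list \<Rightarrow> 'a"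
  have rel: "cl a = cl b" if "(a, b) \<in> hc_rels ?q ?r" for a b :: "gen list \<Rightarrow> 'a"
    unfolding cl_def using that by (rule cls_rel)
  note rels = hc_rels_def[of ?q ?r, folded free0_def, unfolded Let_def]
  have Tcl: "?T i \<in> carrier ?F" "rep_hc (hT i :: 'a hc) = cl (?T i)" if "i \<in> {1..<?r}" for i
    using GT_closed rep_hT that by auto
  have ccl: "?c i \<in> carrier ?F" "rep_hc (hC i :: 'a hc) = cl (?c i)" if "i \<in> {1..?r}" for i
    using GC_closed rep_hC that by auto
  have smul: "cl (a \<odot>\<^bsub>free0\<^esub> f) = rep_hc (sc a) \<otimes>\<^bsub>hc0\<^esub> cl f"
    "a \<odot>\<^bsub>free0\<^esub> f \<in> carrier ?F" if "f \<in> carrier ?F" for a f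
  proof -
    show "cl (a \<odot>\<^bsub>free0\<^esub> f) = rep_hc (sc a) \<otimes>\<^bsub>hc0\<^esub> cl f"
      unfolding rep_sc using C.hom_mult[OF scalar_closed that] by (simp add: free0_scalar_mult)
    show "a \<odot>\<^bsub>free0\<^esub> f \<in> carrier ?F" using that unfolding free0_def by (rule smult_closed)
  qed
  have minus: "cl (f \<ominus>\<^bsub>?F\<^esub> g) = cl f \<ominus>\<^bsub>hc0\<^esub> cl g" if "f \<in> carrier ?F" "g \<in> carrier ?F" for f g
    using that by (simp add: C.R.minus_eq C.S.minus_eq)
  note hom = C.hom_mult C.hom_add C.hom_one C.hom_zero C.hom_a_inv minus smul
    C.R.m_closed C.R.a_closed C.R.minus_closed C.R.one_closed C.R.a_inv_closed
  note rep = rep_hc_plus rep_hc_times rep_hc_uminus rep_hc_minus rep_hc_zero rep_hc_one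
  show ?thesis
  proof
    show "sc ?q * x = x * sc ?q" for x :: "'a hc" by (rule sc_central)
    show "hT t * hT t = (sc ?q - 1) * hT t + sc ?q" if t: "t \<in> {1..<?r}" for t
    proof -
      have "((?T t \<ominus>\<^bsub>?F\<^esub> ?q \<odot>\<^bsub>?F\<^esub> \<one>\<^bsub>?F\<^esub>) \<otimes>\<^bsub>?F\<^esub> (?T t \<oplus>\<^bsub>?F\<^esub> \<one>\<^bsub>?F\<^esub>), \<zero>\<^bsub>?F\<^esub>) \<in> hc_rels ?q ?r"
        unfolding rels using t by blast
      from rel[OF this] have "rep_hc ((hT t - sc ?q * 1) * (hT t + 1)) = rep_hc 0"
        using t by (simp add: hom rep Tcl C.S.r_one[OF rep_hc])
      then have "(hT t - sc ?q) * (hT t + 1) = 0" by (simp add: rep_hc_inject)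
      moreover have "(hT t - sc ?q) * (hT t + 1) = hT t * hT t - ((sc ?q - 1) * hT t + sc ?q)"
        by (simp only: distrib_left distrib_right left_diff_distrib mult_1_left mult_1_right) simp
      ultimately show ?thesis by simp
    qed
    show "hT i * hT j = hT j * (hT i :: 'a hc)" if ij': "i \<in> {1..<?r}" "j \<in> {1..<?r}" "Suc i < j" for i j
    proof -
      have ij: "i \<in> {1..<?r}" "j \<in> {1..<?r}" "\<bar>int i - int j\<bar> > 1" using ij' by auto
      have "(?T i \<otimes>\<^bsub>?F\<^esub> ?T j, ?T j \<otimes>\<^bsub>?F\<^esub> ?T i) \<in> hc_rels ?q ?r"
        unfolding rels using ij by blast
      from rel[OF this] have "rep_hc (hT i * hT j :: 'a hc) = rep_hc (hT j * hT i)"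
        using ij by (simp add: hom rep Tcl)
      then show ?thesis by (simp add: rep_hc_inject)
    qed
    show "hT i * hT (Suc i) * hT i = hT (Suc i) * hT i * (hT (Suc i) :: 'a hc)"
      if i': "i \<in> {1..<?r}" "Suc i \<in> {1..<?r}" for i
    proof -
      have i: "i \<in> {1..<?r}" "i + 1 \<in> {1..<?r}" using i' by (simp_all add: One_nat_def)
      have "(?T i \<otimes>\<^bsub>?F\<^esub> ?T (i + 1) \<otimes>\<^bsub>?F\<^esub> ?T i, ?T (i + 1) \<otimes>\<^bsub>?F\<^esub> ?T i \<otimes>\<^bsub>?F\<^esub> ?T (i + 1)) \<in> hc_rels ?q ?r"
        unfolding rels using i by blast
      from rel[OF this] have "rep_hc (hT i * hT (Suc i) * hT i :: 'a hc) = rep_hc (hT (Suc i) * hT i * hT (Suc i))"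
        using i' Tcl[OF i'(1)] Tcl[OF i'(2)] by (simp add: hom rep One_nat_def)
      then show ?thesis by (simp add: rep_hc_inject)
    qed
    show "hC i * hC i = - (1 :: 'a hc)" if i: "i \<in> {1..?r}" for i
    proof -
      have "(?c i \<otimes>\<^bsub>?F\<^esub> ?c i, \<ominus>\<^bsub>?F\<^esub> \<one>\<^bsub>?F\<^esub>) \<in> hc_rels ?q ?r"
        unfolding rels using i by blast
      from rel[OF this] have "rep_hc (hC i * hC i :: 'a hc) = rep_hc (- 1)"
        using i by (simp add: hom rep ccl)
      then show ?thesis by (simp add: rep_hc_inject)
    qed
    show "hC i * hC j = - (hC j * hC i :: 'a hc)" if ij: "i \<in> {1..?r}" "j \<in> {1..?r}" "i \<noteq> j" for i j
    proof -
      have "(?c i \<otimes>\<^bsub>?F\<^esub> ?c j, \<ominus>\<^bsub>?F\<^esub> (?c j \<otimes>\<^bsub>?F\<^esub> ?c i)) \<in> hc_rels ?q ?r"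
        unfolding rels using ij by blast
      from rel[OF this] have "rep_hc (hC i * hC j :: 'a hc) = rep_hc (- (hC j * hC i))"
        using ij by (simp add: hom rep ccl)
      then show ?thesis by (simp add: rep_hc_inject)
    qed
    show "hC j * hT t = hT t * (hC j :: 'a hc)"
      if t': "t \<in> {1..<?r}" "j \<in> {1..?r}" "j \<noteq> t" "j \<noteq> Suc t" for t j
    proof -
      have t: "t \<in> {1..<?r}" "j \<in> {1..?r}" "j \<noteq> t" "j \<noteq> t + 1"
        using t' by (simp_all add: One_nat_def)
      have "(?c j \<otimes>\<^bsub>?F\<^esub> ?T t, ?T t \<otimes>\<^bsub>?F\<^esub> ?c j) \<in> hc_rels ?q ?r"
        unfolding rels using t by blast
      from rel[OF this] have "rep_hc (hC j * hT t :: 'a hc) = rep_hc (hT t * hC j)"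
        using t by (simp add: hom rep ccl Tcl)
      then show ?thesis by (simp add: rep_hc_inject)
    qed
    show "hC (Suc t) * hT t = hT t * (hC t :: 'a hc)" if t: "t \<in> {1..<?r}" for t
    proof -
      have m: "t \<in> {1..?r}" "Suc t \<in> {1..?r}" using t by auto
      have "(?c (t + 1) \<otimes>\<^bsub>?F\<^esub> ?T t, ?T t \<otimes>\<^bsub>?F\<^esub> ?c t) \<in> hc_rels ?q ?r"
        unfolding rels using t by blast
      from rel[OF this] have "rep_hc (hC (Suc t) * hT t :: 'a hc) = rep_hc (hT t * hC t)"
        using Tcl[OF t] ccl[OF m(1)] ccl[OF m(2)] by (simp add: hom rep One_nat_def)
      then show ?thesis by (simp add: rep_hc_inject)
    qed
    show "hC t * hT t = hT t * hC (Suc t) + (sc ?q - 1) * (hC t - (hC (Suc t) :: 'a hc))"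
      if t: "t \<in> {1..<?r}" for t
    proof -
      have m: "t \<in> {1..?r}" "Suc t \<in> {1..?r}" using t by auto
      have "(?c t \<otimes>\<^bsub>?F\<^esub> ?T t, ?T t \<otimes>\<^bsub>?F\<^esub> ?c (t + 1) \<oplus>\<^bsub>?F\<^esub> (?q - 1) \<odot>\<^bsub>?F\<^esub> (?c t \<ominus>\<^bsub>?F\<^esub> ?c (t + 1))) \<in> hc_rels ?q ?r"
        unfolding rels using t by blast
      from rel[OF this] have "rep_hc (hC t * hT t :: 'a hc) =
          rep_hc (hT t * hC (Suc t) + sc (?q - 1) * (hC t - hC (Suc t)))"
        using Tcl[OF t] ccl[OF m(1)] ccl[OF m(2)] by (simp add: hom rep One_nat_def)
      then show ?thesis by (simp add: rep_hc_inject sc_minus sc_1)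
    qed
  qed
qed

section \<open>Translation of matrices and permutations\<close>

definition flat :: "nat \<Rightarrow> (nat \<Rightarrow> nat \<Rightarrow> 'b) \<Rightarrow> nat \<Rightarrow> 'b" where
  "flat n a u = a (Suc (u mod n)) (Suc (u div n))"

lemma flat_index: "h < n \<Longrightarrow> flat n a (k * n + h) = a (Suc h) (Suc k)"
  by (simp add: flat_def)

lemma upt_Suc_shift: "[1..<n + 1] = map Suc [0..<n]"
  by (simp add: map_Suc_upt One_nat_def)

text \<open>The nested lists in \<open>nu\<close> and \<open>c_star\<close> enumerate the cells in
  the order of the flattening.\<close>

lemma concat_grid:
  "concat (map (\<lambda>j. map (\<lambda>i. g i j) [1..<n+1]) [1..<n+1]) = map (\<lambda>t. g (Suc (t mod n)) (Suc (t div n))) [0..<n * n]"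
proof -
  have "concat (map (\<lambda>j. map (\<lambda>i. g (Suc i) (Suc j)) [0..<n]) [0..<m]) =
      map (\<lambda>t. g (Suc (t mod n)) (Suc (t div n))) [0..<m * n]" for m
  proof (induction m)
    case (Suc m)
    have "[0..<Suc m * n] = [0..<m * n] @ map (\<lambda>i. m * n + i) [0..<n]"
      using upt_add_eq_append[of 0 "m * n" n] map_add_upt[of "m * n" n] by (simp add: add.commute)
    moreover have "map (\<lambda>i. g (Suc i) (Suc m)) [0..<n] =
        map (\<lambda>i. g (Suc ((m * n + i) mod n)) (Suc ((m * n + i) div n))) [0..<n]"
      by (rule map_cong) auto
    ultimately show ?case using Suc by (simp add: o_def)
  qed simp
  then show ?thesis by (simp add: upt_Suc_shift o_def)
qed

lemma nu_flat: "nu n a = map (flat n a) [0..<n * n]"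
  unfolding nu_def concat_grid by (simp add: flat_def[abs_def])

lemma ro_flat: "ro n a = map (rowsum n (flat n a)) [0..<n]"
  unfolding ro_def upt_Suc_shift
  by (simp add: rowsum_def flat_index sum.atLeast1_atMost_eq One_nat_def)

lemma co_flat: "co n a = map (colsum n (flat n a)) [0..<n]"
  unfolding co_def upt_Suc_shift
  by (simp add: colsum_def flat_index sum.atLeast1_atMost_eq One_nat_def)

lemma sum_list_take_map: "t \<le> m \<Longrightarrow> sum_list (take t (map g [0..<m])) = ps g t"
  by (simp add: take_map sum_list_distinct_conv_sum_set ps_def atLeast0LessThan)

lemma sum_list_map: "sum_list (map g [0..<m]) = ps g m"
  using sum_list_take_map[of m m g] by simp

lemma a_tilde_flat:
  assumes "h \<le> n"
  shows "a_tilde n a h (Suc k) = ps (flat n a) (k * n + h)"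
proof -
  have "(\<Sum>p\<in>{1..<Suc k}. \<Sum>u=1..n. a u p) = ps (flat n a) (k * n)"
  proof -
    have "(\<Sum>p\<in>{1..<Suc k}. \<Sum>u=1..n. a u p) = (\<Sum>p<k. \<Sum>u<n. a (Suc u) (Suc p))"
      unfolding atLeastLessThanSuc_atLeastAtMost by (simp add: sum.atLeast1_atMost_eq One_nat_def)
    also have "\<dots> = ps (flat n a) (k * n)"
      unfolding ps_colsum unfolding ps_def colsum_def by (simp add: flat_index)
    finally show ?thesis .
  qed
  moreover have "(\<Sum>u=1..h. a u (Suc k)) = (\<Sum>v<h. flat n a (k * n + v))"
    using assms by (simp add: sum.atLeast1_atMost_eq flat_index One_nat_def)
  ultimately show ?thesis unfolding a_tilde_def ps_add by simp
qed

lemma a_hat_flat: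
  assumes "h < n" "k < n"
  shows "a_hat n a (Suc h) k = ps (flat n a \<circ> tflip n) (h * n + k)"
proof -
  have "sum_list (take h (ro n a)) = ps (flat n a \<circ> tflip n) (h * n)"
    unfolding ro_flat using assms by (simp add: sum_list_take_map ps_rowsum)
  moreover have "(\<Sum>u=1..k. a (Suc h) u) = (\<Sum>v<k. (flat n a \<circ> tflip n) (h * n + v))"
    using assms by (simp add: sum.atLeast1_atMost_eq One_nat_def tflip_def flat_index)
  ultimately show ?thesis unfolding a_hat_def ps_add by simp
qed

text \<open>\<open>young\<close> demands that each interval be mapped onto itself. Invariance of
  \<open>blk\<close> gives inclusion, and an injective self-map of a finite set is onto.\<close>

lemma young_blk: "young (map g [0..<m]) = yg (ps g m) (blk g)"
proof -
  let ?r = "ps g m"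
  let ?B = "\<lambda>t. {ps g t<..ps g (Suc t)}"
  have B: "?B t = {x \<in> {1..?r}. blk g x = t}" if "t < m" for t
    unfolding blk_vimage[OF that] by auto
  have "(\<forall>t<m. w ` ?B t = ?B t) \<longleftrightarrow> (\<forall>x\<in>{1..?r}. blk g (w x) = blk g x)"
    if w: "w permutes {1..?r}" for w
  proof
    assume img: "\<forall>t<m. w ` ?B t = ?B t"
    show "\<forall>x\<in>{1..?r}. blk g (w x) = blk g x"
    proof
      fix x assume x: "x \<in> {1..?r}"
      note t = blk_bounds(1)[OF x]
      have "w x \<in> ?B (blk g x)" using img t x B[OF t] by blast
      then show "blk g (w x) = blk g x" unfolding B[OF t] by simp
    qed
  next
    assume eq: "\<forall>x\<in>{1..?r}. blk g (w x) = blk g x"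
    show "\<forall>t<m. w ` ?B t = ?B t"
    proof (intro allI impI)
      fix t assume t: "t < m"
      have "w ` ?B t \<subseteq> ?B t" unfolding B[OF t] using eq permutes_range[OF w] by auto
      then show "w ` ?B t = ?B t"
        by (rule endo_inj_surj[rotated]) (auto intro: inj_on_subset[OF permutes_inj[OF w]])
    qed
  qed
  then show ?thesis
    unfolding young_def fibre_def sum_list_map
    by (intro Collect_cong conj_cong refl) (simp add: Let_def sum_list_take_map One_nat_def)
qed

lemma min_coset_reps_blk: "min_coset_reps (map g [0..<m]) = dr (ps g m) (blk g)"
  unfolding min_coset_reps_def Let_def sum_list_map young_blk
  using dr_iff_perm_length[OF blk_mono[of g m]] by (auto dest: dr_permutes)

lemma degree_flat: "(\<Sum>i=1..n. \<Sum>j=1..n. a i j) = ps (flat n a) (n * n)"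
proof -
  have "(\<Sum>i=1..n. \<Sum>j=1..n. a i j) = (\<Sum>j=1..n. \<Sum>i=1..n. a i j)" by (rule sum.swap)
  also have "\<dots> = (\<Sum>p<n. \<Sum>u<n. a (Suc u) (Suc p))"
    by (simp add: sum.atLeast1_atMost_eq One_nat_def)
  also have "\<dots> = ps (flat n a) (n * n)"
    unfolding ps_colsum unfolding ps_def colsum_def by (simp add: flat_index)
  finally show ?thesis .
qed

text \<open>Every position of the range lies in exactly one cell, so the prescribed values determine
  the permutation, and the shuffle has them.\<close>

lemma d_perm_shuffle: "d_perm n a = shuffle n (flat n a)"
  unfolding d_perm_def degree_flat
proof (rule the_equality)
  let ?f = "flat n a"
  let ?P = "\<lambda>d. d permutes {1..ps ?f (n * n)} \<and> (\<forall>h\<in>{1..n}. \<forall>k\<in>{1..n}. \<forall>p\<in>{1..a h k}.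
       d (a_tilde n a (h - 1) k + p) = a_hat n a h (k - 1) + p)"
  have sh: "shuffle n ?f (a_tilde n a (h - 1) k + p) = a_hat n a h (k - 1) + p"
    if h: "h \<in> {1..n}" and k: "k \<in> {1..n}" and p: "p \<in> {1..a h k}" for h k p
  proof -
    obtain h' k' where hk: "h = Suc h'" "k = Suc k'" using h k by (cases h; cases k) auto
    let ?t = "k' * n + h'"
    have h'k': "h' < n" "k' < n" using h k hk by auto
    have "Suc k' * n \<le> n * n" using h'k' by (intro mult_le_mono1) simp
    then have t: "?t < n * n" using h'k' by simp
    have ft: "?f ?t = a h k" using h'k' hk by (simp add: flat_index)
    let ?x = "ps ?f ?t + p"
    have b: "blk ?f ?x = ?t" using p ft by (intro blk_unique) (auto simp: ps_Suc)
    have "?x \<le> ps ?f (Suc ?t)" using p ft by (simp add: ps_Suc)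
    also have "\<dots> \<le> ps ?f (n * n)" using t by (intro ps_mono) simp
    finally have x: "?x \<in> {1..ps ?f (n * n)}" using p by simp
    have tf: "tflip n ?t = h' * n + k'" using h'k' by (simp add: tflip_def)
    have at: "a_tilde n a (h - 1) k = ps ?f ?t"
      using a_tilde_flat[of h' n a k'] h'k' hk by simp
    have ah: "a_hat n a h (k - 1) = ps (?f \<circ> tflip n) (h' * n + k')"
      using a_hat_flat[of h' n k' a] h'k' hk by simp
    have "shuffle n ?f ?x = ps (?f \<circ> tflip n) (tflip n (blk ?f ?x)) + (?x - ps ?f (blk ?f ?x))"
      unfolding shuffle_def using x by (rule if_P)
    then show ?thesis unfolding at ah b tf by simp
  qed
  show "?P (shuffle n ?f)" using sh shuffle_permutes by blast
  fix d assume d: "?P d"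
  show "d = shuffle n ?f"
  proof
    fix x
    show "d x = shuffle n ?f x"
    proof (cases "x \<in> {1..ps ?f (n * n)}")
      case True
      let ?t = "blk ?f x"
      note b = blk_bounds[OF True]
      have n: "0 < n" using b(1) by (cases n) auto
      have hk: "Suc (?t mod n) \<in> {1..n}" "Suc (?t div n) \<in> {1..n}"
        using n b(1) by (simp_all add: Suc_le_eq less_mult_imp_div_less)
      have p: "x - ps ?f ?t \<in> {1..a (Suc (?t mod n)) (Suc (?t div n))}"
        using b(2,3) by (auto simp: ps_Suc flat_def)
      have "a_tilde n a (?t mod n) (Suc (?t div n)) = ps ?f ?t"
        using n by (subst a_tilde_flat) auto
      then have "x = a_tilde n a (Suc (?t mod n) - 1) (Suc (?t div n)) + (x - ps ?f ?t)"
        using b(2) by simp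
      then show ?thesis using sh[OF hk p] d hk p by metis
    next
      case False
      then show ?thesis using d shuffle_permutes[of n ?f] by (simp add: permutes_def)
    qed
  qed
qed

section \<open>Formulas in the Hecke--Clifford superalgebra\<close>

context hecke_clifford_ring
begin

text \<open>Everything is read off from the cells below \<open>n * n\<close>. This allows the
  flattening of a changed matrix to be replaced by an update of the old flattening.\<close>

lemma tst_cong:
  assumes r: "r = ps f (n * n)" and f: "\<And>u. u < n * n \<Longrightarrow> f u = f2 u" and ex: "\<And>u. u < n * n \<Longrightarrow> ex u = ex2 u"
  shows "tst n f ex = tst n f2 ex2"
proof -
  have ps: "ps f u = ps f2 u" if "u \<le> n * n" for u using that f by (intro ps_cong) simp
  have b: "blk f x = blk f2 x" if "x \<in> {1..r}" for x
    by (rule blk_cong[of "n * n"]) (use that f r in simp_all)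
  have ix: "k * n + h < n * n" if "k < n" "h < n" for k h
  proof -
    have "Suc k * n \<le> n * n" using that by (intro mult_le_mono1) simp
    then show ?thesis using that by simp
  qed
  have R: "rowsum n f h = rowsum n f2 h" if "h < n" for h
    unfolding rowsum_def using f ix that by (intro sum.cong) auto
  have rb: "blk (rowsum n f) x = blk (rowsum n f2) x" if "x \<in> {1..r}" for x
    by (rule blk_cong[of n]) (use that R in \<open>simp_all add: r ps_rowsum_total\<close>)
  have "fibre r (blk (rowsum n f)) (\<lambda>x. blk f x mod n) = fibre r (blk (rowsum n f2)) (\<lambda>x. blk f2 x mod n)"
    by (rule fibre_cong) (simp_all add: rb b)
  moreover have "cst f ex 0 (n * n) = cst f2 ex2 0 (n * n)"
    by (rule cst_cong) (simp add: ps ex)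
  moreover have "dr r (blk f) = dr r (blk f2)" by (rule dr_cong) (rule b)
  moreover have "yg r (\<lambda>x. blk f x div n) = yg r (\<lambda>x. blk f2 x div n)"
    by (rule fibre_cong) (simp_all add: b)
  ultimately show ?thesis by (simp only: tst_def sig_def)
qed

end

section \<open>Pairs of matrices read cell by cell\<close>

lemma map_nth_upt: "length mu = n \<Longrightarrow> mu = map ((!) mu) [0..<n]"
  by (rule nth_equalityI) simp_all

lemma grid_bounds: "u < n * n \<Longrightarrow> u mod n < n" "u < n * n \<Longrightarrow> u div n < n" for n u :: nat
  by (cases n; simp add: less_mult_imp_div_less)+

lemma grid_cell:
  assumes "i \<in> {1..n}" "j \<in> {1..n}"
  obtains u where "u < n * n" "i = Suc (u mod n)" "j = Suc (u div n)"
proof -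
  obtain i' j' where ij: "i = Suc i'" "j = Suc j'" using assms by (cases i; cases j) auto
  then have lt: "i' < n" "j' < n" using assms by auto
  have "Suc j' * n \<le> n * n" using lt by (intro mult_le_mono1) simp
  then show ?thesis using lt ij by (intro that[of "j' * n + i'"]) simp_all
qed

definition supp_mat :: "nat \<Rightarrow> (nat \<Rightarrow> nat \<Rightarrow> int) \<Rightarrow> bool" where
  "supp_mat n A \<longleftrightarrow> (\<forall>i j. \<not> (i \<in> {1..n} \<and> j \<in> {1..n}) \<longrightarrow> A i j = 0)"

text \<open>In \<open>2 * E h k\<close> the numeral is itself a matrix, constant with value 2, and
  the product is pointwise.\<close>

lemma two_fun: "(2 :: nat \<Rightarrow> nat \<Rightarrow> int) i j = 2"
proof -
  have "(2 :: nat \<Rightarrow> nat \<Rightarrow> int) = 1 + 1" by (rule one_add_one[symmetric])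
  then show ?thesis by simp
qed

lemma supp_mat_simps:
  "supp_mat n A \<Longrightarrow> supp_mat n B \<Longrightarrow> supp_mat n (A + B)"
  "supp_mat n A \<Longrightarrow> supp_mat n B \<Longrightarrow> supp_mat n (A - B)"
  "supp_mat n A \<Longrightarrow> supp_mat n (2 * A)"
  "supp_mat n 0"
  "i \<in> {1..n} \<Longrightarrow> j \<in> {1..n} \<Longrightarrow> supp_mat n (E i j)"
  "length mu = n \<Longrightarrow> supp_mat n (diag mu)"
  by (auto simp: supp_mat_def E_def diag_def)

lemma flat_simps:
  "flat n (A + B) u = flat n A u + flat n B u"
  "flat n (A - B) u = flat n A u - flat n B u"
  "flat n (2 * A) u = 2 * flat n A u"
  "flat n 0 u = 0" for A B :: "nat \<Rightarrow> nat \<Rightarrow> int"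
  by (simp_all add: flat_def two_fun)

lemma flat_E:
  assumes "h < n"
  shows "flat n (E (Suc h) (Suc k)) v = (if v = k * n + h then 1 else 0)"
proof -
  have "v mod n = h \<and> v div n = k \<longleftrightarrow> v = k * n + h" using assms by auto
  then show ?thesis by (simp add: flat_def E_def)
qed

lemma flat_diag:
  assumes "length mu = n" "u < n * n"
  shows "flat n (diag mu) u = int (dmat n ((!) mu) u)"
  using grid_bounds[OF assms(2)] assms(1) by (auto simp: flat_def diag_def dmat_def One_nat_def)

lemma flat_base: "flat n (base (A0, A1)) u = nat (flat n A0 u + flat n A1 u)"
  by (simp add: flat_def base_def)

lemma star_mats_flat:
  "(A0, A1) \<in> star_mats n \<longleftrightarrow> supp_mat n A0 \<and> supp_mat n A1 \<and>
    (\<forall>u<n * n. 0 \<le> flat n A0 u \<and> flat n A1 u \<in> {0, 1})"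
proof -
  have "(\<forall>i\<in>{1..n}. \<forall>j\<in>{1..n}. 0 \<le> A0 i j \<and> A1 i j \<in> {0, 1}) \<longleftrightarrow>
      (\<forall>u<n * n. 0 \<le> flat n A0 u \<and> flat n A1 u \<in> {0, 1})"
  proof (intro iffI allI impI ballI)
    fix u assume *: "\<forall>i\<in>{1..n}. \<forall>j\<in>{1..n}. 0 \<le> A0 i j \<and> A1 i j \<in> {0, 1}" and u: "u < n * n"
    have "Suc (u mod n) \<in> {1..n}" "Suc (u div n) \<in> {1..n}" using grid_bounds[OF u] by (simp_all add: Suc_le_eq)
    with * show "0 \<le> flat n A0 u \<and> flat n A1 u \<in> {0, 1}" unfolding flat_def by blast
  next
    fix i j assume *: "\<forall>u<n * n. 0 \<le> flat n A0 u \<and> flat n A1 u \<in> {0, 1}" and ij: "i \<in> {1..n}" "j \<in> {1..n}"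
    obtain u where "u < n * n" "i = Suc (u mod n)" "j = Suc (u div n)" by (rule grid_cell[OF ij])
    then show "0 \<le> A0 i j \<and> A1 i j \<in> {0, 1}" using * unfolding flat_def by blast
  qed
  then show ?thesis unfolding star_mats_def supp_mat_def by auto
qed

lemma unit_pow_int: "unit_pow q (int N) = q ^ N"
  by (simp add: unit_pow_def)

text \<open>The exponent is negative only for \<open>N = 0\<close>; there \<open>y\<close> is the
  unique inverse that the \<open>THE\<close> selects.\<close>

lemma unit_pow_pred:
  assumes y: "q * y = 1"
  shows "unit_pow q (int N - 1) = q ^ N * y"
proof (cases N)
  case 0
  have "(THE y. q * y = 1) = y"
  proof (rule the_equality[of "\<lambda>y. q * y = 1", OF y])
    fix z assume "q * z = 1"
    then show "z = y" using y by (metis mult.left_commute mult.commute mult_1)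
  qed
  then show ?thesis by (simp add: unit_pow_def 0)
next
  case (Suc M)
  have "q ^ N * y = q ^ M * (q * y)" by (simp add: Suc mult_ac)
  then show ?thesis using y Suc by (simp add: unit_pow_def)
qed

text \<open>The assumption identifies the algebra for \<open>q\<close> and \<open>r\<close> with the
  one underlying the type, so that the identities for \<open>hecke_clifford_ring\<close> apply to it
  through \<open>rep_hc\<close>.\<close>

context
  fixes q :: "'a::comm_ring_1" and r :: nat
  assumes params: "some_params = (q, r)"
begin

lemma hc0_params: "hecke_clifford q r = hc0"
  by (simp add: hc0_def params)

interpretation HC: hecke_clifford_ring r "sc q" hT "hC :: nat \<Rightarrow> 'a hc"
  using hecke_clifford_ring_hc[where 'a = 'a] by (simp add: params)

interpretation R: ring "hc0 :: ('a, (gen list \<Rightarrow> 'a) set) module"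
  by (rule hc0_ring)

lemma hcT_rep: "i \<in> {1..<r} \<Longrightarrow> hcT q r i = rep_hc (hT i)"
  by (simp add: rep_hT params hcT_def cl_def cls_def)

lemma hcC_rep: "i \<in> {1..r} \<Longrightarrow> hcC q r i = rep_hc (hC i)"
  by (simp add: rep_hC params hcC_def cl_def cls_def)

section \<open>The defined elements as images of elements of the type\<close>

lemma T_perm_rep:
  assumes "w permutes {1..r}"
  shows "T_perm q r w = rep_hc (HC.Tw w)"
proof -
  have "reduced_expr r w (SOME is. reduced_expr r w is)"
    by (rule someI_ex) (rule reduced_expr_exists[OF assms])
  then have "set (SOME is. reduced_expr r w is) \<subseteq> {1..<r}" by (simp add: reduced_expr_def)
  then have "map (hcT q r) (SOME is. reduced_expr r w is) =
      map rep_hc (map (hT :: nat \<Rightarrow> 'a hc) (SOME is. reduced_expr r w is))"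
    by (auto intro!: hcT_rep)
  then show ?thesis by (simp only: T_perm_def HC.Tw_def rep_hc_prod_list hc0_params)
qed

lemma finsum_rep:
  assumes "\<And>x. x \<in> A \<Longrightarrow> g x = rep_hc (G x)"
  shows "(\<Oplus>\<^bsub>hecke_clifford q r\<^esub> x\<in>A. g x) = rep_hc (sum G A)"
  unfolding hc0_params rep_hc_sum using assms by (intro R.finsum_cong') (auto intro: rep_hc)

lemma SS_rep:
  assumes "\<And>w. w \<in> U \<Longrightarrow> w permutes {1..r}"
  shows "(\<Oplus>\<^bsub>hecke_clifford q r\<^esub> w\<in>U. T_perm q r w) = rep_hc (HC.SS U)"
  unfolding HC.SS_def using assms by (intro finsum_rep T_perm_rep)

lemma x_elt_rep: "ps g m = r \<Longrightarrow> x_elt q (map g [0..<m]) = rep_hc (HC.SS (yg r (blk g)))"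
  unfolding x_elt_def Let_def sum_list_map young_blk by (simp add: SS_rep fibre_permutes)

lemma c_q_rep:
  assumes "1 \<le> i" "j \<le> r"
  shows "c_q q r i j = rep_hc (HC.Cq i j)"
  unfolding c_q_def Let_def HC.Cq_def
proof (rule finsum_rep)
  fix t assume t: "t \<in> {i..j}"
  show "q ^ (j - t) \<odot>\<^bsub>hecke_clifford q r\<^esub> hcC q r t = rep_hc (sc q ^ (j - t) * hC t)"
    using t assms by (simp add: hcC_rep hc0_params rep_sc_mult sc_power[symmetric])
qed

lemma c_star_rep:
  assumes "ps (flat n (base M)) (n * n) = r"
  shows "c_star q n r M = rep_hc (HC.cst (flat n (base M)) (\<lambda>u. nat (flat n (snd M) u)) 0 (n * n))"
proof -
  let ?f = "flat n (base M)"
  have "map (\<lambda>t. c_q q r (a_tilde n (base M) (Suc (t mod n) - 1) (Suc (t div n)) + 1)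
          (a_tilde n (base M) (Suc (t mod n)) (Suc (t div n))) [^]\<^bsub>hc0\<^esub> nat (snd M (Suc (t mod n)) (Suc (t div n))))
        [0..<n * n] =
      map (\<lambda>t. rep_hc (HC.Cq (Suc (ps ?f t)) (ps ?f (Suc t)) ^ nat (flat n (snd M) t))) [0..<n * n]"
  proof (rule map_cong[OF refl])
    fix t assume "t \<in> set [0..<n * n]"
    then have t: "t < n * n" by simp
    then have n: "0 < n" by (cases n) auto
    then have tm: "t mod n < n" by simp
    have "ps ?f (Suc t) \<le> r" unfolding assms[symmetric] using t by (intro ps_mono) simp
    then have "c_q q r (Suc (ps ?f t)) (ps ?f (Suc t)) = rep_hc (HC.Cq (Suc (ps ?f t)) (ps ?f (Suc t)))"
      by (intro c_q_rep) (simp_all add: One_nat_def)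
    moreover have "a_tilde n (base M) (Suc (t mod n) - 1) (Suc (t div n)) + 1 = Suc (ps ?f t)"
      using tm by (simp add: a_tilde_flat)
    moreover have "a_tilde n (base M) (Suc (t mod n)) (Suc (t div n)) = ps ?f (Suc t)"
      using tm by (subst a_tilde_flat) simp_all
    ultimately show "c_q q r (a_tilde n (base M) (Suc (t mod n) - 1) (Suc (t div n)) + 1)
          (a_tilde n (base M) (Suc (t mod n)) (Suc (t div n))) [^]\<^bsub>hc0\<^esub> nat (snd M (Suc (t mod n)) (Suc (t div n)))
        = rep_hc (HC.Cq (Suc (ps ?f t)) (ps ?f (Suc t)) ^ nat (flat n (snd M) t))"
      by (simp only: rep_hc_power flat_def)
  qed
  then show ?thesis
    unfolding c_star_def Let_def concat_grid HC.cst_def rep_hc_prod_list hc0_params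
    by (simp only: map_map o_def)
qed

lemma Sigma_rep:
  assumes "ps (flat n a) (n * n) = r"
  shows "Sigma_elt q n r a = rep_hc (HC.sig n (flat n a))"
proof -
  let ?f = "flat n a"
  have "blk (colsum n ?f) x = blk ?f x div n" if x: "x \<in> {1..r}" for x
  proof -
    have "0 < n" using x assms by (cases n) auto
    then show ?thesis using x blk_colsum[of x ?f n n] assms by simp
  qed
  then have "yg r (blk (colsum n ?f)) = yg r (\<lambda>x. blk ?f x div n)"
    by (intro fibre_cong) auto
  then show ?thesis
    unfolding Sigma_elt_def nu_flat co_flat min_coset_reps_blk young_blk HC.sig_def ps_colsum[symmetric] assms
    by (subst SS_rep) (auto intro: dr_permutes)
qed

lemma T_tail_rep:
  assumes "ps (flat n (base M)) (n * n) = r"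
  shows "T_tail q n r M = rep_hc (HC.Tw (shuffle n (flat n (base M)))
    * HC.cst (flat n (base M)) (\<lambda>u. nat (flat n (snd M) u)) 0 (n * n) * HC.sig n (flat n (base M)))"
  unfolding T_tail_def Let_def d_perm_shuffle c_star_rep[OF assms] Sigma_rep[OF assms] rep_hc_times
  using T_perm_rep[of "shuffle n (flat n (base M))"] shuffle_permutes[of n "flat n (base M)"] assms
  by (simp add: hc0_params)

lemma ro_rep:
  assumes "ps (flat n a) (n * n) = r"
  shows "x_elt q (ro n a) = rep_hc (HC.SS (yg r (blk (rowsum n (flat n a)))))"
  unfolding ro_flat by (rule x_elt_rep) (simp add: ps_rowsum_total assms)

lemma T_star_rep:
  assumes "ps (flat n (base M)) (n * n) = r"
  shows "T_star q n r M = rep_hc (HC.tst n (flat n (base M)) (\<lambda>u. nat (flat n (snd M) u)))"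
proof -
  let ?f = "flat n (base M)"
  let ?R = "rowsum n ?f"
  have "mono_on {1..r} (blk ?R)" using blk_mono[of ?R n] by (simp add: ps_rowsum_total assms)
  moreover have "shuffle n ?f \<in> dr r (blk ?R)" using shuffle_dr[of n ?f] by (simp add: assms)
  ultimately have "HC.SS (yg r (blk ?R)) * HC.Tw (shuffle n ?f) = HC.SS (fibre r (blk ?R) (blk ?R \<circ> shuffle n ?f))"
    by (rule HC.xx_Tw)
  also have "\<dots> = HC.SS (fibre r (blk ?R) (\<lambda>x. blk ?f x mod n))"
    by (rule HC.vv_cong) (use assms in \<open>simp add: shuffle_row\<close>)
  finally have "HC.tst n ?f (\<lambda>u. nat (flat n (snd M) u)) = HC.SS (yg r (blk ?R)) * HC.Tw (shuffle n ?f)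
      * HC.cst ?f (\<lambda>u. nat (flat n (snd M) u)) 0 (n * n) * HC.sig n ?f"
    by (simp only: HC.tst_def)
  moreover have "T_perm q r (shuffle n ?f) = rep_hc (HC.Tw (shuffle n ?f))"
    by (rule T_perm_rep) (use shuffle_permutes[of n ?f] assms in simp)
  ultimately show ?thesis
    unfolding T_star_def Let_def d_perm_shuffle c_star_rep[OF assms] Sigma_rep[OF assms] ro_rep[OF assms]
    by (simp only: hc0_params rep_hc_times)
qed

lemma T_star_tail:
  assumes "ps (flat n (base M)) (n * n) = r"
  shows "T_star q n r M = x_elt q (ro n (base M)) \<otimes>\<^bsub>hecke_clifford q r\<^esub> T_tail q n r M"
proof -
  have "T_perm q r (shuffle n (flat n (base M))) = rep_hc (HC.Tw (shuffle n (flat n (base M))))"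
    by (rule T_perm_rep) (use shuffle_permutes[of n "flat n (base M)"] assms in simp)
  then show ?thesis
    unfolding T_star_def T_tail_def Let_def d_perm_shuffle c_star_rep[OF assms] Sigma_rep[OF assms] ro_rep[OF assms]
    by (simp only: hc0_params rep_hc_times[symmetric] mult.assoc)
qed

text \<open>The matrices enter only through their cells, the base as \<open>f\<close> and the odd
  part as \<open>ex\<close>, so that updated functions can be substituted.\<close>

lemma T_elt_rep:
  assumes A: "supp_mat n A0" "supp_mat n A1"
    and f: "\<And>u. u < n * n \<Longrightarrow> flat n A0 u + flat n A1 u = int (f u)"
    and ex: "\<And>u. u < n * n \<Longrightarrow> flat n A1 u = int (ex u)"
    and le: "\<And>u. u < n * n \<Longrightarrow> ex u \<le> 1 \<and> ex u \<le> f u"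
    and r: "ps f (n * n) = r"
  shows "(A0, A1) \<in> star_mats_deg n r" and "T_elt q n r (A0, A1) = rep_hc (HC.tst n f ex)"
proof -
  have "0 \<le> flat n A0 u \<and> flat n A1 u \<in> {0, 1}" if "u < n * n" for u
    using f[OF that] ex[OF that] le[OF that] by (cases "ex u = 0") auto
  then have st: "(A0, A1) \<in> star_mats n" using A by (simp add: star_mats_flat)
  have b: "flat n (base (A0, A1)) u = f u" if "u < n * n" for u
    using f[OF that] by (simp add: flat_base)
  have ps: "ps (flat n (base (A0, A1))) (n * n) = r" unfolding r[symmetric] by (rule ps_cong) (rule b)
  then show deg: "(A0, A1) \<in> star_mats_deg n r" using st by (simp add: star_mats_deg_def degree_flat)
  then have "T_elt q n r (A0, A1) = rep_hc (HC.tst n (flat n (base (A0, A1))) (\<lambda>u. nat (flat n A1 u)))"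
    using T_star_rep[OF ps] by (simp add: T_elt_def)
  also have "HC.tst n (flat n (base (A0, A1))) (\<lambda>u. nat (flat n A1 u)) = HC.tst n f ex"
    by (rule HC.tst_cong) (simp_all add: ps b ex)
  finally show "T_elt q n r (A0, A1) = rep_hc (HC.tst n f ex)" .
qed

lemma T_elt_zero:
  assumes "u < n * n" "flat n A0 u < 0 \<or> flat n A1 u \<notin> {0, 1}"
  shows "T_elt q n r (A0, A1) = rep_hc 0"
proof -
  have "(A0, A1) \<notin> star_mats n" unfolding star_mats_flat using assms by (auto simp: not_le)
  then show ?thesis by (simp add: T_elt_def star_mats_deg_def hc0_params rep_hc_zero)
qed

context
  fixes n :: nat and A0 A1 :: "nat \<Rightarrow> nat \<Rightarrow> int" and f ex :: "nat \<Rightarrow> nat"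
  assumes A: "(A0, A1) \<in> star_mats_deg n r"
    and f_def: "f = flat n (base (A0, A1))" and ex_def: "ex = (\<lambda>u. nat (flat n A1 u))"
begin

lemma star_entries:
  assumes "u < n * n"
  shows "flat n A1 u = int (ex u)" "flat n A0 u = int (f u) - int (ex u)" "ex u \<le> 1" "ex u \<le> f u"
proof -
  have "0 \<le> flat n A0 u \<and> flat n A1 u \<in> {0, 1}"
    using A assms by (simp add: star_mats_deg_def star_mats_flat)
  then show "flat n A1 u = int (ex u)" "flat n A0 u = int (f u) - int (ex u)" "ex u \<le> 1" "ex u \<le> f u"
    by (auto simp: f_def ex_def flat_base)
qed

lemma star_total: "ps f (n * n) = r"
  using A by (simp add: star_mats_deg_def degree_flat f_def)

lemma star_supp: "supp_mat n A0" "supp_mat n A1"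
  using A by (simp_all add: star_mats_deg_def star_mats_flat)

context
  fixes h k t :: nat
  assumes k: "k < n" and h: "Suc h < n" and t: "t = k * n + h"
begin

lemma cell: "Suc t < n * n" "t < n * n"
  using HC.index_less[OF k h] by (simp_all add: t)

lemma ex_cell: "ex t = 0 \<or> ex t = 1" "ex (Suc t) = 0 \<or> ex (Suc t) = 1"
  using star_entries(3)[OF cell(1)] star_entries(3)[OF cell(2)] by linarith+

lemma entries_cell:
  "A1 (Suc h) (Suc k) = int (ex t)" "A1 (Suc (Suc h)) (Suc k) = int (ex (Suc t))"
  "A0 (Suc h) (Suc k) = int (f t) - int (ex t)" "A0 (Suc (Suc h)) (Suc k) = int (f (Suc t)) - int (ex (Suc t))"
  "base (A0, A1) (Suc h) (Suc k) = f t" "base (A0, A1) (Suc (Suc h)) (Suc k) = f (Suc t)"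
proof -
  have 1: "flat n B t = B (Suc h) (Suc k)" for B :: "nat \<Rightarrow> nat \<Rightarrow> 'b" unfolding t using h by (intro flat_index) simp
  have 2: "flat n B (Suc t) = B (Suc (Suc h)) (Suc k)" for B :: "nat \<Rightarrow> nat \<Rightarrow> 'b"
    using flat_index[OF h, of B k] by (simp add: t)
  note 1[of A1] 1[of A0] 2[of A1] 2[of A0] 1[of "base (A0, A1)"] 2[of "base (A0, A1)"]
  then show "A1 (Suc h) (Suc k) = int (ex t)" "A1 (Suc (Suc h)) (Suc k) = int (ex (Suc t))"
    "A0 (Suc h) (Suc k) = int (f t) - int (ex t)" "A0 (Suc (Suc h)) (Suc k) = int (f (Suc t)) - int (ex (Suc t))"
    "base (A0, A1) (Suc h) (Suc k) = f t" "base (A0, A1) (Suc (Suc h)) (Suc k) = f (Suc t)"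
    using star_entries(1,2)[OF cell(1)] star_entries(1,2)[OF cell(2)] by (simp_all add: f_def)
qed

lemma flat_E_cell:
  "flat n (E (Suc h) (Suc k)) v = (if v = t then 1 else 0)"
  "flat n (E (Suc (Suc h)) (Suc k)) v = (if v = Suc t then 1 else 0)"
  using h by (simp_all add: flat_E t)

lemma supp_E_cell: "supp_mat n (E (Suc h) (Suc k))" "supp_mat n (E (Suc (Suc h)) (Suc k))"
  using h k by (auto intro!: supp_mat_simps(5))

lemma raise_total: "0 < f (Suc t) \<Longrightarrow> ps (f(t := Suc (f t), Suc t := f (Suc t) - 1)) (n * n) = r"
  using cell by (simp add: ps_move_up star_total)

lemma lower_total: "0 < f t \<Longrightarrow> ps (f(t := f t - 1, Suc t := Suc (f (Suc t)))) (n * n) = r"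
  using cell by (simp add: ps_move_down star_total)

lemmas cell_simps = flat_simps flat_E_cell star_entries supp_mat_simps(1-4) supp_E_cell star_supp

text \<open>Six such identifications match the pairs of the two formulas with updated cells. Each
  condition says that the pair lies in \<open>star_mats\<close>; here, that the even entry of the
  lower cell is positive.\<close>

lemma raise_even:
  "T_elt q n r (A0 + E (Suc h) (Suc k) - E (Suc (Suc h)) (Suc k), A1) =
    rep_hc (if ex (Suc t) < f (Suc t) then HC.tst n (f(t := Suc (f t), Suc t := f (Suc t) - 1)) ex else 0)"
proof (cases "ex (Suc t) < f (Suc t)")
  case True
  then show ?thesis unfolding if_P[OF True]
    by (intro T_elt_rep(2)) (auto simp: cell_simps raise_total le_Suc_eq)
next
  case False
  then show ?thesis
    using star_entries(4)[OF cell(1)] by (simp, intro T_elt_zero[OF cell(1)]) (simp add: cell_simps cell)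
qed

lemma raise_odd:
  "T_elt q n r (A0, A1 + E (Suc h) (Suc k) - E (Suc (Suc h)) (Suc k)) =
    rep_hc (if ex t = 0 \<and> ex (Suc t) = 1
      then HC.tst n (f(t := Suc (f t), Suc t := f (Suc t) - 1)) (ex(t := 1, Suc t := 0)) else 0)"
proof (cases "ex t = 0 \<and> ex (Suc t) = 1")
  case True
  then have "0 < f (Suc t)" using star_entries(4)[OF cell(1)] by simp
  then show ?thesis using True unfolding if_P[OF True]
    by (intro T_elt_rep(2)) (auto simp: cell_simps raise_total)
next
  case False
  have "flat n (A1 + E (Suc h) (Suc k) - E (Suc (Suc h)) (Suc k)) t \<notin> {0, 1} \<or>
      flat n (A1 + E (Suc h) (Suc k) - E (Suc (Suc h)) (Suc k)) (Suc t) \<notin> {0, 1}"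
    using False ex_cell by (auto simp: cell_simps cell)
  then show ?thesis unfolding if_not_P[OF False] using T_elt_zero[OF cell(1)] T_elt_zero[OF cell(2)] by blast
qed

lemma raise_pair:
  "T_elt q n r (A0 + 2 * E (Suc h) (Suc k), A1 - E (Suc h) (Suc k) - E (Suc (Suc h)) (Suc k)) =
    rep_hc (if ex t = 1 \<and> ex (Suc t) = 1
      then HC.tst n (f(t := Suc (f t), Suc t := f (Suc t) - 1)) (ex(t := 0, Suc t := 0)) else 0)"
proof (cases "ex t = 1 \<and> ex (Suc t) = 1")
  case True
  then have "0 < f (Suc t)" using star_entries(4)[OF cell(1)] by simp
  then show ?thesis using True unfolding if_P[OF True]
    by (intro T_elt_rep(2)) (auto simp: cell_simps raise_total)
next
  case False
  have "flat n (A1 - E (Suc h) (Suc k) - E (Suc (Suc h)) (Suc k)) t \<notin> {0, 1} \<or>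
      flat n (A1 - E (Suc h) (Suc k) - E (Suc (Suc h)) (Suc k)) (Suc t) \<notin> {0, 1}"
    using False ex_cell by (auto simp: cell_simps cell)
  then show ?thesis unfolding if_not_P[OF False] using T_elt_zero[OF cell(1)] T_elt_zero[OF cell(2)] by blast
qed

lemma lower_even:
  "T_elt q n r (A0 - E (Suc h) (Suc k) + E (Suc (Suc h)) (Suc k), A1) =
    rep_hc (if ex t < f t then HC.tst n (f(t := f t - 1, Suc t := Suc (f (Suc t)))) ex else 0)"
proof (cases "ex t < f t")
  case True
  then show ?thesis unfolding if_P[OF True]
    by (intro T_elt_rep(2)) (auto simp: cell_simps lower_total le_Suc_eq)
next
  case False
  then show ?thesis
    using star_entries(4)[OF cell(2)] by (simp, intro T_elt_zero[OF cell(2)]) (simp add: cell_simps cell)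
qed

lemma lower_odd:
  "T_elt q n r (A0, A1 - E (Suc h) (Suc k) + E (Suc (Suc h)) (Suc k)) =
    rep_hc (if ex t = 1 \<and> ex (Suc t) = 0
      then HC.tst n (f(t := f t - 1, Suc t := Suc (f (Suc t)))) (ex(t := 0, Suc t := 1)) else 0)"
proof (cases "ex t = 1 \<and> ex (Suc t) = 0")
  case True
  then have "0 < f t" using star_entries(4)[OF cell(2)] by simp
  then show ?thesis using True unfolding if_P[OF True]
    by (intro T_elt_rep(2)) (auto simp: cell_simps lower_total)
next
  case False
  have "flat n (A1 - E (Suc h) (Suc k) + E (Suc (Suc h)) (Suc k)) t \<notin> {0, 1} \<or>
      flat n (A1 - E (Suc h) (Suc k) + E (Suc (Suc h)) (Suc k)) (Suc t) \<notin> {0, 1}"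
    using False ex_cell by (auto simp: cell_simps cell)
  then show ?thesis unfolding if_not_P[OF False] using T_elt_zero[OF cell(1)] T_elt_zero[OF cell(2)] by blast
qed

lemma lower_pair:
  "T_elt q n r (A0 + 2 * E (Suc (Suc h)) (Suc k), A1 - E (Suc h) (Suc k) - E (Suc (Suc h)) (Suc k)) =
    rep_hc (if ex t = 1 \<and> ex (Suc t) = 1
      then HC.tst n (f(t := f t - 1, Suc t := Suc (f (Suc t)))) (ex(t := 0, Suc t := 0)) else 0)"
proof (cases "ex t = 1 \<and> ex (Suc t) = 1")
  case True
  then have "0 < f t" using star_entries(4)[OF cell(2)] by simp
  then show ?thesis using True unfolding if_P[OF True]
    by (intro T_elt_rep(2)) (auto simp: cell_simps lower_total)
next
  case False
  have "flat n (A1 - E (Suc h) (Suc k) - E (Suc (Suc h)) (Suc k)) t \<notin> {0, 1} \<or>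
      flat n (A1 - E (Suc h) (Suc k) - E (Suc (Suc h)) (Suc k)) (Suc t) \<notin> {0, 1}"
    using False ex_cell by (auto simp: cell_simps cell)
  then show ?thesis unfolding if_not_P[OF False] using T_elt_zero[OF cell(1)] T_elt_zero[OF cell(2)] by blast
qed

end

section \<open>Both sides of the product formulas in the type\<close>

lemma qn_rep: "HC.qn m = sc (qnum q m)" "HC.qn2 m = sc (qnum (q\<^sup>2) m)"
  by (simp_all add: HC.qn_def HC.qn2_def qnum_def sc_sum sc_power)

lemma raise_sum_rep:
  assumes h: "Suc h < n" and y: "q * y = 1"
  shows "raise_sum q n r (Suc h) A0 A1 = rep_hc (\<Sum>k<n. sc q ^ (\<Sum>j\<in>{k<..<n}. f (j * n + h)) *
    HC.raise_terms n f ex (sc y) (k * n + h))"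
proof -
  define N where "N k = (\<Sum>j\<in>{k<..<n}. f (j * n + h))" for k
  define G where "G k = sc q ^ N k * HC.raise_terms n f ex (sc y) (k * n + h)" for k
  have Sh: "Suc h + 1 = Suc (Suc h)" by simp
  have trm: "(unit_pow q (int (\<Sum>j=Suc k+1..n. base (A0, A1) (Suc h) j) + A1 (Suc (Suc h)) (Suc k))
          * qnum q (nat (A0 (Suc h) (Suc k)) + 1))
        \<odot>\<^bsub>hc0\<^esub> T_elt q n r (A0 + E (Suc h) (Suc k) - E (Suc (Suc h)) (Suc k), A1)
      \<oplus>\<^bsub>hc0\<^esub> unit_pow q (int (\<Sum>j=Suc k+1..n. base (A0, A1) (Suc h) j))
        \<odot>\<^bsub>hc0\<^esub> T_elt q n r (A0, A1 + E (Suc h) (Suc k) - E (Suc (Suc h)) (Suc k))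
      \<oplus>\<^bsub>hc0\<^esub> (unit_pow q (int (\<Sum>j=Suc k+1..n. base (A0, A1) (Suc h) j) - 1)
          * qnum2 q (q\<^sup>2) (base (A0, A1) (Suc h) (Suc k) + 1))
        \<odot>\<^bsub>hc0\<^esub> T_elt q n r (A0 + 2 * E (Suc h) (Suc k), A1 - E (Suc h) (Suc k) - E (Suc (Suc h)) (Suc k))
      = rep_hc (G k)" if k: "k < n" for k
  proof -
    let ?t = "k * n + h"
    have N: "(\<Sum>j=Suc k+1..n. base (A0, A1) (Suc h) j) = N k"
      unfolding N_def
      by (rule sum.reindex_bij_witness[of _ Suc "\<lambda>j. j - 1"])
        (use h in \<open>auto simp: f_def flat_index One_nat_def Suc_le_eq\<close>)
    note e = entries_cell[OF k h refl]
    have c1: "unit_pow q (int (N k) + int (ex (Suc ?t))) * qnum q (nat (int (f ?t) - int (ex ?t)) + 1) =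
        q ^ N k * (q ^ ex (Suc ?t) * qnum q (Suc (f ?t - ex ?t)))"
    proof -
      have "nat (int (f ?t) - int (ex ?t)) + 1 = Suc (f ?t - ex ?t)" by simp
      moreover have "int (N k) + int (ex (Suc ?t)) = int (N k + ex (Suc ?t))" by simp
      ultimately show ?thesis by (simp only: unit_pow_int power_add mult.assoc)
    qed
    have c3: "unit_pow q (int (N k) - 1) * qnum2 q (q\<^sup>2) (f ?t + 1) =
        q ^ N k * (y * (qnum q (Suc (f ?t)) - qnum (q\<^sup>2) (Suc (f ?t))))"
      by (simp add: unit_pow_pred[OF y] qnum2_def mult.assoc Suc_eq_plus1)
    show ?thesis
      unfolding N e raise_even[OF k h refl] raise_odd[OF k h refl] raise_pair[OF k h refl] c1 unit_pow_int c3
        rep_sc_mult[symmetric] rep_hc_plus[symmetric] G_def HC.raise_terms_def Let_def qn_rep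
        sc_mult sc_power sc_minus
      by (simp add: distrib_left mult.assoc)
  qed
  have "raise_sum q n r (Suc h) A0 A1 = rep_hc (\<Sum>k\<in>{1..n}. G (k - 1))"
    unfolding raise_sum_def Let_def
  proof (rule finsum_rep)
    fix k assume "k \<in> {1..n}"
    then obtain k' where k': "k = Suc k'" "k' < n" by (cases k) auto
    then show "(unit_pow q (int (\<Sum>j=k+1..n. base (A0, A1) (Suc h) j) + A1 (Suc h + 1) k)
          * qnum q (nat (A0 (Suc h) k) + 1))
        \<odot>\<^bsub>hecke_clifford q r\<^esub> T_elt q n r (A0 + E (Suc h) k - E (Suc h + 1) k, A1)
      \<oplus>\<^bsub>hecke_clifford q r\<^esub> unit_pow q (int (\<Sum>j=k+1..n. base (A0, A1) (Suc h) j))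
        \<odot>\<^bsub>hecke_clifford q r\<^esub> T_elt q n r (A0, A1 + E (Suc h) k - E (Suc h + 1) k)
      \<oplus>\<^bsub>hecke_clifford q r\<^esub> (unit_pow q (int (\<Sum>j=k+1..n. base (A0, A1) (Suc h) j) - 1)
          * qnum2 q (q\<^sup>2) (base (A0, A1) (Suc h) k + 1))
        \<odot>\<^bsub>hecke_clifford q r\<^esub> T_elt q n r (A0 + 2 * E (Suc h) k, A1 - E (Suc h) k - E (Suc h + 1) k)
      = rep_hc (G (k - 1))"
      unfolding Sh hc0_params k'(1) using trm[OF k'(2)] by simp
  qed
  also have "(\<Sum>k\<in>{1..n}. G (k - 1)) = (\<Sum>k<n. G k)"
    by (simp add: sum.atLeast1_atMost_eq One_nat_def)
  finally show ?thesis by (simp only: G_def N_def)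
qed

lemma lower_sum_rep:
  assumes h: "Suc h < n" and y: "q * y = 1"
  shows "lower_sum q n r (Suc h) A0 A1 = rep_hc (\<Sum>k<n. sc q ^ (\<Sum>j<k. f (Suc (j * n + h))) *
    HC.lower_terms n f ex (sc y) (k * n + h))"
proof -
  define N where "N k = (\<Sum>j<k. f (Suc (j * n + h)))" for k
  define G where "G k = sc q ^ N k * HC.lower_terms n f ex (sc y) (k * n + h)" for k
  have Sh: "Suc h + 1 = Suc (Suc h)" by simp
  have trm: "(unit_pow q (int (\<Sum>u\<in>{1..<Suc k}. base (A0, A1) (Suc (Suc h)) u))
          * qnum q (nat (A0 (Suc (Suc h)) (Suc k)) + 1))
        \<odot>\<^bsub>hc0\<^esub> T_elt q n r (A0 - E (Suc h) (Suc k) + E (Suc (Suc h)) (Suc k), A1)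
      \<oplus>\<^bsub>hc0\<^esub> unit_pow q (int (\<Sum>u\<in>{1..<Suc k}. base (A0, A1) (Suc (Suc h)) u) + int (base (A0, A1) (Suc h) (Suc k)) - 1)
        \<odot>\<^bsub>hc0\<^esub> T_elt q n r (A0, A1 - E (Suc h) (Suc k) + E (Suc (Suc h)) (Suc k))
      \<oplus>\<^bsub>hc0\<^esub> (unit_pow q (int (\<Sum>u\<in>{1..<Suc k}. base (A0, A1) (Suc (Suc h)) u) + int (base (A0, A1) (Suc h) (Suc k)) - 2)
          * qnum2 q (q\<^sup>2) (base (A0, A1) (Suc (Suc h)) (Suc k) + 1))
        \<odot>\<^bsub>hc0\<^esub> T_elt q n r (A0 + 2 * E (Suc (Suc h)) (Suc k), A1 - E (Suc h) (Suc k) - E (Suc (Suc h)) (Suc k))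
      = rep_hc (G k)" if k: "k < n" for k
  proof -
    let ?t = "k * n + h"
    have N: "(\<Sum>u\<in>{1..<Suc k}. base (A0, A1) (Suc (Suc h)) u) = N k"
      unfolding N_def atLeastLessThanSuc_atLeastAtMost
      using h flat_index[of "Suc h" n "base (A0, A1)"]
      by (simp add: sum.atLeast1_atMost_eq One_nat_def f_def)
    note e = entries_cell[OF k h refl]
    have c1: "unit_pow q (int (N k)) * qnum q (nat (int (f (Suc ?t)) - int (ex (Suc ?t))) + 1) =
        q ^ N k * qnum q (Suc (f (Suc ?t) - ex (Suc ?t)))"
    proof -
      have "nat (int (f (Suc ?t)) - int (ex (Suc ?t))) + 1 = Suc (f (Suc ?t) - ex (Suc ?t))" by simp
      then show ?thesis by (simp only: unit_pow_int)
    qed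
    show ?thesis
    \<comment> \<open>The exponents with \<open>f ?t - 1\<close> and \<open>f ?t - 2\<close> belong
      to terms that vanish unless the upper cell is odd. If it is odd, \<open>f ?t\<close> is
      positive and only the second exponent can reach \<open>-1\<close>.\<close>
    proof (cases "ex ?t = 1")
      case False
      then show ?thesis
        unfolding N e lower_even[OF k h refl] lower_odd[OF k h refl] lower_pair[OF k h refl] c1
          rep_sc_mult[symmetric] rep_hc_plus[symmetric] G_def HC.lower_terms_def Let_def qn_rep
          sc_mult sc_power sc_minus
        by (simp add: distrib_left mult.assoc)
    next
      case True
      then have "0 < f ?t" using star_entries(4)[OF cell(2)[OF k h refl]] by simp
      then have I: "int (N k) + int (f ?t) - 1 = int (N k + (f ?t - 1))"
        "int (N k) + int (f ?t) - 2 = int (N k + (f ?t - 1)) - 1" by simp_all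
      have c2: "unit_pow q (int (N k) + int (f ?t) - 1) = q ^ N k * q ^ (f ?t - 1)"
        unfolding I unit_pow_int by (rule power_add)
      have c3: "unit_pow q (int (N k) + int (f ?t) - 2) * qnum2 q (q\<^sup>2) (f (Suc ?t) + 1) =
          q ^ N k * (q ^ (f ?t - 1) * (y * (qnum q (Suc (f (Suc ?t))) - qnum (q\<^sup>2) (Suc (f (Suc ?t))))))"
        unfolding I unit_pow_pred[OF y] power_add by (simp add: qnum2_def mult.assoc Suc_eq_plus1)
      show ?thesis
        unfolding N e lower_even[OF k h refl] lower_odd[OF k h refl] lower_pair[OF k h refl] c1 c2 c3
          rep_sc_mult[symmetric] rep_hc_plus[symmetric] G_def HC.lower_terms_def Let_def qn_rep
          sc_mult sc_power sc_minus
        by (simp add: distrib_left mult.assoc)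
    qed
  qed
  have "lower_sum q n r (Suc h) A0 A1 = rep_hc (\<Sum>k\<in>{1..n}. G (k - 1))"
    unfolding lower_sum_def Let_def
  proof (rule finsum_rep)
    fix k assume "k \<in> {1..n}"
    then obtain k' where k': "k = Suc k'" "k' < n" by (cases k) auto
    then show "(unit_pow q (int (\<Sum>u\<in>{1..<k}. base (A0, A1) (Suc h + 1) u))
          * qnum q (nat (A0 (Suc h + 1) k) + 1))
        \<odot>\<^bsub>hecke_clifford q r\<^esub> T_elt q n r (A0 - E (Suc h) k + E (Suc h + 1) k, A1)
      \<oplus>\<^bsub>hecke_clifford q r\<^esub> unit_pow q (int (\<Sum>u\<in>{1..<k}. base (A0, A1) (Suc h + 1) u) + int (base (A0, A1) (Suc h) k) - 1)
        \<odot>\<^bsub>hecke_clifford q r\<^esub> T_elt q n r (A0, A1 - E (Suc h) k + E (Suc h + 1) k)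
      \<oplus>\<^bsub>hecke_clifford q r\<^esub> (unit_pow q (int (\<Sum>u\<in>{1..<k}. base (A0, A1) (Suc h + 1) u) + int (base (A0, A1) (Suc h) k) - 2)
          * qnum2 q (q\<^sup>2) (base (A0, A1) (Suc h + 1) k + 1))
        \<odot>\<^bsub>hecke_clifford q r\<^esub> T_elt q n r (A0 + 2 * E (Suc h + 1) k, A1 - E (Suc h) k - E (Suc h + 1) k)
      = rep_hc (G (k - 1))"
      unfolding Sh hc0_params k'(1) using trm[OF k'(2)] by simp
  qed
  also have "(\<Sum>k\<in>{1..n}. G (k - 1)) = (\<Sum>k<n. G k)"
    by (simp add: sum.atLeast1_atMost_eq One_nat_def)
  finally show ?thesis by (simp only: G_def N_def)
qed

lemma T_star_right_multiple:
  "\<exists>y\<in>carrier (hecke_clifford q r).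
    T_star q n r (A0, A1) = y \<otimes>\<^bsub>hecke_clifford q r\<^esub> x_elt q (co n (base (A0, A1)))"
proof -
  note r = star_total[unfolded f_def]
  have "\<exists>y. HC.tst n f ex = y * HC.SS (yg r (\<lambda>x. blk f x div n))"
    by (rule HC.SS_right_multiple) (simp_all add: star_total star_entries)
  then obtain y where y: "HC.tst n f ex = y * HC.SS (yg r (\<lambda>x. blk f x div n))" by blast
  have b: "blk (colsum n f) x = blk f x div n" if x: "x \<in> {1..r}" for x
  proof -
    have "0 < n" using x star_total by (cases n) auto
    then show ?thesis using x blk_colsum[of x f n n] star_total by simp
  qed
  have "yg r (blk (colsum n f)) = yg r (\<lambda>x. blk f x div n)"
    by (rule fibre_cong) (use b in auto)
  moreover have "x_elt q (co n (base (A0, A1))) = rep_hc (HC.SS (yg r (blk (colsum n f))))"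
    unfolding co_flat f_def by (rule x_elt_rep) (simp add: ps_colsum[symmetric] r)
  moreover have "T_star q n r (A0, A1) = rep_hc (HC.tst n f ex)"
    using T_star_rep[of n "(A0, A1)"] r by (simp add: f_def ex_def)
  ultimately have "T_star q n r (A0, A1) = rep_hc y \<otimes>\<^bsub>hc0\<^esub> x_elt q (co n (base (A0, A1)))"
    by (simp add: y rep_hc_times)
  then show ?thesis unfolding hc0_params by (intro bexI[OF _ rep_hc])
qed

lemma T_tail_typed:
  "T_tail q n r (A0, A1) = rep_hc (HC.Tw (shuffle n f) * HC.cst f ex 0 (n * n) * HC.sig n f)"
  using T_tail_rep[of n "(A0, A1)"] star_total by (simp add: f_def ex_def)

lemma lam_typed: "ro n (base (A0, A1)) = map (rowsum n f) [0..<n]" "length (ro n (base (A0, A1))) = n"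
  by (simp_all add: ro_flat f_def)

lemma dmat_lam:
  assumes "u < n * n"
  shows "dmat n ((!) (ro n (base (A0, A1)))) u = dmat n (rowsum n f) u"
  using grid_bounds[OF assms] by (simp add: dmat_def lam_typed)

lemma raise_product:
  assumes h: "Suc h < n" and y: "q * y = 1" and lam: "lam = ro n (base (A0, A1))"
    and B: "(diag lam + E (Suc h) (Suc h + 1) - E (Suc h + 1) (Suc h + 1), 0) \<in> star_mats n"
  shows "T_star q n r (diag lam + E (Suc h) (Suc h + 1) - E (Suc h + 1) (Suc h + 1), 0)
    \<otimes>\<^bsub>hecke_clifford q r\<^esub> T_tail q n r (A0, A1) = raise_sum q n r (Suc h) A0 A1"
proof -
  let ?R = "rowsum n f"
  let ?d = "dmat n ?R"
  define u where "u = Suc h * n + h"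
  have Su: "Suc u = Suc h * n + Suc h" by (simp add: u_def)
  have u: "Suc u < n * n" "u < n * n" using HC.index_less[OF h h] by (simp_all add: u_def)
  have du: "?d u = 0" using dmat_index[of h n ?R "Suc h"] h by (simp add: u_def)
  have dSu: "?d (Suc u) = ?R (Suc h)" unfolding Su using dmat_index[OF h, of ?R "Suc h"] by simp
  have fE: "flat n (E (Suc h) (Suc (Suc h))) v = (if v = u then 1 else 0)"
    "flat n (E (Suc (Suc h)) (Suc (Suc h))) v = (if v = Suc u then 1 else 0)" for v
    unfolding u_def using flat_E_cell[OF h h refl] by simp_all
  have Sh: "Suc h + 1 = Suc (Suc h)" by simp
  have fl: "flat n (diag lam + E (Suc h) (Suc (Suc h)) - E (Suc (Suc h)) (Suc (Suc h))) v =
      int (?d v) + (if v = u then 1 else 0) - (if v = Suc u then 1 else 0)" if "v < n * n" for v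
    using that by (simp add: flat_simps fE flat_diag lam lam_typed(2) dmat_lam)
  have "0 \<le> flat n (diag lam + E (Suc h) (Suc (Suc h)) - E (Suc (Suc h)) (Suc (Suc h))) (Suc u)"
    using B u(1) unfolding Sh star_mats_flat by blast
  \<comment> \<open>That the elementary matrix has no negative entry means that row
    \<open>Suc h\<close> is not empty, so there is a position to move.\<close>
  then have row: "0 < ?R (Suc h)" unfolding fl[OF u(1)] dSu by simp
  let ?g = "?d(u := 1, Suc u := ?R (Suc h) - 1)"
  have "?g = ?d(u := Suc (?d u), Suc u := ?d (Suc u) - 1)" by (simp add: du dSu One_nat_def)
  then have tot: "ps ?g (n * n) = r"
    using ps_move_up[of ?d u "n * n"] row u star_total by (simp add: dSu ps_dmat_total ps_rowsum_total)
  have supp: "supp_mat n (diag lam + E (Suc h) (Suc (Suc h)) - E (Suc (Suc h)) (Suc (Suc h)))"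
    by (intro supp_mat_simps) (use h in \<open>simp_all add: lam lam_typed(2)\<close>)
  have "flat n (diag lam + E (Suc h) (Suc (Suc h)) - E (Suc (Suc h)) (Suc (Suc h))) v + flat n 0 v = int (?g v)" if "v < n * n" for v
    using row by (auto simp: fl[OF that] flat_simps(4) du dSu One_nat_def)
  note B2 = T_elt_rep[OF supp supp_mat_simps(4) this, of "\<lambda>_. 0", OF _ _ _ tot, simplified flat_simps(4)]
  from B2 have "T_star q n r (diag lam + E (Suc h) (Suc h + 1) - E (Suc h + 1) (Suc h + 1), 0) = rep_hc (HC.tst n ?g (\<lambda>_. 0))"
    unfolding Sh by (simp add: T_elt_def fun_upd_def)
  moreover have "HC.tst n ?g (\<lambda>_. 0) = HC.SS (yg r ((blk ?R)(Suc (ps ?R (Suc h)) := h)))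
      * HC.Vup (Suc (ps ?R (Suc h))) (ps ?R (Suc (Suc h)))"
    unfolding u_def by (rule HC.tst_elementary_up) (use h row star_total in \<open>simp_all add: ps_rowsum_total\<close>)
  moreover have "HC.SS (yg r ((blk ?R)(Suc (ps ?R (Suc h)) := h)))
      * HC.Vup (Suc (ps ?R (Suc h))) (ps ?R (Suc (Suc h))) * HC.Tw (shuffle n f) * HC.cst f ex 0 (n * n) * HC.sig n f =
    (\<Sum>k<n. sc q ^ (\<Sum>j\<in>{k<..<n}. f (j * n + h)) * HC.raise_terms n f ex (sc y) (k * n + h))"
  proof (rule HC.root_raise[OF star_total[symmetric] h row])
    show "sc y * sc q = 1" using y by (simp add: sc_mult[symmetric] mult.commute sc_1)
    show "ex u \<le> f u \<and> ex u \<le> 1" if "u < n * n" for u using star_entries(3,4)[OF that] by simp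
  qed
  ultimately show ?thesis
    unfolding raise_sum_rep[OF h y] T_tail_typed hc0_params rep_hc_times[symmetric]
    by (simp only: mult.assoc rep_hc_times[symmetric])
qed

lemma lower_product:
  assumes h: "Suc h < n" and y: "q * y = 1" and lam: "lam = ro n (base (A0, A1))"
    and B: "(diag lam - E (Suc h) (Suc h) + E (Suc h + 1) (Suc h), 0) \<in> star_mats n"
  shows "T_star q n r (diag lam - E (Suc h) (Suc h) + E (Suc h + 1) (Suc h), 0)
    \<otimes>\<^bsub>hecke_clifford q r\<^esub> T_tail q n r (A0, A1) = lower_sum q n r (Suc h) A0 A1"
proof -
  let ?R = "rowsum n f"
  let ?d = "dmat n ?R"
  have h': "h < n" using h by simp
  define u where "u = h * n + h"
  have Su: "Suc u = h * n + Suc h" by (simp add: u_def)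
  have u: "Suc u < n * n" "u < n * n" using HC.index_less[OF h' h] by (simp_all add: u_def)
  have du: "?d u = ?R h" using dmat_index[of h n ?R h] h by (simp add: u_def)
  have dSu: "?d (Suc u) = 0" unfolding Su using dmat_index[OF h, of ?R h] by simp
  have fE: "flat n (E (Suc h) (Suc h)) v = (if v = u then 1 else 0)"
    "flat n (E (Suc (Suc h)) (Suc h)) v = (if v = Suc u then 1 else 0)" for v
    unfolding u_def using flat_E_cell[OF h' h refl] by simp_all
  have Sh: "Suc h + 1 = Suc (Suc h)" by simp
  have fl: "flat n (diag lam - E (Suc h) (Suc h) + E (Suc (Suc h)) (Suc h)) v =
      int (?d v) - (if v = u then 1 else 0) + (if v = Suc u then 1 else 0)" if "v < n * n" for v
    using that by (simp add: flat_simps fE flat_diag lam lam_typed(2) dmat_lam)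
  have "0 \<le> flat n (diag lam - E (Suc h) (Suc h) + E (Suc (Suc h)) (Suc h)) u"
    using B u(2) unfolding Sh star_mats_flat by blast
  then have row: "0 < ?R h" unfolding fl[OF u(2)] du by simp
  let ?g = "?d(u := ?R h - 1, Suc u := 1)"
  have "?g = ?d(u := ?d u - 1, Suc u := Suc (?d (Suc u)))" by (simp add: du dSu One_nat_def)
  then have tot: "ps ?g (n * n) = r"
    using ps_move_down[of ?d u "n * n"] row u star_total by (simp add: du ps_dmat_total ps_rowsum_total)
  have supp: "supp_mat n (diag lam - E (Suc h) (Suc h) + E (Suc (Suc h)) (Suc h))"
    by (intro supp_mat_simps) (use h in \<open>simp_all add: lam lam_typed(2)\<close>)
  have "flat n (diag lam - E (Suc h) (Suc h) + E (Suc (Suc h)) (Suc h)) v + flat n 0 v = int (?g v)" if "v < n * n" for v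
    using row by (auto simp: fl[OF that] flat_simps(4) du dSu One_nat_def)
  note B2 = T_elt_rep[OF supp supp_mat_simps(4) this, of "\<lambda>_. 0", OF _ _ _ tot, simplified flat_simps(4)]
  from B2 have "T_star q n r (diag lam - E (Suc h) (Suc h) + E (Suc h + 1) (Suc h), 0) = rep_hc (HC.tst n ?g (\<lambda>_. 0))"
    unfolding Sh by (simp add: T_elt_def fun_upd_def)
  moreover have "HC.tst n ?g (\<lambda>_. 0) = HC.SS (yg r ((blk ?R)(ps ?R (Suc h) := Suc h)))
      * HC.Vdn (Suc (ps ?R h)) (ps ?R (Suc h))"
    unfolding u_def by (rule HC.tst_elementary_down) (use h row star_total in \<open>simp_all add: ps_rowsum_total\<close>)
  moreover have "HC.SS (yg r ((blk ?R)(ps ?R (Suc h) := Suc h)))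
      * HC.Vdn (Suc (ps ?R h)) (ps ?R (Suc h)) * HC.Tw (shuffle n f) * HC.cst f ex 0 (n * n) * HC.sig n f =
    (\<Sum>k<n. sc q ^ (\<Sum>j<k. f (Suc (j * n + h))) * HC.lower_terms n f ex (sc y) (k * n + h))"
  proof (rule HC.root_lower[OF star_total[symmetric] h row])
    show "sc y * sc q = 1" using y by (simp add: sc_mult[symmetric] mult.commute sc_1)
    show "ex u \<le> f u \<and> ex u \<le> 1" if "u < n * n" for u using star_entries(3,4)[OF that] by simp
  qed
  ultimately show ?thesis
    unfolding lower_sum_rep[OF h y] T_tail_typed hc0_params rep_hc_times[symmetric]
    by (simp only: mult.assoc rep_hc_times[symmetric])
qed

end

lemma T_star_diag:
  assumes "mu \<in> compositions n r"
  shows "T_star q n r (diag mu, 0) = x_elt q mu"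
proof -
  have l: "length mu = n" and "sum_list mu = r" using assms by (auto simp: compositions_def)
  then have ps: "ps ((!) mu) n = r" using map_nth_upt[OF l] by (metis sum_list_map)
  have tot: "ps (dmat n ((!) mu)) (n * n) = r" by (simp add: ps ps_dmat_total)
  have "flat n (diag mu) v + flat n 0 v = int (dmat n ((!) mu) v)" if "v < n * n" for v
    using that by (simp add: flat_diag[OF l] flat_simps(4))
  note B2 = T_elt_rep[OF supp_mat_simps(6)[OF l] supp_mat_simps(4) this, of "\<lambda>_. 0", OF _ _ _ tot, simplified flat_simps(4)]
  from B2 have "T_star q n r (diag mu, 0) = rep_hc (HC.SS (yg r (blk ((!) mu))))"
    using HC.tst_diag[OF ps[symmetric]] by (simp add: T_elt_def)
  also have "\<dots> = x_elt q (map ((!) mu) [0..<n])" by (rule x_elt_rep[OF ps, symmetric])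
  finally show ?thesis using map_nth_upt[OF l] by simp
qed

lemma hc_formulas_params:
  assumes "q dvd 1"
  shows "hc_formulas q r"
proof -
  obtain y where y: "q * y = 1" using assms by (metis dvdE)
  show ?thesis
    unfolding hc_formulas_def
  proof (intro conjI allI impI ballI)
    fix n mu assume mu: "mu \<in> compositions n r"
    show "T_star q n r (diag mu, 0) = x_elt q mu" by (rule T_star_diag[OF mu])
    have l: "length mu = n" and "sum_list mu = r" using mu by (auto simp: compositions_def)
    then have "ps ((!) mu) n = r" using map_nth_upt[OF l] by (metis sum_list_map)
    then show "x_elt q mu \<in> carrier (hecke_clifford q r)"
      using x_elt_rep[of "(!) mu" n] map_nth_upt[OF l] by (simp add: hc0_params rep_hc)
  next
    fix n A0 A1 assume A: "(A0, A1) \<in> star_mats_deg n r"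
    note r = star_total[OF A refl refl]
    show "T_tail q n r (A0, A1) \<in> carrier (hecke_clifford q r)"
      unfolding T_tail_rep[OF r] hc0_params by (rule rep_hc)
    show "T_star q n r (A0, A1) = x_elt q (ro n (base (A0, A1))) \<otimes>\<^bsub>hecke_clifford q r\<^esub> T_tail q n r (A0, A1)"
      by (rule T_star_tail[OF r])
    show "\<exists>y\<in>carrier (hecke_clifford q r).
        T_star q n r (A0, A1) = y \<otimes>\<^bsub>hecke_clifford q r\<^esub> x_elt q (co n (base (A0, A1)))"
      by (rule T_star_right_multiple[OF A refl refl])
    fix h lam assume "h \<in> {1..n-1}" and lam: "lam = ro n (base (A0, A1))"
    then obtain h' where h: "h = Suc h'" "Suc h' < n" by (cases h) auto
    show "T_star q n r (diag lam + E h (h+1) - E (h+1) (h+1), 0) \<otimes>\<^bsub>hecke_clifford q r\<^esub>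
            T_tail q n r (A0, A1) = raise_sum q n r h A0 A1"
      if "(diag lam + E h (h+1) - E (h+1) (h+1), 0) \<in> star_mats n"
      using raise_product[OF A refl refl h(2) y lam] that by (simp only: h(1))
    show "T_star q n r (diag lam - E h h + E (h+1) h, 0) \<otimes>\<^bsub>hecke_clifford q r\<^esub>
            T_tail q n r (A0, A1) = lower_sum q n r h A0 A1"
      if "(diag lam - E h h + E (h+1) h, 0) \<in> star_mats n"
      using lower_product[OF A refl refl h(2) y lam] that by (simp only: h(1))
  qed
qed

end

theorem hecke_clifford_formulas:
  fixes q :: "'a::comm_ring_1"
  assumes "q dvd 1"
  shows "hc_formulas q r"
proof (rule ccontr)
  assume "\<not> hc_formulas q r"
  with assms have "\<exists>p :: 'a \<times> nat. fst p dvd 1 \<and> \<not> hc_formulas (fst p) (snd p)" by auto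
  then have "fst (some_params :: 'a \<times> nat) dvd 1 \<and> \<not> hc_formulas (fst (some_params :: 'a \<times> nat)) (snd (some_params :: 'a \<times> nat))"
    unfolding some_params_def by (rule someI_ex)
  then show False using hc_formulas_params[OF prod.collapse[symmetric]] by blast
qed

section \<open>The queer q-Schur superalgebra\<close>

text \<open>The counterpart of \<open>sc\<close> for arbitrary parameters, as an element of the
  carrier.\<close>

definition hc_scalar :: "'a::comm_ring_1 \<Rightarrow> nat \<Rightarrow> 'a \<Rightarrow> (gen list \<Rightarrow> 'a) set" where
  "hc_scalar q r a = cls q r (a \<odot>\<^bsub>free_alg r\<^esub> \<one>\<^bsub>free_alg r\<^esub>)"

lemma
  fixes q :: "'a::comm_ring_1"
  shows hc_scalar_closed: "hc_scalar q r a \<in> carrier (hecke_clifford q r)"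
    and hc_scalar_left: "x \<in> carrier (hecke_clifford q r) \<Longrightarrow>
      a \<odot>\<^bsub>hecke_clifford q r\<^esub> x = hc_scalar q r a \<otimes>\<^bsub>hecke_clifford q r\<^esub> x"
    and hc_scalar_right: "x \<in> carrier (hecke_clifford q r) \<Longrightarrow>
      a \<odot>\<^bsub>hecke_clifford q r\<^esub> x = x \<otimes>\<^bsub>hecke_clifford q r\<^esub> hc_scalar q r a"
    and hc_scalar_0: "hc_scalar q r 0 = \<zero>\<^bsub>hecke_clifford q r\<^esub>"
    and hc_scalar_1: "hc_scalar q r 1 = \<one>\<^bsub>hecke_clifford q r\<^esub>"
proof -
  interpret C: ring_hom_ring "free_alg r :: ('a, gen list \<Rightarrow> 'a) module" "hecke_clifford q r" "cls q r"
    by (rule cls_hom)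
  have s: "a \<odot>\<^bsub>free_alg r\<^esub> \<one>\<^bsub>free_alg r\<^esub> \<in> carrier (free_alg r :: ('a, gen list \<Rightarrow> 'a) module)"
    by (rule smult_closed[OF one_closed])
  show "hc_scalar q r a \<in> carrier (hecke_clifford q r)"
    unfolding hc_scalar_def by (rule C.hom_closed[OF s])
  have "(0::'a) \<odot>\<^bsub>free_alg r\<^esub> \<one>\<^bsub>free_alg r\<^esub> = \<zero>\<^bsub>free_alg r\<^esub>"
    "(1::'a) \<odot>\<^bsub>free_alg r\<^esub> \<one>\<^bsub>free_alg r\<^esub> = \<one>\<^bsub>free_alg r\<^esub>"
    by (simp_all add: free_alg_smult free_alg_zero)
  then show "hc_scalar q r 0 = \<zero>\<^bsub>hecke_clifford q r\<^esub>" "hc_scalar q r 1 = \<one>\<^bsub>hecke_clifford q r\<^esub>"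
    unfolding hc_scalar_def by (simp_all only: C.hom_zero C.hom_one)
  assume "x \<in> carrier (hecke_clifford q r)"
  then obtain f where f: "f \<in> carrier (free_alg r)" "x = cls q r f" by (rule cls_surj)
  have m: "(a \<odot>\<^bsub>free_alg r\<^esub> \<one>\<^bsub>free_alg r\<^esub>) \<otimes>\<^bsub>free_alg r\<^esub> f = a \<odot>\<^bsub>free_alg r\<^esub> f"
    "f \<otimes>\<^bsub>free_alg r\<^esub> (a \<odot>\<^bsub>free_alg r\<^esub> \<one>\<^bsub>free_alg r\<^esub>) = a \<odot>\<^bsub>free_alg r\<^esub> f"
    by (simp_all only: free_alg_mult smult_mult free_alg_one one_conv conv_one)
  show "a \<odot>\<^bsub>hecke_clifford q r\<^esub> x = hc_scalar q r a \<otimes>\<^bsub>hecke_clifford q r\<^esub> x"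
    "a \<odot>\<^bsub>hecke_clifford q r\<^esub> x = x \<otimes>\<^bsub>hecke_clifford q r\<^esub> hc_scalar q r a"
    unfolding f(2) smult_cls[OF f(1)] hc_scalar_def C.hom_mult[OF s f(1), symmetric] C.hom_mult[OF f(1) s, symmetric] m
    by (rule refl)+
qed

section \<open>Row and column sums of matrix pairs\<close>

lemma finite_compositions: "finite (compositions n r)"
proof (rule finite_subset)
  show "compositions n r \<subseteq> {xs. set xs \<subseteq> {..r} \<and> length xs = n}"
    by (auto simp: compositions_def dest: member_le_sum_list)
qed (simp add: finite_lists_length_eq)

lemma sum_list_ro: "sum_list (ro n a) = (\<Sum>i=1..n. \<Sum>j=1..n. a i j)"
  unfolding ro_flat sum_list_map ps_rowsum_total degree_flat ..

lemma sum_list_co: "sum_list (co n a) = (\<Sum>i=1..n. \<Sum>j=1..n. a i j)"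
  unfolding co_flat sum_list_map ps_colsum[symmetric] degree_flat ..

lemma length_ro_co [simp]: "length (ro n a) = n" "length (co n a) = n"
  by (simp_all add: ro_flat co_flat)

lemma ro_co_compositions:
  assumes "M \<in> star_mats_deg n r"
  shows "ro n (base M) \<in> compositions n r" "co n (base M) \<in> compositions n r"
  using assms by (simp_all add: compositions_def star_mats_deg_def sum_list_ro sum_list_co)

lemma star_mats_deg_iff: "M \<in> star_mats_deg n r \<longleftrightarrow> M \<in> star_mats n \<and> sum_list (co n (base M)) = r"
  by (simp add: star_mats_deg_def sum_list_co)

lemma base_int:
  assumes "(B0, B1) \<in> star_mats n"
  shows "int (base (B0, B1) i j) = B0 i j + B1 i j"
proof (cases "i \<in> {1..n} \<and> j \<in> {1..n}")
  case True
  then have "0 \<le> B0 i j" "B1 i j \<in> {0, 1}" using assms by (auto simp: star_mats_def)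
  then show ?thesis by (auto simp: base_def)
next
  case False
  then have "B0 i j = 0 \<and> B1 i j = 0" using assms by (auto simp: star_mats_def)
  then show ?thesis by (simp add: base_def)
qed

lemma ro_int:
  assumes "(B0, B1) \<in> star_mats n" "i < n"
  shows "int (ro n (base (B0, B1)) ! i) = (\<Sum>j=1..n. B0 (Suc i) j + B1 (Suc i) j)"
  using assms by (simp add: ro_def base_int One_nat_def del: upt_Suc)

lemma co_int:
  assumes "(B0, B1) \<in> star_mats n" "j < n"
  shows "int (co n (base (B0, B1)) ! j) = (\<Sum>i=1..n. B0 i (Suc j) + B1 i (Suc j))"
  using assms by (simp add: co_def base_int One_nat_def del: upt_Suc)

text \<open>Only the base matters: a unit moves within column \<open>k\<close> from row
  \<open>h2\<close> to row \<open>h1\<close>, however it is divided between even and odd part. This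
  covers the elementary matrix and the three kinds of summands alike.\<close>

lemma move_box:
  assumes A: "(A0, A1) \<in> star_mats n" and B: "(B0, B1) \<in> star_mats n"
    and h: "h1 \<in> {1..n}" "h2 \<in> {1..n}" and k: "k \<in> {1..n}"
    and eq: "\<And>i j. B0 i j + B1 i j = A0 i j + A1 i j + E h1 k i j - E h2 k i j"
  shows "co n (base (B0, B1)) = co n (base (A0, A1))"
    and "i < n \<Longrightarrow> int (ro n (base (B0, B1)) ! i) =
      int (ro n (base (A0, A1)) ! i) + (if Suc i = h1 then 1 else 0) - (if Suc i = h2 then 1 else 0)"
proof -
  have col: "(\<Sum>i=1..n. E h0 k i j) = (if j = k then 1 else 0)" if "h0 \<in> {1..n}" for h0 j
  proof -
    have "(\<Sum>i=1..n. E h0 k i j) = (\<Sum>i=1..n. if i = h0 then if j = k then 1 else 0 else 0)"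
      by (intro sum.cong) (auto simp: E_def)
    then show ?thesis using that by (simp add: sum.delta)
  qed
  have row: "(\<Sum>j=1..n. E h0 k i j) = (if i = h0 then 1 else 0)" for h0 i
  proof -
    have "(\<Sum>j=1..n. E h0 k i j) = (\<Sum>j=1..n. if j = k then if i = h0 then 1 else 0 else 0)"
      by (intro sum.cong) (auto simp: E_def)
    then show ?thesis using k by (simp add: sum.delta)
  qed
  have "int (co n (base (B0, B1)) ! j) = int (co n (base (A0, A1)) ! j)" if "j < n" for j
    unfolding co_int[OF B that] co_int[OF A that] eq
    using col[OF h(1)] col[OF h(2)] by (simp add: sum.distrib sum_subtractf)
  then show "co n (base (B0, B1)) = co n (base (A0, A1))"
    by (intro nth_equalityI) simp_all
  show "int (ro n (base (B0, B1)) ! i) =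
      int (ro n (base (A0, A1)) ! i) + (if Suc i = h1 then 1 else 0) - (if Suc i = h2 then 1 else 0)" if "i < n"
    unfolding ro_int[OF B that] ro_int[OF A that] eq
    by (simp only: sum.distrib sum_subtractf row)
qed

lemma diag_star_mats: "lam \<in> compositions n r \<Longrightarrow> (diag lam, 0) \<in> star_mats n"
  by (auto simp: star_mats_def diag_def compositions_def)

lemma ro_co_diag:
  assumes "lam \<in> compositions n r"
  shows "ro n (base (diag lam, 0)) = lam" "co n (base (diag lam, 0)) = lam"
proof -
  have l: "length lam = n" using assms by (simp add: compositions_def)
  note D = diag_star_mats[OF assms]
  have "(\<Sum>j=1..n. diag lam (Suc i) j) = int (lam ! i)" "(\<Sum>j=1..n. diag lam j (Suc i)) = int (lam ! i)" if "i < n" for i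
  proof -
    have "(\<Sum>j=1..n. diag lam (Suc i) j) = (\<Sum>j=1..n. if j = Suc i then int (lam ! i) else 0)"
      "(\<Sum>j=1..n. diag lam j (Suc i)) = (\<Sum>j=1..n. if j = Suc i then int (lam ! i) else 0)"
      using that l by (auto intro!: sum.cong simp: diag_def One_nat_def)
    then show "(\<Sum>j=1..n. diag lam (Suc i) j) = int (lam ! i)" "(\<Sum>j=1..n. diag lam j (Suc i)) = int (lam ! i)"
      using that by (simp_all add: sum.delta One_nat_def)
  qed
  then show "ro n (base (diag lam, 0)) = lam" "co n (base (diag lam, 0)) = lam"
    using ro_int[OF D] co_int[OF D] by (intro nth_equalityI; simp add: l)+
qed

lemma diag_star_mats_deg: "lam \<in> compositions n r \<Longrightarrow> (diag lam, 0) \<in> star_mats_deg n r"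
  unfolding star_mats_deg_iff by (simp add: diag_star_mats ro_co_diag) (simp add: compositions_def)

context
  fixes q :: "'a::comm_ring_1" and n r :: nat
  assumes formulas: "hc_formulas q r"
begin

abbreviation (input) "HA \<equiv> hecke_clifford q r"
abbreviation (input) "DS \<equiv> dsum q n r"
abbreviation (input) "QS \<equiv> queer_schur q n r"
abbreviation (input) "CO \<equiv> compositions n r"

interpretation H: ring HA by (rule hc_ring)

lemma x_closed: "mu \<in> CO \<Longrightarrow> x_elt q mu \<in> carrier HA"
  and T_star_diag_x: "mu \<in> CO \<Longrightarrow> T_star q n r (diag mu, 0) = x_elt q mu"
  using formulas unfolding hc_formulas_def by blast+

lemma T_star_facts:
  assumes "(A0, A1) \<in> star_mats_deg n r"
  shows "T_tail q n r (A0, A1) \<in> carrier HA"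
    and "T_star q n r (A0, A1) = x_elt q (ro n (base (A0, A1))) \<otimes>\<^bsub>HA\<^esub> T_tail q n r (A0, A1)"
    and "\<exists>y\<in>carrier HA. T_star q n r (A0, A1) = y \<otimes>\<^bsub>HA\<^esub> x_elt q (co n (base (A0, A1)))"
  using formulas assms unfolding hc_formulas_def by blast+

lemma hc_smult_closed: "x \<in> carrier HA \<Longrightarrow> a \<odot>\<^bsub>HA\<^esub> x \<in> carrier HA"
  by (simp add: hc_scalar_left hc_scalar_closed)

lemma hc_smult_add:
  "x \<in> carrier HA \<Longrightarrow> y \<in> carrier HA \<Longrightarrow> a \<odot>\<^bsub>HA\<^esub> (x \<oplus>\<^bsub>HA\<^esub> y) = a \<odot>\<^bsub>HA\<^esub> x \<oplus>\<^bsub>HA\<^esub> a \<odot>\<^bsub>HA\<^esub> y"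
  by (simp add: hc_scalar_left hc_scalar_closed H.r_distr)

lemma hc_smult_mult:
  "x \<in> carrier HA \<Longrightarrow> y \<in> carrier HA \<Longrightarrow> (a \<odot>\<^bsub>HA\<^esub> x) \<otimes>\<^bsub>HA\<^esub> y = a \<odot>\<^bsub>HA\<^esub> (x \<otimes>\<^bsub>HA\<^esub> y)"
  by (simp add: hc_scalar_left hc_scalar_closed H.m_assoc)

lemma hc_smult_zero: "a \<odot>\<^bsub>HA\<^esub> \<zero>\<^bsub>HA\<^esub> = \<zero>\<^bsub>HA\<^esub>" "x \<in> carrier HA \<Longrightarrow> 0 \<odot>\<^bsub>HA\<^esub> x = \<zero>\<^bsub>HA\<^esub>"
  "x \<in> carrier HA \<Longrightarrow> 1 \<odot>\<^bsub>HA\<^esub> x = x"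
  by (simp_all add: hc_scalar_left hc_scalar_closed hc_scalar_0 hc_scalar_1)

section \<open>Endomorphisms of the direct sum of right ideals\<close>

definition rid :: "nat list \<Rightarrow> (gen list \<Rightarrow> 'a) set set" where
  "rid mu = {x_elt q mu \<otimes>\<^bsub>HA\<^esub> h | h. h \<in> carrier HA}"

lemma ridE:
  assumes "m \<in> rid mu"
  obtains h where "h \<in> carrier HA" "m = x_elt q mu \<otimes>\<^bsub>HA\<^esub> h"
  using assms by (auto simp: rid_def)

lemma rid_closed: "mu \<in> CO \<Longrightarrow> m \<in> rid mu \<Longrightarrow> m \<in> carrier HA"
  by (auto simp: rid_def x_closed)

lemma ridI: "h \<in> carrier HA \<Longrightarrow> x_elt q mu \<otimes>\<^bsub>HA\<^esub> h \<in> rid mu"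
  by (auto simp: rid_def)

lemma rid_zero: "mu \<in> CO \<Longrightarrow> \<zero>\<^bsub>HA\<^esub> \<in> rid mu"
  using ridI[of "\<zero>\<^bsub>HA\<^esub>" mu] by (simp add: x_closed)

lemma rid_add:
  assumes mu: "mu \<in> CO" and "m \<in> rid mu" "m' \<in> rid mu"
  shows "m \<oplus>\<^bsub>HA\<^esub> m' \<in> rid mu"
proof -
  obtain h h' where "h \<in> carrier HA" "h' \<in> carrier HA" "m = x_elt q mu \<otimes>\<^bsub>HA\<^esub> h" "m' = x_elt q mu \<otimes>\<^bsub>HA\<^esub> h'"
    using assms by (auto elim!: ridE)
  then show ?thesis using ridI[of "h \<oplus>\<^bsub>HA\<^esub> h'" mu] by (simp add: H.r_distr x_closed mu)
qed

lemma rid_act: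
  assumes mu: "mu \<in> CO" and "m \<in> rid mu" "g \<in> carrier HA"
  shows "m \<otimes>\<^bsub>HA\<^esub> g \<in> rid mu"
proof -
  obtain h where "h \<in> carrier HA" "m = x_elt q mu \<otimes>\<^bsub>HA\<^esub> h" using assms by (auto elim!: ridE)
  then show ?thesis using ridI[of "h \<otimes>\<^bsub>HA\<^esub> g" mu] assms by (simp add: H.m_assoc x_closed)
qed

lemma rid_smult: "mu \<in> CO \<Longrightarrow> m \<in> rid mu \<Longrightarrow> a \<odot>\<^bsub>HA\<^esub> m \<in> rid mu"
  using rid_act[of mu m "hc_scalar q r a"] rid_closed[of mu m] by (simp add: hc_scalar_right hc_scalar_closed)

lemma V_PiE: "DS = PiE CO rid"
  by (simp add: dsum_def rid_def[abs_def] Let_def)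

lemma V_rid: "v \<in> DS \<Longrightarrow> mu \<in> CO \<Longrightarrow> v mu \<in> rid mu"
  by (auto simp: V_PiE)

lemma V_closed: "v \<in> DS \<Longrightarrow> mu \<in> CO \<Longrightarrow> v mu \<in> carrier HA"
  using V_rid rid_closed by blast

lemma V_eqI: "u \<in> DS \<Longrightarrow> v \<in> DS \<Longrightarrow> (\<And>mu. mu \<in> CO \<Longrightarrow> u mu = v mu) \<Longrightarrow> u = v"
  unfolding V_PiE by (rule PiE_ext)

lemma V_restrict: "(\<And>mu. mu \<in> CO \<Longrightarrow> g mu \<in> rid mu) \<Longrightarrow> (\<lambda>mu\<in>CO. g mu) \<in> DS"
  by (simp add: V_PiE)

lemma dsum_ops_closed:
  "u \<in> DS \<Longrightarrow> v \<in> DS \<Longrightarrow> dsum_add q n r u v \<in> DS"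
  "v \<in> DS \<Longrightarrow> g \<in> carrier HA \<Longrightarrow> dsum_act q n r v g \<in> DS"
  "v \<in> DS \<Longrightarrow> dsum_smult q n r a v \<in> DS"
  "m \<in> rid mu \<Longrightarrow> dsum_in q n r mu m \<in> DS"
  "(\<lambda>mu\<in>CO. \<zero>\<^bsub>HA\<^esub>) \<in> DS"
proof -
  show "dsum_add q n r u v \<in> DS" if "u \<in> DS" "v \<in> DS"
    unfolding dsum_add_def by (rule V_restrict, rule rid_add) (simp_all add: V_rid that)
  show "dsum_act q n r v g \<in> DS" if "v \<in> DS" "g \<in> carrier HA"
    unfolding dsum_act_def by (rule V_restrict, rule rid_act) (simp_all add: V_rid that)
  show "dsum_smult q n r a v \<in> DS" if "v \<in> DS"
    unfolding dsum_smult_def by (rule V_restrict, rule rid_smult) (simp_all add: V_rid that)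
  show "dsum_in q n r mu m \<in> DS" if "m \<in> rid mu"
    unfolding dsum_in_def by (rule V_restrict) (simp add: rid_zero that)
  show "(\<lambda>mu\<in>CO. \<zero>\<^bsub>HA\<^esub>) \<in> DS" by (rule V_restrict) (rule rid_zero)
qed

lemma dsum_ops_apply:
  assumes "mu \<in> CO"
  shows "dsum_add q n r u v mu = u mu \<oplus>\<^bsub>HA\<^esub> v mu"
    "dsum_act q n r v g mu = v mu \<otimes>\<^bsub>HA\<^esub> g"
    "dsum_smult q n r a v mu = a \<odot>\<^bsub>HA\<^esub> v mu"
    "dsum_in q n r lam m mu = (if mu = lam then m else \<zero>\<^bsub>HA\<^esub>)"
  using assms by (simp_all add: dsum_add_def dsum_act_def dsum_smult_def dsum_in_def)

lemma Q_carrier: "f \<in> carrier QS \<longleftrightarrow> f \<in> DS \<rightarrow>\<^sub>E DS \<and>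
    (\<forall>u\<in>DS. \<forall>v\<in>DS. f (dsum_add q n r u v) = dsum_add q n r (f u) (f v)) \<and>
    (\<forall>v\<in>DS. \<forall>h\<in>carrier HA. f (dsum_act q n r v h) = dsum_act q n r (f v) h)"
  by (simp add: queer_schur_def Let_def)

lemma Q_ops:
  "f \<otimes>\<^bsub>QS\<^esub> g = compose DS f g"
  "\<zero>\<^bsub>QS\<^esub> = (\<lambda>v\<in>DS. \<lambda>lam\<in>CO. \<zero>\<^bsub>HA\<^esub>)"
  "f \<oplus>\<^bsub>QS\<^esub> g = (\<lambda>v\<in>DS. dsum_add q n r (f v) (g v))"
  "a \<odot>\<^bsub>QS\<^esub> f = (\<lambda>v\<in>DS. dsum_smult q n r a (f v))"
  by (simp_all add: queer_schur_def Let_def)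

lemma Q_V: "f \<in> carrier QS \<Longrightarrow> v \<in> DS \<Longrightarrow> f v \<in> DS"
  by (auto simp: Q_carrier)

lemma Q_closed: "f \<in> carrier QS \<Longrightarrow> v \<in> DS \<Longrightarrow> mu \<in> CO \<Longrightarrow> f v mu \<in> carrier HA"
  by (rule V_closed[OF Q_V])

lemma Q_apply:
  assumes "v \<in> DS" "mu \<in> CO"
  shows "(f \<otimes>\<^bsub>QS\<^esub> g) v mu = f (g v) mu" "\<zero>\<^bsub>QS\<^esub> v mu = \<zero>\<^bsub>HA\<^esub>"
    "(f \<oplus>\<^bsub>QS\<^esub> g) v mu = f v mu \<oplus>\<^bsub>HA\<^esub> g v mu" "(a \<odot>\<^bsub>QS\<^esub> f) v mu = a \<odot>\<^bsub>HA\<^esub> f v mu"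
  using assms by (simp_all add: Q_ops compose_def dsum_ops_apply)

lemma Q_eqI:
  assumes "f \<in> carrier QS" "g \<in> carrier QS" "\<And>v mu. v \<in> DS \<Longrightarrow> mu \<in> CO \<Longrightarrow> f v mu = g v mu"
  shows "f = g"
proof (rule PiE_ext[of f DS "\<lambda>_. DS" g])
  show "f \<in> DS \<rightarrow>\<^sub>E DS" "g \<in> DS \<rightarrow>\<^sub>E DS" using assms by (simp_all add: Q_carrier)
  fix v assume v: "v \<in> DS"
  show "f v = g v" by (rule V_eqI) (use assms v Q_V in auto)
qed

lemma Q_I:
  assumes DS: "\<And>v. v \<in> DS \<Longrightarrow> F v \<in> DS"
    and add: "\<And>u v mu. u \<in> DS \<Longrightarrow> v \<in> DS \<Longrightarrow> mu \<in> CO \<Longrightarrow> F (dsum_add q n r u v) mu = F u mu \<oplus>\<^bsub>HA\<^esub> F v mu"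
    and act: "\<And>v h mu. v \<in> DS \<Longrightarrow> h \<in> carrier HA \<Longrightarrow> mu \<in> CO \<Longrightarrow> F (dsum_act q n r v h) mu = F v mu \<otimes>\<^bsub>HA\<^esub> h"
  shows "(\<lambda>v\<in>DS. F v) \<in> carrier QS"
  unfolding Q_carrier
proof (intro conjI ballI)
  show "(\<lambda>v\<in>DS. F v) \<in> DS \<rightarrow>\<^sub>E DS" using DS by simp
next
  fix u v assume uv: "u \<in> DS" "v \<in> DS"
  have "F (dsum_add q n r u v) = dsum_add q n r (F u) (F v)"
    by (rule V_eqI) (use uv DS add in \<open>auto simp: dsum_ops_closed dsum_ops_apply\<close>)
  then show "(\<lambda>v\<in>DS. F v) (dsum_add q n r u v) = dsum_add q n r ((\<lambda>v\<in>DS. F v) u) ((\<lambda>v\<in>DS. F v) v)"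
    using uv by (simp add: dsum_ops_closed)
next
  fix v h assume v: "v \<in> DS" "h \<in> carrier HA"
  have "F (dsum_act q n r v h) = dsum_act q n r (F v) h"
    by (rule V_eqI) (use v DS act in \<open>auto simp: dsum_ops_closed dsum_ops_apply\<close>)
  then show "(\<lambda>v\<in>DS. F v) (dsum_act q n r v h) = dsum_act q n r ((\<lambda>v\<in>DS. F v) v) h"
    using v by (simp add: dsum_ops_closed)
qed

lemma Q_add_apply:
  assumes "f \<in> carrier QS" "u \<in> DS" "v \<in> DS" "mu \<in> CO"
  shows "f (dsum_add q n r u v) mu = f u mu \<oplus>\<^bsub>HA\<^esub> f v mu"
  using assms by (simp add: Q_carrier dsum_ops_apply)

lemma Q_act_apply:
  assumes "f \<in> carrier QS" "v \<in> DS" "h \<in> carrier HA" "mu \<in> CO"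
  shows "f (dsum_act q n r v h) mu = f v mu \<otimes>\<^bsub>HA\<^esub> h"
  using assms by (simp add: Q_carrier dsum_ops_apply)

lemma Q_zero_closed: "\<zero>\<^bsub>QS\<^esub> \<in> carrier QS"
  unfolding Q_ops by (rule Q_I) (auto simp: dsum_ops_closed)

lemma Q_add_closed: "f \<in> carrier QS \<Longrightarrow> g \<in> carrier QS \<Longrightarrow> f \<oplus>\<^bsub>QS\<^esub> g \<in> carrier QS"
  unfolding Q_ops
  by (rule Q_I)
    (simp_all add: dsum_ops_closed dsum_ops_apply Q_V Q_add_apply Q_act_apply Q_closed H.a_ac H.l_distr)

lemma Q_smult_closed: "f \<in> carrier QS \<Longrightarrow> a \<odot>\<^bsub>QS\<^esub> f \<in> carrier QS"
  unfolding Q_ops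
  by (rule Q_I)
    (simp_all add: dsum_ops_closed dsum_ops_apply Q_V Q_add_apply Q_act_apply Q_closed hc_smult_add hc_smult_mult)

lemma Q_mult_closed:
  assumes f: "f \<in> carrier QS" and g: "g \<in> carrier QS"
  shows "f \<otimes>\<^bsub>QS\<^esub> g \<in> carrier QS"
  unfolding Q_ops compose_def
proof (rule Q_I)
  show "f (g v) \<in> DS" if "v \<in> DS" for v using Q_V[OF f] Q_V[OF g] that by blast
  show "f (g (dsum_add q n r u v)) mu = f (g u) mu \<oplus>\<^bsub>HA\<^esub> f (g v) mu"
    if "u \<in> DS" "v \<in> DS" "mu \<in> CO" for u v mu
    using g Q_add_apply[OF f Q_V[OF g that(1)] Q_V[OF g that(2)] that(3)] that by (simp add: Q_carrier)
  show "f (g (dsum_act q n r v h)) mu = f (g v) mu \<otimes>\<^bsub>HA\<^esub> h"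
    if "v \<in> DS" "h \<in> carrier HA" "mu \<in> CO" for v h mu
    using g Q_act_apply[OF f Q_V[OF g that(1)] that(2,3)] that by (simp add: Q_carrier)
qed

text \<open>What is required to evaluate \<open>finsum\<close> in \<open>queer_schur\<close>
  componentwise.\<close>

lemma Q_abelian_monoid: "abelian_monoid QS"
proof (rule abelian_monoidI)
  show "\<zero>\<^bsub>QS\<^esub> \<in> carrier QS" by (rule Q_zero_closed)
  fix f g assume f: "f \<in> carrier QS" and g: "g \<in> carrier QS"
  show "f \<oplus>\<^bsub>QS\<^esub> g \<in> carrier QS" by (rule Q_add_closed[OF f g])
  show "f \<oplus>\<^bsub>QS\<^esub> g = g \<oplus>\<^bsub>QS\<^esub> f"
    by (rule Q_eqI) (simp_all add: f g Q_add_closed Q_apply H.a_comm Q_closed)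
  show "\<zero>\<^bsub>QS\<^esub> \<oplus>\<^bsub>QS\<^esub> f = f"
    by (rule Q_eqI) (simp_all add: f Q_zero_closed Q_add_closed Q_apply Q_closed)
  fix k assume k: "k \<in> carrier QS"
  show "f \<oplus>\<^bsub>QS\<^esub> g \<oplus>\<^bsub>QS\<^esub> k = f \<oplus>\<^bsub>QS\<^esub> (g \<oplus>\<^bsub>QS\<^esub> k)"
    by (rule Q_eqI) (simp_all add: f g k Q_add_closed Q_apply H.a_assoc Q_closed)
qed

lemma Q_finsum:
  assumes "finite S" "\<And>k. k \<in> S \<Longrightarrow> F k \<in> carrier QS"
  shows "finsum QS F S \<in> carrier QS"
    and "v \<in> DS \<Longrightarrow> mu \<in> CO \<Longrightarrow> finsum QS F S v mu = (\<Oplus>\<^bsub>HA\<^esub> k\<in>S. F k v mu)"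
proof -
  interpret Q: abelian_monoid QS by (rule Q_abelian_monoid)
  show c: "finsum QS F S \<in> carrier QS" using assms by (intro Q.finsum_closed) auto
  assume v: "v \<in> DS" and mu: "mu \<in> CO"
  show "finsum QS F S v mu = (\<Oplus>\<^bsub>HA\<^esub> k\<in>S. F k v mu)"
    using assms
  proof (induction S rule: finite_induct)
    case empty
    then show ?case by (simp add: Q_apply v mu)
  next
    case (insert k S)
    have F: "F k \<in> carrier QS" "F \<in> S \<rightarrow> carrier QS" using insert.prems by auto
    have "finsum QS F (insert k S) v mu = F k v mu \<oplus>\<^bsub>HA\<^esub> finsum QS F S v mu"
      using Q.finsum_insert[OF insert.hyps F(2,1)] by (simp add: Q_apply v mu)
    moreover have "(\<Oplus>\<^bsub>HA\<^esub> j\<in>insert k S. F j v mu) = F k v mu \<oplus>\<^bsub>HA\<^esub> (\<Oplus>\<^bsub>HA\<^esub> j\<in>S. F j v mu)"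
      using F by (intro H.finsum_insert[OF insert.hyps]) (simp_all add: Q_closed v mu Pi_iff)
    ultimately show ?case using insert by simp
  qed
qed

text \<open>The zero vector is its own product with 0, and homomorphisms commute with the right
  action.\<close>

lemma Q_zero_vec:
  assumes f: "f \<in> carrier QS" and mu: "mu \<in> CO"
  shows "f (\<lambda>lam\<in>CO. \<zero>\<^bsub>HA\<^esub>) mu = \<zero>\<^bsub>HA\<^esub>"
proof -
  let ?z = "\<lambda>lam\<in>CO. \<zero>\<^bsub>HA\<^esub>"
  have "dsum_act q n r ?z \<zero>\<^bsub>HA\<^esub> = ?z"
    by (rule V_eqI) (simp_all add: dsum_ops_closed dsum_ops_apply)
  then have "f ?z mu = f ?z mu \<otimes>\<^bsub>HA\<^esub> \<zero>\<^bsub>HA\<^esub>"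
    using Q_act_apply[OF f dsum_ops_closed(5) H.zero_closed mu] by simp
  then show ?thesis using Q_closed[OF f dsum_ops_closed(5) mu] by simp
qed

text \<open>Induction on the support: \<open>cut S\<close> keeps the components of \<open>v\<close>
  in \<open>S\<close>, and each component is a multiple of the generator of its summand.\<close>

lemma Q_eq_generators:
  assumes f: "f \<in> carrier QS" and g: "g \<in> carrier QS"
    and gen: "\<And>mu h. mu \<in> CO \<Longrightarrow> h \<in> carrier HA \<Longrightarrow>
      f (dsum_in q n r mu (x_elt q mu \<otimes>\<^bsub>HA\<^esub> h)) = g (dsum_in q n r mu (x_elt q mu \<otimes>\<^bsub>HA\<^esub> h))"
  shows "f = g"
proof (rule Q_eqI[OF f g])
  fix v lam assume v: "v \<in> DS" and lam: "lam \<in> CO"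
  define cut where "cut S = (\<lambda>mu\<in>CO. if mu \<in> S then v mu else \<zero>\<^bsub>HA\<^esub>)" for S
  have cutV: "cut S \<in> DS" for S
    unfolding cut_def using v by (intro V_restrict) (auto intro: rid_zero V_rid)
  have "f (cut S) lam = g (cut S) lam" if "finite S" "S \<subseteq> CO" for S
    using that
  proof (induction S rule: finite_induct)
    case empty
    have c: "cut {} = (\<lambda>mu\<in>CO. \<zero>\<^bsub>HA\<^esub>)" by (simp add: cut_def)
    show ?case unfolding c Q_zero_vec[OF f lam] Q_zero_vec[OF g lam] by (rule refl)
  next
    case (insert mu S)
    then have mu: "mu \<in> CO" by simp
    note vr = V_rid[OF v mu]
    have c: "cut (insert mu S) = dsum_add q n r (cut S) (dsum_in q n r mu (v mu))"
    proof (rule V_eqI[OF cutV dsum_ops_closed(1)[OF cutV dsum_ops_closed(4)[OF vr]]])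
      fix ka assume "ka \<in> CO"
      then show "cut (insert mu S) ka = dsum_add q n r (cut S) (dsum_in q n r mu (v mu)) ka"
        using insert.hyps(2) by (simp add: dsum_ops_apply cut_def V_closed v mu)
    qed
    obtain h where h: "h \<in> carrier HA" "v mu = x_elt q mu \<otimes>\<^bsub>HA\<^esub> h" by (rule ridE[OF vr])
    have "f (dsum_in q n r mu (v mu)) lam = g (dsum_in q n r mu (v mu)) lam"
      unfolding h(2) using gen[OF mu h(1)] by simp
    then show ?case
      unfolding c using insert lam Q_add_apply[OF f cutV dsum_ops_closed(4)[OF vr] lam]
        Q_add_apply[OF g cutV dsum_ops_closed(4)[OF vr] lam] by simp
  qed
  from this[OF finite_compositions subset_refl] have "f (cut CO) lam = g (cut CO) lam" .
  moreover have "cut CO = v" by (rule V_eqI[OF cutV v]) (simp add: cut_def)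
  ultimately show "f v lam = g v lam" by simp
qed

text \<open>The concrete form of \<open>phi\<close>: left multiplication by \<open>y\<close> from
  the component \<open>mu\<close> to the component \<open>lam\<close>. It acts on elements and not
  on their presentations \<open>x_mu h\<close>, so no choice of \<open>h\<close> enters.\<close>

definition hom_elt :: "nat list \<Rightarrow> nat list \<Rightarrow> (gen list \<Rightarrow> 'a) set \<Rightarrow>
    (nat list \<Rightarrow> (gen list \<Rightarrow> 'a) set) \<Rightarrow> nat list \<Rightarrow> (gen list \<Rightarrow> 'a) set" where
  "hom_elt lam mu y = (\<lambda>v\<in>DS. dsum_in q n r lam (y \<otimes>\<^bsub>HA\<^esub> v mu))"

lemma hom_elt_closed:
  assumes lam: "lam \<in> CO" and mu: "mu \<in> CO" and y: "y \<in> carrier HA" and t: "y \<otimes>\<^bsub>HA\<^esub> x_elt q mu \<in> rid lam"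
  shows "hom_elt lam mu y \<in> carrier QS"
proof -
  have yv: "y \<otimes>\<^bsub>HA\<^esub> v mu \<in> rid lam" if v: "v \<in> DS" for v
  proof -
    obtain h where h: "h \<in> carrier HA" "v mu = x_elt q mu \<otimes>\<^bsub>HA\<^esub> h" by (rule ridE[OF V_rid[OF v mu]])
    then have "y \<otimes>\<^bsub>HA\<^esub> v mu = (y \<otimes>\<^bsub>HA\<^esub> x_elt q mu) \<otimes>\<^bsub>HA\<^esub> h" by (simp add: H.m_assoc y x_closed mu)
    then show ?thesis using rid_act[OF lam t h(1)] by simp
  qed
  show ?thesis
    unfolding hom_elt_def
    by (rule Q_I) (simp_all add: dsum_ops_closed yv dsum_ops_apply mu V_closed H.r_distr y H.m_assoc)
qed

lemma T_star_rid: "M \<in> star_mats_deg n r \<Longrightarrow> T_star q n r M \<in> rid (ro n (base M))"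
  using T_star_facts(1,2)[of "fst M" "snd M"] ridI by simp

lemma T_star_closed: "M \<in> star_mats_deg n r \<Longrightarrow> T_star q n r M \<in> carrier HA"
  by (rule rid_closed[OF ro_co_compositions(1) T_star_rid])

text \<open>If \<open>T_star\<close> is \<open>y\<close> times \<open>x_co\<close>, left
  multiplication by \<open>y\<close> takes the prescribed values on generators; a homomorphism is
  determined by these, which resolves the \<open>THE\<close>.\<close>

lemma phi_hom_elt:
  assumes M: "M \<in> star_mats_deg n r"
    and y: "y \<in> carrier HA" "T_star q n r M = y \<otimes>\<^bsub>HA\<^esub> x_elt q (co n (base M))"
  shows "phi q n r M = hom_elt (ro n (base M)) (co n (base M)) y"
    and "hom_elt (ro n (base M)) (co n (base M)) y \<in> carrier QS"
proof -
  let ?l = "ro n (base M)" and ?m = "co n (base M)"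
  note lm = ro_co_compositions[OF M]
  show c: "hom_elt ?l ?m y \<in> carrier QS"
    using T_star_rid[OF M] by (intro hom_elt_closed lm y(1)) (simp add: y(2))
  have gen: "hom_elt ?l ?m y (dsum_in q n r mu (x_elt q mu \<otimes>\<^bsub>HA\<^esub> h)) =
      dsum_in q n r ?l (if mu = ?m then T_star q n r M \<otimes>\<^bsub>HA\<^esub> h else \<zero>\<^bsub>HA\<^esub>)"
    if mu: "mu \<in> CO" and h: "h \<in> carrier HA" for mu h
  proof -
    have "dsum_in q n r mu (x_elt q mu \<otimes>\<^bsub>HA\<^esub> h) \<in> DS" by (rule dsum_ops_closed(4)[OF ridI[OF h]])
    then show ?thesis
      using lm y by (auto simp: hom_elt_def dsum_ops_apply H.m_assoc x_closed h)
  qed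
  have "(THE f. f \<in> carrier QS \<and> (\<forall>mu\<in>CO. \<forall>h\<in>carrier HA. f (dsum_in q n r mu (x_elt q mu \<otimes>\<^bsub>HA\<^esub> h)) =
      dsum_in q n r ?l (if mu = ?m then T_star q n r M \<otimes>\<^bsub>HA\<^esub> h else \<zero>\<^bsub>HA\<^esub>))) = hom_elt ?l ?m y"
  proof (rule the_equality)
    show "hom_elt ?l ?m y \<in> carrier QS \<and> (\<forall>mu\<in>CO. \<forall>h\<in>carrier HA.
        hom_elt ?l ?m y (dsum_in q n r mu (x_elt q mu \<otimes>\<^bsub>HA\<^esub> h)) =
        dsum_in q n r ?l (if mu = ?m then T_star q n r M \<otimes>\<^bsub>HA\<^esub> h else \<zero>\<^bsub>HA\<^esub>))"
      using c gen by blast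
    fix f assume f: "f \<in> carrier QS \<and> (\<forall>mu\<in>CO. \<forall>h\<in>carrier HA. f (dsum_in q n r mu (x_elt q mu \<otimes>\<^bsub>HA\<^esub> h)) =
      dsum_in q n r ?l (if mu = ?m then T_star q n r M \<otimes>\<^bsub>HA\<^esub> h else \<zero>\<^bsub>HA\<^esub>))"
    then show "f = hom_elt ?l ?m y" by (intro Q_eq_generators c) (simp_all only: gen)
  qed
  then show "phi q n r M = hom_elt ?l ?m y" using M by (simp add: phi_def Let_def)
qed

section \<open>Values of \<open>phi\<close> and products of two such homomorphisms\<close>

lemma phi_zero: "M \<notin> star_mats_deg n r \<Longrightarrow> phi q n r M = \<zero>\<^bsub>QS\<^esub>"
  by (simp add: phi_def Let_def)

lemma phi_closed: "phi q n r M \<in> carrier QS"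
proof (cases "M \<in> star_mats_deg n r")
  case True
  then obtain y where "y \<in> carrier HA" "T_star q n r M = y \<otimes>\<^bsub>HA\<^esub> x_elt q (co n (base M))"
    using T_star_facts(3)[of "fst M" "snd M"] by auto
  then show ?thesis using phi_hom_elt[OF True] by simp
next
  case False
  then show ?thesis by (simp add: phi_zero Q_zero_closed)
qed

text \<open>Row and column sums are prescribed only for \<open>M\<close> in
  \<open>star_mats_deg\<close>, so that the formula also covers summands that are 0 by
  convention.\<close>

lemma phi_apply:
  assumes M: "M \<in> star_mats_deg n r \<Longrightarrow> ro n (base M) = lam \<and> co n (base M) = mu"
    and v: "v \<in> DS" and h: "h \<in> carrier HA" and vh: "v mu = x_elt q mu \<otimes>\<^bsub>HA\<^esub> h" and lam': "lam' \<in> CO"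
  shows "phi q n r M v lam' = (if lam' = lam then T_elt q n r M \<otimes>\<^bsub>HA\<^esub> h else \<zero>\<^bsub>HA\<^esub>)"
proof (cases "M \<in> star_mats_deg n r")
  case True
  then obtain y where y: "y \<in> carrier HA" "T_star q n r M = y \<otimes>\<^bsub>HA\<^esub> x_elt q (co n (base M))"
    using T_star_facts(3)[of "fst M" "snd M"] by auto
  have mu: "mu \<in> CO" using ro_co_compositions(2)[OF True] M[OF True] by simp
  show ?thesis
    using M[OF True] True v h vh lam' mu y
    by (simp add: phi_hom_elt(1)[OF True y] hom_elt_def dsum_ops_apply T_elt_def H.m_assoc x_closed)
next
  case False
  then show ?thesis using v h lam' by (simp add: phi_zero Q_apply T_elt_def)
qed

lemma phi_star_apply:
  assumes M: "M \<in> star_mats_deg n r" and v: "v \<in> DS" and h: "h \<in> carrier HA"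
    and vh: "v (co n (base M)) = x_elt q (co n (base M)) \<otimes>\<^bsub>HA\<^esub> h" and lam: "lam \<in> CO"
  shows "phi q n r M v lam = (if lam = ro n (base M) then T_star q n r M \<otimes>\<^bsub>HA\<^esub> h else \<zero>\<^bsub>HA\<^esub>)"
  using phi_apply[OF _ v h vh lam, of M "ro n (base M)"] M by (simp add: T_elt_def)

lemma phi_diag_apply:
  assumes mu: "mu \<in> CO" and v: "v \<in> DS" and lam: "lam \<in> CO"
  shows "phi q n r (diag mu, 0) v lam = (if lam = mu then v mu else \<zero>\<^bsub>HA\<^esub>)"
proof -
  obtain h where h: "h \<in> carrier HA" "v mu = x_elt q mu \<otimes>\<^bsub>HA\<^esub> h" by (rule ridE[OF V_rid[OF v mu]])
  show ?thesis
    using phi_star_apply[OF diag_star_mats_deg[OF mu] v h(1) _ lam] h(2)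
    by (simp add: ro_co_diag[OF mu] T_star_diag_x[OF mu])
qed

lemma phi_off_row:
  assumes M: "M \<in> star_mats_deg n r" and v: "v \<in> DS" and lam: "lam \<in> CO" "lam \<noteq> ro n (base M)"
  shows "phi q n r M v lam = \<zero>\<^bsub>HA\<^esub>"
proof -
  obtain h where h: "h \<in> carrier HA" "v (co n (base M)) = x_elt q (co n (base M)) \<otimes>\<^bsub>HA\<^esub> h"
    by (rule ridE[OF V_rid[OF v ro_co_compositions(2)[OF M]]])
  show ?thesis using phi_star_apply[OF M v h lam(1)] lam(2) by simp
qed

lemma phi_null_column:
  assumes M: "M \<in> star_mats_deg n r" and v: "v \<in> DS" "v (co n (base M)) = \<zero>\<^bsub>HA\<^esub>" and lam: "lam \<in> CO"
  shows "phi q n r M v lam = \<zero>\<^bsub>HA\<^esub>"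
  using phi_star_apply[OF M v(1) H.zero_closed _ lam] v(2) T_star_closed[OF M] x_closed[OF ro_co_compositions(2)[OF M]]
  by simp

lemma phi_diag_mult:
  assumes mu: "mu \<in> CO" and M: "M \<in> star_mats_deg n r"
  shows "phi q n r (diag mu, 0) \<otimes>\<^bsub>QS\<^esub> phi q n r M = of_bool (mu = ro n (base M)) \<odot>\<^bsub>QS\<^esub> phi q n r M"
proof (rule Q_eqI[OF Q_mult_closed[OF phi_closed phi_closed] Q_smult_closed[OF phi_closed]])
  fix v lam assume v: "v \<in> DS" and lam: "lam \<in> CO"
  have "phi q n r (diag mu, 0) (phi q n r M v) lam = (if lam = mu then phi q n r M v mu else \<zero>\<^bsub>HA\<^esub>)"
    by (rule phi_diag_apply[OF mu Q_V[OF phi_closed v] lam])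
  then show "(phi q n r (diag mu, 0) \<otimes>\<^bsub>QS\<^esub> phi q n r M) v lam =
      (of_bool (mu = ro n (base M)) \<odot>\<^bsub>QS\<^esub> phi q n r M) v lam"
    using phi_off_row[OF M v lam] phi_off_row[OF M v mu] Q_closed[OF phi_closed v lam, of M]
    unfolding Q_apply[OF v lam]
    by (cases "mu = ro n (base M)"; cases "lam = mu") (simp_all add: hc_smult_zero)
qed

lemma phi_mult_diag:
  assumes mu: "mu \<in> CO" and M: "M \<in> star_mats_deg n r"
  shows "phi q n r M \<otimes>\<^bsub>QS\<^esub> phi q n r (diag mu, 0) = of_bool (mu = co n (base M)) \<odot>\<^bsub>QS\<^esub> phi q n r M"
proof (rule Q_eqI[OF Q_mult_closed[OF phi_closed phi_closed] Q_smult_closed[OF phi_closed]])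
  fix v lam assume v: "v \<in> DS" and lam: "lam \<in> CO"
  note m = ro_co_compositions(2)[OF M]
  let ?u = "phi q n r (diag mu, 0) v"
  have u: "?u \<in> DS" by (rule Q_V[OF phi_closed v])
  have um: "?u (co n (base M)) = (if co n (base M) = mu then v mu else \<zero>\<^bsub>HA\<^esub>)"
    by (rule phi_diag_apply[OF mu v m])
  have "phi q n r M ?u lam = (if mu = co n (base M) then phi q n r M v lam else \<zero>\<^bsub>HA\<^esub>)"
  proof (cases "mu = co n (base M)")
    case True
    obtain h where h: "h \<in> carrier HA" "v (co n (base M)) = x_elt q (co n (base M)) \<otimes>\<^bsub>HA\<^esub> h"
      by (rule ridE[OF V_rid[OF v m]])
    then have "?u (co n (base M)) = x_elt q (co n (base M)) \<otimes>\<^bsub>HA\<^esub> h" using um True by simp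
    then show ?thesis
      using phi_star_apply[OF M v h lam] phi_star_apply[OF M u h(1) _ lam] True by simp
  next
    case False
    then show ?thesis using phi_null_column[OF M u _ lam] um by simp
  qed
  then show "(phi q n r M \<otimes>\<^bsub>QS\<^esub> phi q n r (diag mu, 0)) v lam =
      (of_bool (mu = co n (base M)) \<odot>\<^bsub>QS\<^esub> phi q n r M) v lam"
    using Q_closed[OF phi_closed v lam, of M] by (simp add: Q_apply v lam hc_smult_zero)
qed

text \<open>Raising and lowering differ only in the rows between which the unit moves, in the pairs
  and in the coefficients, so both are instances. The hypothesis \<open>prod\<close> is the formula
  for the value on a generator; the rest concerns the cases in which a side vanishes.\<close>

lemma phi_elementary_mult:
  fixes A0 A1 :: "nat \<Rightarrow> nat \<Rightarrow> int" and M1 M2 M3 :: "nat \<Rightarrow> star_mat" and c1 c2 c3 :: "nat \<Rightarrow> 'a"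
  assumes A: "(A0, A1) \<in> star_mats_deg n r" and lam: "lam \<in> CO"
    and h: "h1 \<in> {1..n}" "h2 \<in> {1..n}"
    and B0: "B0 = diag lam + E h1 h2 - E h2 h2"
    and M: "\<And>M k i j. M \<in> {M1, M2, M3} \<Longrightarrow> fst (M k) i j + snd (M k) i j = A0 i j + A1 i j + E h1 k i j - E h2 k i j"
    and prod: "lam = ro n (base (A0, A1)) \<Longrightarrow> (B0, 0) \<in> star_mats n \<Longrightarrow>
      T_star q n r (B0, 0) \<otimes>\<^bsub>HA\<^esub> T_tail q n r (A0, A1) =
      (\<Oplus>\<^bsub>HA\<^esub> k\<in>{1..n}. c1 k \<odot>\<^bsub>HA\<^esub> T_elt q n r (M1 k) \<oplus>\<^bsub>HA\<^esub> c2 k \<odot>\<^bsub>HA\<^esub> T_elt q n r (M2 k)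
        \<oplus>\<^bsub>HA\<^esub> c3 k \<odot>\<^bsub>HA\<^esub> T_elt q n r (M3 k))"
  shows "phi q n r (B0, 0) \<otimes>\<^bsub>QS\<^esub> phi q n r (A0, A1) = of_bool (lam = ro n (base (A0, A1))) \<odot>\<^bsub>QS\<^esub>
    (\<Oplus>\<^bsub>QS\<^esub> k\<in>{1..n}. c1 k \<odot>\<^bsub>QS\<^esub> phi q n r (M1 k) \<oplus>\<^bsub>QS\<^esub> c2 k \<odot>\<^bsub>QS\<^esub> phi q n r (M2 k)
      \<oplus>\<^bsub>QS\<^esub> c3 k \<odot>\<^bsub>QS\<^esub> phi q n r (M3 k))"
proof -
  let ?a = "base (A0, A1)"
  define G where "G k = c1 k \<odot>\<^bsub>QS\<^esub> phi q n r (M1 k) \<oplus>\<^bsub>QS\<^esub> c2 k \<odot>\<^bsub>QS\<^esub> phi q n r (M2 k)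
      \<oplus>\<^bsub>QS\<^esub> c3 k \<odot>\<^bsub>QS\<^esub> phi q n r (M3 k)" for k
  have G: "G k \<in> carrier QS" for k
    unfolding G_def by (intro Q_add_closed Q_smult_closed phi_closed)
  note sumG = Q_finsum[of "{1..n}" G, OF finite_atLeastAtMost G]
  have A': "(A0, A1) \<in> star_mats n" using A by (simp add: star_mats_deg_def)
  note cA = ro_co_compositions(2)[OF A]
  have B_co: "co n (base (B0, 0)) = lam" and B_ro: "i < n \<Longrightarrow> int (ro n (base (B0, 0)) ! i) =
      int (lam ! i) + (if Suc i = h1 then 1 else 0) - (if Suc i = h2 then 1 else 0)"
    if "(B0, 0) \<in> star_mats n" for i
    using move_box[OF diag_star_mats[OF lam] that h h(2)] by (simp_all add: B0 ro_co_diag[OF lam])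
  have M_box: "co n (base (M k)) = co n ?a" "i < n \<Longrightarrow> int (ro n (base (M k)) ! i) =
      int (ro n ?a ! i) + (if Suc i = h1 then 1 else 0) - (if Suc i = h2 then 1 else 0)"
    if "M k \<in> star_mats n" "k \<in> {1..n}" "M \<in> {M1, M2, M3}" for M k i
  proof -
    obtain C0 C1 where C: "M k = (C0, C1)" by (cases "M k")
    have "C0 i j + C1 i j = A0 i j + A1 i j + E h1 k i j - E h2 k i j" for i j
      using M[OF that(3), of k i j] by (simp add: C)
    note move_box[OF A' that(1)[unfolded C] h that(2) this]
    then show "co n (base (M k)) = co n ?a" "i < n \<Longrightarrow> int (ro n (base (M k)) ! i) =
      int (ro n ?a ! i) + (if Suc i = h1 then 1 else 0) - (if Suc i = h2 then 1 else 0)"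
      unfolding C by blast+
  qed
  have pointwise: "(phi q n r (B0, 0) \<otimes>\<^bsub>QS\<^esub> phi q n r (A0, A1)) v mu =
      (of_bool (lam = ro n ?a) \<odot>\<^bsub>QS\<^esub> finsum QS G {1..n}) v mu" if v: "v \<in> DS" and mu: "mu \<in> CO" for v mu
  proof -
    let ?u = "phi q n r (A0, A1) v"
    have u: "?u \<in> DS" by (rule Q_V[OF phi_closed v])
    have lhs: "(phi q n r (B0, 0) \<otimes>\<^bsub>QS\<^esub> phi q n r (A0, A1)) v mu = phi q n r (B0, 0) ?u mu"
      by (rule Q_apply(1)[OF v mu])
    have rhs: "(of_bool (lam = ro n ?a) \<odot>\<^bsub>QS\<^esub> finsum QS G {1..n}) v mu =
        of_bool (lam = ro n ?a) \<odot>\<^bsub>HA\<^esub> (\<Oplus>\<^bsub>HA\<^esub> k\<in>{1..n}. G k v mu)"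
      by (simp only: Q_apply(4)[OF v mu] sumG(2)[OF v mu])
    have sum_closed: "(\<Oplus>\<^bsub>HA\<^esub> k\<in>{1..n}. G k v mu) \<in> carrier HA"
      by (rule H.finsum_closed) (use Q_closed[OF G v mu] in simp)
    have Gv: "G k v mu = c1 k \<odot>\<^bsub>HA\<^esub> phi q n r (M1 k) v mu \<oplus>\<^bsub>HA\<^esub> c2 k \<odot>\<^bsub>HA\<^esub> phi q n r (M2 k) v mu
      \<oplus>\<^bsub>HA\<^esub> c3 k \<odot>\<^bsub>HA\<^esub> phi q n r (M3 k) v mu" for k
      by (simp only: G_def Q_apply[OF v mu])
    show ?thesis
    proof (cases "lam = ro n ?a")
      case False
      have "phi q n r (B0, 0) ?u mu = \<zero>\<^bsub>HA\<^esub>"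
      proof (cases "(B0, 0) \<in> star_mats_deg n r")
        case True
        then have "(B0, 0) \<in> star_mats n" by (simp add: star_mats_deg_def)
        then have "co n (base (B0, 0)) = lam" by (rule B_co)
        then show ?thesis
          using phi_null_column[OF True u _ mu] phi_off_row[OF A v lam False] by simp
      next
        case False
        then show ?thesis by (simp add: phi_zero Q_apply u mu)
      qed
      then show ?thesis unfolding lhs rhs using False sum_closed by (simp add: hc_smult_zero)
    next
      case True
      show ?thesis
      proof (cases "(B0, 0) \<in> star_mats n")
        case False
        \<comment> \<open>A summand in \<open>star_mats\<close> with \<open>h1 \<noteq> h2\<close>
          would require a positive part of \<open>lam\<close> in row \<open>h2\<close>, and then the
          elementary matrix would have no negative entry either. So both sides are 0.\<close>
        have no_M: "M k \<notin> star_mats n" if k: "k \<in> {1..n}" and Mem: "M \<in> {M1, M2, M3}" for M k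
        proof
          assume Mk: "M k \<in> star_mats n"
          obtain i where i: "h2 = Suc i" "i < n" using h(2) by (cases h2) auto
          have "0 < lam ! i \<or> h1 = h2"
            using M_box(2)[OF Mk k Mem i(2)] True i by (auto split: if_splits)
          then have "(B0, 0) \<in> star_mats n"
            using lam h i unfolding B0 by (auto simp: star_mats_def diag_def E_def compositions_def One_nat_def)
          then show False using False by simp
        qed
        have "phi q n r (M k) v mu = \<zero>\<^bsub>HA\<^esub>" if "k \<in> {1..n}" "M \<in> {M1, M2, M3}" for M k
          using no_M[OF that] by (simp add: phi_zero star_mats_deg_def Q_apply v mu)
        then have "G k v mu = \<zero>\<^bsub>HA\<^esub>" if "k \<in> {1..n}" for k
          unfolding Gv using that by (simp add: hc_smult_zero)
        then have "(\<Oplus>\<^bsub>HA\<^esub> k\<in>{1..n}. G k v mu) = (\<Oplus>\<^bsub>HA\<^esub> k\<in>{1..n}. \<zero>\<^bsub>HA\<^esub>)"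
          by (intro H.finsum_cong') auto
        moreover have "phi q n r (B0, 0) ?u mu = \<zero>\<^bsub>HA\<^esub>"
          using False by (simp add: phi_zero star_mats_deg_def Q_apply u mu)
        ultimately show ?thesis unfolding lhs rhs by (simp add: hc_smult_zero)
      next
        case B: True
        have Bdeg: "(B0, 0) \<in> star_mats_deg n r"
          using B B_co[OF B] lam by (simp add: star_mats_deg_iff compositions_def)
        obtain g where g: "g \<in> carrier HA" "v (co n ?a) = x_elt q (co n ?a) \<otimes>\<^bsub>HA\<^esub> g"
          by (rule ridE[OF V_rid[OF v cA]])
        have M_phi: "phi q n r (M k) v mu = (if mu = ro n (base (B0, 0)) then T_elt q n r (M k) \<otimes>\<^bsub>HA\<^esub> g else \<zero>\<^bsub>HA\<^esub>)"
          if k: "k \<in> {1..n}" and Mem: "M \<in> {M1, M2, M3}" for M k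
        proof (rule phi_apply[OF _ v g mu])
          assume "M k \<in> star_mats_deg n r"
          then have Mk: "M k \<in> star_mats n" by (simp add: star_mats_deg_def)
          have "ro n (base (M k)) ! i = ro n (base (B0, 0)) ! i" if "i < n" for i
            using M_box(2)[OF Mk k Mem that] B_ro[OF B that] True by simp
          then have "ro n (base (M k)) = ro n (base (B0, 0))"
            by (intro nth_equalityI) simp_all
          then show "ro n (base (M k)) = ro n (base (B0, 0)) \<and> co n (base (M k)) = co n ?a"
            using M_box(1)[OF Mk k Mem] by simp
        qed
        have Te: "T_elt q n r M \<in> carrier HA" for M
          using T_star_closed[of M] by (simp add: T_elt_def)
        define t where "t k = c1 k \<odot>\<^bsub>HA\<^esub> T_elt q n r (M1 k) \<oplus>\<^bsub>HA\<^esub> c2 k \<odot>\<^bsub>HA\<^esub> T_elt q n r (M2 k)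
        \<oplus>\<^bsub>HA\<^esub> c3 k \<odot>\<^bsub>HA\<^esub> T_elt q n r (M3 k)" for k
        have t: "t k \<in> carrier HA" for k unfolding t_def by (simp add: Te hc_smult_closed)
        have "G k v mu = (if mu = ro n (base (B0, 0)) then t k \<otimes>\<^bsub>HA\<^esub> g else \<zero>\<^bsub>HA\<^esub>)" if "k \<in> {1..n}" for k
          unfolding Gv t_def using that
          by (simp add: M_phi hc_smult_zero H.l_distr Te hc_smult_closed hc_smult_mult g)
        then have "(\<Oplus>\<^bsub>HA\<^esub> k\<in>{1..n}. G k v mu) =
            (\<Oplus>\<^bsub>HA\<^esub> k\<in>{1..n}. if mu = ro n (base (B0, 0)) then t k \<otimes>\<^bsub>HA\<^esub> g else \<zero>\<^bsub>HA\<^esub>)"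
          by (intro H.finsum_cong') (use t g in auto)
        also have "\<dots> = (if mu = ro n (base (B0, 0)) then (\<Oplus>\<^bsub>HA\<^esub> k\<in>{1..n}. t k) \<otimes>\<^bsub>HA\<^esub> g else \<zero>\<^bsub>HA\<^esub>)"
          using H.finsum_ldistr[of "{1..n}" g t] t g by simp
        also have "(\<Oplus>\<^bsub>HA\<^esub> k\<in>{1..n}. t k) = T_star q n r (B0, 0) \<otimes>\<^bsub>HA\<^esub> T_tail q n r (A0, A1)"
          using prod[OF True B] by (simp only: t_def)
        finally have r: "(\<Oplus>\<^bsub>HA\<^esub> k\<in>{1..n}. G k v mu) =
            (if mu = ro n (base (B0, 0)) then T_star q n r (B0, 0) \<otimes>\<^bsub>HA\<^esub> (T_tail q n r (A0, A1) \<otimes>\<^bsub>HA\<^esub> g) else \<zero>\<^bsub>HA\<^esub>)"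
          by (simp only: H.m_assoc[OF T_star_closed[OF Bdeg] T_star_facts(1)[OF A] g(1)])
        \<comment> \<open>The first homomorphism sends \<open>x_co g\<close> to
          \<open>x_lam (T_tail g)\<close>, so the second one is evaluated at its generator times
          \<open>T_tail g\<close>.\<close>
        have "?u lam = T_star q n r (A0, A1) \<otimes>\<^bsub>HA\<^esub> g"
          using phi_star_apply[OF A v g lam] True by simp
        also have "\<dots> = x_elt q lam \<otimes>\<^bsub>HA\<^esub> (T_tail q n r (A0, A1) \<otimes>\<^bsub>HA\<^esub> g)"
          unfolding T_star_facts(2)[OF A] True[symmetric]
          by (rule H.m_assoc[OF x_closed[OF lam] T_star_facts(1)[OF A] g(1)])
        finally have "phi q n r (B0, 0) ?u mu = (if mu = ro n (base (B0, 0))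
            then T_star q n r (B0, 0) \<otimes>\<^bsub>HA\<^esub> (T_tail q n r (A0, A1) \<otimes>\<^bsub>HA\<^esub> g) else \<zero>\<^bsub>HA\<^esub>)"
          using phi_star_apply[OF Bdeg u _ _ mu, of "T_tail q n r (A0, A1) \<otimes>\<^bsub>HA\<^esub> g"]
          by (simp add: B_co[OF B] T_star_facts(1)[OF A] g)
        then show ?thesis
          unfolding lhs rhs using r sum_closed True by (simp add: hc_smult_zero)
      qed
    qed
  qed
  have "phi q n r (B0, 0) \<otimes>\<^bsub>QS\<^esub> phi q n r (A0, A1) = of_bool (lam = ro n ?a) \<odot>\<^bsub>QS\<^esub> finsum QS G {1..n}"
    by (rule Q_eqI[OF Q_mult_closed[OF phi_closed phi_closed] Q_smult_closed[OF sumG(1)] pointwise])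
  then show ?thesis by (simp only: G_def[abs_def])
qed

end

theorem theorem5p3:
  fixes q :: "'a::comm_ring_1"
    and n r h :: nat
    and A0 A1 :: "nat \<Rightarrow> nat \<Rightarrow> int"
    and a :: "nat \<Rightarrow> nat \<Rightarrow> nat"
    and lam mu :: "nat list"
    and rr rl :: "nat \<Rightarrow> int"
    and \<phi> :: "star_mat \<Rightarrow>
      (nat list \<Rightarrow> (gen list \<Rightarrow> 'a) set) \<Rightarrow> nat list \<Rightarrow> (gen list \<Rightarrow> 'a) set"
    and \<epsilon> :: 'a
  defines "Q \<equiv> queer_schur q n r"
    and "\<phi> \<equiv> phi q n r"
    and "a \<equiv> base (A0, A1)"
    and "rr \<equiv> (\<lambda>k. int (\<Sum>j=k+1..n. a h j))"
    and "rl \<equiv> (\<lambda>k. int (\<Sum>u\<in>{1..<k}. a (h+1) u))"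
    and "\<epsilon> \<equiv> of_bool (lam = ro n a)"
  assumes "q dvd 1" and "q \<noteq> 1"
    and "h \<in> {1..n-1}"
    and "(A0, A1) \<in> star_mats_deg n r"
    and "lam \<in> compositions n r" and "mu \<in> compositions n r"
  shows
    "\<phi> (diag mu, 0) \<otimes>\<^bsub>Q\<^esub> \<phi> (A0, A1) = of_bool (mu = ro n a) \<odot>\<^bsub>Q\<^esub> \<phi> (A0, A1)
     \<and> \<phi> (A0, A1) \<otimes>\<^bsub>Q\<^esub> \<phi> (diag mu, 0) = of_bool (mu = co n a) \<odot>\<^bsub>Q\<^esub> \<phi> (A0, A1)
     \<and> \<phi> (diag lam + E h (h+1) - E (h+1) (h+1), 0) \<otimes>\<^bsub>Q\<^esub> \<phi> (A0, A1) =
        \<epsilon> \<odot>\<^bsub>Q\<^esub> (\<Oplus>\<^bsub>Q\<^esub> k\<in>{1..n}.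
            (unit_pow q (rr k + A1 (h+1) k) * qnum q (nat (A0 h k) + 1))
              \<odot>\<^bsub>Q\<^esub> \<phi> (A0 + E h k - E (h+1) k, A1)
          \<oplus>\<^bsub>Q\<^esub> unit_pow q (rr k) \<odot>\<^bsub>Q\<^esub> \<phi> (A0, A1 + E h k - E (h+1) k)
          \<oplus>\<^bsub>Q\<^esub> (unit_pow q (rr k - 1) * qnum2 q (q\<^sup>2) (a h k + 1))
              \<odot>\<^bsub>Q\<^esub> \<phi> (A0 + 2 * E h k, A1 - E h k - E (h+1) k))
     \<and> \<phi> (diag lam - E h h + E (h+1) h, 0) \<otimes>\<^bsub>Q\<^esub> \<phi> (A0, A1) =
        \<epsilon> \<odot>\<^bsub>Q\<^esub> (\<Oplus>\<^bsub>Q\<^esub> k\<in>{1..n}.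
            (unit_pow q (rl k) * qnum q (nat (A0 (h+1) k) + 1))
              \<odot>\<^bsub>Q\<^esub> \<phi> (A0 - E h k + E (h+1) k, A1)
          \<oplus>\<^bsub>Q\<^esub> unit_pow q (rl k + int (a h k) - 1) \<odot>\<^bsub>Q\<^esub> \<phi> (A0, A1 - E h k + E (h+1) k)
          \<oplus>\<^bsub>Q\<^esub> (unit_pow q (rl k + int (a h k) - 2) * qnum2 q (q\<^sup>2) (a (h+1) k + 1))
              \<odot>\<^bsub>Q\<^esub> \<phi> (A0 + 2 * E (h+1) k, A1 - E h k - E (h+1) k))"
proof -
  have F: "hc_formulas q r" by (rule hecke_clifford_formulas) fact
  note A = assms(10) and lam = assms(11) and mu = assms(12)
  have h: "h \<in> {1..n}" "h + 1 \<in> {1..n}" using assms(9) by auto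
  have raise: "\<phi> (diag lam + E h (h+1) - E (h+1) (h+1), 0) \<otimes>\<^bsub>Q\<^esub> \<phi> (A0, A1) =
        \<epsilon> \<odot>\<^bsub>Q\<^esub> (\<Oplus>\<^bsub>Q\<^esub> k\<in>{1..n}.
            (unit_pow q (rr k + A1 (h+1) k) * qnum q (nat (A0 h k) + 1))
              \<odot>\<^bsub>Q\<^esub> \<phi> (A0 + E h k - E (h+1) k, A1)
          \<oplus>\<^bsub>Q\<^esub> unit_pow q (rr k) \<odot>\<^bsub>Q\<^esub> \<phi> (A0, A1 + E h k - E (h+1) k)
          \<oplus>\<^bsub>Q\<^esub> (unit_pow q (rr k - 1) * qnum2 q (q\<^sup>2) (a h k + 1))
              \<odot>\<^bsub>Q\<^esub> \<phi> (A0 + 2 * E h k, A1 - E h k - E (h+1) k))"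
    unfolding Q_def \<phi>_def \<epsilon>_def a_def
  proof (rule phi_elementary_mult[OF F A lam h refl])
    show "fst (M k) i j + snd (M k) i j = A0 i j + A1 i j + E h k i j - E (h+1) k i j"
      if "M \<in> {\<lambda>k. (A0 + E h k - E (h+1) k, A1), \<lambda>k. (A0, A1 + E h k - E (h+1) k),
        \<lambda>k. (A0 + 2 * E h k, A1 - E h k - E (h+1) k)}" for M k i j
      using that by (auto simp: two_fun)
    assume "lam = ro n (base (A0, A1))" "(diag lam + E h (h+1) - E (h+1) (h+1), 0) \<in> star_mats n"
    then show "T_star q n r (diag lam + E h (h+1) - E (h+1) (h+1), 0) \<otimes>\<^bsub>hecke_clifford q r\<^esub> T_tail q n r (A0, A1) =
      (\<Oplus>\<^bsub>hecke_clifford q r\<^esub> k\<in>{1..n}. (unit_pow q (rr k + A1 (h+1) k) * qnum q (nat (A0 h k) + 1))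
              \<odot>\<^bsub>hecke_clifford q r\<^esub> T_elt q n r (A0 + E h k - E (h+1) k, A1)
          \<oplus>\<^bsub>hecke_clifford q r\<^esub> unit_pow q (rr k) \<odot>\<^bsub>hecke_clifford q r\<^esub> T_elt q n r (A0, A1 + E h k - E (h+1) k)
          \<oplus>\<^bsub>hecke_clifford q r\<^esub> (unit_pow q (rr k - 1) * qnum2 q (q\<^sup>2) (base (A0, A1) h k + 1))
              \<odot>\<^bsub>hecke_clifford q r\<^esub> T_elt q n r (A0 + 2 * E h k, A1 - E h k - E (h+1) k))"
      using F A assms(9) unfolding hc_formulas_def raise_sum_def Let_def rr_def a_def by blast
  qed
  \<comment> \<open>Lowering is the general statement with the rows \<open>h + 1\<close> and
    \<open>h\<close> in the places of \<open>h1\<close> and \<open>h2\<close>; only the order of the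
    summands has to be adapted.\<close>
  have swap: "diag lam - E h h + E (h+1) h = diag lam + E (h+1) h - E h h"
    by (simp add: fun_eq_iff)
  have lower: "\<phi> (diag lam - E h h + E (h+1) h, 0) \<otimes>\<^bsub>Q\<^esub> \<phi> (A0, A1) =
        \<epsilon> \<odot>\<^bsub>Q\<^esub> (\<Oplus>\<^bsub>Q\<^esub> k\<in>{1..n}.
            (unit_pow q (rl k) * qnum q (nat (A0 (h+1) k) + 1))
              \<odot>\<^bsub>Q\<^esub> \<phi> (A0 - E h k + E (h+1) k, A1)
          \<oplus>\<^bsub>Q\<^esub> unit_pow q (rl k + int (a h k) - 1) \<odot>\<^bsub>Q\<^esub> \<phi> (A0, A1 - E h k + E (h+1) k)
          \<oplus>\<^bsub>Q\<^esub> (unit_pow q (rl k + int (a h k) - 2) * qnum2 q (q\<^sup>2) (a (h+1) k + 1))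
              \<odot>\<^bsub>Q\<^esub> \<phi> (A0 + 2 * E (h+1) k, A1 - E h k - E (h+1) k))"
    unfolding Q_def \<phi>_def \<epsilon>_def a_def
  proof (rule phi_elementary_mult[OF F A lam h(2,1) swap])
    show "fst (M k) i j + snd (M k) i j = A0 i j + A1 i j + E (h+1) k i j - E h k i j"
      if "M \<in> {\<lambda>k. (A0 - E h k + E (h+1) k, A1), \<lambda>k. (A0, A1 - E h k + E (h+1) k),
        \<lambda>k. (A0 + 2 * E (h+1) k, A1 - E h k - E (h+1) k)}" for M k i j
      using that by (auto simp: two_fun)
    assume "lam = ro n (base (A0, A1))" "(diag lam - E h h + E (h+1) h, 0) \<in> star_mats n"
    then show "T_star q n r (diag lam - E h h + E (h+1) h, 0) \<otimes>\<^bsub>hecke_clifford q r\<^esub> T_tail q n r (A0, A1) =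
      (\<Oplus>\<^bsub>hecke_clifford q r\<^esub> k\<in>{1..n}. (unit_pow q (rl k) * qnum q (nat (A0 (h+1) k) + 1))
              \<odot>\<^bsub>hecke_clifford q r\<^esub> T_elt q n r (A0 - E h k + E (h+1) k, A1)
          \<oplus>\<^bsub>hecke_clifford q r\<^esub> unit_pow q (rl k + int (base (A0, A1) h k) - 1)
              \<odot>\<^bsub>hecke_clifford q r\<^esub> T_elt q n r (A0, A1 - E h k + E (h+1) k)
          \<oplus>\<^bsub>hecke_clifford q r\<^esub> (unit_pow q (rl k + int (base (A0, A1) h k) - 2)
                * qnum2 q (q\<^sup>2) (base (A0, A1) (h+1) k + 1))
              \<odot>\<^bsub>hecke_clifford q r\<^esub> T_elt q n r (A0 + 2 * E (h+1) k, A1 - E h k - E (h+1) k))"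
      using F A assms(9) unfolding hc_formulas_def lower_sum_def Let_def rl_def a_def by blast
  qed
  show ?thesis
    using raise lower phi_diag_mult[OF F mu A] phi_mult_diag[OF F mu A]
    unfolding Q_def \<phi>_def a_def by blast
qed

end
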